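(* Let $G=\{G(x),x\in R_+\}$, $G(0)=0$, be a mean zero Gaussian process with stationary increments and increments variance $E(G(x)-G(y))^2=\sigma^2(x-y)=\sigma^2(|x-y|)$. Assume that: (i) $\sigma^2(h)$ is a convex function that is regularly varying at zero; (ii) $\lim_{h\to 0}\frac{h^2}{\sigma^2(h)}=0$ and $\lim_{h\to 0}\frac{\sigma^2(h)}{h}=0$; (iii) there is a constant $C<\infty$ such that $\frac{\sigma^2(s+h)+\sigma^2(s-h)-2\sigma^2(s)}{h^2}\le C\,\frac{\sigma^2(s)}{s^2}$ for $0<h\le \frac{s}{8}$; (iv) $\sigma^2(s)$ has a second derivative for each $s\neq 0$. Set $\rho(s):=\frac12\frac{d^2}{ds^2}\sigma^2(s)\ge 0$ for $s\ne 0$. Fix an integer $k\ge 1$ and assume that there exist $0<\delta<1/2$, $M>0$ and a constant $C_M<\infty$ such that $$\rho(x)\le \frac{C_M}{|x|^{(1-\delta)/k}},\qquad 0<|x|\le M,$$ and $$|\rho(x+h)-\rho(x)|\le C_M\,\frac{|h|}{|x|}\,\rho(x),\qquad 4|h|\le |x|\le M,\ x\neq 0.$$ Then for all $g\in\mathcal B_0(R_+)$, $$\lim_{h\downarrow 0}\int :\left(\frac{G(x+h)-G(x)}{h}\right)^{k}: g(x)\,dx \;=\; :(G')^{k}:(g)\qquad\text{almost surely.}$$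
   Context: $\mathcal B_0(R_+)$ is the set of bounded Lebesgue measurable functions on $R_+=[0,\infty)$ with compact support; integrals $\int\cdots g(x)\,dx$ are over $R_+$. $G$ is taken to be its continuous version (which exists under the stated hypotheses). The $k$-th Wick power of a mean zero Gaussian random variable $X$ is $$:X^k:\;=\sum_{j=0}^{[k/2]}(-1)^j\binom{k}{2j}E(X^{2j})\,X^{k-2j}.$$ The generalized derivative $G'=\{G'(g),g\in\mathcal B_0(R_+)\}$ is the mean zero Gaussian field defined by $$G'(g)=\lim_{h\to 0}\int\frac{G(x+h)-G(x)}{h}\,g(x)\,dx\quad\text{in }L^2$$ (the limit is known to exist), with covariance $E(G'(g)G'(\tilde g))=\int\!\!\int\rho(t-s)g(s)\tilde g(t)\,ds\,dt$. The $k$-th order Wick power chaos $:(G')^k:(g)$ is defined as follows. Let $\{f_\delta\}$, $0<\delta\le\delta_0$, be a continuous approximate identity: each $f_\delta$ is a continuous nonnegative symmetric function supported in $[-\delta,\delta]$ with $\int f_\delta(y)\,dy=1$, and let $f_{x,\delta}(y)=f_\delta(y-x)$ (restricted to $R_+$). Then $$:(G')^k:(g):=\lim_{\delta\to 0}\int :(G'(f_{x,\delta}))^k:\,g(x)\,dx\quad\text{in }L^2$$ (the limit is known to exist under the stated hypotheses, and $E(:(G')^k:(g))^2=k!\int\!\!\int\rho^k(x-y)g(x)g(y)\,dx\,dy$). Since it is defined as an $L^2$ limit, $:(G')^k:(g)$ is determined up to almost sure equality. *)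

theory Defs
  imports "HOL-Probability.Probability"
begin

text \<open>Functions and processes on \<open>[0, \<infinity>)\<close> are represented by total functions on \<^typ>\<open>real\<close>, of
  which only the values on \<open>{0..}\<close> are used.\<close>

definition B0_Rplus :: "(real \<Rightarrow> real) set" where
  "B0_Rplus = {g. g \<in> borel_measurable (lebesgue_on {0..}) \<and> bounded (g ` {0..}) \<and>
     compact (closure {x \<in> {0..}. g x \<noteq> 0})}"

text \<open>Almost surely constant variables count as Gaussian.\<close>

definition gaussian_rv :: "'a measure \<Rightarrow> ('a \<Rightarrow> real) \<Rightarrow> bool" where
  "gaussian_rv M X \<longleftrightarrow> X \<in> borel_measurable M \<and>
     ((\<exists>c. AE \<omega> in M. X \<omega> = c) \<or>
      (\<exists>\<mu> \<sigma>. 0 < \<sigma> \<and> distributed M lborel X (\<lambda>x. ennreal (normal_density \<mu> \<sigma> x))))"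

definition gaussian_process :: "'a measure \<Rightarrow> 'i set \<Rightarrow> ('i \<Rightarrow> 'a \<Rightarrow> real) \<Rightarrow> bool" where
  "gaussian_process M T G \<longleftrightarrow>
     (\<forall>S a. finite S \<and> S \<subseteq> T \<longrightarrow> gaussian_rv M (\<lambda>\<omega>. \<Sum>x\<in>S. a x * G x \<omega>))"

definition stationary_increments :: "'a measure \<Rightarrow> (real \<Rightarrow> 'a \<Rightarrow> real) \<Rightarrow> bool" where
  "stationary_increments M G \<longleftrightarrow>
     (\<forall>S h. finite S \<and> S \<subseteq> {0..} \<and> 0 \<le> h \<longrightarrow>
        distr M (Pi\<^sub>M S (\<lambda>_. borel)) (\<lambda>\<omega>. \<lambda>x\<in>S. G (x + h) \<omega> - G h \<omega>) =
        distr M (Pi\<^sub>M S (\<lambda>_. borel)) (\<lambda>\<omega>. \<lambda>x\<in>S. G x \<omega> - G 0 \<omega>))"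

definition regularly_varying_at_zero :: "(real \<Rightarrow> real) \<Rightarrow> bool" where
  "regularly_varying_at_zero f \<longleftrightarrow>
     (\<exists>e>0. set_borel_measurable borel {0<..<e} f \<and> (\<forall>x\<in>{0<..<e}. 0 < f x)) \<and>
     (\<exists>p. \<forall>c>0. ((\<lambda>x. f (c * x) / f x) \<longlongrightarrow> c powr p) (at_right 0))"

definition wick_power :: "'a measure \<Rightarrow> nat \<Rightarrow> ('a \<Rightarrow> real) \<Rightarrow> 'a \<Rightarrow> real" where
  "wick_power M k X \<omega> =
     (\<Sum>j=0..k div 2. (-1) ^ j * real (k choose (2 * j)) *
        (\<integral>\<omega>'. X \<omega>' ^ (2 * j) \<partial>M) * X \<omega> ^ (k - 2 * j))"

definition L2_tendsto ::
    "'a measure \<Rightarrow> ('i \<Rightarrow> 'a \<Rightarrow> real) \<Rightarrow> ('a \<Rightarrow> real) \<Rightarrow> 'i filter \<Rightarrow> bool" where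
  "L2_tendsto M X Y F \<longleftrightarrow>
     Y \<in> borel_measurable M \<and> integrable M (\<lambda>\<omega>. (Y \<omega>)\<^sup>2) \<and>
     (\<forall>\<^sub>F t in F. X t \<in> borel_measurable M \<and> integrable M (\<lambda>\<omega>. (X t \<omega>)\<^sup>2)) \<and>
     ((\<lambda>t. \<integral>\<omega>. (X t \<omega> - Y \<omega>)\<^sup>2 \<partial>M) \<longlongrightarrow> 0) F"

text \<open>An \<open>L\<^sup>2\<close> limit is determined up to almost sure equality; this picks one version.\<close>

definition L2_Lim :: "'a measure \<Rightarrow> ('i \<Rightarrow> 'a \<Rightarrow> real) \<Rightarrow> 'i filter \<Rightarrow> 'a \<Rightarrow> real" where
  "L2_Lim M X F = (SOME Y. L2_tendsto M X Y F)"

text \<open>The field \<open>G'(g)\<close>. As \<open>G\<close> is indexed by \<open>[0, \<infinity>)\<close> and \<open>x\<close> ranges over \<open>[0, \<infinity>)\<close>,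
  the increment \<open>G (x + h) - G x\<close> is available for \<open>h > 0\<close> only.\<close>

definition gen_deriv :: "'a measure \<Rightarrow> (real \<Rightarrow> 'a \<Rightarrow> real) \<Rightarrow> (real \<Rightarrow> real) \<Rightarrow> 'a \<Rightarrow> real" where
  "gen_deriv M G g =
     L2_Lim M (\<lambda>h \<omega>. LINT x:{0..}|lebesgue. (G (x + h) \<omega> - G x \<omega>) / h * g x) (at_right 0)"

definition approx_identity :: "real \<Rightarrow> (real \<Rightarrow> real \<Rightarrow> real) \<Rightarrow> bool" where
  "approx_identity \<delta>\<^sub>0 f \<longleftrightarrow> 0 < \<delta>\<^sub>0 \<and>
     (\<forall>\<delta>. 0 < \<delta> \<and> \<delta> \<le> \<delta>\<^sub>0 \<longrightarrow>
        continuous_on UNIV (f \<delta>) \<and> (\<forall>y. 0 \<le> f \<delta> y) \<and> (\<forall>y. f \<delta> (- y) = f \<delta> y) \<and>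
        (\<forall>y. \<delta> < \<bar>y\<bar> \<longrightarrow> f \<delta> y = 0) \<and> (LINT y|lborel. f \<delta> y) = 1)"

text \<open>For each \<open>x\<close> the variable \<open>G'(f\<^sub>x\<^sub>,\<^sub>\<delta>)\<close> is determined only almost surely, so integrating it
  in \<open>x\<close> for fixed \<open>\<omega>\<close> requires a jointly measurable version. By Fubini the integral does not
  depend on that version, up to almost sure equality.\<close>

definition is_measurable_version ::
    "'a measure \<Rightarrow> (real \<Rightarrow> 'a \<Rightarrow> real) \<Rightarrow> (real \<Rightarrow> 'a \<Rightarrow> real) \<Rightarrow> bool" where
  "is_measurable_version M X Z \<longleftrightarrow>
     (\<lambda>(x, \<omega>). Z x \<omega>) \<in> borel_measurable (borel \<Otimes>\<^sub>M M) \<and>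
     (\<forall>x\<ge>0. AE \<omega> in M. Z x \<omega> = X x \<omega>)"

definition measurable_version ::
    "'a measure \<Rightarrow> (real \<Rightarrow> 'a \<Rightarrow> real) \<Rightarrow> real \<Rightarrow> 'a \<Rightarrow> real" where
  "measurable_version M X = (SOME Z. is_measurable_version M X Z)"

definition smoothed_deriv ::
    "'a measure \<Rightarrow> (real \<Rightarrow> 'a \<Rightarrow> real) \<Rightarrow> (real \<Rightarrow> real \<Rightarrow> real) \<Rightarrow> real \<Rightarrow> real \<Rightarrow> 'a \<Rightarrow> real" where
  "smoothed_deriv M G f \<delta> = measurable_version M (\<lambda>x. gen_deriv M G (\<lambda>y. f \<delta> (y - x)))"

text \<open>The chaos \<open>:(G')\<^sup>k:(g)\<close>, formed with the approximate identity \<open>f\<close>.\<close>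

definition wick_chaos ::
    "'a measure \<Rightarrow> (real \<Rightarrow> 'a \<Rightarrow> real) \<Rightarrow> (real \<Rightarrow> real \<Rightarrow> real) \<Rightarrow> nat \<Rightarrow> (real \<Rightarrow> real) \<Rightarrow>
      'a \<Rightarrow> real" where
  "wick_chaos M G f k g =
     L2_Lim M (\<lambda>\<delta> \<omega>. LINT x:{0..}|lebesgue.
       wick_power M k (smoothed_deriv M G f \<delta> x) \<omega> * g x) (at_right 0)"

text \<open>The value at \<open>0\<close> is irrelevant.\<close>

definition half_second_deriv :: "(real \<Rightarrow> real) \<Rightarrow> real \<Rightarrow> real" where
  "half_second_deriv \<sigma>2 s = 1 / 2 * deriv (deriv \<sigma>2) s"

end

theory Submission
  imports Defs
begin

text \<open>
  All smoothings of \<open>G'\<close> that occur, the difference quotients of \<open>G\<close> as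
  well as \<open>G'(f\<^sub>x\<^sub>,\<^sub>\<delta>)\<close>, have covariances of the form
  \<open>\<rho>\<close> convolved with a probability measure (up to a cut-off at the boundary
  \<open>0\<close>), and the covariance of the \<open>k\<close>-th Wick powers of jointly Gaussian
  variables is \<open>k!\<close> times the \<open>k\<close>-th power of their covariance. By the
  singularity and regularity bounds on \<open>\<rho>\<close>, smoothing at scale \<open>h\<close>
  moves an integrated Wick power by \<open>O(h\<^bsup>\<delta>\<^esup>)\<close> in squared
  \<open>L\<^sup>2\<close> norm. So the integrals over the difference quotients form an
  \<open>L\<^sup>2\<close> Cauchy family as \<open>h \<rightarrow> 0\<close>, with the same limit as
  the integrals that define the chaos.

  Writing a difference quotient of step \<open>h\<close> as a convex combination of quotients of
  smaller steps shows moreover that the integrals are Lipschitz in \<open>log h\<close> in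
  \<open>L\<^sup>2\<close>. A Kolmogorov chaining argument in the variable \<open>log h\<close>
  combines both bounds into almost sure convergence.
\<close>

text \<open>The bounds on \<open>\<rho>\<close> are available only for |x| \<le> m, so nothing is
  known about powers of the covariance at larger distances. The test function is therefore cut into
  pieces supported in intervals of length m/2; each piece is treated alone and the limits are added.
  The decay O(h^\<delta>) by itself yields convergence only along geometric sequences of steps. The
  Lipschitz bound supplies the control between them, and because it is quadratic in the distance of
  the logarithms, second moments suffice and no higher moments of the chaos are estimated. Both
  bounds start from one formula: the second moment of a difference of two integrated Wick powers is
  a double integral of a mixed second difference of k-th powers of covariances. For the decay each
  power is compared with \<open>\<rho>\<close> to the power k, which cancels in the mixed
  difference; for the Lipschitz bound the mixed difference itself is quadratic in the relative
  change of the step. Convexity of the variance makes \<open>\<rho>\<close> nonnegative. Covariances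
  can thus be computed as extended nonnegative integrals by Tonelli, and a cut-off at the boundary
  can only lower them.\<close>

section \<open>Wick powers of Gaussian variables\<close>

text \<open>Stated through the characteristic function instead of a density: variance 0 is then
  included, and the property passes to limits in L2.\<close>

definition centered_gaussian :: "'a measure \<Rightarrow> ('a \<Rightarrow> real) \<Rightarrow> bool" where
  "centered_gaussian M X \<longleftrightarrow> X \<in> borel_measurable M \<and> integrable M (\<lambda>\<omega>. (X \<omega>)\<^sup>2) \<and>
     (\<forall>t. (CLINT \<omega>|M. iexp (t * X \<omega>)) = of_real (exp (- ((\<integral>\<omega>. (X \<omega>)\<^sup>2 \<partial>M) * t\<^sup>2 / 2))))"

definition normal_moment :: "nat \<Rightarrow> real" where
  "normal_moment n = (if even n then fact n / (2 ^ (n div 2) * fact (n div 2)) else 0)"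

lemma normal_moment_simps [simp]: "normal_moment 0 = 1" "normal_moment (Suc 0) = 0"
  by (simp_all add: normal_moment_def)

lemma normal_moment_Suc_Suc: "normal_moment (n + 2) = real (n + 1) * normal_moment n"
proof (cases "even n")
  case True
  then obtain l where l: "n = 2 * l" by (elim evenE)
  have cancel: "(2 * c) * (b * F) / (2 * P * (c * f)) = b * (F / (P * f))" if "c \<noteq> 0"
    for b c f F P :: real
    using that by simp
  have "normal_moment (n + 2) = fact (2 * l + 2) / (2 ^ (l + 1) * fact (l + 1))"
    unfolding normal_moment_def l by simp
  also have "\<dots> = (2 * real (l + 1)) * (real (2 * l + 1) * fact (2 * l)) / (2 * 2 ^ l * (real (l + 1) * fact l))"
    by (simp add: algebra_simps)
  also have "\<dots> = real (2 * l + 1) * (fact (2 * l) / (2 ^ l * fact l))"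
    by (rule cancel) simp
  finally show ?thesis by (simp add: normal_moment_def l)
qed (simp add: normal_moment_def)

lemma std_normal_distribution_moment:
  "(LINT x|std_normal_distribution. x ^ n) = normal_moment n"
proof (cases "even n")
  case True
  then show ?thesis
    using std_normal_distribution_even_moments(1)[of "n div 2"] by (simp add: normal_moment_def)
qed (simp add: normal_moment_def integral_std_normal_distribution_moment_odd)

context prob_space
begin

lemma integrable_square_imp_integrable:
  fixes X :: "'a \<Rightarrow> real"
  assumes "X \<in> borel_measurable M" "integrable M (\<lambda>\<omega>. (X \<omega>)\<^sup>2)"
  shows "integrable M X"
  using square_integrable_imp_integrable[OF assms] .

text \<open>Both laws have the same characteristic function. Scaling the standard normal, rather
  than standardizing X, avoids dividing by the standard deviation, so variance 0 is no special
  case.\<close>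

lemma centered_gaussian_distr:
  assumes X: "centered_gaussian M X"
  shows "distr M borel X =
    distr std_normal_distribution borel (\<lambda>x. sqrt (\<integral>\<omega>. (X \<omega>)\<^sup>2 \<partial>M) * x)"
proof (rule Levy_uniqueness)
  interpret N: real_distribution std_normal_distribution by (rule real_dist_normal_dist)
  have [measurable]: "X \<in> borel_measurable M" using X by (simp add: centered_gaussian_def)
  show "real_distribution (distr M borel X)"
    by (intro real_distribution_distr) simp
  show "real_distribution (distr std_normal_distribution borel
      (\<lambda>x. sqrt (\<integral>\<omega>. (X \<omega>)\<^sup>2 \<partial>M) * x))"
    by (intro N.real_distribution_distr) simp
  let ?v = "\<integral>\<omega>. (X \<omega>)\<^sup>2 \<partial>M"
  have v: "0 \<le> ?v" by simp
  show "char (distr M borel X) = char (distr std_normal_distribution borel (\<lambda>x. sqrt ?v * x))"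
  proof
    fix t
    have "char (distr std_normal_distribution borel (\<lambda>x. sqrt ?v * x)) t
        = (CLINT x|std_normal_distribution. iexp (t * (sqrt ?v * x)))"
      unfolding char_def by (subst integral_distr) auto
    also have "\<dots> = char std_normal_distribution (t * sqrt ?v)"
      unfolding char_def by (simp add: mult.assoc)
    also have "\<dots> = of_real (exp (- (?v * t\<^sup>2 / 2)))"
      unfolding char_std_normal_distribution using v by (simp add: power_mult_distrib mult.commute)
    also have "\<dots> = (CLINT \<omega>|M. iexp (t * X \<omega>))"
      using X by (simp add: centered_gaussian_def)
    also have "\<dots> = char (distr M borel X) t"
      unfolding char_def by (subst integral_distr) auto
    finally show "char (distr M borel X) t
      = char (distr std_normal_distribution borel (\<lambda>x. sqrt ?v * x)) t" by simp
  qed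
qed

lemma centered_gaussian_moment:
  assumes X: "centered_gaussian M X"
  shows "integrable M (\<lambda>\<omega>. X \<omega> ^ n)"
    and "(\<integral>\<omega>. X \<omega> ^ n \<partial>M) = normal_moment n * sqrt (\<integral>\<omega>. (X \<omega>)\<^sup>2 \<partial>M) ^ n"
proof -
  have [measurable]: "X \<in> borel_measurable M" using X by (simp add: centered_gaussian_def)
  let ?s = "sqrt (\<integral>\<omega>. (X \<omega>)\<^sup>2 \<partial>M)"
  have "integrable (distr M borel X) (\<lambda>x. x ^ n)"
    unfolding centered_gaussian_distr[OF X]
    by (subst integrable_distr_eq)
       (auto simp: power_mult_distrib intro!: integrable_mult_right integrable_std_normal_distribution_moment)
  then show "integrable M (\<lambda>\<omega>. X \<omega> ^ n)"
    by (subst (asm) integrable_distr_eq) auto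
  have "(\<integral>\<omega>. X \<omega> ^ n \<partial>M) = (\<integral>x. x ^ n \<partial>distr M borel X)"
    by (subst integral_distr) auto
  also have "\<dots> = (LINT x|std_normal_distribution. (?s * x) ^ n)"
    unfolding centered_gaussian_distr[OF X] by (subst integral_distr) auto
  also have "\<dots> = normal_moment n * ?s ^ n"
    by (simp add: power_mult_distrib std_normal_distribution_moment)
  finally show "(\<integral>\<omega>. X \<omega> ^ n \<partial>M) = normal_moment n * ?s ^ n" .
qed

lemma integrable_mult_of_squares:
  fixes X Y :: "'a \<Rightarrow> real"
  assumes [measurable]: "X \<in> borel_measurable M" "Y \<in> borel_measurable M"
    and "integrable M (\<lambda>\<omega>. (X \<omega>)\<^sup>2)" "integrable M (\<lambda>\<omega>. (Y \<omega>)\<^sup>2)"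
  shows "integrable M (\<lambda>\<omega>. X \<omega> * Y \<omega>)"
proof (rule Bochner_Integration.integrable_bound)
  show "integrable M (\<lambda>\<omega>. (X \<omega>)\<^sup>2 + (Y \<omega>)\<^sup>2)" using assms by auto
  have "\<bar>X \<omega> * Y \<omega>\<bar> \<le> (X \<omega>)\<^sup>2 + (Y \<omega>)\<^sup>2" for \<omega>
    using sum_squares_bound[of "\<bar>X \<omega>\<bar>" "\<bar>Y \<omega>\<bar>"] abs_ge_zero[of "X \<omega> * Y \<omega>"]
    unfolding abs_mult power2_abs by linarith
  then show "AE \<omega> in M. norm (X \<omega> * Y \<omega>) \<le> norm ((X \<omega>)\<^sup>2 + (Y \<omega>)\<^sup>2)" by auto
qed simp

lemma integrable_power_mult_power:
  assumes X: "centered_gaussian M X" and Y: "centered_gaussian M Y"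
  shows "integrable M (\<lambda>\<omega>. X \<omega> ^ i * Y \<omega> ^ j)"
proof (rule integrable_mult_of_squares)
  show "integrable M (\<lambda>\<omega>. (X \<omega> ^ i)\<^sup>2)" "integrable M (\<lambda>\<omega>. (Y \<omega> ^ j)\<^sup>2)"
    using centered_gaussian_moment(1)[OF X, of "i * 2"] centered_gaussian_moment(1)[OF Y, of "j * 2"]
    by (simp_all add: power_mult)
qed (use X Y in \<open>auto simp: centered_gaussian_def\<close>)

end

text \<open>Joint normality in the Cramer-Wold form. No joint density is involved, so degenerate
  pairs such as X = Y are allowed; they are needed for second moments.\<close>

locale gaussian_pair = prob_space +
  fixes X Y :: "'a \<Rightarrow> real"
  assumes lin: "\<And>a b. centered_gaussian M (\<lambda>\<omega>. a * X \<omega> + b * Y \<omega>)"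
begin

lemma gaussian_X: "centered_gaussian M X" using lin[of 1 0] by simp
lemma gaussian_Y: "centered_gaussian M Y" using lin[of 0 1] by simp

abbreviation "varX \<equiv> \<integral>\<omega>. (X \<omega>)\<^sup>2 \<partial>M"
abbreviation "varY \<equiv> \<integral>\<omega>. (Y \<omega>)\<^sup>2 \<partial>M"
abbreviation "cov \<equiv> \<integral>\<omega>. X \<omega> * Y \<omega> \<partial>M"

definition mixed_moment :: "nat \<Rightarrow> nat \<Rightarrow> real" where
  "mixed_moment i j = (\<integral>\<omega>. X \<omega> ^ i * Y \<omega> ^ j \<partial>M)"

text \<open>This is E (X + b Y)^n as a polynomial in b. Its values are known from the
  one-dimensional moments, so comparing coefficients determines all mixed moments.\<close>

definition moment_poly :: "nat \<Rightarrow> real poly" where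
  "moment_poly n = (\<Sum>j\<le>n. monom (real (n choose j) * mixed_moment (n - j) j) j)"

lemma coeff_moment_poly: "coeff (moment_poly n) j = real (n choose j) * mixed_moment (n - j) j"
  by (simp add: moment_poly_def coeff_sum)

lemma poly_moment_poly: "poly (moment_poly n) b = (\<integral>\<omega>. (X \<omega> + b * Y \<omega>) ^ n \<partial>M)"
proof -
  have int: "integrable M (\<lambda>\<omega>. X \<omega> ^ i * Y \<omega> ^ j)" for i j
    by (rule integrable_power_mult_power[OF gaussian_X gaussian_Y])
  have "(\<integral>\<omega>. (X \<omega> + b * Y \<omega>) ^ n \<partial>M) =
      (\<integral>\<omega>. (\<Sum>j\<le>n. real (n choose j) * b ^ j * (X \<omega> ^ (n - j) * Y \<omega> ^ j)) \<partial>M)"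
    by (rule Bochner_Integration.integral_cong[OF refl], subst add.commute, subst binomial_ring)
       (simp add: power_mult_distrib mult_ac)
  also have "\<dots> = (\<Sum>j\<le>n. real (n choose j) * b ^ j * mixed_moment (n - j) j)"
    unfolding mixed_moment_def by (subst Bochner_Integration.integral_sum) (auto intro: int)
  finally show ?thesis
    by (simp add: moment_poly_def poly_sum poly_monom mult_ac)
qed

lemma second_moment: "(\<integral>\<omega>. (X \<omega> + b * Y \<omega>)\<^sup>2 \<partial>M) = varX + 2 * b * cov + b\<^sup>2 * varY"
proof -
  have int: "integrable M (\<lambda>\<omega>. X \<omega> ^ i * Y \<omega> ^ j)" for i j
    by (rule integrable_power_mult_power[OF gaussian_X gaussian_Y])
  have "(\<integral>\<omega>. (X \<omega> + b * Y \<omega>)\<^sup>2 \<partial>M) = (\<integral>\<omega>. (X \<omega>)\<^sup>2 + 2 * b * (X \<omega> * Y \<omega>) + b\<^sup>2 * (Y \<omega>)\<^sup>2 \<partial>M)"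
    by (rule Bochner_Integration.integral_cong) (auto simp: power2_eq_square algebra_simps)
  also have "\<dots> = varX + 2 * b * cov + b\<^sup>2 * varY"
    using int[of 2 0] int[of 1 1] int[of 0 2] by simp
  finally show ?thesis .
qed

lemma poly_moment_poly': "poly (moment_poly n) b = normal_moment n * sqrt (varX + 2 * b * cov + b\<^sup>2 * varY) ^ n"
  using centered_gaussian_moment(2)[OF lin[of 1 b], of n]
  by (simp add: poly_moment_poly second_moment)

lemma moment_poly_odd: "odd n \<Longrightarrow> moment_poly n = 0"
  by (rule poly_eq_poly_eq_iff[THEN iffD1]) (auto simp: poly_moment_poly' normal_moment_def)

lemma moment_poly_even:
  "moment_poly (2 * l) = smult (normal_moment (2 * l)) ([:varX, 2 * cov, varY:] ^ l)"
proof (rule poly_eq_poly_eq_iff[THEN iffD1], rule ext)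
  fix b
  have "0 \<le> (\<integral>\<omega>. (X \<omega> + b * Y \<omega>)\<^sup>2 \<partial>M)" by simp
  then show "poly (moment_poly (2 * l)) b
      = poly (smult (normal_moment (2 * l)) ([:varX, 2 * cov, varY:] ^ l)) b"
    unfolding second_moment poly_moment_poly' power_mult poly_smult poly_power
    by (subst real_sqrt_pow2) (simp_all add: algebra_simps power2_eq_square)
qed

text \<open>For n = 2 l the moment polynomial is a multiple of the l-th power of the quadratic b
  \<mapsto> E (X + b Y)^2, whose derivative is twice cov + b varY; the chain rule and the recursion
  of \<open>normal_moment\<close> give the factor.\<close>

lemma pderiv_moment_poly:
  "pderiv (moment_poly (n + 2)) = smult (real ((n + 2) * (n + 1))) ([:cov, varY:] * moment_poly n)"
proof (cases "even n")
  case True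
  then obtain l where l: "n = 2 * l" by (elim evenE)
  let ?Q = "[:varX, 2 * cov, varY:]"
  have "pderiv (moment_poly (n + 2)) = smult (normal_moment (n + 2)) (smult (real (l + 1)) (?Q ^ l) * pderiv ?Q)"
    using moment_poly_even[of "l + 1"] by (simp add: l pderiv_smult pderiv_power_Suc del: power_Suc)
  also have "pderiv ?Q = smult 2 [:cov, varY:]"
    by (simp add: pderiv_pCons)
  also have "smult (normal_moment (n + 2)) (smult (real (l + 1)) (?Q ^ l) * smult 2 [:cov, varY:])
    = smult (real ((n + 2) * (n + 1))) ([:cov, varY:] * smult (normal_moment n) (?Q ^ l))"
    unfolding normal_moment_Suc_Suc mult_smult_left mult_smult_right smult_smult mult.commute[of _ "?Q ^ l"]
    by (rule arg_cong2[of _ _ _ _ smult]) (simp_all add: l algebra_simps)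
  also have "smult (normal_moment n) (?Q ^ l) = moment_poly n"
    by (simp add: l moment_poly_even)
  finally show ?thesis .
qed (simp add: moment_poly_odd)

text \<open>Isserlis' recursion: one factor Y is paired with each X and with each other Y. It is the
  coefficient of b^j in \<open>pderiv_moment_poly\<close>. The truncated indices i - 1 and j - 1 do
  no harm, since they come with the factors i and j.\<close>

lemma mixed_moment_rec:
  "mixed_moment i (j + 1) = cov * (real i * mixed_moment (i - 1) j) + varY * (real j * mixed_moment i (j - 1))"
proof (cases "i + j = 0")
  case True
  have "coeff (moment_poly 1) 1 = 0" by (simp add: moment_poly_odd)
  with True show ?thesis by (simp add: coeff_moment_poly)
next
  case False
  then obtain n where n: "i + j = n + 1" by (cases "i + j") auto
  have rat: "a = b" if "c * a = c * b" "c \<noteq> 0" for a b c :: real using that by simp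
  have i: "i = n + 1 - j" "j \<le> n + 1" using n by auto
  \<comment> \<open>\<open>e1\<close> to \<open>e3\<close> bring the three binomial coefficients to
    the common factor (n + 1 choose j), which is cancelled at the end.\<close>
  have e1: "real (j + 1) * real ((n + 2) choose (j + 1)) = real (n + 2) * real ((n + 1) choose j)"
    using Suc_times_binomial[of j "n + 1"] unfolding of_nat_mult[symmetric] of_nat_eq_iff by simp
  have e2: "real (n + 1) * real (n choose j) = real i * real ((n + 1) choose j)"
    using binomial_absorb_comp[of "n + 1" j] i unfolding of_nat_mult[symmetric] of_nat_eq_iff by (simp del: binomial_Suc_Suc)
  have e3: "real (n + 1) * real (n choose (j - 1)) = real j * real ((n + 1) choose j)" if "j \<noteq> 0"
    using Suc_times_binomial[of "j - 1" "n"] that unfolding of_nat_mult[symmetric] of_nat_eq_iff by (simp del: binomial_Suc_Suc)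
  have m1: "mixed_moment (n + 2 - (j + 1)) (j + 1) = mixed_moment i (j + 1)" using i by simp
  have m2: "real (n choose j) * mixed_moment (n - j) j = real (n choose j) * mixed_moment (i - 1) j"
    using i by (cases "j = n + 1") auto
  have m3: "mixed_moment (n - (j - 1)) (j - 1) = mixed_moment i (j - 1)" if "j \<noteq> 0"
    using i that by simp
  have "real (j + 1) * real ((n + 2) choose (j + 1)) * mixed_moment i (j + 1) = coeff (pderiv (moment_poly (n + 2))) j"
    unfolding coeff_pderiv coeff_moment_poly m1[symmetric] by (simp add: algebra_simps)
  also have "\<dots> = real (n + 2) * (cov * (real (n + 1) * real (n choose j)) * mixed_moment (i - 1) j +
      (if j = 0 then 0 else varY * (real (n + 1) * real (n choose (j - 1))) * mixed_moment i (j - 1)))"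
  proof -
    have "coeff ([:cov, varY:] * moment_poly n) j = cov * coeff (moment_poly n) j
        + (if j = 0 then 0 else varY * coeff (moment_poly n) (j - 1))"
      by (cases j) (simp_all add: mult_pCons_left)
    then show ?thesis
      unfolding pderiv_moment_poly coeff_smult coeff_moment_poly m2
      using m3 by (simp add: algebra_simps)
  qed
  also have "\<dots> = real (n + 2) * real ((n + 1) choose j) * (cov * (real i * mixed_moment (i - 1) j) + varY * (real j * mixed_moment i (j - 1)))"
    unfolding e2 using e3 by (cases "j = 0") (simp_all add: algebra_simps)
  finally show ?thesis
    unfolding e1 by (rule rat) (use i in \<open>simp add: binomial_eq_0_iff\<close>)
qed

text \<open>Gaussian integration by parts. For polynomials it is the bilinear extension of
  \<open>mixed_moment_rec\<close>, which is the case of monomials.\<close>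

lemma stein:
  "(\<integral>\<omega>. Y \<omega> * (poly F (X \<omega>) * poly H (Y \<omega>)) \<partial>M) =
     cov * (\<integral>\<omega>. poly (pderiv F) (X \<omega>) * poly H (Y \<omega>) \<partial>M) +
     varY * (\<integral>\<omega>. poly F (X \<omega>) * poly (pderiv H) (Y \<omega>) \<partial>M)"
proof -
  have int: "integrable M (\<lambda>\<omega>. X \<omega> ^ i * Y \<omega> ^ j)" for i j
    by (rule integrable_power_mult_power[OF gaussian_X gaussian_Y])
  have dF: "poly (pderiv F) x = (\<Sum>i\<le>degree F. real i * coeff F i * x ^ (i - 1))" for F :: "real poly" and x
  proof -
    have sum: "pderiv (\<Sum>i\<in>A. p i) = (\<Sum>i\<in>A. pderiv (p i))" for A :: "nat set" and p :: "nat \<Rightarrow> real poly"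
      by (induction A rule: infinite_finite_induct) (simp_all add: pderiv_add)
    have "poly (pderiv F) x = poly (pderiv (\<Sum>i\<le>degree F. monom (coeff F i) i)) x"
      by (simp add: poly_as_sum_of_monoms)
    then show ?thesis
      by (simp add: sum pderiv_monom poly_sum poly_monom)
  qed
  have F: "poly F x = (\<Sum>i\<le>degree F. coeff F i * x ^ i)" for F :: "real poly" and x
    by (simp add: poly_altdef)
  have L: "(\<integral>\<omega>. Y \<omega> * (poly F (X \<omega>) * poly H (Y \<omega>)) \<partial>M) =
     (\<Sum>i\<le>degree F. \<Sum>j\<le>degree H. coeff F i * coeff H j * mixed_moment i (j + 1))"
  proof -
    have "Y \<omega> * (poly F (X \<omega>) * poly H (Y \<omega>)) =
       (\<Sum>i\<le>degree F. \<Sum>j\<le>degree H. coeff F i * coeff H j * (X \<omega> ^ i * Y \<omega> ^ (j + 1)))" for \<omega>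
      unfolding F sum_product by (simp add: sum_distrib_left mult_ac)
    then show ?thesis
      unfolding mixed_moment_def using int by (simp del: power_Suc add: Bochner_Integration.integral_sum)
  qed
  have R1: "(\<integral>\<omega>. poly (pderiv F) (X \<omega>) * poly H (Y \<omega>) \<partial>M) =
     (\<Sum>i\<le>degree F. \<Sum>j\<le>degree H. coeff F i * coeff H j * (real i * mixed_moment (i - 1) j))"
  proof -
    have "poly (pderiv F) (X \<omega>) * poly H (Y \<omega>) =
       (\<Sum>i\<le>degree F. \<Sum>j\<le>degree H. coeff F i * coeff H j * (real i * (X \<omega> ^ (i - 1) * Y \<omega> ^ j)))" for \<omega>
      unfolding F[of H] dF sum_product by (simp add: mult_ac)
    then show ?thesis
      unfolding mixed_moment_def using int by (simp add: Bochner_Integration.integral_sum)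
  qed
  have R2: "(\<integral>\<omega>. poly F (X \<omega>) * poly (pderiv H) (Y \<omega>) \<partial>M) =
     (\<Sum>i\<le>degree F. \<Sum>j\<le>degree H. coeff F i * coeff H j * (real j * mixed_moment i (j - 1)))"
  proof -
    have "poly F (X \<omega>) * poly (pderiv H) (Y \<omega>) =
       (\<Sum>i\<le>degree F. \<Sum>j\<le>degree H. coeff F i * coeff H j * (real j * (X \<omega> ^ i * Y \<omega> ^ (j - 1))))" for \<omega>
      unfolding F[of F] dF sum_product by (simp add: mult_ac)
    then show ?thesis
      unfolding mixed_moment_def using int by (simp add: Bochner_Integration.integral_sum)
  qed
  show ?thesis
    unfolding L R1 R2 mixed_moment_rec
    by (simp add: sum_distrib_left sum.distrib[symmetric] algebra_simps)
qed

end

text \<open>The Hermite polynomial for variance v, which for v > 0 is v^(n/2) He_n(x / sqrt v). In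
  this scaling it still makes sense for v = 0.\<close>

fun hermite_poly :: "real \<Rightarrow> nat \<Rightarrow> real poly" where
  "hermite_poly v 0 = 1"
| "hermite_poly v (Suc 0) = [:0, 1:]"
| "hermite_poly v (Suc (Suc n)) =
     [:0, 1:] * hermite_poly v (Suc n) - smult (real (Suc n) * v) (hermite_poly v n)"

lemma hermite_poly_Suc:
  "hermite_poly v (Suc n) = [:0, 1:] * hermite_poly v n - smult (real n * v) (hermite_poly v (n - 1))"
  by (cases n) simp_all

lemma pderiv_hermite_poly: "pderiv (hermite_poly v n) = smult (real n) (hermite_poly v (n - 1))"
proof (induction v n rule: hermite_poly.induct)
  case (3 v n)
  have "pderiv (hermite_poly v (Suc (Suc n))) = hermite_poly v (Suc n) +
      smult (real (Suc n)) ([:0, 1:] * hermite_poly v n - smult (real n * v) (hermite_poly v (n - 1)))"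
    by (simp add: pderiv_diff pderiv_smult pderiv_mult pderiv_pCons 3 smult_diff_right mult.commute mult.left_commute)
  also have "\<dots> = smult (real (Suc (Suc n))) (hermite_poly v (Suc n))"
    unfolding hermite_poly_Suc[symmetric] by (simp add: smult_add_left[of 1 "real (Suc n)", simplified])
  finally show ?case by simp
qed (simp_all add: pderiv_pCons)

section \<open>Orthogonality of Hermite polynomials of jointly Gaussian variables\<close>

context gaussian_pair
begin

lemma integrable_poly_mult_poly: "integrable M (\<lambda>\<omega>. poly F (X \<omega>) * poly H (Y \<omega>))"
proof -
  have "poly F (X \<omega>) * poly H (Y \<omega>) =
     (\<Sum>i\<le>degree F. \<Sum>j\<le>degree H. coeff F i * coeff H j * (X \<omega> ^ i * Y \<omega> ^ j))" for \<omega>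
    unfolding poly_altdef sum_product by (simp add: mult_ac)
  then show ?thesis
    by (simp add: integrable_power_mult_power[OF gaussian_X gaussian_Y])
qed

text \<open>In the three term recursion the subtracted term cancels exactly the varY term of
  \<open>stein\<close>. Only the derivative of the polynomial in X survives, which lowers its index
  and contributes the factor l.\<close>

lemma hermite_expectation_Suc:
  "(\<integral>\<omega>. poly (hermite_poly varX l) (X \<omega>) * poly (hermite_poly varY (Suc k)) (Y \<omega>) \<partial>M)
     = real l * cov * (\<integral>\<omega>. poly (hermite_poly varX (l - 1)) (X \<omega>) * poly (hermite_poly varY k) (Y \<omega>) \<partial>M)"
  (is "?L = _")
proof -
  let ?H = "hermite_poly varX l" and ?K = "hermite_poly varY"
  have "?L = (\<integral>\<omega>. poly ?H (X \<omega>) * poly ([:0, 1:] * ?K k) (Y \<omega>)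
      - real k * varY * (poly ?H (X \<omega>) * poly (?K (k - 1)) (Y \<omega>)) \<partial>M)"
    unfolding hermite_poly_Suc by (simp add: algebra_simps)
  also have "\<dots> = (\<integral>\<omega>. poly ?H (X \<omega>) * poly ([:0, 1:] * ?K k) (Y \<omega>) \<partial>M)
      - real k * varY * (\<integral>\<omega>. poly ?H (X \<omega>) * poly (?K (k - 1)) (Y \<omega>) \<partial>M)"
    by (subst Bochner_Integration.integral_diff)
       (simp_all only: integrable_poly_mult_poly integral_mult_right_zero integrable_mult_right)
  also have "(\<integral>\<omega>. poly ?H (X \<omega>) * poly ([:0, 1:] * ?K k) (Y \<omega>) \<partial>M)
      = (\<integral>\<omega>. Y \<omega> * (poly ?H (X \<omega>) * poly (?K k) (Y \<omega>)) \<partial>M)"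
    by (simp add: mult_ac)
  finally show ?thesis
    unfolding stein pderiv_hermite_poly by (simp add: mult_ac)
qed

end

lemma (in gaussian_pair) gaussian_pair_swap: "gaussian_pair M Y X"
proof unfold_locales
  fix a b show "centered_gaussian M (\<lambda>\<omega>. a * Y \<omega> + b * X \<omega>)"
    using lin[of b a] by (simp add: add.commute)
qed

lemma (in gaussian_pair) hermite_expectation:
  "(\<integral>\<omega>. poly (hermite_poly varX l) (X \<omega>) * poly (hermite_poly varY k) (Y \<omega>) \<partial>M)
     = (if l = k then fact k * cov ^ k else 0)"
proof (induction k arbitrary: l)
  case 0
  show ?case
  proof (cases l)
    case (Suc m)
    \<comment> \<open>With the roles of X and Y exchanged the index to be lowered is the positive
      one, and the factor l of the recursion is 0.\<close>
    then show ?thesis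
      using gaussian_pair.hermite_expectation_Suc[OF gaussian_pair_swap, of 0 m] by simp
  qed (simp add: prob_space)
next
  case (Suc k)
  show ?case
    unfolding hermite_expectation_Suc Suc by (cases l) (auto simp: algebra_simps)
qed

text \<open>The constant coefficient of \<open>hermite_poly v n\<close>.\<close>

definition hermite_coeff :: "real \<Rightarrow> nat \<Rightarrow> real" where
  "hermite_coeff v n = (if even n then (- 1) ^ (n div 2) * normal_moment n * v ^ (n div 2) else 0)"

lemma hermite_coeff_Suc_Suc: "hermite_coeff v (n + 2) = - (real (n + 1) * v) * hermite_coeff v n"
  unfolding hermite_coeff_def normal_moment_Suc_Suc by simp

text \<open>By \<open>pderiv_hermite_poly\<close> the coefficient of index i + 1 follows from the
  one of index i one degree lower; only the constant coefficient needs the recursion itself.\<close>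

lemma coeff_hermite_poly: "coeff (hermite_poly v k) i = real (k choose i) * hermite_coeff v (k - i)"
proof (induction k arbitrary: i)
  case 0
  then show ?case by (cases i) (simp_all add: hermite_coeff_def)
next
  case (Suc k)
  show ?case
  proof (cases i)
    case 0
    have "coeff (hermite_poly v n) 0 = hermite_coeff v n" for n
    proof (induction n rule: induct_nat_012)
      case (ge2 n)
      then show ?case
        using hermite_coeff_Suc_Suc[of v n] by simp
    qed (simp_all add: hermite_coeff_def)
    then show ?thesis using 0 by simp
  next
    case (Suc m)
    have "real (Suc m) * coeff (hermite_poly v (Suc k)) (Suc m) = coeff (pderiv (hermite_poly v (Suc k))) m"
      by (simp add: coeff_pderiv)
    also have "\<dots> = real (Suc k) * (real (k choose m) * hermite_coeff v (k - m))"
      by (simp add: pderiv_hermite_poly Suc.IH)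
    also have "\<dots> = real (Suc m) * (real (Suc k choose Suc m) * hermite_coeff v (Suc k - Suc m))"
    proof -
      have "real (Suc k) * real (k choose m) = real (Suc m) * real (Suc k choose Suc m)"
        using Suc_times_binomial[of m k] unfolding of_nat_mult[symmetric] of_nat_eq_iff by metis
      then show ?thesis by (simp del: binomial_Suc_Suc of_nat_Suc add: mult.assoc[symmetric])
    qed
    finally show ?thesis using Suc by (simp del: of_nat_Suc binomial_Suc_Suc)
  qed
qed

text \<open>For a centered Gaussian, E X^(2j) is \<open>normal_moment (2 * j)\<close> times the j-th
  power of the variance, which turns the sum of the Wick power into the even-index part of the
  Hermite coefficients; the odd ones vanish.\<close>

lemma (in prob_space) wick_power_eq_hermite:
  assumes X: "centered_gaussian M X"
  shows "wick_power M k X \<omega> = poly (hermite_poly (\<integral>\<omega>. (X \<omega>)\<^sup>2 \<partial>M) k) (X \<omega>)"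
proof -
  let ?v = "\<integral>\<omega>. (X \<omega>)\<^sup>2 \<partial>M"
  have deg: "degree (hermite_poly ?v k) \<le> k"
    by (rule degree_le) (simp add: coeff_hermite_poly)
  have "poly (hermite_poly ?v k) (X \<omega>) = (\<Sum>i\<le>k. coeff (hermite_poly ?v k) i * X \<omega> ^ i)"
    using deg by (subst poly_altdef) (rule sum.mono_neutral_left, auto simp: coeff_eq_0)
  also have "\<dots> = (\<Sum>i\<le>k. real (k choose i) * hermite_coeff ?v i * X \<omega> ^ (k - i))"
    unfolding atMost_atLeast0
    by (subst sum.atLeastAtMost_rev)
       (auto simp: coeff_hermite_poly binomial_symmetric[symmetric] intro!: sum.cong)
  also have "\<dots> = (\<Sum>i\<in>(\<lambda>j. 2 * j) ` {0..k div 2}. real (k choose i) * hermite_coeff ?v i * X \<omega> ^ (k - i))"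
  proof (rule sum.mono_neutral_right)
    show "\<forall>i\<in>{..k} - (\<lambda>j. 2 * j) ` {0..k div 2}. real (k choose i) * hermite_coeff ?v i * X \<omega> ^ (k - i) = 0"
    proof
      fix i assume i: "i \<in> {..k} - (\<lambda>j. 2 * j) ` {0..k div 2}"
      have "odd i"
      proof
        assume "even i"
        then have "i = 2 * (i div 2)" by simp
        with i show False by (metis DiffD1 DiffD2 atLeastAtMost_iff atMost_iff div_le_mono image_eqI zero_le)
      qed
      then show "real (k choose i) * hermite_coeff ?v i * X \<omega> ^ (k - i) = 0"
        by (simp add: hermite_coeff_def)
    qed
  qed auto
  also have "\<dots> = (\<Sum>j=0..k div 2. real (k choose (2 * j)) * hermite_coeff ?v (2 * j) * X \<omega> ^ (k - 2 * j))"
    by (subst sum.reindex) (auto simp: inj_on_def)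
  also have "\<dots> = wick_power M k X \<omega>"
    unfolding wick_power_def centered_gaussian_moment(2)[OF X, of "2 * j" for j]
    by (intro sum.cong) (auto simp: hermite_coeff_def power_mult)
  finally show ?thesis by simp
qed

lemma (in gaussian_pair) wick_power_expectation:
  "(\<integral>\<omega>. wick_power M k X \<omega> * wick_power M k Y \<omega> \<partial>M) = fact k * cov ^ k"
  using hermite_expectation[of k k] by (simp add: wick_power_eq_hermite gaussian_X gaussian_Y)

section \<open>Second moments and Gaussian Hilbert spaces\<close>

definition square_integrable :: "'a measure \<Rightarrow> ('a \<Rightarrow> real) \<Rightarrow> bool" where
  "square_integrable M X \<longleftrightarrow> X \<in> borel_measurable M \<and> integrable M (\<lambda>\<omega>. (X \<omega>)\<^sup>2)"

lemma square_integrableD [dest]: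
  assumes "square_integrable M X"
  shows "X \<in> borel_measurable M" "integrable M (\<lambda>\<omega>. (X \<omega>)\<^sup>2)"
  using assms by (auto simp: square_integrable_def)

section \<open>Inequalities and limits for square integrable variables\<close>

context prob_space
begin

lemma square_integrable_mult:
  "square_integrable M X \<Longrightarrow> square_integrable M Y \<Longrightarrow> integrable M (\<lambda>\<omega>. X \<omega> * Y \<omega>)"
  by (auto simp: square_integrable_def intro: integrable_mult_of_squares)

lemma square_integrable_integrable: "square_integrable M X \<Longrightarrow> integrable M X"
  by (auto simp: square_integrable_def intro: integrable_square_imp_integrable)

lemma square_integrable_lincomb:
  assumes X: "square_integrable M X" and Y: "square_integrable M Y"
  shows "square_integrable M (\<lambda>\<omega>. a * X \<omega> + b * Y \<omega>)"
    and "(\<integral>\<omega>. (a * X \<omega> + b * Y \<omega>)\<^sup>2 \<partial>M) =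
      a\<^sup>2 * (\<integral>\<omega>. (X \<omega>)\<^sup>2 \<partial>M) + 2 * a * b * (\<integral>\<omega>. X \<omega> * Y \<omega> \<partial>M) + b\<^sup>2 * (\<integral>\<omega>. (Y \<omega>)\<^sup>2 \<partial>M)"
proof -
  note [measurable] = square_integrableD(1)[OF X] square_integrableD(1)[OF Y]
  have e: "(a * X \<omega> + b * Y \<omega>)\<^sup>2 = a\<^sup>2 * (X \<omega>)\<^sup>2 + 2 * a * b * (X \<omega> * Y \<omega>) + b\<^sup>2 * (Y \<omega>)\<^sup>2" for \<omega>
    by (simp add: power2_eq_square algebra_simps)
  note i = square_integrableD(2)[OF X] square_integrableD(2)[OF Y] square_integrable_mult[OF X Y]
  show "square_integrable M (\<lambda>\<omega>. a * X \<omega> + b * Y \<omega>)"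
    using i unfolding square_integrable_def e by auto
  show "(\<integral>\<omega>. (a * X \<omega> + b * Y \<omega>)\<^sup>2 \<partial>M) =
      a\<^sup>2 * (\<integral>\<omega>. (X \<omega>)\<^sup>2 \<partial>M) + 2 * a * b * (\<integral>\<omega>. X \<omega> * Y \<omega> \<partial>M) + b\<^sup>2 * (\<integral>\<omega>. (Y \<omega>)\<^sup>2 \<partial>M)"
    unfolding e using i by simp
qed

lemma square_integrable_diff:
  "square_integrable M X \<Longrightarrow> square_integrable M Y \<Longrightarrow> square_integrable M (\<lambda>\<omega>. X \<omega> - Y \<omega>)"
  using square_integrable_lincomb(1)[of X Y 1 "-1"] by simp

lemma square_integrable_add:
  "square_integrable M X \<Longrightarrow> square_integrable M Y \<Longrightarrow> square_integrable M (\<lambda>\<omega>. X \<omega> + Y \<omega>)"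
  using square_integrable_lincomb(1)[of X Y 1 1] by simp

lemma square_integrable_cmult:
  "square_integrable M X \<Longrightarrow> square_integrable M (\<lambda>\<omega>. c * X \<omega>)"
  using square_integrable_lincomb(1)[of X X c 0] by simp

lemma square_integrable_zero: "square_integrable M (\<lambda>\<omega>. 0)"
  by (simp add: square_integrable_def)

lemma square_integrable_sum:
  "(\<And>i. i \<in> A \<Longrightarrow> square_integrable M (X i)) \<Longrightarrow> square_integrable M (\<lambda>\<omega>. \<Sum>i\<in>A. X i \<omega>)"
  by (induction A rule: infinite_finite_induct)
     (simp_all add: square_integrable_zero square_integrable_add)

lemma second_moment_diff:
  assumes X: "square_integrable M X" and Y: "square_integrable M Y"
  shows "(\<integral>\<omega>. (X \<omega> - Y \<omega>)\<^sup>2 \<partial>M) =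
      (\<integral>\<omega>. (X \<omega>)\<^sup>2 \<partial>M) - 2 * (\<integral>\<omega>. X \<omega> * Y \<omega> \<partial>M) + (\<integral>\<omega>. (Y \<omega>)\<^sup>2 \<partial>M)"
  using square_integrable_lincomb(2)[OF assms, of 1 "-1"] by simp

lemma Cauchy_Schwarz_expectation:
  assumes X: "square_integrable M X" and Y: "square_integrable M Y"
  shows "(\<integral>\<omega>. X \<omega> * Y \<omega> \<partial>M)\<^sup>2 \<le> (\<integral>\<omega>. (X \<omega>)\<^sup>2 \<partial>M) * (\<integral>\<omega>. (Y \<omega>)\<^sup>2 \<partial>M)"
proof -
  let ?a = "\<integral>\<omega>. (X \<omega>)\<^sup>2 \<partial>M" and ?b = "\<integral>\<omega>. X \<omega> * Y \<omega> \<partial>M" and ?c = "\<integral>\<omega>. (Y \<omega>)\<^sup>2 \<partial>M"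
  have q: "0 \<le> ?a + 2 * l * ?b + l\<^sup>2 * ?c" for l
  proof -
    have "0 \<le> (\<integral>\<omega>. (1 * X \<omega> + l * Y \<omega>)\<^sup>2 \<partial>M)" by simp
    then show ?thesis unfolding square_integrable_lincomb(2)[OF X Y] by simp
  qed
  show ?thesis
  proof (cases "?c = 0")
    case True
    have "?b = 0"
    proof (rule ccontr)
      assume "?b \<noteq> 0"
      \<comment> \<open>When E Y^2 = 0 the quadratic is affine in l. The chosen l gives it the value
        -1, which is impossible unless the slope vanishes.\<close>
      then have "0 \<le> ?a + 2 * (- (?a + 1) / (2 * ?b)) * ?b" using q[of "- (?a + 1) / (2 * ?b)"] True by simp
      with \<open>?b \<noteq> 0\<close> show False by (simp add: field_simps)
    qed
    then show ?thesis using True by simp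
  next
    case False
    then have c: "0 < ?c" by (simp add: order_less_le)
    have "0 \<le> ?c * (?a + 2 * (- ?b / ?c) * ?b + (- ?b / ?c)\<^sup>2 * ?c)"
      using q[of "- ?b / ?c"] c by (intro mult_nonneg_nonneg) (simp_all only: less_imp_le)
    then show ?thesis using c by (simp add: field_simps power2_eq_square)
  qed
qed

lemma abs_expectation_mult_le:
  assumes X: "square_integrable M X" and Y: "square_integrable M Y"
  shows "\<bar>\<integral>\<omega>. X \<omega> * Y \<omega> \<partial>M\<bar> \<le> sqrt (\<integral>\<omega>. (X \<omega>)\<^sup>2 \<partial>M) * sqrt (\<integral>\<omega>. (Y \<omega>)\<^sup>2 \<partial>M)"
proof -
  have "\<bar>\<integral>\<omega>. X \<omega> * Y \<omega> \<partial>M\<bar>\<^sup>2 \<le> (\<integral>\<omega>. (X \<omega>)\<^sup>2 \<partial>M) * (\<integral>\<omega>. (Y \<omega>)\<^sup>2 \<partial>M)"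
    using Cauchy_Schwarz_expectation[OF assms] by simp
  then show ?thesis unfolding real_sqrt_mult[symmetric] by (rule real_le_rsqrt)
qed

lemma second_moment_add_le:
  assumes X: "square_integrable M X" and Y: "square_integrable M Y"
  shows "(\<integral>\<omega>. (X \<omega> + Y \<omega>)\<^sup>2 \<partial>M) \<le> 2 * (\<integral>\<omega>. (X \<omega>)\<^sup>2 \<partial>M) + 2 * (\<integral>\<omega>. (Y \<omega>)\<^sup>2 \<partial>M)"
proof -
  have "0 \<le> (\<integral>\<omega>. (X \<omega> - Y \<omega>)\<^sup>2 \<partial>M)" by simp
  then show ?thesis
    using square_integrable_lincomb(2)[OF X Y, of 1 1] by (simp add: second_moment_diff[OF X Y])
qed

lemma second_moment_triangle:
  assumes X: "square_integrable M X" and Y: "square_integrable M Y" and Z: "square_integrable M Z"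
  shows "(\<integral>\<omega>. (X \<omega> - Z \<omega>)\<^sup>2 \<partial>M) \<le> 2 * (\<integral>\<omega>. (X \<omega> - Y \<omega>)\<^sup>2 \<partial>M) + 2 * (\<integral>\<omega>. (Y \<omega> - Z \<omega>)\<^sup>2 \<partial>M)"
  using second_moment_add_le[OF square_integrable_diff[OF X Y] square_integrable_diff[OF Y Z]] by simp

lemma expectation_mult_tendsto:
  assumes X: "\<And>n. square_integrable M (X n)" "square_integrable M X'"
    and Y: "\<And>n. square_integrable M (Y n)" "square_integrable M Y'"
    and lX: "((\<lambda>n. \<integral>\<omega>. (X n \<omega> - X' \<omega>)\<^sup>2 \<partial>M) \<longlongrightarrow> 0) F"
    and lY: "((\<lambda>n. \<integral>\<omega>. (Y n \<omega> - Y' \<omega>)\<^sup>2 \<partial>M) \<longlongrightarrow> 0) F"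
  shows "((\<lambda>n. \<integral>\<omega>. X n \<omega> * Y n \<omega> \<partial>M) \<longlongrightarrow> (\<integral>\<omega>. X' \<omega> * Y' \<omega> \<partial>M)) F"
proof -
  note sq = square_integrable_diff[OF X(1) X(2)] square_integrable_diff[OF Y(1) Y(2)]
  let ?d = "\<lambda>n. sqrt (\<integral>\<omega>. (X n \<omega> - X' \<omega>)\<^sup>2 \<partial>M) * sqrt (\<integral>\<omega>. (Y n \<omega> - Y' \<omega>)\<^sup>2 \<partial>M)
     + sqrt (\<integral>\<omega>. (X n \<omega> - X' \<omega>)\<^sup>2 \<partial>M) * sqrt (\<integral>\<omega>. (Y' \<omega>)\<^sup>2 \<partial>M)
     + sqrt (\<integral>\<omega>. (X' \<omega>)\<^sup>2 \<partial>M) * sqrt (\<integral>\<omega>. (Y n \<omega> - Y' \<omega>)\<^sup>2 \<partial>M)"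
  have "((\<lambda>n. (\<integral>\<omega>. X n \<omega> * Y n \<omega> \<partial>M) - (\<integral>\<omega>. X' \<omega> * Y' \<omega> \<partial>M)) \<longlongrightarrow> 0) F"
  proof (rule Lim_null_comparison)
    have sX: "((\<lambda>n. sqrt (\<integral>\<omega>. (X n \<omega> - X' \<omega>)\<^sup>2 \<partial>M)) \<longlongrightarrow> 0) F"
      using tendsto_real_sqrt[OF lX] by simp
    have sY: "((\<lambda>n. sqrt (\<integral>\<omega>. (Y n \<omega> - Y' \<omega>)\<^sup>2 \<partial>M)) \<longlongrightarrow> 0) F"
      using tendsto_real_sqrt[OF lY] by simp
    show "(?d \<longlongrightarrow> 0) F"
      using tendsto_add[OF tendsto_add[OF tendsto_mult[OF sX sY] tendsto_mult_left_zero[OF sX]] tendsto_mult_right_zero[OF sY]]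
      by simp
    have "norm ((\<integral>\<omega>. X n \<omega> * Y n \<omega> \<partial>M) - (\<integral>\<omega>. X' \<omega> * Y' \<omega> \<partial>M)) \<le> ?d n" for n
    proof -
      have "(\<integral>\<omega>. X n \<omega> * Y n \<omega> \<partial>M) - (\<integral>\<omega>. X' \<omega> * Y' \<omega> \<partial>M) =
        (\<integral>\<omega>. (X n \<omega> * Y n \<omega> - X' \<omega> * Y' \<omega>) \<partial>M)"
        by (subst Bochner_Integration.integral_diff) (auto intro!: square_integrable_mult X Y)
      also have "\<dots> = (\<integral>\<omega>. (X n \<omega> - X' \<omega>) * (Y n \<omega> - Y' \<omega>) + (X n \<omega> - X' \<omega>) * Y' \<omega> + X' \<omega> * (Y n \<omega> - Y' \<omega>) \<partial>M)"
        by (rule Bochner_Integration.integral_cong) (auto simp: algebra_simps)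
      also have "\<dots> = (\<integral>\<omega>. (X n \<omega> - X' \<omega>) * (Y n \<omega> - Y' \<omega>) \<partial>M) + (\<integral>\<omega>. (X n \<omega> - X' \<omega>) * Y' \<omega> \<partial>M)
         + (\<integral>\<omega>. X' \<omega> * (Y n \<omega> - Y' \<omega>) \<partial>M)"
        proof -
          have i: "integrable M (\<lambda>\<omega>. (X n \<omega> - X' \<omega>) * (Y n \<omega> - Y' \<omega>))" "integrable M (\<lambda>\<omega>. (X n \<omega> - X' \<omega>) * Y' \<omega>)"
            "integrable M (\<lambda>\<omega>. X' \<omega> * (Y n \<omega> - Y' \<omega>))"
            by (intro square_integrable_mult sq X(2) Y(2))+
          show ?thesis
            unfolding Bochner_Integration.integral_add[OF Bochner_Integration.integrable_add[OF i(1,2)] i(3)]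
              Bochner_Integration.integral_add[OF i(1,2)] ..
        qed
      finally show ?thesis
        using abs_expectation_mult_le[OF sq(1)[of n] sq(2)[of n]] abs_expectation_mult_le[OF sq(1)[of n] Y(2)]
          abs_expectation_mult_le[OF X(2) sq(2)[of n]]
        unfolding real_norm_def by linarith
    qed
    then show "\<forall>\<^sub>F n in F. norm ((\<integral>\<omega>. X n \<omega> * Y n \<omega> \<partial>M) - (\<integral>\<omega>. X' \<omega> * Y' \<omega> \<partial>M)) \<le> ?d n" by simp
  qed
  then show ?thesis by (simp add: LIM_zero_iff)
qed

lemma cmod_iexp_diff_le: "cmod (iexp x - iexp y) \<le> \<bar>x - y\<bar>"
proof -
  have "iexp x - iexp y = iexp y * (iexp (x - y) - 1)"
    unfolding right_diff_distrib exp_add[symmetric] by (simp add: algebra_simps)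
  then show ?thesis
    using iexp_approx1[of "x - y" 0] by (simp add: norm_mult)
qed

lemma centered_gaussian_cong_AE:
  assumes "centered_gaussian M X" "Y \<in> borel_measurable M" "AE \<omega> in M. X \<omega> = Y \<omega>"
  shows "centered_gaussian M Y"
proof -
  have [measurable]: "X \<in> borel_measurable M" "Y \<in> borel_measurable M"
    using assms by (auto simp: centered_gaussian_def)
  have "(\<integral>\<omega>. (X \<omega>)\<^sup>2 \<partial>M) = (\<integral>\<omega>. (Y \<omega>)\<^sup>2 \<partial>M)"
    using assms(3) by (intro integral_cong_AE) auto
  moreover have "(CLINT \<omega>|M. iexp (t * X \<omega>)) = (CLINT \<omega>|M. iexp (t * Y \<omega>))" for t
    using assms(3) by (intro integral_cong_AE) auto
  moreover have "integrable M (\<lambda>\<omega>. (X \<omega>)\<^sup>2) = integrable M (\<lambda>\<omega>. (Y \<omega>)\<^sup>2)"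
    using assms(3) by (intro integrable_cong_AE) auto
  ultimately show ?thesis using assms unfolding centered_gaussian_def by simp
qed

lemma gaussian_rv_imp_centered:
  assumes X: "gaussian_rv M X" and E: "(\<integral>\<omega>. X \<omega> \<partial>M) = 0"
  shows "centered_gaussian M X"
proof -
  have X_meas [measurable]: "X \<in> borel_measurable M" using X by (simp add: gaussian_rv_def)
  consider c where "AE \<omega> in M. X \<omega> = c"
    | \<mu> \<sigma> where "0 < \<sigma>" "distributed M lborel X (\<lambda>x. ennreal (normal_density \<mu> \<sigma> x))"
    using X by (auto simp: gaussian_rv_def)
  then show ?thesis
  proof cases
    case 1
    have "(\<integral>\<omega>. X \<omega> \<partial>M) = (\<integral>\<omega>. c \<partial>M)"
      using 1 by (intro integral_cong_AE) auto
    then have "c = 0" using E by (simp add: prob_space)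
    have zero: "centered_gaussian M (\<lambda>_. 0)"
      unfolding centered_gaussian_def using prob_space by simp
    show ?thesis
    proof (rule centered_gaussian_cong_AE[OF zero X_meas])
      show "AE \<omega> in M. 0 = X \<omega>" using 1 \<open>c = 0\<close> by auto
    qed
  next
    case 2
    have \<mu>: "\<mu> = 0" using normal_distributed_expectation[OF 2] E by simp
    let ?Z = "\<lambda>\<omega>. X \<omega> / \<sigma>"
    have Z: "distributed M lborel ?Z std_normal_density"
      using 2 normal_standard_normal_convert[OF 2(1), of X \<mu>] by (simp add: \<mu>)
    have D: "distr M borel ?Z = std_normal_distribution"
      using distributed_distr_eq_density[OF Z] by (simp cong: distr_cong)
    have i: "integrable (distr M borel ?Z) (\<lambda>x. x\<^sup>2)"
      unfolding D by (rule integrable_std_normal_distribution_moment)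
    then have "integrable M (\<lambda>\<omega>. \<sigma>\<^sup>2 * (X \<omega> / \<sigma>)\<^sup>2)"
      by (intro integrable_mult_right) (subst (asm) integrable_distr_eq, auto)
    then have i2: "integrable M (\<lambda>\<omega>. (X \<omega>)\<^sup>2)"
      using 2(1) by (simp add: power_divide)
    have "(\<integral>x. x\<^sup>2 \<partial>distr M borel ?Z) = 1"
      unfolding D std_normal_distribution_moment by (simp add: normal_moment_def)
    then have v: "(\<integral>\<omega>. (X \<omega>)\<^sup>2 \<partial>M) = \<sigma>\<^sup>2"
      using 2(1) by (subst (asm) integral_distr) (auto simp: power_divide)
    have "(CLINT \<omega>|M. iexp (t * X \<omega>)) = char (distr M borel ?Z) (t * \<sigma>)" for t
      unfolding char_def using 2(1) by (subst integral_distr) auto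
    then show ?thesis
      unfolding D char_std_normal_distribution centered_gaussian_def v
      using i2 by (simp add: power_mult_distrib mult.commute)
  qed
qed

text \<open>L2 convergence gives convergence of the variances, and of the characteristic functions
  because the function \<open>iexp\<close> is 1-Lipschitz; the defining identity passes to the
  limit.\<close>

lemma centered_gaussian_L2_limit:
  assumes X: "\<And>n. centered_gaussian M (X n)" and Y: "square_integrable M Y"
    and lim: "(\<lambda>n. \<integral>\<omega>. (X n \<omega> - Y \<omega>)\<^sup>2 \<partial>M) \<longlonglongrightarrow> 0"
  shows "centered_gaussian M Y"
proof -
  have X': "square_integrable M (X n)" for n
    using X by (simp add: centered_gaussian_def square_integrable_def)
  have [measurable]: "X n \<in> borel_measurable M" "Y \<in> borel_measurable M" for n
    using X' Y by auto
  have v: "(\<lambda>n. \<integral>\<omega>. (X n \<omega>)\<^sup>2 \<partial>M) \<longlonglongrightarrow> (\<integral>\<omega>. (Y \<omega>)\<^sup>2 \<partial>M)"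
    using expectation_mult_tendsto[OF X' Y X' Y lim lim] by (simp add: power2_eq_square)
  have "(CLINT \<omega>|M. iexp (t * Y \<omega>)) = of_real (exp (- ((\<integral>\<omega>. (Y \<omega>)\<^sup>2 \<partial>M) * t\<^sup>2 / 2)))" for t
  proof (rule LIMSEQ_unique)
    show "(\<lambda>n. CLINT \<omega>|M. iexp (t * X n \<omega>)) \<longlonglongrightarrow> of_real (exp (- ((\<integral>\<omega>. (Y \<omega>)\<^sup>2 \<partial>M) * t\<^sup>2 / 2)))"
    proof -
      have "(CLINT \<omega>|M. iexp (t * X n \<omega>)) = of_real (exp (- ((\<integral>\<omega>. (X n \<omega>)\<^sup>2 \<partial>M) * t\<^sup>2 / 2)))" for n
        using X by (simp add: centered_gaussian_def)
      moreover have "(\<lambda>n. complex_of_real (exp (- ((\<integral>\<omega>. (X n \<omega>)\<^sup>2 \<partial>M) * t\<^sup>2 / 2))))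
         \<longlonglongrightarrow> of_real (exp (- ((\<integral>\<omega>. (Y \<omega>)\<^sup>2 \<partial>M) * t\<^sup>2 / 2)))"
        by (intro tendsto_intros v) auto
      ultimately show ?thesis by simp
    qed
    have "(\<lambda>n. (CLINT \<omega>|M. iexp (t * X n \<omega>)) - (CLINT \<omega>|M. iexp (t * Y \<omega>))) \<longlonglongrightarrow> 0"
    proof (rule Lim_null_comparison)
      have "(\<lambda>n. \<bar>t\<bar> * (sqrt (\<integral>\<omega>. (X n \<omega> - Y \<omega>)\<^sup>2 \<partial>M))) \<longlonglongrightarrow> \<bar>t\<bar> * sqrt 0"
        by (intro tendsto_intros lim)
      then show "(\<lambda>n. \<bar>t\<bar> * (sqrt (\<integral>\<omega>. (X n \<omega> - Y \<omega>)\<^sup>2 \<partial>M))) \<longlonglongrightarrow> 0" by simp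
      have "norm ((CLINT \<omega>|M. iexp (t * X n \<omega>)) - (CLINT \<omega>|M. iexp (t * Y \<omega>)))
          \<le> \<bar>t\<bar> * (sqrt (\<integral>\<omega>. (X n \<omega> - Y \<omega>)\<^sup>2 \<partial>M))" for n
      proof -
        have sq: "square_integrable M (\<lambda>\<omega>. X n \<omega> - Y \<omega>)" by (intro square_integrable_diff X' Y)
        have int: "integrable M (\<lambda>\<omega>. iexp (t * Z \<omega>))" if [measurable]: "Z \<in> borel_measurable M" for Z
          by (intro integrable_const_bound[of _ 1]) auto
        have "norm ((CLINT \<omega>|M. iexp (t * X n \<omega>)) - (CLINT \<omega>|M. iexp (t * Y \<omega>)))
          = norm (CLINT \<omega>|M. iexp (t * X n \<omega>) - iexp (t * Y \<omega>))"
          by (subst Bochner_Integration.integral_diff[OF int int]) simp_all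
        also have "\<dots> \<le> (\<integral>\<omega>. norm (iexp (t * X n \<omega>) - iexp (t * Y \<omega>)) \<partial>M)"
          by (rule integral_norm_bound)
        also have "\<dots> \<le> (\<integral>\<omega>. \<bar>t\<bar> * \<bar>X n \<omega> - Y \<omega>\<bar> \<partial>M)"
        proof (rule integral_mono)
          show "integrable M (\<lambda>\<omega>. norm (iexp (t * X n \<omega>) - iexp (t * Y \<omega>)))"
            by (intro integrable_norm Bochner_Integration.integrable_diff int) simp_all
          show "integrable M (\<lambda>\<omega>. \<bar>t\<bar> * \<bar>X n \<omega> - Y \<omega>\<bar>)"
            using square_integrable_integrable[OF sq] by auto
          show "norm (iexp (t * X n \<omega>) - iexp (t * Y \<omega>)) \<le> \<bar>t\<bar> * \<bar>X n \<omega> - Y \<omega>\<bar>" for \<omega>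
            using cmod_iexp_diff_le[of "t * X n \<omega>" "t * Y \<omega>"]
            unfolding right_diff_distrib[symmetric] abs_mult .
        qed
        also have "\<dots> \<le> \<bar>t\<bar> * (sqrt (\<integral>\<omega>. (X n \<omega> - Y \<omega>)\<^sup>2 \<partial>M))"
        proof -
          have "square_integrable M (\<lambda>\<omega>. \<bar>X n \<omega> - Y \<omega>\<bar>)" "square_integrable M (\<lambda>\<omega>. 1)"
            using sq by (auto simp: square_integrable_def)
          from abs_expectation_mult_le[OF this] show ?thesis
            by (simp add: prob_space mult_left_mono)
        qed
        finally show ?thesis .
      qed
      then show "\<forall>\<^sub>F n in sequentially. norm ((CLINT \<omega>|M. iexp (t * X n \<omega>)) - (CLINT \<omega>|M. iexp (t * Y \<omega>)))
          \<le> \<bar>t\<bar> * (sqrt (\<integral>\<omega>. (X n \<omega> - Y \<omega>)\<^sup>2 \<partial>M))" by simp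
    qed
    then show "(\<lambda>n. CLINT \<omega>|M. iexp (t * X n \<omega>)) \<longlonglongrightarrow> (CLINT \<omega>|M. iexp (t * Y \<omega>))"
      by (simp add: LIM_zero_iff)
  qed
  then show ?thesis using Y by (auto simp: centered_gaussian_def square_integrable_def)
qed

end

section \<open>The Gaussian Hilbert space of the process\<close>

locale centered_gaussian_process = prob_space +
  fixes G :: "real \<Rightarrow> 'a \<Rightarrow> real"
  assumes gaussian: "gaussian_process M {0..} G"
    and mean_zero: "\<And>x. 0 \<le> x \<Longrightarrow> (\<integral>\<omega>. G x \<omega> \<partial>M) = 0"
begin

text \<open>The Gaussian Hilbert space of the process: the closed linear span of \<open>G\<close> in \<open>L\<^sup>2\<close>.\<close>

definition gspace :: "('a \<Rightarrow> real) set" where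
  "gspace = {X. square_integrable M X \<and>
     (\<forall>e>0. \<exists>S a. finite S \<and> S \<subseteq> {0..} \<and> (\<integral>\<omega>. (X \<omega> - (\<Sum>x\<in>S. a x * G x \<omega>))\<^sup>2 \<partial>M) < e)}"

lemma gspace_square_integrable: "X \<in> gspace \<Longrightarrow> square_integrable M X"
  by (simp add: gspace_def)

lemma G_square_integrable:
  assumes "0 \<le> x" shows "square_integrable M (G x)"
proof -
  have "gaussian_rv M (G x)"
    using gaussian[unfolded gaussian_process_def, rule_format, of "{x}" "\<lambda>_. 1"] assms by simp
  then have "centered_gaussian M (G x)"
    using gaussian_rv_imp_centered[of "G x"] mean_zero[OF assms] by simp
  then show ?thesis by (simp add: centered_gaussian_def square_integrable_def)
qed

lemma lincomb_square_integrable: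
  "S \<subseteq> {0..} \<Longrightarrow> square_integrable M (\<lambda>\<omega>. \<Sum>x\<in>S. a x * G x \<omega>)"
  by (intro square_integrable_sum square_integrable_cmult G_square_integrable) auto

lemma lincomb_centered_gaussian:
  assumes "finite S" "S \<subseteq> {0..}"
  shows "centered_gaussian M (\<lambda>\<omega>. \<Sum>x\<in>S. a x * G x \<omega>)"
proof (rule gaussian_rv_imp_centered)
  show "gaussian_rv M (\<lambda>\<omega>. \<Sum>x\<in>S. a x * G x \<omega>)"
    using gaussian assms unfolding gaussian_process_def by blast
  have "integrable M (G x)" if "x \<in> S" for x
    using square_integrable_integrable[OF G_square_integrable] that assms(2) by auto
  then have "(\<integral>\<omega>. (\<Sum>x\<in>S. a x * G x \<omega>) \<partial>M) = (\<Sum>x\<in>S. a x * (\<integral>\<omega>. G x \<omega> \<partial>M))"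
    by (subst Bochner_Integration.integral_sum) auto
  also have "\<dots> = 0" using assms(2) by (intro sum.neutral) (auto simp: mean_zero subset_iff)
  finally show "(\<integral>\<omega>. (\<Sum>x\<in>S. a x * G x \<omega>) \<partial>M) = 0" .
qed

lemma lincomb_in_gspace:
  assumes "finite S" "S \<subseteq> {0..}"
  shows "(\<lambda>\<omega>. \<Sum>x\<in>S. a x * G x \<omega>) \<in> gspace"
proof -
  have "\<exists>S' a'. finite S' \<and> S' \<subseteq> {0..} \<and>
      (\<integral>\<omega>. ((\<Sum>x\<in>S. a x * G x \<omega>) - (\<Sum>x\<in>S'. a' x * G x \<omega>))\<^sup>2 \<partial>M) < e" if "0 < e" for e :: real
    using assms that by (intro exI[of _ S] exI[of _ a]) simp
  then show ?thesis
    unfolding gspace_def using lincomb_square_integrable[OF assms(2)] by auto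
qed

lemma G_in_gspace: "0 \<le> x \<Longrightarrow> G x \<in> gspace"
  using lincomb_in_gspace[of "{x}" "\<lambda>_. 1"] by simp

lemma gspace_lincomb:
  assumes X: "X \<in> gspace" and Y: "Y \<in> gspace"
  shows "(\<lambda>\<omega>. a * X \<omega> + b * Y \<omega>) \<in> gspace"
proof -
  note sX = gspace_square_integrable[OF X] and sY = gspace_square_integrable[OF Y]
  have "\<exists>S c. finite S \<and> S \<subseteq> {0..} \<and>
      (\<integral>\<omega>. ((a * X \<omega> + b * Y \<omega>) - (\<Sum>x\<in>S. c x * G x \<omega>))\<^sup>2 \<partial>M) < e" if "0 < e" for e :: real
  proof -
    \<comment> \<open>The summand 1 keeps the divisor positive when a = b = 0 and makes the final
      inequality strict.\<close>
    let ?q = "2 * a\<^sup>2 + 2 * b\<^sup>2 + 1"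
    have q: "0 < ?q" using zero_le_power2[of a] zero_le_power2[of b] by linarith
    with \<open>0 < e\<close> have eq: "0 < e / ?q" by simp
    obtain S u where S: "finite S" "S \<subseteq> {0..}" "(\<integral>\<omega>. (X \<omega> - (\<Sum>x\<in>S. u x * G x \<omega>))\<^sup>2 \<partial>M) < e / ?q"
      using X eq unfolding gspace_def by blast
    obtain T v where T: "finite T" "T \<subseteq> {0..}" "(\<integral>\<omega>. (Y \<omega> - (\<Sum>x\<in>T. v x * G x \<omega>))\<^sup>2 \<partial>M) < e / ?q"
      using Y eq unfolding gspace_def by blast
    let ?c = "\<lambda>x. a * (if x \<in> S then u x else 0) + b * (if x \<in> T then v x else 0)"
    let ?X = "\<lambda>\<omega>. X \<omega> - (\<Sum>x\<in>S. u x * G x \<omega>)" and ?Y = "\<lambda>\<omega>. Y \<omega> - (\<Sum>x\<in>T. v x * G x \<omega>)"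
    have s: "square_integrable M ?X" "square_integrable M ?Y"
      by (intro square_integrable_diff sX sY lincomb_square_integrable S T)+
    have su: "(\<Sum>x\<in>S \<union> T. ?c x * G x \<omega>) = a * (\<Sum>x\<in>S. u x * G x \<omega>) + b * (\<Sum>x\<in>T. v x * G x \<omega>)" for \<omega>
    proof -
      have "(\<Sum>x\<in>S \<union> T. ?c x * G x \<omega>) = a * (\<Sum>x\<in>S \<union> T. (if x \<in> S then u x * G x \<omega> else 0))
         + b * (\<Sum>x\<in>S \<union> T. (if x \<in> T then v x * G x \<omega> else 0))"
        unfolding sum_distrib_left sum.distrib[symmetric] by (intro sum.cong) (auto simp: algebra_simps)
      moreover have "(S \<union> T) \<inter> S = S" "(S \<union> T) \<inter> T = T" by auto
      ultimately show ?thesis using S(1) T(1) by (simp add: sum.If_cases)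
    qed
    have "(a * X \<omega> + b * Y \<omega> - (\<Sum>x\<in>S \<union> T. ?c x * G x \<omega>)) = a * ?X \<omega> + b * ?Y \<omega>" for \<omega>
      unfolding su by (simp add: algebra_simps)
    then have "(\<integral>\<omega>. (a * X \<omega> + b * Y \<omega> - (\<Sum>x\<in>S \<union> T. ?c x * G x \<omega>))\<^sup>2 \<partial>M) =
        (\<integral>\<omega>. (a * ?X \<omega> + b * ?Y \<omega>)\<^sup>2 \<partial>M)" by simp
    also have "\<dots> \<le> 2 * (\<integral>\<omega>. (a * ?X \<omega>)\<^sup>2 \<partial>M) + 2 * (\<integral>\<omega>. (b * ?Y \<omega>)\<^sup>2 \<partial>M)"
      by (intro second_moment_add_le square_integrable_cmult s)
    also have "\<dots> = 2 * a\<^sup>2 * (\<integral>\<omega>. (?X \<omega>)\<^sup>2 \<partial>M) + 2 * b\<^sup>2 * (\<integral>\<omega>. (?Y \<omega>)\<^sup>2 \<partial>M)"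
      by (simp add: power_mult_distrib)
    also have "\<dots> \<le> 2 * a\<^sup>2 * (e / ?q) + 2 * b\<^sup>2 * (e / ?q)"
      using S(3) T(3) by (intro add_mono mult_left_mono) auto
    also have "\<dots> < ?q * (e / ?q)"
      using eq by (simp only: distrib_right)
    also have "\<dots> = e" using q by simp
    finally show ?thesis
      using S T by (intro exI[of _ "S \<union> T"] exI[of _ ?c]) simp
  qed
  then show ?thesis
    unfolding gspace_def using square_integrable_lincomb(1)[OF sX sY] by auto
qed

lemma gspace_L2_limit:
  assumes X: "\<And>n. X n \<in> gspace" and Y: "square_integrable M Y"
    and lim: "((\<lambda>n. \<integral>\<omega>. (X n \<omega> - Y \<omega>)\<^sup>2 \<partial>M) \<longlongrightarrow> 0) F" and F: "F \<noteq> bot"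
  shows "Y \<in> gspace"
proof -
  have "\<exists>S a. finite S \<and> S \<subseteq> {0..} \<and> (\<integral>\<omega>. (Y \<omega> - (\<Sum>x\<in>S. a x * G x \<omega>))\<^sup>2 \<partial>M) < e" if "0 < e" for e :: real
  proof -
    have "\<forall>\<^sub>F n in F. (\<integral>\<omega>. (X n \<omega> - Y \<omega>)\<^sup>2 \<partial>M) < e / 4"
      using lim \<open>0 < e\<close> by (intro order_tendstoD(2)) auto
    then obtain n where n: "(\<integral>\<omega>. (X n \<omega> - Y \<omega>)\<^sup>2 \<partial>M) < e / 4"
      using F eventually_happens by blast
    have "0 < e / 4" using \<open>0 < e\<close> by simp
    then obtain S a where S: "finite S" "S \<subseteq> {0..}" "(\<integral>\<omega>. (X n \<omega> - (\<Sum>x\<in>S. a x * G x \<omega>))\<^sup>2 \<partial>M) < e / 4"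
      using X[of n] unfolding gspace_def by blast
    have "(\<integral>\<omega>. (Y \<omega> - (\<Sum>x\<in>S. a x * G x \<omega>))\<^sup>2 \<partial>M) < e"
      using second_moment_triangle[OF Y gspace_square_integrable[OF X[of n]] lincomb_square_integrable[OF S(2), of a]]
        n S(3) by (simp add: power2_commute[of "Y _" "X n _"])
    then show ?thesis using S by blast
  qed
  then show ?thesis unfolding gspace_def using Y by auto
qed

text \<open>Finite linear combinations of the process are Gaussian, and the Gaussian property
  survives L2 limits. As the space is linear, any two of its elements form a
  \<open>gaussian_pair\<close>.\<close>

lemma gspace_centered_gaussian:
  assumes X: "X \<in> gspace" shows "centered_gaussian M X"
proof -
  have "\<forall>n. \<exists>Z. centered_gaussian M Z \<and> (\<integral>\<omega>. (X \<omega> - Z \<omega>)\<^sup>2 \<partial>M) < inverse (real (Suc n))"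
  proof
    fix n
    have "0 < inverse (real (Suc n))" by simp
    then obtain S a where "finite S" "S \<subseteq> {0..}"
        "(\<integral>\<omega>. (X \<omega> - (\<Sum>x\<in>S. a x * G x \<omega>))\<^sup>2 \<partial>M) < inverse (real (Suc n))"
      using X unfolding gspace_def by blast
    with lincomb_centered_gaussian[of S a]
    show "\<exists>Z. centered_gaussian M Z \<and> (\<integral>\<omega>. (X \<omega> - Z \<omega>)\<^sup>2 \<partial>M) < inverse (real (Suc n))"
      by blast
  qed
  from choice[OF this] obtain Z where Z: "\<And>n. centered_gaussian M (Z n)"
    "\<And>n. (\<integral>\<omega>. (X \<omega> - Z n \<omega>)\<^sup>2 \<partial>M) < inverse (real (Suc n))"
    by blast
  show ?thesis
  proof (rule centered_gaussian_L2_limit)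
    show "centered_gaussian M (Z n)" for n by (rule Z(1))
    show "square_integrable M X" using X by (rule gspace_square_integrable)
    show "(\<lambda>n. \<integral>\<omega>. (Z n \<omega> - X \<omega>)\<^sup>2 \<partial>M) \<longlonglongrightarrow> 0"
    proof (rule Lim_null_comparison[OF _ LIMSEQ_inverse_real_of_nat])
      show "\<forall>\<^sub>F n in sequentially. norm (\<integral>\<omega>. (Z n \<omega> - X \<omega>)\<^sup>2 \<partial>M) \<le> inverse (real (Suc n))"
        using Z(2) by (intro always_eventually) (simp add: power2_commute[of "Z _ _"] less_imp_le)
    qed
  qed
qed

lemma gspace_pair: "X \<in> gspace \<Longrightarrow> Y \<in> gspace \<Longrightarrow> gaussian_pair M X Y"
  by unfold_locales (intro gspace_centered_gaussian gspace_lincomb)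

lemma gspace_wick_expectation:
  assumes "X \<in> gspace" "Y \<in> gspace"
  shows "(\<integral>\<omega>. wick_power M k X \<omega> * wick_power M k Y \<omega> \<partial>M) = fact k * (\<integral>\<omega>. X \<omega> * Y \<omega> \<partial>M) ^ k"
  using gaussian_pair.wick_power_expectation[OF gspace_pair[OF assms]] .

end

section \<open>Chaining\<close>

text \<open>A dyadic point is reached from 0 by using at most one step from each level, so the
  increments sum to a geometric series. Continuity carries the bound to all other points.\<close>

lemma dyadic_chaining:
  fixes x :: "real \<Rightarrow> real"
  assumes cont: "continuous_on {0..1} x" and q: "0 \<le> q" "q < 1" and K: "0 \<le> K"
    and step: "\<And>i j. j < 2 ^ i \<Longrightarrow> \<bar>x (real (j + 1) / 2 ^ i) - x (real j / 2 ^ i)\<bar> \<le> K * q ^ i"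
    and t: "t \<in> {0..1}"
  shows "\<bar>x t - x 0\<bar> \<le> K / (1 - q)"
proof -
  have dy: "\<bar>x (real j / 2 ^ n) - x 0\<bar> \<le> K * (\<Sum>i\<le>n. q ^ i)" if "j \<le> 2 ^ n" for j n
    using that
  proof (induction n arbitrary: j)
    case 0
    then have "j = 0 \<or> j = 1" by auto
    then show ?case using step[of 0 0] K by auto
  next
    case (Suc n)
    have half: "real (2 * i) / 2 ^ Suc n = real i / 2 ^ n" for i :: nat by simp
    show ?case
    proof (cases "even j")
      case True
      then obtain i where i: "j = 2 * i" by (elim evenE)
      have "\<bar>x (real i / 2 ^ n) - x 0\<bar> \<le> K * (\<Sum>i\<le>n. q ^ i)"
        using Suc i by auto
      also have "\<dots> \<le> K * (\<Sum>i\<le>Suc n. q ^ i)"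
        using K q by (intro mult_left_mono) auto
      finally show ?thesis unfolding i half .
    next
      case False
      then obtain i where i: "j = 2 * i + 1" by (elim oddE)
      have "\<bar>x (real i / 2 ^ n) - x 0\<bar> \<le> K * (\<Sum>i\<le>n. q ^ i)"
        using Suc i by auto
      moreover have "\<bar>x (real j / 2 ^ Suc n) - x (real i / 2 ^ n)\<bar> \<le> K * q ^ Suc n"
        using step[of "2 * i" "Suc n"] Suc.prems unfolding half i by auto
      ultimately have "\<bar>x (real j / 2 ^ Suc n) - x 0\<bar> \<le> K * (\<Sum>i\<le>n. q ^ i) + K * q ^ Suc n"
        by linarith
      then show ?thesis by (simp add: algebra_simps)
    qed
  qed
  \<comment> \<open>The largest dyadic point of level n that does not exceed t.\<close>
  define s where "s n = real (nat \<lfloor>t * 2 ^ n\<rfloor>) / 2 ^ n" for n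
  have fl: "real (nat \<lfloor>t * 2 ^ n\<rfloor>) \<le> t * 2 ^ n" "t * 2 ^ n < real (nat \<lfloor>t * 2 ^ n\<rfloor>) + 1" for n
  proof -
    have "0 \<le> \<lfloor>t * 2 ^ n\<rfloor>" using t by simp
    then have e: "real (nat \<lfloor>t * 2 ^ n\<rfloor>) = of_int \<lfloor>t * 2 ^ n\<rfloor>" by simp
    show "real (nat \<lfloor>t * 2 ^ n\<rfloor>) \<le> t * 2 ^ n" "t * 2 ^ n < real (nat \<lfloor>t * 2 ^ n\<rfloor>) + 1"
      unfolding e by linarith+
  qed
  have s1: "s n \<le> t" "t - (1/2) ^ n \<le> s n" for n
  proof -
    show "s n \<le> t" using fl(1)[of n] by (simp add: s_def divide_le_eq)
    have "t - (1/2) ^ n = (t * 2 ^ n - 1) / 2 ^ n" by (simp add: field_simps)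
    also have "\<dots> \<le> s n" unfolding s_def using fl(2)[of n] by (intro divide_right_mono) auto
    finally show "t - (1/2) ^ n \<le> s n" .
  qed
  have s0: "s n \<in> {0..1}" for n
  proof -
    have "0 \<le> s n" by (simp add: s_def)
    then show ?thesis using s1(1)[of n] t by simp
  qed
  have "(\<lambda>n. t - (1/2) ^ n) \<longlonglongrightarrow> t - 0"
    by (intro tendsto_diff tendsto_const LIMSEQ_realpow_zero) auto
  then have "s \<longlonglongrightarrow> t"
    by (intro tendsto_sandwich[of "\<lambda>n. t - (1/2) ^ n" s sequentially "\<lambda>_. t"] always_eventually allI s1) auto
  then have "(\<lambda>n. x (s n)) \<longlonglongrightarrow> x t"
    by (rule continuous_on_tendsto_compose[OF cont _ t always_eventually]) (use s0 in blast)
  then have "(\<lambda>n. \<bar>x (s n) - x 0\<bar>) \<longlonglongrightarrow> \<bar>x t - x 0\<bar>"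
    by (intro tendsto_intros)
  moreover have "\<bar>x (s n) - x 0\<bar> \<le> K / (1 - q)" for n
  proof -
    have "real (nat \<lfloor>t * 2 ^ n\<rfloor>) \<le> 2 ^ n"
    proof (rule order_trans[OF fl(1)])
      show "t * 2 ^ n \<le> 2 ^ n" using mult_right_mono[of t 1 "2 ^ n"] t by simp
    qed
    then have "nat \<lfloor>t * 2 ^ n\<rfloor> \<le> 2 ^ n" by (metis of_nat_le_iff of_nat_numeral of_nat_power)
    from dy[OF this] have "\<bar>x (s n) - x 0\<bar> \<le> K * (\<Sum>i\<le>n. q ^ i)" by (simp add: s_def)
    also have "(\<Sum>i\<le>n. q ^ i) = (1 - q ^ Suc n) / (1 - q)"
      using q by (simp add: sum_gp0)
    also have "K * \<dots> \<le> K * (1 / (1 - q))"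
      using K q by (intro mult_left_mono divide_right_mono) auto
    finally show ?thesis by simp
  qed
  ultimately show ?thesis by (intro LIMSEQ_le_const2) auto
qed

text \<open>The values at the integers converge because their increments are summable, and the
  oscillation between consecutive integers tends to 0.\<close>

lemma dyadic_block_convergent:
  fixes x :: "real \<Rightarrow> real"
  assumes r: "0 \<le> r" "r < 1"
    and osc: "\<And>n t. t \<in> {0..1} \<Longrightarrow> \<bar>x (real n + t) - x (real n)\<bar> \<le> D * r ^ n"
  shows "\<exists>l. (x \<longlongrightarrow> l) at_top"
proof -
  have "summable (\<lambda>n. x (real (Suc n)) - x (real n))"
  proof (rule summable_comparison_test')
    show "summable (\<lambda>n. D * r ^ n)" using r by (intro summable_mult summable_geometric) auto
    show "norm (x (real (Suc n)) - x (real n)) \<le> D * r ^ n" for n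
      using osc[of 1 n] by (simp add: add.commute)
  qed
  then have "convergent (\<lambda>n. \<Sum>i<n. x (real (Suc i)) - x (real i))"
    by (simp add: summable_iff_convergent)
  then have "convergent (\<lambda>n. (x (real n) - x 0) + x 0)"
    unfolding sum_lessThan_telescope[of "\<lambda>i. x (real i)"] by (intro convergent_add convergent_const) simp
  then obtain l where l: "(\<lambda>n. x (real n)) \<longlonglongrightarrow> l"
    by (auto simp: convergent_def)
  have fl: "filterlim (\<lambda>u::real. nat \<lfloor>u\<rfloor>) sequentially at_top"
    by (rule filterlim_compose[OF filterlim_nat_sequentially filterlim_floor_sequentially])
  have "((\<lambda>u. x u - x (real (nat \<lfloor>u\<rfloor>))) \<longlongrightarrow> 0) at_top"
  proof (rule Lim_null_comparison)
    have "(\<lambda>n. D * r ^ n) \<longlonglongrightarrow> D * 0"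
      using r by (intro tendsto_intros LIMSEQ_realpow_zero) auto
    then have "(\<lambda>n. D * r ^ n) \<longlonglongrightarrow> 0" by simp
    from filterlim_compose[OF this fl] show "((\<lambda>u::real. D * r ^ nat \<lfloor>u\<rfloor>) \<longlongrightarrow> 0) at_top" .
    show "\<forall>\<^sub>F u in at_top. norm (x u - x (real (nat \<lfloor>u\<rfloor>))) \<le> D * r ^ nat \<lfloor>u\<rfloor>"
      using eventually_ge_at_top[of "0::real"]
    proof eventually_elim
      case (elim u)
      have "0 \<le> \<lfloor>u\<rfloor>" using elim by simp
      then have "real (nat \<lfloor>u\<rfloor>) = of_int \<lfloor>u\<rfloor>" by simp
      then have "u - real (nat \<lfloor>u\<rfloor>) \<in> {0..1}" by (simp, linarith)
      from osc[OF this, of "nat \<lfloor>u\<rfloor>"] show ?case by simp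
    qed
  qed
  from tendsto_add[OF this filterlim_compose[OF l fl]] show ?thesis by auto
qed

text \<open>Kolmogorov's chaining argument. Interpolating between the two second moment bounds makes the
  sum of the squared increments over the dyadic points of level \<open>i\<close> in \<open>[n, n + 1]\<close> summable in
  both \<open>i\<close> and \<open>n\<close>, so second moments suffice.\<close>

lemma chaining_AE_convergent:
  fixes X :: "real \<Rightarrow> 'a \<Rightarrow> real"
  assumes meas: "\<And>u. 0 \<le> u \<Longrightarrow> X u \<in> borel_measurable M"
    and cont: "\<And>\<omega>. \<omega> \<in> space M \<Longrightarrow> continuous_on {0..} (\<lambda>u. X u \<omega>)"
    and e: "0 < e" "e < 1" and C: "0 \<le> C"
    and int: "\<And>u v. 0 \<le> u \<Longrightarrow> 0 \<le> v \<Longrightarrow> integrable M (\<lambda>\<omega>. (X v \<omega> - X u \<omega>)\<^sup>2)"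
    and decay: "\<And>n u v. real n \<le> u \<Longrightarrow> u \<le> v \<Longrightarrow> v \<le> real n + 1 \<Longrightarrow>
      (\<integral>\<omega>. (X v \<omega> - X u \<omega>)\<^sup>2 \<partial>M) \<le> C * (e ^ 16) ^ n"
    and smooth: "\<And>n u v. real n \<le> u \<Longrightarrow> u \<le> v \<Longrightarrow> v \<le> real n + 1 \<Longrightarrow>
      (\<integral>\<omega>. (X v \<omega> - X u \<omega>)\<^sup>2 \<partial>M) \<le> C * (v - u)\<^sup>2"
  shows "AE \<omega> in M. \<exists>l. ((\<lambda>u. X u \<omega>) \<longlongrightarrow> l) at_top"
proof -
  \<comment> \<open>An eighth root of 1/2: the mesh width of level i is \<open>(p ^ 8) ^ i\<close>,
    and all exponents below are integers.\<close>
  define p :: real where "p = (1 / 2) powr (1 / 8)"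
  have p: "0 < p" "p < 1" "p ^ 8 = 1 / 2"
  proof -
    show "0 < p" by (simp add: p_def)
    show p8: "p ^ 8 = 1 / 2"
      unfolding p_def by (subst powr_realpow[symmetric]) (simp_all add: powr_powr)
    show "p < 1"
    proof (rule ccontr)
      assume "\<not> p < 1"
      then have "1 \<le> p ^ 8" by (intro one_le_power) simp
      with p8 show False by simp
    qed
  qed
  define pt where "pt n i j = real n + real j / 2 ^ i" for n i j :: nat
  define V where "V n i \<omega> = (\<Sum>j<2^i. (X (pt n i (j + 1)) \<omega> - X (pt n i j) \<omega>)\<^sup>2)" for n i :: nat and \<omega>
  have pt0: "0 \<le> pt n i j" for n i j by (simp add: pt_def)
  have [measurable]: "X (pt n i j) \<in> borel_measurable M" for n i j by (intro meas pt0)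
  have V_meas [measurable]: "V n i \<in> borel_measurable M" for n i unfolding V_def by measurable
  have V0: "0 \<le> V n i \<omega>" for n i \<omega> by (simp add: V_def sum_nonneg)
  have intV: "integrable M (V n i)" for n i
    unfolding V_def by (intro Bochner_Integration.integrable_sum int pt0)
  \<comment> \<open>The minimum of the two second moment bounds is at most their geometric mean with
    weights 3/4 and 1/4. An increment of level i then costs p^(12 i), and the 2^i = p^(-8 i) of them
    still sum to p^(4 i).\<close>
  have interp: "min (a ^ 4) (b ^ 4) \<le> a ^ 3 * b" if "0 \<le> a" "0 \<le> b" for a b :: real
  proof (cases "a \<le> b")
    case True
    then have "a ^ 3 * a \<le> a ^ 3 * b" using that by (intro mult_left_mono) auto
    then show ?thesis by (simp add: eval_nat_numeral mult_ac min.coboundedI1)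
  next
    case False
    then have "b ^ 3 * b \<le> a ^ 3 * b" using that by (intro mult_right_mono power_mono) auto
    then show ?thesis by (simp add: eval_nat_numeral mult_ac min.coboundedI2)
  qed
  have EV: "(\<integral>\<omega>. V n i \<omega> \<partial>M) \<le> C * (p ^ 4) ^ i * (e ^ 4) ^ n" for n i
  proof -
    have "(\<integral>\<omega>. (X (pt n i (j + 1)) \<omega> - X (pt n i j) \<omega>)\<^sup>2 \<partial>M) \<le> C * (((p ^ 4) ^ i) ^ 3 * (e ^ 4) ^ n)"
      if j: "j < 2 ^ i" for j
    proof -
      have "real (j + 1) \<le> 2 ^ i" using j by (metis Suc_eq_plus1 Suc_leI of_nat_le_iff of_nat_numeral of_nat_power)
      then have b: "real n \<le> pt n i j" "pt n i j \<le> pt n i (j + 1)" "pt n i (j + 1) \<le> real n + 1"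
        by (simp_all add: pt_def divide_right_mono divide_le_eq)
      have d: "pt n i (j + 1) - pt n i j = (p ^ 8) ^ i"
        unfolding p(3) by (simp add: pt_def field_simps)
      have "(\<integral>\<omega>. (X (pt n i (j + 1)) \<omega> - X (pt n i j) \<omega>)\<^sup>2 \<partial>M) \<le> min (C * ((p ^ 8) ^ i)\<^sup>2) (C * (e ^ 16) ^ n)"
        using decay[OF b] smooth[OF b] unfolding d by simp
      also have "\<dots> = C * min (((p ^ 4) ^ i) ^ 4) (((e ^ 4) ^ n) ^ 4)"
        unfolding min_mult_distrib_left using C
        by (simp add: power_mult[symmetric] mult.commute[of i] mult.commute[of n] mult.assoc)
      also have "\<dots> \<le> C * (((p ^ 4) ^ i) ^ 3 * (e ^ 4) ^ n)"
        using C p e by (intro mult_left_mono interp) auto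
      finally show ?thesis .
    qed
    then have "(\<Sum>j<2^i. \<integral>\<omega>. (X (pt n i (j + 1)) \<omega> - X (pt n i j) \<omega>)\<^sup>2 \<partial>M) \<le>
        (\<Sum>j<(2::nat)^i. C * (((p ^ 4) ^ i) ^ 3 * (e ^ 4) ^ n))"
      by (intro sum_mono) auto
    also have "\<dots> = (2 * p ^ 8) ^ i * (C * (p ^ 4) ^ i * (e ^ 4) ^ n)"
      by (simp add: power_mult_distrib power_mult[symmetric] power_add[symmetric] mult_ac)
    finally show ?thesis
      unfolding V_def p(3) by (subst Bochner_Integration.integral_sum) (auto intro!: int pt0)
  qed
  \<comment> \<open>The weights use up half of the exponents in \<open>EV\<close>, so the expected
    sum stays finite. A finite value K for one path bounds V by K p^(2 i) e^(2 n), and the square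
    root of this is the step bound of \<open>dyadic_chaining\<close>.\<close>
  define W where "W \<omega> = (\<Sum>n. \<Sum>i. ennreal (V n i \<omega> / ((p ^ 2) ^ i * (e ^ 2) ^ n)))" for \<omega>
  have [measurable]: "W \<in> borel_measurable M" unfolding W_def by measurable
  have pe: "(p ^ 2) ^ i * (e ^ 2) ^ n > 0" for i n using p e by simp
  have "(\<integral>\<^sup>+\<omega>. W \<omega> \<partial>M) = (\<Sum>n. \<Sum>i. \<integral>\<^sup>+\<omega>. ennreal (V n i \<omega> / ((p ^ 2) ^ i * (e ^ 2) ^ n)) \<partial>M)"
    unfolding W_def by (simp add: nn_integral_suminf)
  also have "\<dots> \<le> (\<Sum>n. \<Sum>i. ennreal (C * (e ^ 2) ^ n * (p ^ 2) ^ i))"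
  proof (intro suminf_le allI summableI)
    fix n i
    have "(\<integral>\<^sup>+\<omega>. ennreal (V n i \<omega> / ((p ^ 2) ^ i * (e ^ 2) ^ n)) \<partial>M) =
        ennreal (\<integral>\<omega>. V n i \<omega> / ((p ^ 2) ^ i * (e ^ 2) ^ n) \<partial>M)"
      using pe[of i n] V0 by (intro nn_integral_eq_integral) (auto intro!: intV less_imp_le simp del: power_mult_distrib)
    also have "\<dots> \<le> ennreal (C * (p ^ 4) ^ i * (e ^ 4) ^ n / ((p ^ 2) ^ i * (e ^ 2) ^ n))"
      using EV[of n i] pe[of i n] by (intro ennreal_leI) (simp only: integral_divide_zero divide_right_mono less_imp_le)
    also have "C * (p ^ 4) ^ i * (e ^ 4) ^ n / ((p ^ 2) ^ i * (e ^ 2) ^ n) = C * (e ^ 2) ^ n * (p ^ 2) ^ i"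
    proof -
      have "(p ^ 4) ^ i = (p ^ 2) ^ i * (p ^ 2) ^ i" "(e ^ 4) ^ n = (e ^ 2) ^ n * (e ^ 2) ^ n"
        by (simp_all add: power_mult[symmetric] power_add[symmetric] mult_2[symmetric])
      then show ?thesis using pe[of i n] p e by (simp add: field_simps)
    qed
    finally show "(\<integral>\<^sup>+\<omega>. ennreal (V n i \<omega> / ((p ^ 2) ^ i * (e ^ 2) ^ n)) \<partial>M) \<le> ennreal (C * (e ^ 2) ^ n * (p ^ 2) ^ i)" .
  qed
  also have "\<dots> = (\<Sum>n. ennreal (C * (1 / (1 - p ^ 2)) * (e ^ 2) ^ n))"
  proof (rule suminf_cong)
    fix n
    have "(\<lambda>i. C * (e ^ 2) ^ n * (p ^ 2) ^ i) sums (C * (e ^ 2) ^ n * (1 / (1 - p ^ 2)))"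
      using p by (intro sums_mult geometric_sums) (auto simp: power_less_one_iff abs_if)
    then show "(\<Sum>i. ennreal (C * (e ^ 2) ^ n * (p ^ 2) ^ i)) = ennreal (C * (1 / (1 - p ^ 2)) * (e ^ 2) ^ n)"
      using C e p by (subst suminf_ennreal_eq) (auto simp: mult_ac)
  qed
  also have "\<dots> = ennreal (C * (1 / (1 - p ^ 2)) * (1 / (1 - e ^ 2)))"
  proof (rule suminf_ennreal_eq)
    show "(\<lambda>n. C * (1 / (1 - p ^ 2)) * (e ^ 2) ^ n) sums (C * (1 / (1 - p ^ 2)) * (1 / (1 - e ^ 2)))"
      using e by (intro sums_mult geometric_sums) (auto simp: power_less_one_iff abs_if)
    show "0 \<le> C * (1 / (1 - p ^ 2)) * (e ^ 2) ^ n" for n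
    proof -
      have "p ^ 2 \<le> 1" using p by (intro power_le_one) auto
      then show ?thesis using C e by simp
    qed
  qed
  finally have "(\<integral>\<^sup>+\<omega>. W \<omega> \<partial>M) \<noteq> \<infinity>" by (auto simp: top_unique)
  then have "AE \<omega> in M. W \<omega> \<noteq> \<infinity>" by (intro nn_integral_PInf_AE) auto
  with AE_space show ?thesis
  proof eventually_elim
    case (elim \<omega>)
    then obtain K where K: "0 \<le> K" "W \<omega> = ennreal K" by (cases "W \<omega>") auto
    have term_le: "f i \<le> (\<Sum>i. f i)" for f :: "nat \<Rightarrow> ennreal" and i
      using sum_le_suminf[of f "{i}"] by simp
    have VK: "V n i \<omega> \<le> K * ((p ^ 2) ^ i * (e ^ 2) ^ n)" for n i
    proof -
      have "ennreal (V n i \<omega> / ((p ^ 2) ^ i * (e ^ 2) ^ n)) \<le> (\<Sum>i. ennreal (V n i \<omega> / ((p ^ 2) ^ i * (e ^ 2) ^ n)))"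
        by (rule term_le)
      also have "\<dots> \<le> W \<omega>"
        unfolding W_def by (rule term_le)
      finally show ?thesis using K pe[of i n] by (simp add: divide_le_eq)
    qed
    have "\<bar>X (real n + t) \<omega> - X (real n) \<omega>\<bar> \<le> (sqrt K / (1 - p)) * e ^ n" if t: "t \<in> {0..1}" for n t
    proof -
      have "\<bar>X (real n + t) \<omega> - X (real n + 0) \<omega>\<bar> \<le> (sqrt K * e ^ n) / (1 - p)"
      proof (rule dyadic_chaining[where x = "\<lambda>t. X (real n + t) \<omega>" and q = p])
        show "continuous_on {0..1} (\<lambda>t. X (real n + t) \<omega>)"
          by (rule continuous_on_compose2[OF cont[OF elim(1)]]) (auto intro!: continuous_intros)
        show "\<bar>X (real n + real (j + 1) / 2 ^ i) \<omega> - X (real n + real j / 2 ^ i) \<omega>\<bar> \<le> sqrt K * e ^ n * p ^ i"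
          if j: "j < 2 ^ i" for i j
        proof -
          have "(X (pt n i (j + 1)) \<omega> - X (pt n i j) \<omega>)\<^sup>2 \<le> V n i \<omega>"
            unfolding V_def using j by (intro member_le_sum[of j "{..<2^i}"]) auto
          also note VK[of n i]
          also have "K * ((p ^ 2) ^ i * (e ^ 2) ^ n) = (sqrt K * e ^ n * p ^ i)\<^sup>2"
            using K by (simp add: power_mult_distrib power_mult[symmetric] mult_ac)
          finally have "\<bar>X (pt n i (j + 1)) \<omega> - X (pt n i j) \<omega>\<bar> \<le> sqrt K * e ^ n * p ^ i"
            using K p e by (subst (asm) abs_le_square_iff[symmetric]) auto
          then show ?thesis by (simp add: pt_def)
        qed
      qed (use p K e t in auto)
      then show ?thesis by simp
    qed
    then show ?case
      by (intro dyadic_block_convergent[where r = e and D = "sqrt K / (1 - p)"]) (use e in auto)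
  qed
qed

section \<open>Singular kernels\<close>

text \<open>Convexity of the power function on the half line, as a tangent inequality; it is
  integrated in \<open>nn_integral_power_le\<close>.\<close>

lemma power_tangent_le:
  fixes x a :: real
  assumes "0 \<le> x" "0 \<le> a"
  shows "a ^ Suc n + real (Suc n) * a ^ n * (x - a) \<le> x ^ Suc n"
proof (induction n)
  case (Suc n)
  have "x * (a ^ Suc n + real (Suc n) * a ^ n * (x - a)) \<le> x * x ^ Suc n"
    using Suc assms(1) by (rule mult_left_mono)
  moreover have "x * (a ^ Suc n + real (Suc n) * a ^ n * (x - a)) =
      a ^ Suc (Suc n) + real (Suc (Suc n)) * a ^ Suc n * (x - a) + real (Suc n) * a ^ n * (x - a)\<^sup>2"
    by (simp add: power2_eq_square algebra_simps)
  moreover have "0 \<le> real (Suc n) * a ^ n * (x - a)\<^sup>2" using assms by simp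
  ultimately show ?case by simp
qed simp

text \<open>Jensen's inequality: integrate the tangent inequality at the mean. If the right-hand
  side is finite and k > 0, F is integrable because F \<le> 1 + F^k; otherwise the claim is
  immediate.\<close>

lemma (in prob_space) nn_integral_power_le:
  fixes F :: "'a \<Rightarrow> real"
  assumes [measurable]: "F \<in> borel_measurable M" and F: "\<And>x. 0 \<le> F x"
  shows "(\<integral>\<^sup>+x. ennreal (F x) \<partial>M) ^ k \<le> (\<integral>\<^sup>+x. ennreal (F x ^ k) \<partial>M)"
proof (cases k)
  case 0
  then show ?thesis by (simp add: emeasure_space_1)
next
  case (Suc n)
  show ?thesis
  proof (cases "(\<integral>\<^sup>+x. ennreal (F x ^ k) \<partial>M) = \<infinity>")
    case False
    then have ik: "integrable M (\<lambda>x. F x ^ k)"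
      using F by (intro integrableI_nonneg) (auto simp: top.not_eq_extremum)
    have i: "integrable M F"
    proof (rule Bochner_Integration.integrable_bound)
      show "integrable M (\<lambda>x. 1 + F x ^ k)" using ik by simp
      have "F x \<le> 1 + F x ^ k" for x
      proof (cases "F x \<le> 1")
        case False
        then have "F x ^ 1 \<le> F x ^ k" using Suc by (intro power_increasing) auto
        then show ?thesis by simp
      qed (use F in \<open>simp add: add_increasing2\<close>)
      then show "AE x in M. norm (F x) \<le> norm (1 + F x ^ k)" using F by (simp add: abs_of_nonneg add_nonneg_nonneg)
    qed simp
    let ?a = "\<integral>x. F x \<partial>M"
    have a: "0 \<le> ?a" using F by simp
    have "?a ^ k = (\<integral>x. ?a ^ Suc n + real (Suc n) * ?a ^ n * (F x - ?a) \<partial>M)"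
      using i by (simp add: Suc prob_space)
    also have "\<dots> \<le> (\<integral>x. F x ^ k \<partial>M)"
      unfolding Suc using ik i F a
      by (intro integral_mono power_tangent_le) (auto simp: Suc simp del: power_Suc)
    finally have "ennreal (?a ^ k) \<le> ennreal (\<integral>x. F x ^ k \<partial>M)" by (rule ennreal_leI)
    then show ?thesis
      using i ik F a by (simp add: nn_integral_eq_integral ennreal_power)
  qed simp
qed

lemma nn_integral_abs_powr:
  fixes \<beta> R :: real
  assumes "\<beta> < 1" "0 \<le> R"
  shows "(\<integral>\<^sup>+z. ennreal (\<bar>z\<bar> powr (- \<beta>)) * indicator {-R..R} z \<partial>lborel) = ennreal (2 * R powr (1 - \<beta>) / (1 - \<beta>))"
proof -
  let ?f = "\<lambda>z::real. ennreal (z powr (- \<beta>)) * indicator {0..R} z"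
  have half: "(\<integral>\<^sup>+z. ?f z \<partial>lborel) = ennreal (R powr (1 - \<beta>) / (1 - \<beta>))"
    using nn_integral_has_integral_lebesgue'[OF _ has_integral_powr_from_0[of "- \<beta>" R]] assms
    by (simp add: add.commute)
  have refl: "(\<integral>\<^sup>+z. ?f (- z) \<partial>lborel) = (\<integral>\<^sup>+z. ?f z \<partial>lborel)"
    using nn_integral_real_affine[of ?f "-1" 0] by simp
  have "(\<integral>\<^sup>+z. ennreal (\<bar>z\<bar> powr (- \<beta>)) * indicator {-R..R} z \<partial>lborel) = (\<integral>\<^sup>+z. ?f z + ?f (- z) \<partial>lborel)"
    by (rule nn_integral_cong_AE, rule AE_mp[OF AE_lborel_singleton[of 0]], rule AE_I2) (auto simp: indicator_def)
  also have "\<dots> = (\<integral>\<^sup>+z. ?f z \<partial>lborel) + (\<integral>\<^sup>+z. ?f (- z) \<partial>lborel)"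
    by (rule nn_integral_add) measurable
  also have "\<dots> = ennreal (2 * R powr (1 - \<beta>) / (1 - \<beta>))"
    unfolding refl half using assms by (simp flip: ennreal_plus)
  finally show ?thesis .
qed

lemma nn_integral_abs_powr_tail:
  fixes \<beta> R :: real
  assumes "0 < \<beta>" "0 < R"
  shows "(\<integral>\<^sup>+z. ennreal (\<bar>z\<bar> powr (- 1 - \<beta>)) * indicator {z. R \<le> \<bar>z\<bar>} z \<partial>lborel) = ennreal (2 * R powr (- \<beta>) / \<beta>)"
proof -
  let ?f = "\<lambda>z::real. ennreal (z powr (- 1 - \<beta>)) * indicator {R..} z"
  have half: "(\<integral>\<^sup>+z. ?f z \<partial>lborel) = ennreal (R powr (- \<beta>) / \<beta>)"
    using nn_integral_has_integral_lebesgue'[OF _ has_integral_powr_to_inf[of "- 1 - \<beta>" R]] assms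
    by simp
  have refl: "(\<integral>\<^sup>+z. ?f (- z) \<partial>lborel) = (\<integral>\<^sup>+z. ?f z \<partial>lborel)"
    using nn_integral_real_affine[of ?f "-1" 0] by simp
  have "(\<integral>\<^sup>+z. ennreal (\<bar>z\<bar> powr (- 1 - \<beta>)) * indicator {z. R \<le> \<bar>z\<bar>} z \<partial>lborel) = (\<integral>\<^sup>+z. ?f z + ?f (- z) \<partial>lborel)"
    using assms by (intro nn_integral_cong) (auto simp: indicator_def abs_if)
  also have "\<dots> = (\<integral>\<^sup>+z. ?f z \<partial>lborel) + (\<integral>\<^sup>+z. ?f (- z) \<partial>lborel)"
    by (rule nn_integral_add) measurable
  also have "\<dots> = ennreal (2 * R powr (- \<beta>) / \<beta>)"
    unfolding refl half using assms by (simp flip: ennreal_plus)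
  finally show ?thesis .
qed

text \<open>The mean value estimate for u^k with one extra factor R on both sides, so that the
  exponent k - 1 never appears and k = 0 and R = 0 are covered.\<close>

lemma abs_power_diff_le:
  fixes x y R :: real
  assumes "0 \<le> x" "x \<le> R" "0 \<le> y" "y \<le> R"
  shows "\<bar>x ^ k - y ^ k\<bar> * R \<le> real k * \<bar>x - y\<bar> * R ^ k"
proof (induction k)
  case (Suc k)
  have R: "0 \<le> R" using assms by simp
  have "x ^ Suc k - y ^ Suc k = x * (x ^ k - y ^ k) + (x - y) * y ^ k" by (simp add: algebra_simps)
  then have "\<bar>x ^ Suc k - y ^ Suc k\<bar> \<le> x * \<bar>x ^ k - y ^ k\<bar> + \<bar>x - y\<bar> * y ^ k"
    using assms by (metis abs_mult abs_of_nonneg abs_triangle_ineq zero_le_power)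
  also have "\<dots> \<le> R * \<bar>x ^ k - y ^ k\<bar> + \<bar>x - y\<bar> * R ^ k"
    using assms by (intro add_mono mult_right_mono mult_left_mono power_mono) auto
  finally have "\<bar>x ^ Suc k - y ^ Suc k\<bar> * R \<le> (R * \<bar>x ^ k - y ^ k\<bar> + \<bar>x - y\<bar> * R ^ k) * R"
    using R by (rule mult_right_mono)
  also have "\<dots> = R * (\<bar>x ^ k - y ^ k\<bar> * R) + \<bar>x - y\<bar> * R ^ Suc k" by (simp add: algebra_simps)
  also have "\<dots> \<le> R * (real k * \<bar>x - y\<bar> * R ^ k) + \<bar>x - y\<bar> * R ^ Suc k"
    using Suc R by (intro add_mono mult_left_mono) auto
  also have "\<dots> = real (Suc k) * \<bar>x - y\<bar> * R ^ Suc k" by (simp add: algebra_simps)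
  finally show ?case .
qed simp

text \<open>The mixed second difference of \<open>u\<^sup>k\<close> is quadratic in \<open>s\<close>; this is what makes the
  increments of the integrated Wick power Lipschitz in \<open>L\<^sup>2\<close>.\<close>

lemma power_second_difference_le:
  fixes P Q S A R s :: real
  assumes b: "0 \<le> P" "P \<le> R" "0 \<le> Q" "Q \<le> R" "0 \<le> S" "S \<le> R" "0 \<le> A" "A \<le> R"
    and s: "0 \<le> s"
    and d: "\<bar>P - Q\<bar> \<le> 4 * s * R" "\<bar>P - S\<bar> \<le> 4 * s * R" "\<bar>Q - A\<bar> \<le> 4 * s * R" "\<bar>S - A\<bar> \<le> 4 * s * R"
      "\<bar>P - Q - S + A\<bar> \<le> 4 * s\<^sup>2 * R"
  shows "\<bar>P ^ k - Q ^ k - S ^ k + A ^ k\<bar> \<le> 16 * (real k)\<^sup>2 * s\<^sup>2 * R ^ k"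
proof (induction k)
  case (Suc k)
  have R: "0 \<le> R" using b by linarith
  \<comment> \<open>The product rule for the mixed second difference of u * u^k. Its two middle
    terms are products of first differences and hence again quadratic in s.\<close>
  have id: "P ^ Suc k - Q ^ Suc k - S ^ Suc k + A ^ Suc k =
      P * (P ^ k - Q ^ k - S ^ k + A ^ k) + (P - Q) * (Q ^ k - A ^ k) + (P - S) * (S ^ k - A ^ k) + (P - Q - S + A) * A ^ k"
    by (simp add: algebra_simps)
  have abs4: "\<bar>a + b + c + d\<bar> \<le> \<bar>a\<bar> + \<bar>b\<bar> + \<bar>c\<bar> + \<bar>d\<bar>" for a b c d :: real by linarith
  have t1: "\<bar>P * (P ^ k - Q ^ k - S ^ k + A ^ k)\<bar> \<le> R * (16 * (real k)\<^sup>2 * s\<^sup>2 * R ^ k)"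
    unfolding abs_mult using b R Suc by (intro mult_mono) auto
  have t2: "\<bar>(U - V) * (W ^ k - A ^ k)\<bar> \<le> 16 * real k * s\<^sup>2 * R ^ Suc k"
    if "\<bar>U - V\<bar> \<le> 4 * s * R" "\<bar>W - A\<bar> \<le> 4 * s * R" "0 \<le> W" "W \<le> R" for U V W
  proof -
    have "\<bar>(U - V) * (W ^ k - A ^ k)\<bar> \<le> (4 * s * R) * \<bar>W ^ k - A ^ k\<bar>"
      unfolding abs_mult using that by (intro mult_right_mono) auto
    also have "\<dots> = 4 * s * (\<bar>W ^ k - A ^ k\<bar> * R)" by simp
    also have "\<dots> \<le> 4 * s * (real k * \<bar>W - A\<bar> * R ^ k)"
      using s abs_power_diff_le[of W R A k] that b by (intro mult_left_mono) auto
    also have "\<dots> \<le> 4 * s * (real k * (4 * s * R) * R ^ k)"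
      using s R that by (intro mult_left_mono mult_right_mono) auto
    also have "\<dots> = 16 * real k * s\<^sup>2 * R ^ Suc k" by (simp add: power2_eq_square)
    finally show ?thesis .
  qed
  have t3: "\<bar>(P - Q - S + A) * A ^ k\<bar> \<le> (4 * s\<^sup>2 * R) * R ^ k"
    unfolding abs_mult using b R d by (intro mult_mono) (auto intro: power_mono)
  have "\<bar>P ^ Suc k - Q ^ Suc k - S ^ Suc k + A ^ Suc k\<bar> \<le> R * (16 * (real k)\<^sup>2 * s\<^sup>2 * R ^ k)
      + 16 * real k * s\<^sup>2 * R ^ Suc k + 16 * real k * s\<^sup>2 * R ^ Suc k + (4 * s\<^sup>2 * R) * R ^ k"
    unfolding id by (rule order_trans[OF abs4 add_mono[OF add_mono[OF add_mono[OF t1 t2] t2] t3]]) (use b d in auto)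
  also have "\<dots> = (16 * (real k)\<^sup>2 + 32 * real k + 4) * (s\<^sup>2 * R ^ Suc k)"
    by (simp add: algebra_simps)
  also have "\<dots> \<le> (16 * (real (Suc k))\<^sup>2) * (s\<^sup>2 * R ^ Suc k)"
  proof (rule mult_right_mono)
    show "0 \<le> s\<^sup>2 * R ^ Suc k" using R by simp
    show "16 * (real k)\<^sup>2 + 32 * real k + 4 \<le> 16 * (real (Suc k))\<^sup>2"
      by (simp add: power2_eq_square algebra_simps)
  qed
  finally show ?case by (simp add: mult.assoc)
qed simp

text \<open>The exponent \<beta>/k makes \<open>\<rho> x ^ k\<close> comparable to |x|^(-\<beta>),
  which is integrable at 0 since \<beta> < 1. In the application \<beta> = 1 - \<delta>, so the
  exponent 1 - \<beta> of the estimates is \<delta>.\<close>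

locale singular_kernel =
  fixes \<rho> :: "real \<Rightarrow> real" and m \<beta> B :: real and k :: nat
  assumes rho_meas [measurable]: "\<rho> \<in> borel_measurable borel"
    and rho_nonneg: "\<And>x. 0 \<le> \<rho> x"
    and m_pos: "0 < m" and beta: "0 < \<beta>" "\<beta> < 1" and k_pos: "1 \<le> k" and B_nonneg: "0 \<le> B"
    and rho_le: "\<And>x. 0 < \<bar>x\<bar> \<Longrightarrow> \<bar>x\<bar> \<le> m \<Longrightarrow> \<rho> x \<le> B / \<bar>x\<bar> powr (\<beta> / real k)"
    and rho_smooth: "\<And>x h. x \<noteq> 0 \<Longrightarrow> 4 * \<bar>h\<bar> \<le> \<bar>x\<bar> \<Longrightarrow> \<bar>x\<bar> \<le> m \<Longrightarrow>
          \<bar>\<rho> (x + h) - \<rho> x\<bar> \<le> B * (\<bar>h\<bar> / \<bar>x\<bar>) * \<rho> x"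
begin

lemma rho_power_le:
  assumes "0 < \<bar>x\<bar>" "\<bar>x\<bar> \<le> m" shows "\<rho> x ^ k \<le> B ^ k * \<bar>x\<bar> powr (- \<beta>)"
proof -
  have "\<rho> x ^ k \<le> (B / \<bar>x\<bar> powr (\<beta> / real k)) ^ k"
    using rho_le[OF assms] rho_nonneg by (intro power_mono)
  also have "\<dots> = B ^ k * \<bar>x\<bar> powr (- \<beta>)"
  proof -
    have "(\<bar>x\<bar> powr (\<beta> / real k)) ^ k = (\<bar>x\<bar> powr (\<beta> / real k)) powr real k"
      using assms by (simp add: powr_realpow)
    also have "\<dots> = \<bar>x\<bar> powr \<beta>" using k_pos by (simp add: powr_powr)
    finally show ?thesis unfolding power_divide by (simp only: powr_minus divide_inverse)
  qed
  finally show ?thesis .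
qed

definition near_const :: real where "near_const = 2 * B ^ k / (1 - \<beta>)"

lemma near_const_nonneg: "0 \<le> near_const"
  using beta B_nonneg by (simp add: near_const_def)

lemma nn_integral_rho_power:
  assumes "0 \<le> R" "R \<le> m"
  shows "(\<integral>\<^sup>+z. ennreal (\<rho> z ^ k) * indicator {-R..R} z \<partial>lborel) \<le> ennreal (near_const * R powr (1 - \<beta>))"
proof -
  have "(\<integral>\<^sup>+z. ennreal (\<rho> z ^ k) * indicator {-R..R} z \<partial>lborel) \<le>
      (\<integral>\<^sup>+z. ennreal (B ^ k) * (ennreal (\<bar>z\<bar> powr (- \<beta>)) * indicator {-R..R} z) \<partial>lborel)"
  proof (rule nn_integral_mono_AE, rule AE_mp[OF AE_lborel_singleton[of 0]], rule AE_I2, rule impI)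
    fix z :: real assume "z \<noteq> 0"
    then show "ennreal (\<rho> z ^ k) * indicator {-R..R} z \<le> ennreal (B ^ k) * (ennreal (\<bar>z\<bar> powr (- \<beta>)) * indicator {-R..R} z)"
      using rho_power_le[of z] assms B_nonneg
      by (auto simp: indicator_def ennreal_mult[symmetric] intro!: ennreal_leI)
  qed
  also have "\<dots> = ennreal (B ^ k) * ennreal (2 * R powr (1 - \<beta>) / (1 - \<beta>))"
    using assms beta by (subst nn_integral_cmult) (simp_all add: nn_integral_abs_powr)
  also have "\<dots> = ennreal (near_const * R powr (1 - \<beta>))"
    using beta B_nonneg by (simp add: near_const_def ennreal_mult[symmetric])
  finally show ?thesis .
qed

text \<open>\<open>kernel N\<close> is \<open>\<rho>\<close> smoothed by the law of \<open>u - v\<close> under \<open>N\<close>; every covariance below has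
  this form.\<close>

definition kernel :: "(real \<times> real) measure \<Rightarrow> real \<Rightarrow> ennreal" where
  "kernel N z = (\<integral>\<^sup>+p. ennreal (\<rho> (z + (fst p - snd p))) \<partial>N)"

definition smoother :: "(real \<times> real) measure \<Rightarrow> real \<Rightarrow> bool" where
  "smoother N e \<longleftrightarrow> prob_space N \<and> sets N = sets (borel \<Otimes>\<^sub>M borel) \<and> (AE p in N. \<bar>fst p - snd p\<bar> \<le> e)"

lemma kernel_measurable [measurable]:
  assumes "smoother N e"
  shows "kernel N \<in> borel_measurable borel"
proof -
  interpret prob_space N using assms by (simp add: smoother_def)
  have [measurable_cong]: "sets N = sets (borel \<Otimes>\<^sub>M borel)" using assms by (simp add: smoother_def)
  show ?thesis unfolding kernel_def by measurable
qed

text \<open>Jensen moves the power inside the average over N. After Fubini each summand is a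
  translate of \<open>\<rho> z ^ k\<close> by at most e, so the interval of integration grows by e
  on each side.\<close>

lemma kernel_power_integral:
  assumes N: "smoother N e" and r: "0 \<le> r" "0 \<le> e" "r + e \<le> m"
  shows "(\<integral>\<^sup>+z. kernel N z ^ k * indicator {-r..r} z \<partial>lborel) \<le> ennreal (near_const * (r + e) powr (1 - \<beta>))"
proof -
  interpret prob_space N using N by (simp add: smoother_def)
  have [measurable_cong]: "sets N = sets (borel \<Otimes>\<^sub>M borel)" using N by (simp add: smoother_def)
  interpret pair_sigma_finite lborel N by unfold_locales
  have "(\<integral>\<^sup>+z. kernel N z ^ k * indicator {-r..r} z \<partial>lborel) \<le>
      (\<integral>\<^sup>+z. (\<integral>\<^sup>+p. ennreal (\<rho> (z + (fst p - snd p)) ^ k) * indicator {-r..r} z \<partial>N) \<partial>lborel)"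
  proof (rule nn_integral_mono)
    fix z :: real
    have "kernel N z ^ k \<le> (\<integral>\<^sup>+p. ennreal (\<rho> (z + (fst p - snd p)) ^ k) \<partial>N)"
      unfolding kernel_def by (rule nn_integral_power_le) (simp_all add: rho_nonneg)
    then show "kernel N z ^ k * indicator {-r..r} z \<le> (\<integral>\<^sup>+p. ennreal (\<rho> (z + (fst p - snd p)) ^ k) * indicator {-r..r} z \<partial>N)"
      by (subst nn_integral_multc) (simp_all add: mult_right_mono)
  qed
  also have "\<dots> = (\<integral>\<^sup>+p. (\<integral>\<^sup>+z. ennreal (\<rho> (z + (fst p - snd p)) ^ k) * indicator {-r..r} z \<partial>lborel) \<partial>N)"
    by (rule Fubini'[symmetric]) measurable
  also have "\<dots> \<le> (\<integral>\<^sup>+p. ennreal (near_const * (r + e) powr (1 - \<beta>)) \<partial>N)"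
  proof (rule nn_integral_mono_AE)
    have "AE p in N. \<bar>fst p - snd p\<bar> \<le> e" using N by (simp add: smoother_def)
    then show "AE p in N. (\<integral>\<^sup>+z. ennreal (\<rho> (z + (fst p - snd p)) ^ k) * indicator {-r..r} z \<partial>lborel)
        \<le> ennreal (near_const * (r + e) powr (1 - \<beta>))"
    proof eventually_elim
      case (elim p)
      let ?w = "fst p - snd p"
      have "(\<integral>\<^sup>+z. ennreal (\<rho> (z + ?w) ^ k) * indicator {-r..r} z \<partial>lborel)
          \<le> (\<integral>\<^sup>+z. ennreal (\<rho> (?w + 1 * z) ^ k) * indicator {-(r+e)..r+e} (?w + 1 * z) \<partial>lborel)"
        using elim by (intro nn_integral_mono) (auto simp: indicator_def add.commute)
      also have "\<dots> = (\<integral>\<^sup>+z. ennreal (\<rho> z ^ k) * indicator {-(r+e)..r+e} z \<partial>lborel)"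
        by (subst nn_integral_real_affine[of "\<lambda>z. ennreal (\<rho> z ^ k) * indicator {-(r+e)..r+e} z" 1 ?w]) simp_all
      also have "\<dots> \<le> ennreal (near_const * (r + e) powr (1 - \<beta>))"
        using r by (intro nn_integral_rho_power) auto
      finally show ?case .
    qed
  qed
  also have "\<dots> = ennreal (near_const * (r + e) powr (1 - \<beta>))" by (simp add: emeasure_space_1)
  finally show ?thesis .
qed

text \<open>At distance at least 4 e from the singularity the regularity of \<open>\<rho>\<close>
  applies to all displacements up to e, giving a relative error of B e / |z|; the size of
  \<open>\<rho> z ^ k\<close> then provides the power of |z|.\<close>

lemma kernel_far:
  assumes N: "smoother N e" and e: "0 < e" and z: "4 * e \<le> \<bar>z\<bar>" "\<bar>z\<bar> \<le> m"
  shows "kernel N z < \<infinity>"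
    and "\<bar>enn2real (kernel N z) ^ k - \<rho> z ^ k\<bar> \<le> real k * B * (1 + B) ^ k * B ^ k * e * \<bar>z\<bar> powr (- 1 - \<beta>)"
proof -
  interpret prob_space N using N by (simp add: smoother_def)
  have [measurable_cong]: "sets N = sets (borel \<Otimes>\<^sub>M borel)" using N by (simp add: smoother_def)
  have z0: "0 < \<bar>z\<bar>" using e z by linarith
  let ?d = "B * (e / \<bar>z\<bar>) * \<rho> z"
  have pt: "AE p in N. \<bar>\<rho> (z + (fst p - snd p)) - \<rho> z\<bar> \<le> ?d"
  proof -
    have "AE p in N. \<bar>fst p - snd p\<bar> \<le> e" using N by (simp add: smoother_def)
    then show ?thesis
    proof eventually_elim
      case (elim p)
      have "\<bar>\<rho> (z + (fst p - snd p)) - \<rho> z\<bar> \<le> B * (\<bar>fst p - snd p\<bar> / \<bar>z\<bar>) * \<rho> z"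
        using elim z z0 by (intro rho_smooth) auto
      also have "\<dots> \<le> ?d"
        using elim B_nonneg rho_nonneg by (intro mult_right_mono mult_left_mono divide_right_mono) auto
      finally show ?case .
    qed
  qed
  have i: "integrable N (\<lambda>p. \<rho> (z + (fst p - snd p)))"
  proof (rule integrable_const_bound[of _ "\<rho> z + ?d"])
    show "AE p in N. norm (\<rho> (z + (fst p - snd p))) \<le> \<rho> z + ?d"
      using pt by eventually_elim (use rho_nonneg in auto)
  qed measurable
  have k_eq: "kernel N z = ennreal (\<integral>p. \<rho> (z + (fst p - snd p)) \<partial>N)"
    unfolding kernel_def using i rho_nonneg by (intro nn_integral_eq_integral) auto
  show "kernel N z < \<infinity>" unfolding k_eq by simp
  let ?K = "enn2real (kernel N z)"
  have K: "?K = (\<integral>p. \<rho> (z + (fst p - snd p)) \<partial>N)"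
    unfolding k_eq using rho_nonneg by simp
  have K0: "0 \<le> ?K" by simp
  have "?K - \<rho> z = (\<integral>p. \<rho> (z + (fst p - snd p)) - \<rho> z \<partial>N)"
    unfolding K using i by (simp add: prob_space)
  then have "\<bar>?K - \<rho> z\<bar> \<le> (\<integral>p. \<bar>\<rho> (z + (fst p - snd p)) - \<rho> z\<bar> \<partial>N)"
    by (metis integral_abs_bound)
  also have "\<dots> \<le> (\<integral>p. ?d \<partial>N)"
    using i pt by (intro integral_mono_AE) auto
  finally have Kd: "\<bar>?K - \<rho> z\<bar> \<le> ?d" by (simp add: prob_space)
  have "e / \<bar>z\<bar> \<le> 1" using e z z0 by (simp add: divide_le_eq)
  then have "?d \<le> B * 1 * \<rho> z" using B_nonneg rho_nonneg by (intro mult_right_mono mult_left_mono) auto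
  with Kd have KR: "?K \<le> (1 + B) * \<rho> z" by (simp add: algebra_simps)
  \<comment> \<open>A common upper bound for \<open>\<rho> z\<close> and its smoothed value. It is
    proportional to \<open>\<rho> z\<close>, so one factor \<open>\<rho> z\<close> can be cancelled
    below; the value 0 is treated apart.\<close>
  let ?R = "(1 + B) * \<rho> z"
  have rR: "\<rho> z \<le> ?R" using B_nonneg rho_nonneg[of z] by (simp add: algebra_simps)
  have main: "\<bar>?K ^ k - \<rho> z ^ k\<bar> \<le> real k * B * (1 + B) ^ k * (e / \<bar>z\<bar>) * \<rho> z ^ k"
  proof (cases "\<rho> z = 0")
    case True
    then have "?K = 0" using KR K0 by simp
    then show ?thesis using True k_pos by (simp add: power_0_left)
  next
    case False
    then have rp: "0 < \<rho> z" using rho_nonneg[of z] by simp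
    have "\<bar>?K ^ k - \<rho> z ^ k\<bar> * \<rho> z \<le> \<bar>?K ^ k - \<rho> z ^ k\<bar> * ?R"
      using rR by (intro mult_left_mono) auto
    also have "\<dots> \<le> real k * \<bar>?K - \<rho> z\<bar> * ?R ^ k"
      using K0 KR rR rho_nonneg by (intro abs_power_diff_le) auto
    also have "\<dots> \<le> real k * ?d * ?R ^ k"
      using Kd B_nonneg rp by (intro mult_right_mono mult_left_mono) auto
    also have "\<dots> = (real k * B * (1 + B) ^ k * (e / \<bar>z\<bar>) * \<rho> z ^ k) * \<rho> z"
      by (simp add: power_mult_distrib mult_ac)
    finally show ?thesis using rp by (rule mult_right_le_imp_le)
  qed
  also have "\<dots> \<le> real k * B * (1 + B) ^ k * (e / \<bar>z\<bar>) * (B ^ k * \<bar>z\<bar> powr (- \<beta>))"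
    using B_nonneg e z z0 by (intro mult_left_mono rho_power_le) auto
  also have "\<dots> = real k * B * (1 + B) ^ k * B ^ k * e * \<bar>z\<bar> powr (- 1 - \<beta>)"
    using z0 by (simp add: powr_diff powr_minus divide_inverse mult_ac)
  finally show "\<bar>?K ^ k - \<rho> z ^ k\<bar> \<le> real k * B * (1 + B) ^ k * B ^ k * e * \<bar>z\<bar> powr (- 1 - \<beta>)" .
qed

text \<open>The terms stand for the smoothed kernel on |z| \<le> 4 e, for \<open>\<rho>\<close> on
  the same interval, and for their difference beyond it. The 5 is 4 + 1: smoothing at scale e widens
  the interval by e.\<close>

definition smoothing_const :: real where
  "smoothing_const = near_const * 5 powr (1 - \<beta>) + near_const * 4 powr (1 - \<beta>)
     + real k * B * (1 + B) ^ k * B ^ k * (2 * 4 powr (- \<beta>) / \<beta>)"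

lemma smoothing_const_nonneg: "0 \<le> smoothing_const"
  using near_const_nonneg B_nonneg beta by (simp add: smoothing_const_def)

text \<open>Near the singularity, |z| \<le> 4 e, both powers are bounded separately, each integral
  being of order e^(1 - \<beta>). Beyond it \<open>kernel_far\<close> leaves e times the tail
  integral of |z|^(-1 - \<beta>), which has the same order.\<close>

lemma kernel_smoothing_error:
  assumes N: "smoother N e" and e: "0 < e" "5 * e \<le> m" and r: "r \<le> m"
  shows "(\<integral>\<^sup>+z. ennreal \<bar>enn2real (kernel N z) ^ k - \<rho> z ^ k\<bar> * indicator {-r..r} z \<partial>lborel)
    \<le> ennreal (smoothing_const * e powr (1 - \<beta>))"
proof -
  note [measurable] = kernel_measurable[OF N]
  let ?c = "real k * B * (1 + B) ^ k * B ^ k"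
  have c: "0 \<le> ?c" using B_nonneg by simp
  have "(\<integral>\<^sup>+z. ennreal \<bar>enn2real (kernel N z) ^ k - \<rho> z ^ k\<bar> * indicator {-r..r} z \<partial>lborel) \<le>
     (\<integral>\<^sup>+z. kernel N z ^ k * indicator {-(4*e)..4*e} z + ennreal (\<rho> z ^ k) * indicator {-(4*e)..4*e} z
       + ennreal (?c * e) * (ennreal (\<bar>z\<bar> powr (- 1 - \<beta>)) * indicator {z. 4 * e \<le> \<bar>z\<bar>} z) \<partial>lborel)"
  proof (rule nn_integral_mono)
    fix z :: real
    show "ennreal \<bar>enn2real (kernel N z) ^ k - \<rho> z ^ k\<bar> * indicator {-r..r} z \<le>
      kernel N z ^ k * indicator {-(4*e)..4*e} z + ennreal (\<rho> z ^ k) * indicator {-(4*e)..4*e} z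
       + ennreal (?c * e) * (ennreal (\<bar>z\<bar> powr (- 1 - \<beta>)) * indicator {z. 4 * e \<le> \<bar>z\<bar>} z)"
    proof (cases "\<bar>z\<bar> \<le> r")
      case False
      then have "z \<notin> {-r..r}" by auto
      then show ?thesis by simp
    next
      case zr: True
      show ?thesis
      proof (cases "4 * e \<le> \<bar>z\<bar>")
        case True
        have "ennreal \<bar>enn2real (kernel N z) ^ k - \<rho> z ^ k\<bar> * indicator {-r..r} z \<le> ennreal \<bar>enn2real (kernel N z) ^ k - \<rho> z ^ k\<bar>"
          by (auto simp: indicator_def)
        also have "\<dots> \<le> ennreal (?c * e * \<bar>z\<bar> powr (- 1 - \<beta>))"
          using kernel_far(2)[OF N e(1) True] zr r by (intro ennreal_leI) auto
        also have "\<dots> = ennreal (?c * e) * (ennreal (\<bar>z\<bar> powr (- 1 - \<beta>)) * indicator {z. 4 * e \<le> \<bar>z\<bar>} z)"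
          using True c e by (simp add: ennreal_mult)
        finally show ?thesis by (simp add: add_increasing)
      next
        case False
        then have ind: "z \<in> {-(4*e)..4*e}" by auto
        have "\<bar>enn2real (kernel N z) ^ k - \<rho> z ^ k\<bar> \<le> enn2real (kernel N z) ^ k + \<rho> z ^ k"
          using rho_nonneg[of z] by (simp add: abs_le_iff add_increasing add_increasing2)
        then have "ennreal \<bar>enn2real (kernel N z) ^ k - \<rho> z ^ k\<bar> \<le> ennreal (enn2real (kernel N z) ^ k + \<rho> z ^ k)"
          by (rule ennreal_leI)
        also have "\<dots> = ennreal (enn2real (kernel N z)) ^ k + ennreal (\<rho> z ^ k)"
          using rho_nonneg by (simp add: ennreal_power)
        \<comment> \<open>Only an inequality, because the kernel may be infinite near the
          singularity and \<open>enn2real\<close> sends infinity to 0.\<close>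
        also have "\<dots> \<le> kernel N z ^ k + ennreal (\<rho> z ^ k)"
        proof (intro add_right_mono power_mono)
          show "ennreal (enn2real (kernel N z)) \<le> kernel N z"
            by (cases "kernel N z") auto
        qed simp
        finally show ?thesis using ind False by (auto simp: indicator_def)
      qed
    qed
  qed
  also have "\<dots> = (\<integral>\<^sup>+z. kernel N z ^ k * indicator {-(4*e)..4*e} z \<partial>lborel)
      + (\<integral>\<^sup>+z. ennreal (\<rho> z ^ k) * indicator {-(4*e)..4*e} z \<partial>lborel)
      + ennreal (?c * e) * (\<integral>\<^sup>+z. ennreal (\<bar>z\<bar> powr (- 1 - \<beta>)) * indicator {z. 4 * e \<le> \<bar>z\<bar>} z \<partial>lborel)"
    by (simp add: nn_integral_add nn_integral_cmult)
  also have "\<dots> \<le> ennreal (near_const * (4 * e + e) powr (1 - \<beta>)) + ennreal (near_const * (4 * e) powr (1 - \<beta>))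
      + ennreal (?c * e) * ennreal (2 * (4 * e) powr (- \<beta>) / \<beta>)"
    using e beta by (intro add_mono kernel_power_integral[OF N] nn_integral_rho_power mult_left_mono)
       (auto simp: nn_integral_abs_powr_tail)
  also have "\<dots> = ennreal (near_const * (4 * e + e) powr (1 - \<beta>) + near_const * (4 * e) powr (1 - \<beta>)
      + (?c * e) * (2 * (4 * e) powr (- \<beta>) / \<beta>))"
    using near_const_nonneg c e beta by (simp add: ennreal_mult[symmetric] ennreal_plus[symmetric] del: ennreal_plus)
  also have "near_const * (4 * e + e) powr (1 - \<beta>) + near_const * (4 * e) powr (1 - \<beta>)
      + (?c * e) * (2 * (4 * e) powr (- \<beta>) / \<beta>) = smoothing_const * e powr (1 - \<beta>)"
  proof -
    have 1: "4 * e + e = 5 * e" by simp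
    have 2: "e * e powr (- \<beta>) = e powr (1 - \<beta>)"
      using e powr_add[of e 1 "- \<beta>"] by simp
    show ?thesis
      unfolding smoothing_const_def 1 using e
      by (simp add: powr_mult 2[symmetric] algebra_simps add_divide_distrib)
  qed
  finally show ?thesis .
qed

end

section \<open>Measurable versions and random fields\<close>

context prob_space
begin

text \<open>Fatou's lemma for the squared distance to Z. Square integrability of Y is a by-product,
  since Y = Z - (Z - Y).\<close>

lemma Fatou_second_moment:
  fixes X :: "nat \<Rightarrow> 'a \<Rightarrow> real"
  assumes X: "\<And>n. X n \<in> borel_measurable M" and Y [measurable]: "Y \<in> borel_measurable M"
    and lim: "AE \<omega> in M. (\<lambda>n. X n \<omega>) \<longlonglongrightarrow> Y \<omega>"
    and Z: "square_integrable M Z"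
    and bound: "\<And>n. N \<le> n \<Longrightarrow> square_integrable M (X n) \<and> (\<integral>\<omega>. (Z \<omega> - X n \<omega>)\<^sup>2 \<partial>M) \<le> c"
  shows "square_integrable M Y" and "(\<integral>\<omega>. (Z \<omega> - Y \<omega>)\<^sup>2 \<partial>M) \<le> c"
proof -
  note [measurable] = X square_integrableD(1)[OF Z]
  have "0 \<le> (\<integral>\<omega>. (Z \<omega> - X N \<omega>)\<^sup>2 \<partial>M)" by simp
  with bound[of N] have c: "0 \<le> c" by linarith
  have "(\<integral>\<^sup>+\<omega>. ennreal ((Z \<omega> - Y \<omega>)\<^sup>2) \<partial>M) = (\<integral>\<^sup>+\<omega>. liminf (\<lambda>n. ennreal ((Z \<omega> - X (n + N) \<omega>)\<^sup>2)) \<partial>M)"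
  proof (rule nn_integral_cong_AE)
    show "AE \<omega> in M. ennreal ((Z \<omega> - Y \<omega>)\<^sup>2) = liminf (\<lambda>n. ennreal ((Z \<omega> - X (n + N) \<omega>)\<^sup>2))"
      using lim
    proof eventually_elim
      case (elim \<omega>)
      have "(\<lambda>n. ennreal ((Z \<omega> - X (n + N) \<omega>)\<^sup>2)) \<longlonglongrightarrow> ennreal ((Z \<omega> - Y \<omega>)\<^sup>2)"
        by (intro tendsto_intros tendsto_ennrealI LIMSEQ_ignore_initial_segment elim)
      from lim_imp_Liminf[OF _ this] show ?case by simp
    qed
  qed
  also have "\<dots> \<le> liminf (\<lambda>n. \<integral>\<^sup>+\<omega>. ennreal ((Z \<omega> - X (n + N) \<omega>)\<^sup>2) \<partial>M)"
    by (rule nn_integral_liminf) simp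
  also have "\<dots> \<le> ennreal c"
  proof (rule Liminf_le)
    show "\<forall>\<^sub>F n in sequentially. (\<integral>\<^sup>+\<omega>. ennreal ((Z \<omega> - X (n + N) \<omega>)\<^sup>2) \<partial>M) \<le> ennreal c"
    proof (intro always_eventually allI)
      fix n
      have "integrable M (\<lambda>\<omega>. (Z \<omega> - X (n + N) \<omega>)\<^sup>2)"
        using square_integrable_diff[OF Z conjunct1[OF bound[of "n + N"]]] by auto
      then show "(\<integral>\<^sup>+\<omega>. ennreal ((Z \<omega> - X (n + N) \<omega>)\<^sup>2) \<partial>M) \<le> ennreal c"
        using bound[of "n + N"] by (subst nn_integral_eq_integral) (auto intro: ennreal_leI)
    qed
  qed simp
  finally have fin: "(\<integral>\<^sup>+\<omega>. ennreal ((Z \<omega> - Y \<omega>)\<^sup>2) \<partial>M) \<le> ennreal c" .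
  have i: "integrable M (\<lambda>\<omega>. (Z \<omega> - Y \<omega>)\<^sup>2)"
    using fin by (intro integrableI_nonneg) (auto simp: less_top[symmetric] top_unique)
  have "square_integrable M (\<lambda>\<omega>. Z \<omega> - Y \<omega>)" using i by (simp add: square_integrable_def)
  from square_integrable_diff[OF Z this] show "square_integrable M Y" by simp
  show "(\<integral>\<omega>. (Z \<omega> - Y \<omega>)\<^sup>2 \<partial>M) \<le> c"
    using fin i c by (subst (asm) nn_integral_eq_integral) auto
qed

text \<open>The L1 norms of the increments are at most 2^(-n), so the series of increments converges
  absolutely almost surely.\<close>

lemma AE_convergent_of_second_moments:
  fixes X :: "nat \<Rightarrow> 'a \<Rightarrow> real"
  assumes X: "\<And>n. square_integrable M (X n)"
    and step: "\<And>n. (\<integral>\<omega>. (X (Suc n) \<omega> - X n \<omega>)\<^sup>2 \<partial>M) \<le> (1 / 4) ^ n"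
  shows "AE \<omega> in M. convergent (\<lambda>n. X n \<omega>)"
proof -
  have [measurable]: "X n \<in> borel_measurable M" for n by (rule square_integrableD(1)[OF X])
  have "(\<integral>\<^sup>+\<omega>. (\<Sum>n. ennreal \<bar>X (Suc n) \<omega> - X n \<omega>\<bar>) \<partial>M) = (\<Sum>n. \<integral>\<^sup>+\<omega>. ennreal \<bar>X (Suc n) \<omega> - X n \<omega>\<bar> \<partial>M)"
    by (rule nn_integral_suminf) simp
  also have "\<dots> \<le> (\<Sum>n. ennreal ((1 / 2) ^ n))"
  proof (intro suminf_le allI summableI)
    fix n
    let ?D = "\<lambda>\<omega>. X (Suc n) \<omega> - X n \<omega>"
    have D: "square_integrable M ?D" by (intro square_integrable_diff X)
    have a: "square_integrable M (\<lambda>\<omega>. \<bar>?D \<omega>\<bar>)" "square_integrable M (\<lambda>\<omega>. 1)"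
      using D by (auto simp: square_integrable_def)
    have "(\<integral>\<omega>. \<bar>?D \<omega>\<bar> \<partial>M) \<le> sqrt (\<integral>\<omega>. (?D \<omega>)\<^sup>2 \<partial>M)"
      using abs_expectation_mult_le[OF a] by (simp add: prob_space)
    also have "\<dots> \<le> sqrt (((1 / 2) ^ n)\<^sup>2)"
      using step[of n] by (intro real_sqrt_le_mono) (simp add: power_mult[symmetric] mult.commute[of n] power_mult power_divide)
    finally have "(\<integral>\<omega>. \<bar>?D \<omega>\<bar> \<partial>M) \<le> (1 / 2) ^ n" by simp
    then show "(\<integral>\<^sup>+\<omega>. ennreal \<bar>?D \<omega>\<bar> \<partial>M) \<le> ennreal ((1 / 2) ^ n)"
      using square_integrable_integrable[OF a(1)] by (subst nn_integral_eq_integral) (auto intro: ennreal_leI)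
  qed
  also have "\<dots> = ennreal 2"
    using geometric_sums[of "1 / 2 :: real"] by (intro suminf_ennreal_eq) auto
  finally have "(\<integral>\<^sup>+\<omega>. (\<Sum>n. ennreal \<bar>X (Suc n) \<omega> - X n \<omega>\<bar>) \<partial>M) \<noteq> \<infinity>"
    by (auto simp: top_unique)
  then have "AE \<omega> in M. (\<Sum>n. ennreal \<bar>X (Suc n) \<omega> - X n \<omega>\<bar>) \<noteq> \<infinity>"
    by (intro nn_integral_PInf_AE) auto
  then show ?thesis
  proof eventually_elim
    case (elim \<omega>)
    then have "summable (\<lambda>n. \<bar>X (Suc n) \<omega> - X n \<omega>\<bar>)"
      by (intro summable_suminf_not_top) auto
    then have "summable (\<lambda>n. X (Suc n) \<omega> - X n \<omega>)"
      by (rule summable_rabs_cancel)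
    then have "convergent (\<lambda>n. \<Sum>i<n. X (Suc i) \<omega> - X i \<omega>)"
      by (simp add: summable_iff_convergent)
    then have "convergent (\<lambda>n. (X n \<omega> - X 0 \<omega>) + X 0 \<omega>)"
      unfolding sum_lessThan_telescope[of "\<lambda>i. X i \<omega>"] by (intro convergent_add convergent_const) simp
    then show ?case by simp
  qed
qed

text \<open>For each parameter \<open>x\<close> a fast subsequence is selected; the selected indices are measurable
  in \<open>x\<close>, so the limit along them is jointly measurable without any uniformity in \<open>x\<close>.\<close>

lemma measurable_L2_limit:
  fixes Z :: "nat \<Rightarrow> real \<Rightarrow> 'a \<Rightarrow> real"
  assumes meas: "\<And>n. (\<lambda>(x, \<omega>). Z n x \<omega>) \<in> borel_measurable (borel \<Otimes>\<^sub>M M)"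
    and sq: "\<And>n x. square_integrable M (Z n x)"
    and Cauchy: "\<And>x e. 0 < e \<Longrightarrow> \<exists>N. \<forall>p\<ge>N. \<forall>q\<ge>N. (\<integral>\<omega>. (Z p x \<omega> - Z q x \<omega>)\<^sup>2 \<partial>M) \<le> e"
  shows "\<exists>Y. (\<lambda>(x, \<omega>). Y x \<omega>) \<in> borel_measurable (borel \<Otimes>\<^sub>M M) \<and>
    (\<forall>x. square_integrable M (Y x) \<and> (\<lambda>n. \<integral>\<omega>. (Z n x \<omega> - Y x \<omega>)\<^sup>2 \<partial>M) \<longlonglongrightarrow> 0)"
proof -
  note [measurable] = meas
  have [measurable]: "Z n x \<in> borel_measurable M" for n x by (rule square_integrableD(1)[OF sq])
  define d where "d p q x = (\<integral>\<omega>. (Z p x \<omega> - Z q x \<omega>)\<^sup>2 \<partial>M)" for p q x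
  have [measurable]: "d p q \<in> borel_measurable borel" for p q
    unfolding d_def by measurable
  define P where "P j x N \<longleftrightarrow> (\<forall>p\<ge>N. \<forall>q\<ge>N. d p q x \<le> (1 / 4) ^ j)" for j N :: nat and x
  have [measurable]: "Measurable.pred borel (\<lambda>x. P j x N)" for j N
    unfolding P_def by measurable
  define I where "I j x = (LEAST N. P j x N)" for j x
  have [measurable]: "I j \<in> measurable borel (count_space UNIV)" for j
    unfolding I_def by measurable
  have exP: "\<exists>N. P j x N" for j x unfolding P_def d_def by (intro Cauchy) simp
  have PI: "P j x (I j x)" for j x unfolding I_def using exP by (rule LeastI_ex)
  have I_mono: "I j x \<le> I (Suc j) x" for j x
    unfolding I_def[of j]
  proof (rule Least_le)
    have "(1 / 4 :: real) ^ Suc j \<le> (1 / 4) ^ j" by simp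
    then show "P j x (I (Suc j) x)" using PI[of "Suc j" x] unfolding P_def by (meson order.trans)
  qed
  then have I_mono': "I i x \<le> I j x" if "i \<le> j" for i j x
    using that by (rule lift_Suc_mono_le)
  define U where "U j x \<omega> = Z (I j x) x \<omega>" for j x \<omega>
  have U_meas [measurable]: "(\<lambda>(x, \<omega>). U j x \<omega>) \<in> borel_measurable (borel \<Otimes>\<^sub>M M)" for j
  proof -
    have "(\<lambda>p. (\<lambda>n p. Z n (fst p) (snd p)) (I j (fst p)) p) \<in> borel_measurable (borel \<Otimes>\<^sub>M M)"
    proof (rule measurable_compose_countable[where f = "\<lambda>n p. Z n (fst p) (snd p)" and g = "\<lambda>p. I j (fst p)"])
      show "(\<lambda>p. Z n (fst p) (snd p)) \<in> borel_measurable (borel \<Otimes>\<^sub>M M)" for n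
        using meas[of n] by (simp add: case_prod_beta)
      show "(\<lambda>p. I j (fst p)) \<in> measurable (borel \<Otimes>\<^sub>M M) (count_space UNIV)" by measurable
    qed
    then show ?thesis by (simp add: U_def case_prod_beta)
  qed
  have Usq: "square_integrable M (U j x)" for j x using sq[of "I j x" x] by (simp add: U_def[abs_def])
  \<comment> \<open>Where the sequence diverges the value of \<open>lim\<close> is arbitrary; for
    each x this concerns a null set only, and measurability holds regardless.\<close>
  define Y where "Y x \<omega> = lim (\<lambda>j. U j x \<omega>)" for x \<omega>
  have Y_meas: "(\<lambda>(x, \<omega>). Y x \<omega>) \<in> borel_measurable (borel \<Otimes>\<^sub>M M)"
  proof -
    have "(\<lambda>p. lim (\<lambda>j. (\<lambda>(x, \<omega>). U j x \<omega>) p)) \<in> borel_measurable (borel \<Otimes>\<^sub>M M)"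
      by (rule borel_measurable_lim_metric) (rule U_meas)
    then show ?thesis by (simp add: Y_def case_prod_beta)
  qed
  note [measurable] = Y_meas
  have Yx: "Y x \<in> borel_measurable M" for x
    using measurable_compose[OF measurable_Pair1'[of x borel M] Y_meas] by simp
  have "square_integrable M (Y x) \<and> (\<lambda>n. \<integral>\<omega>. (Z n x \<omega> - Y x \<omega>)\<^sup>2 \<partial>M) \<longlonglongrightarrow> 0" for x
  proof -
    have "AE \<omega> in M. convergent (\<lambda>j. U j x \<omega>)"
    proof (rule AE_convergent_of_second_moments[OF Usq])
      fix n show "(\<integral>\<omega>. (U (Suc n) x \<omega> - U n x \<omega>)\<^sup>2 \<partial>M) \<le> (1 / 4) ^ n"
        using PI[of n x] I_mono[of n x] unfolding P_def d_def U_def by simp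
    qed
    then have lim: "AE \<omega> in M. (\<lambda>j. U j x \<omega>) \<longlonglongrightarrow> Y x \<omega>"
      by eventually_elim (simp add: Y_def convergent_LIMSEQ_iff)
    have Um: "U n x \<in> borel_measurable M" for n by (rule square_integrableD(1)[OF Usq])
    have b: "square_integrable M (Y x) \<and> (\<integral>\<omega>. (Z n x \<omega> - Y x \<omega>)\<^sup>2 \<partial>M) \<le> (1 / 4) ^ i" if n: "I i x \<le> n" for n i
    proof -
      have bd: "square_integrable M (U j x) \<and> (\<integral>\<omega>. (Z n x \<omega> - U j x \<omega>)\<^sup>2 \<partial>M) \<le> (1 / 4) ^ i" if "i \<le> j" for j
        using PI[of i x] n I_mono'[OF that, of x] Usq unfolding P_def d_def U_def by simp
      show ?thesis
        using Fatou_second_moment[OF Um Yx lim sq[of n x] bd] by blast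
    qed
    have "(\<lambda>n. \<integral>\<omega>. (Z n x \<omega> - Y x \<omega>)\<^sup>2 \<partial>M) \<longlonglongrightarrow> 0"
    proof (rule LIMSEQ_I)
      fix r :: real assume "0 < r"
      then obtain i where i: "(1 / 4) ^ i < r" using real_arch_pow_inv[of r "1 / 4"] by auto
      show "\<exists>no. \<forall>n\<ge>no. norm ((\<integral>\<omega>. (Z n x \<omega> - Y x \<omega>)\<^sup>2 \<partial>M) - 0) < r"
        using b[of i] i by (intro exI[of _ "I i x"]) (auto intro: order.strict_trans1)
    qed
    then show ?thesis using b[of 0 "I 0 x"] by simp
  qed
  with Y_meas show ?thesis by blast
qed

end

text \<open>The second moment bound uses the nonnegative integral and thereby includes
  integrability. With the bounded support it justifies every exchange of expectation and integration
  over x.\<close>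

locale bounded_field = prob_space +
  fixes F :: "real \<Rightarrow> 'a \<Rightarrow> real" and a b K :: real
  assumes F_meas [measurable]: "(\<lambda>(x, \<omega>). F x \<omega>) \<in> borel_measurable (borel \<Otimes>\<^sub>M M)"
    and F_supp: "\<And>x \<omega>. x \<notin> {a..b} \<Longrightarrow> F x \<omega> = 0"
    and F_bound: "\<And>x. (\<integral>\<^sup>+\<omega>. ennreal ((F x \<omega>)\<^sup>2) \<partial>M) \<le> ennreal K"
    and K_nonneg: "0 \<le> K"
begin

lemma F_sq: "square_integrable M (F x)"
proof -
  have [measurable]: "F x \<in> borel_measurable M"
    using measurable_compose[OF measurable_Pair1'[of x borel M] F_meas] by simp
  have "integrable M (\<lambda>\<omega>. (F x \<omega>)\<^sup>2)"
    using F_bound[of x] by (intro integrableI_nonneg) (auto simp: less_top[symmetric] top_unique)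
  then show ?thesis by (simp add: square_integrable_def)
qed

lemma F_second_moment: "(\<integral>\<omega>. (F x \<omega>)\<^sup>2 \<partial>M) \<le> K"
  using F_bound[of x] K_nonneg square_integrableD[OF F_sq[of x]] by (subst (asm) nn_integral_eq_integral) auto

sublocale pair_sigma_finite lborel M by unfold_locales

lemma field_integral_measurable [measurable]: "(\<lambda>\<omega>. \<integral>x. F x \<omega> \<partial>lborel) \<in> borel_measurable M"
  by (intro lborel.borel_measurable_lebesgue_integral) simp

lemma field_integral_square_integrable: "square_integrable M (\<lambda>\<omega>. \<integral>x. F x \<omega> \<partial>lborel)"
proof -
  let ?i = "indicator {a..b} :: real \<Rightarrow> ennreal"
  have "(\<integral>\<^sup>+\<omega>. ennreal ((\<integral>x. F x \<omega> \<partial>lborel)\<^sup>2) \<partial>M)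
      \<le> (\<integral>\<^sup>+\<omega>. (\<integral>\<^sup>+x. ennreal ((F x \<omega>)\<^sup>2) \<partial>lborel) * emeasure lborel {a..b} \<partial>M)"
  proof (rule nn_integral_mono)
    fix \<omega> assume [measurable]: "\<omega> \<in> space M"
    have [measurable]: "(\<lambda>x. F x \<omega>) \<in> borel_measurable borel"
      using measurable_compose[OF measurable_Pair2'[of \<omega> M borel] F_meas] \<open>\<omega> \<in> space M\<close> by simp
    \<comment> \<open>For \<omega> whose path is not integrable the Bochner integral is 0, so the
      bound holds for all \<omega>.\<close>
    have "ennreal \<bar>\<integral>x. F x \<omega> \<partial>lborel\<bar> \<le> (\<integral>\<^sup>+x. ennreal \<bar>F x \<omega>\<bar> \<partial>lborel)"
    proof (cases "integrable lborel (\<lambda>x. F x \<omega>)")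
      case True
      then show ?thesis
        using integral_norm_bound_ennreal[OF True] by simp
    qed (simp add: not_integrable_integral_eq)
    also have "\<dots> = (\<integral>\<^sup>+x. ennreal \<bar>F x \<omega>\<bar> * ?i x \<partial>lborel)"
      by (intro nn_integral_cong) (auto simp: indicator_def F_supp)
    finally have "(ennreal \<bar>\<integral>x. F x \<omega> \<partial>lborel\<bar>)\<^sup>2 \<le> (\<integral>\<^sup>+x. ennreal \<bar>F x \<omega>\<bar> * ?i x \<partial>lborel)\<^sup>2"
      by (intro power_mono) auto
    also have "\<dots> \<le> (\<integral>\<^sup>+x. ennreal \<bar>F x \<omega>\<bar> ^ 2 \<partial>lborel) * (\<integral>\<^sup>+x. ?i x ^ 2 \<partial>lborel)"
      by (rule Cauchy_Schwarz_nn_integral) auto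
    also have "(\<integral>\<^sup>+x. ?i x ^ 2 \<partial>lborel) = (\<integral>\<^sup>+x. ?i x \<partial>lborel)"
      by (intro nn_integral_cong) (auto simp: indicator_def)
    finally show "ennreal ((\<integral>x. F x \<omega> \<partial>lborel)\<^sup>2) \<le> (\<integral>\<^sup>+x. ennreal ((F x \<omega>)\<^sup>2) \<partial>lborel) * emeasure lborel {a..b}"
      by (simp add: ennreal_power)
  qed
  also have "\<dots> = (\<integral>\<^sup>+\<omega>. (\<integral>\<^sup>+x. ennreal ((F x \<omega>)\<^sup>2) \<partial>lborel) \<partial>M) * emeasure lborel {a..b}"
    by (rule nn_integral_multc) measurable
  also have "(\<integral>\<^sup>+\<omega>. (\<integral>\<^sup>+x. ennreal ((F x \<omega>)\<^sup>2) \<partial>lborel) \<partial>M) = (\<integral>\<^sup>+x. (\<integral>\<^sup>+\<omega>. ennreal ((F x \<omega>)\<^sup>2) \<partial>M) \<partial>lborel)"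
    by (rule Fubini') measurable
  also have "\<dots> \<le> (\<integral>\<^sup>+x. ennreal K * ?i x \<partial>lborel)"
    using F_bound by (intro nn_integral_mono) (auto simp: indicator_def F_supp)
  also have "\<dots> = ennreal K * emeasure lborel {a..b}" by (simp add: nn_integral_cmult)
  finally have "(\<integral>\<^sup>+\<omega>. ennreal ((\<integral>x. F x \<omega> \<partial>lborel)\<^sup>2) \<partial>M) \<le> ennreal K * emeasure lborel {a..b} * emeasure lborel {a..b}"
    by (simp add: mult_right_mono)
  also have "\<dots> < \<infinity>" by (cases "a \<le> b") (auto simp: ennreal_mult_less_top)
  finally show ?thesis
    unfolding square_integrable_def by (intro conjI integrableI_nonneg) auto
qed

text \<open>Cauchy-Schwarz for each x bounds E |F x Y| uniformly on the bounded support, which is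
  the hypothesis of Fubini's theorem.\<close>

lemma field_mult_integrable_pair:
  assumes Y: "square_integrable M Y"
  shows "integrable (lborel \<Otimes>\<^sub>M M) (\<lambda>(x, \<omega>). F x \<omega> * Y \<omega>)"
proof -
  note [measurable] = square_integrableD(1)[OF Y]
  let ?c = "sqrt K * sqrt (\<integral>\<omega>. (Y \<omega>)\<^sup>2 \<partial>M)"
  show ?thesis
  proof (rule Fubini_integrable)
    show "integrable lborel (\<lambda>x. \<integral>\<omega>. norm ((\<lambda>(x, \<omega>). F x \<omega> * Y \<omega>) (x, \<omega>)) \<partial>M)"
    proof (rule Bochner_Integration.integrable_bound)
      show "integrable lborel (\<lambda>x. ?c * indicator {a..b} x)" by (cases "a \<le> b") auto
      have "\<bar>\<integral>\<omega>. \<bar>F x \<omega> * Y \<omega>\<bar> \<partial>M\<bar> \<le> \<bar>?c * indicator {a..b} x\<bar>" for x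
      proof (cases "x \<in> {a..b}")
        case True
        have s: "square_integrable M (\<lambda>\<omega>. \<bar>F x \<omega>\<bar>)" "square_integrable M (\<lambda>\<omega>. \<bar>Y \<omega>\<bar>)"
          using F_sq[of x] Y by (auto simp: square_integrable_def)
        have "\<bar>\<integral>\<omega>. \<bar>F x \<omega> * Y \<omega>\<bar> \<partial>M\<bar> \<le> sqrt (\<integral>\<omega>. (F x \<omega>)\<^sup>2 \<partial>M) * sqrt (\<integral>\<omega>. (Y \<omega>)\<^sup>2 \<partial>M)"
          using abs_expectation_mult_le[OF s] by (simp add: abs_mult)
        also have "\<dots> \<le> ?c"
          using F_second_moment[of x] by (intro mult_right_mono real_sqrt_le_mono) auto
        finally show ?thesis using True K_nonneg by (simp add: abs_mult)
      qed (simp add: F_supp)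
      then show "AE x in lborel. norm (\<integral>\<omega>. norm ((\<lambda>(x, \<omega>). F x \<omega> * Y \<omega>) (x, \<omega>)) \<partial>M) \<le> norm (?c * indicator {a..b} x)"
        by simp
    qed measurable
    show "AE x in lborel. integrable M (\<lambda>\<omega>. (\<lambda>(x, \<omega>). F x \<omega> * Y \<omega>) (x, \<omega>))"
      using square_integrable_mult[OF F_sq Y] by simp
  qed measurable
qed

lemma field_mult_integrable:
  assumes Y: "square_integrable M Y"
  shows "integrable lborel (\<lambda>x. \<integral>\<omega>. F x \<omega> * Y \<omega> \<partial>M)"
  using integrable_fst'[OF field_mult_integrable_pair[OF Y]] by simp

lemma field_integral_mult:
  assumes Y: "square_integrable M Y"
  shows "(\<integral>\<omega>. (\<integral>x. F x \<omega> \<partial>lborel) * Y \<omega> \<partial>M) = (\<integral>x. (\<integral>\<omega>. F x \<omega> * Y \<omega> \<partial>M) \<partial>lborel)"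
proof -
  have "(\<integral>\<omega>. (\<integral>x. F x \<omega> \<partial>lborel) * Y \<omega> \<partial>M) = (\<integral>\<omega>. (\<integral>x. F x \<omega> * Y \<omega> \<partial>lborel) \<partial>M)" by simp
  also have "\<dots> = (\<integral>x. (\<integral>\<omega>. F x \<omega> * Y \<omega> \<partial>M) \<partial>lborel)"
    using field_mult_integrable_pair[OF Y] by (rule Fubini_integral)
  finally show ?thesis .
qed

text \<open>\<open>field_integral_mult\<close> is applied twice: first with Y the integral itself,
  then with Y = F x.\<close>

lemma field_integral_second_moment:
  "(\<integral>\<omega>. (\<integral>x. F x \<omega> \<partial>lborel)\<^sup>2 \<partial>M) = (\<integral>x. (\<integral>y. (\<integral>\<omega>. F x \<omega> * F y \<omega> \<partial>M) \<partial>lborel) \<partial>lborel)"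
proof -
  have "(\<integral>\<omega>. (\<integral>x. F x \<omega> \<partial>lborel)\<^sup>2 \<partial>M) = (\<integral>x. (\<integral>\<omega>. F x \<omega> * (\<integral>y. F y \<omega> \<partial>lborel) \<partial>M) \<partial>lborel)"
    using field_integral_mult[OF field_integral_square_integrable] by (simp add: power2_eq_square)
  also have "\<dots> = (\<integral>x. (\<integral>y. (\<integral>\<omega>. F x \<omega> * F y \<omega> \<partial>M) \<partial>lborel) \<partial>lborel)"
  proof (rule Bochner_Integration.integral_cong[OF refl])
    fix x show "(\<integral>\<omega>. F x \<omega> * (\<integral>y. F y \<omega> \<partial>lborel) \<partial>M) = (\<integral>y. (\<integral>\<omega>. F x \<omega> * F y \<omega> \<partial>M) \<partial>lborel)"
      using field_integral_mult[OF F_sq[of x]] by (simp add: mult.commute)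
  qed
  finally show ?thesis .
qed

lemma field_integral_second_moment_le:
  assumes "a \<le> b"
  shows "(\<integral>\<omega>. (\<integral>x. F x \<omega> \<partial>lborel)\<^sup>2 \<partial>M) \<le> K * (b - a)\<^sup>2"
proof -
  have e: "\<bar>\<integral>\<omega>. F x \<omega> * F y \<omega> \<partial>M\<bar> \<le> K * indicator {a..b} x * indicator {a..b} y" for x y
  proof (cases "x \<in> {a..b} \<and> y \<in> {a..b}")
    case True
    have "\<bar>\<integral>\<omega>. F x \<omega> * F y \<omega> \<partial>M\<bar> \<le> sqrt (\<integral>\<omega>. (F x \<omega>)\<^sup>2 \<partial>M) * sqrt (\<integral>\<omega>. (F y \<omega>)\<^sup>2 \<partial>M)"
      by (intro abs_expectation_mult_le F_sq)
    also have "\<dots> \<le> sqrt K * sqrt K"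
      using F_second_moment K_nonneg by (intro mult_mono real_sqrt_le_mono) auto
    finally show ?thesis using True K_nonneg by simp
  qed (auto simp: F_supp)
  have inner: "(\<integral>y. (\<integral>\<omega>. F x \<omega> * F y \<omega> \<partial>M) \<partial>lborel) \<le> K * (b - a) * indicator {a..b} x" for x
  proof -
    have "(\<integral>y. (\<integral>\<omega>. F x \<omega> * F y \<omega> \<partial>M) \<partial>lborel) \<le> (\<integral>y. K * indicator {a..b} x * indicator {a..b} y \<partial>lborel)"
    proof (rule integral_mono')
      show "integrable lborel (\<lambda>y. K * indicator {a..b} x * indicator {a..b} y :: real)" using assms by simp
    qed (use e[of x] K_nonneg in \<open>auto simp: abs_le_iff\<close>)
    then show ?thesis using assms by (simp add: mult_ac)
  qed
  have "(\<integral>x. (\<integral>y. (\<integral>\<omega>. F x \<omega> * F y \<omega> \<partial>M) \<partial>lborel) \<partial>lborel) \<le> (\<integral>x. K * (b - a) * indicator {a..b} x \<partial>lborel)"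
  proof (rule integral_mono')
    show "integrable lborel (\<lambda>x. K * (b - a) * indicator {a..b} x :: real)" using assms by simp
  qed (use inner K_nonneg assms in auto)
  then show ?thesis
    unfolding field_integral_second_moment using assms by (simp add: power2_eq_square mult_ac)
qed

end

section \<open>Covariances of the generalized derivative\<close>

locale smooth_gaussian_process = centered_gaussian_process +
  fixes \<sigma>2 :: "real \<Rightarrow> real"
  assumes cont: "\<And>\<omega>. \<omega> \<in> space M \<Longrightarrow> continuous_on {0..} (\<lambda>x. G x \<omega>)"
    and variance: "\<And>x y. 0 \<le> x \<Longrightarrow> 0 \<le> y \<Longrightarrow> (\<integral>\<omega>. (G x \<omega> - G y \<omega>)\<^sup>2 \<partial>M) = \<sigma>2 (x - y)"
    and even_var: "\<And>h. \<sigma>2 h = \<sigma>2 \<bar>h\<bar>"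
    and convex_var: "convex_on UNIV \<sigma>2"
    and var_small: "((\<lambda>h. \<sigma>2 h / h) \<longlongrightarrow> 0) (at 0)"
    and diff1: "\<And>s. s \<noteq> 0 \<Longrightarrow> \<sigma>2 differentiable (at s)"
    and diff2: "\<And>s. s \<noteq> 0 \<Longrightarrow> deriv \<sigma>2 differentiable (at s)"
begin

section \<open>Derivatives of the increment variance and the density they define\<close>

abbreviation "D \<equiv> deriv \<sigma>2"

lemma var_zero: "\<sigma>2 0 = 0" using variance[of 0 0] by simp

lemma var_nonneg: "0 \<le> \<sigma>2 h"
proof -
  have "0 \<le> (\<integral>\<omega>. (G \<bar>h\<bar> \<omega> - G 0 \<omega>)\<^sup>2 \<partial>M)" by simp
  also have "\<dots> = \<sigma>2 \<bar>h\<bar>" using variance[of "\<bar>h\<bar>" 0] by simp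
  finally show ?thesis by (simp flip: even_var)
qed

text \<open>Differentiability is assumed away from 0 only; at 0 the assumption on
  \<open>\<sigma>2 h / h\<close> is itself the derivative.\<close>

lemma DERIV_var_0: "(\<sigma>2 has_real_derivative 0) (at 0)"
  using var_small by (simp add: DERIV_def var_zero)

lemma D_zero: "D 0 = 0" using DERIV_var_0 by (rule DERIV_imp_deriv)

lemma DERIV_var: "(\<sigma>2 has_real_derivative D x) (at x)"
proof (cases "x = 0")
  case True
  then show ?thesis using DERIV_var_0 by (simp add: D_zero)
next
  case False
  then show ?thesis
    using diff1 by (metis DERIV_deriv_iff_real_differentiable)
qed

lemma DERIV_D: "x \<noteq> 0 \<Longrightarrow> (D has_real_derivative deriv D x) (at x)"
  using diff2 by (metis DERIV_deriv_iff_real_differentiable)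

lemma var_above_tangent: "D x * (y - x) \<le> \<sigma>2 y - \<sigma>2 x"
  using convex_on_imp_above_tangent[OF convex_var connected_UNIV, of x y "D x"] DERIV_var by simp

lemma D_mono: "x \<le> y \<Longrightarrow> D x \<le> D y"
proof (cases "x = y")
  case False
  assume "x \<le> y"
  have "D x * (y - x) \<le> D y * (y - x)"
    using var_above_tangent[of x y] var_above_tangent[of y x] by (simp add: algebra_simps)
  then show ?thesis using \<open>x \<le> y\<close> False by simp
qed simp

lemma D_odd: "D (- x) = - D x"
proof -
  have "((\<lambda>x. \<sigma>2 (- x)) has_real_derivative (D (- x) * (- 1))) (at x)"
    by (rule DERIV_chain2[OF DERIV_var]) (auto intro!: derivative_eq_intros)
  moreover have "(\<lambda>x. \<sigma>2 (- x)) = \<sigma>2"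
    using even_var[of "- x" for x] by (simp add: fun_eq_iff flip: even_var)
  ultimately have "(\<sigma>2 has_real_derivative (- D (- x))) (at x)" by simp
  from DERIV_unique[OF this DERIV_var] show ?thesis by simp
qed

text \<open>At 0 the second derivative may fail to exist. There convexity helps: the tangent at h,
  compared with the value at 2 h, gives D h \<le> \<open>\<sigma>2 (2 * h) / h\<close> for h > 0,
  which tends to 0; oddness handles h < 0.\<close>

lemma D_continuous: "continuous_on UNIV D"
proof -
  have "isCont D x" for x
  proof (cases "x = 0")
    case False
    then show ?thesis using DERIV_D DERIV_isCont by blast
  next
    case True
    have pos: "\<bar>D h\<bar> \<le> \<bar>\<sigma>2 (2 * h) / h\<bar>" if "0 < h" for h
    proof -
      have "D h * (2 * h - h) \<le> \<sigma>2 (2 * h) - \<sigma>2 h" by (rule var_above_tangent)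
      then have "D h * h \<le> \<sigma>2 (2 * h)" using var_nonneg[of h] by simp
      then have "D h \<le> \<sigma>2 (2 * h) / h" using that by (simp add: pos_le_divide_eq)
      moreover have "0 \<le> D h" using D_mono[of 0 h] D_zero that by simp
      ultimately show ?thesis by linarith
    qed
    have b: "\<bar>D h\<bar> \<le> \<bar>\<sigma>2 (2 * h) / h\<bar>" if "h \<noteq> 0" for h
    proof (cases "0 < h")
      case True then show ?thesis by (rule pos)
    next
      case False
      then show ?thesis
        using pos[of "- h"] that even_var[of "2 * h"] even_var[of "2 * - h"] D_odd[of h] by simp
    qed
    have "filterlim (\<lambda>h::real. 2 * h) (at 0) (at 0)"
      unfolding filterlim_at by (auto simp: eventually_at_filter intro!: tendsto_eq_intros)
    from filterlim_compose[OF var_small this]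
    have "((\<lambda>h. 2 * (\<sigma>2 (2 * h) / (2 * h))) \<longlongrightarrow> 2 * 0) (at 0)"
      by (intro tendsto_mult tendsto_const)
    then have "((\<lambda>h. \<bar>\<sigma>2 (2 * h) / h\<bar>) \<longlongrightarrow> 0) (at 0)"
      by (intro tendsto_rabs_zero) simp
    then have "(D \<longlongrightarrow> 0) (at 0)"
      by (rule Lim_null_comparison[rotated]) (use b in \<open>auto simp: eventually_at_filter\<close>)
    then show ?thesis using True D_zero by (simp add: isCont_def)
  qed
  then show ?thesis by (simp add: continuous_on_eq_continuous_at)
qed

lemma var_continuous: "continuous_on UNIV \<sigma>2"
  using DERIV_var DERIV_isCont by (metis continuous_at_imp_continuous_on)

lemma var_mono:
  assumes "0 \<le> x" "x \<le> y" shows "\<sigma>2 x \<le> \<sigma>2 y"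
proof -
  have "0 \<le> D x" using D_mono[of 0 x] D_zero assms by simp
  then have "0 \<le> D x * (y - x)" using assms by simp
  also note var_above_tangent[of x y]
  finally show ?thesis by simp
qed

text \<open>The density \<open>\<rho>\<close>, with the junk value of the derivative at \<open>0\<close> replaced by \<open>0\<close>.\<close>

definition rho0 :: "real \<Rightarrow> real" where
  "rho0 x = (if x = 0 then 0 else deriv D x / 2)"

lemma rho0_nonneg: "0 \<le> rho0 x"
proof (cases "x = 0")
  case False
  have "0 \<le> deriv D x"
    by (rule mono_on_imp_deriv_nonneg[OF _ DERIV_D[OF False], of UNIV]) (auto simp: monotone_on_def D_mono)
  then show ?thesis by (simp add: rho0_def)
qed (simp add: rho0_def)

lemma rho0_even: "rho0 (- x) = rho0 x"
proof (cases "x = 0")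
  case False
  have "((\<lambda>x. D (- x)) has_real_derivative (deriv D (- x) * (- 1))) (at x)"
    by (rule DERIV_chain2[OF DERIV_D]) (use False in \<open>auto intro!: derivative_eq_intros\<close>)
  moreover have "((\<lambda>x. - D x) has_real_derivative (- deriv D x)) (at x)"
    using DERIV_D[OF False] by (rule DERIV_minus)
  ultimately have "deriv D (- x) = deriv D x"
    unfolding D_odd by (auto dest: DERIV_unique)
  then show ?thesis using False by (simp add: rho0_def)
qed simp

text \<open>A derivative of the continuous function D is a pointwise limit of its difference
  quotients; the point 0 is set aside throughout.\<close>

lemma rho0_measurable [measurable]: "rho0 \<in> borel_measurable borel"
proof (rule borel_measurable_LIMSEQ_real)
  have [measurable]: "D \<in> borel_measurable borel"
    by (rule borel_measurable_continuous_onI[OF D_continuous])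
  show "(\<lambda>x. if x = 0 then 0 else (D (x + inverse (real (Suc n))) - D x) / inverse (real (Suc n)) / 2) \<in> borel_measurable borel" for n
    by measurable
  fix x :: real
  show "(\<lambda>n. if x = 0 then 0 else (D (x + inverse (real (Suc n))) - D x) / inverse (real (Suc n)) / 2) \<longlonglongrightarrow> rho0 x"
  proof (cases "x = 0")
    case False
    have "filterlim (\<lambda>n. inverse (real (Suc n))) (at 0) sequentially"
      unfolding filterlim_at using LIMSEQ_inverse_real_of_nat by auto
    moreover have "((\<lambda>h. (D (x + h) - D x) / h) \<longlongrightarrow> deriv D x) (at 0)"
      using DERIV_D[OF False] by (simp add: DERIV_def)
    ultimately have "(\<lambda>n. (D (x + inverse (real (Suc n))) - D x) / inverse (real (Suc n))) \<longlonglongrightarrow> deriv D x"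
      by (rule filterlim_compose[rotated])
    then have "(\<lambda>n. (D (x + inverse (real (Suc n))) - D x) / inverse (real (Suc n)) / 2) \<longlonglongrightarrow> deriv D x / 2"
      by (intro tendsto_divide tendsto_const) auto
    then show ?thesis using False by (simp add: rho0_def)
  qed (simp add: rho0_def)
qed

text \<open>Continuity of D at 0 allows the fundamental theorem of calculus across the singularity,
  with 0 as exceptional point. Thus \<open>rho0\<close> is locally integrable and the second
  derivative of the variance carries no atom at 0.\<close>

lemma nn_integral_rho0:
  assumes "a \<le> b"
  shows "(\<integral>\<^sup>+x. ennreal (rho0 x) * indicator {a..b} x \<partial>lborel) = ennreal ((D b - D a) / 2)"
proof (rule nn_integral_has_integral_lebesgue'[OF rho0_nonneg])
  have "(rho0 has_integral (D b / 2 - D a / 2)) {a..b}"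
  proof (rule fundamental_theorem_of_calculus_interior_strong[of "{0}"])
    show "continuous_on {a..b} (\<lambda>x. D x / 2)"
      using continuous_on_subset[OF D_continuous] by (intro continuous_intros) auto
    fix x :: real assume x: "x \<in> {a<..<b} - {0}"
    then have "((\<lambda>x. D x / 2) has_real_derivative (deriv D x / 2)) (at x)"
      by (intro DERIV_cdivide DERIV_D) auto
    then show "((\<lambda>x. D x / 2) has_vector_derivative rho0 x) (at x)"
      using x by (simp add: rho0_def has_real_derivative_iff_has_vector_derivative)
  qed (use assms in auto)
  then show "(rho0 has_integral ((D b - D a) / 2)) {a..b}" by (simp add: diff_divide_distrib)
qed

lemma nn_integral_rho0_shift:
  assumes "c \<le> d"
  shows "(\<integral>\<^sup>+v. ennreal (rho0 (u - v)) * indicator {c..d} v \<partial>lborel) = ennreal ((D (d - u) - D (c - u)) / 2)"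
proof -
  have "(\<integral>\<^sup>+v. ennreal (rho0 (u - v)) * indicator {c..d} v \<partial>lborel) =
      (\<integral>\<^sup>+v. ennreal (rho0 (- u + 1 * v)) * indicator {c - u..d - u} (- u + 1 * v) \<partial>lborel)"
    using rho0_even[of "u - v" for v] by (intro nn_integral_cong) (auto simp: indicator_def)
  also have "\<dots> = (\<integral>\<^sup>+v. ennreal (rho0 v) * indicator {c - u..d - u} v \<partial>lborel)"
    by (subst nn_integral_real_affine[of "\<lambda>v. ennreal (rho0 v) * indicator {c - u..d - u} v" 1 "- u"]) simp_all
  finally show ?thesis using assms by (simp add: nn_integral_rho0)
qed

definition pot :: "(real \<Rightarrow> ennreal) \<Rightarrow> real \<Rightarrow> ennreal" where
  "pot \<psi> u = (\<integral>\<^sup>+v. ennreal (rho0 (u - v)) * \<psi> v \<partial>lborel)"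

text \<open>The covariance form of G'. All densities are nonnegative, so extended real values let
  Tonelli apply without integrability conditions.\<close>

definition Rho :: "(real \<Rightarrow> ennreal) \<Rightarrow> (real \<Rightarrow> ennreal) \<Rightarrow> ennreal" where
  "Rho \<phi> \<psi> = (\<integral>\<^sup>+u. \<phi> u * pot \<psi> u \<partial>lborel)"

lemma pot_measurable [measurable]:
  assumes [measurable]: "\<psi> \<in> borel_measurable borel"
  shows "pot \<psi> \<in> borel_measurable borel"
  unfolding pot_def by measurable

lemma Rho_sym:
  assumes [measurable]: "\<phi> \<in> borel_measurable borel" "\<psi> \<in> borel_measurable borel"
  shows "Rho \<phi> \<psi> = Rho \<psi> \<phi>"
proof -
  have "Rho \<phi> \<psi> = (\<integral>\<^sup>+u. (\<integral>\<^sup>+v. \<phi> u * (ennreal (rho0 (u - v)) * \<psi> v) \<partial>lborel) \<partial>lborel)"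
    unfolding Rho_def pot_def by (subst nn_integral_cmult) auto
  also have "\<dots> = (\<integral>\<^sup>+v. (\<integral>\<^sup>+u. \<phi> u * (ennreal (rho0 (u - v)) * \<psi> v) \<partial>lborel) \<partial>lborel)"
    by (rule lborel_pair.Fubini') measurable
  also have "\<dots> = (\<integral>\<^sup>+v. (\<integral>\<^sup>+u. \<psi> v * (ennreal (rho0 (v - u)) * \<phi> u) \<partial>lborel) \<partial>lborel)"
    using rho0_even[of "u - v" for u v] by (intro nn_integral_cong) (simp add: mult_ac)
  also have "\<dots> = Rho \<psi> \<phi>"
    unfolding Rho_def pot_def by (subst nn_integral_cmult) auto
  finally show ?thesis .
qed

lemma Rho_mono: "(\<And>u. \<phi> u \<le> \<phi>' u) \<Longrightarrow> (\<And>u. \<psi> u \<le> \<psi>' u) \<Longrightarrow> Rho \<phi> \<psi> \<le> Rho \<phi>' \<psi>'"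
  unfolding Rho_def pot_def by (intro nn_integral_mono mult_mono) auto

lemma Rho_cmult_left:
  "\<phi> \<in> borel_measurable borel \<Longrightarrow> \<psi> \<in> borel_measurable borel \<Longrightarrow> Rho (\<lambda>u. c * \<phi> u) \<psi> = c * Rho \<phi> \<psi>"
  unfolding Rho_def by (simp add: mult.assoc nn_integral_cmult)

lemma Rho_cmult_right:
  "\<phi> \<in> borel_measurable borel \<Longrightarrow> \<psi> \<in> borel_measurable borel \<Longrightarrow> Rho \<phi> (\<lambda>u. c * \<psi> u) = c * Rho \<phi> \<psi>"
  by (subst Rho_sym) (simp_all add: Rho_cmult_left Rho_sym[of \<psi>])

text \<open>Integrating \<open>rho0\<close> twice gives first differences of D/2 and then of
  \<open>\<sigma>2\<close>. The result is the covariance of two increments in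
  \<open>increment_covariance\<close>, which ties the form \<open>Rho\<close> to the
  process.\<close>

lemma Rho_intervals:
  assumes "a \<le> b" "c \<le> d"
  shows "0 \<le> \<sigma>2 (b - c) + \<sigma>2 (a - d) - \<sigma>2 (b - d) - \<sigma>2 (a - c)"
    and "Rho (indicator {a..b}) (indicator {c..d}) =
      ennreal ((\<sigma>2 (b - c) + \<sigma>2 (a - d) - \<sigma>2 (b - d) - \<sigma>2 (a - c)) / 2)"
proof -
  let ?F = "\<lambda>u. (\<sigma>2 (c - u) - \<sigma>2 (d - u)) / 2"
  have sw: "\<sigma>2 (x - y) = \<sigma>2 (y - x)" for x y
    using even_var[of "x - y"] even_var[of "y - x"] by (simp add: abs_minus_commute)
  have eq: "?F b - ?F a = (\<sigma>2 (b - c) + \<sigma>2 (a - d) - \<sigma>2 (b - d) - \<sigma>2 (a - c)) / 2"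
    by (simp add: sw[of c] sw[of d] diff_divide_distrib add_divide_distrib)
  have der: "(?F has_real_derivative ((D (d - u) - D (c - u)) / 2)) (at u)" for u
    by (auto intro!: derivative_eq_intros DERIV_chain2[OF DERIV_var] simp: field_simps)
  have nn: "0 \<le> (D (d - u) - D (c - u)) / 2" for u using D_mono[of "c - u" "d - u"] assms by simp
  have "?F a \<le> ?F b"
    by (rule DERIV_nonneg_imp_nondecreasing[OF assms(1)]) (use der nn in blast)
  then have "0 \<le> ?F b - ?F a" by simp
  then show "0 \<le> \<sigma>2 (b - c) + \<sigma>2 (a - d) - \<sigma>2 (b - d) - \<sigma>2 (a - c)" unfolding eq by simp
  have "Rho (indicator {a..b}) (indicator {c..d}) = (\<integral>\<^sup>+u. ennreal ((D (d - u) - D (c - u)) / 2) * indicator {a..b} u \<partial>lborel)"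
    unfolding Rho_def pot_def nn_integral_rho0_shift[OF assms(2)] by (simp add: mult.commute)
  also have "\<dots> = ennreal (?F b - ?F a)"
    using assms nn has_field_derivative_at_within[OF der]
    by (intro nn_integral_FTC_Icc borel_measurable_continuous_onI continuous_intros continuous_on_compose2[OF D_continuous]) auto
  finally show "Rho (indicator {a..b}) (indicator {c..d}) =
      ennreal ((\<sigma>2 (b - c) + \<sigma>2 (a - d) - \<sigma>2 (b - d) - \<sigma>2 (a - c)) / 2)"
    unfolding eq .
qed

text \<open>Polarization: the product of two increments is half of a signed sum of squares of the
  four increments between their end points.\<close>

lemma increment_covariance:
  assumes "0 \<le> a" "0 \<le> b" "0 \<le> c" "0 \<le> d"
  shows "(\<integral>\<omega>. (G b \<omega> - G a \<omega>) * (G d \<omega> - G c \<omega>) \<partial>M) = (\<sigma>2 (b - c) + \<sigma>2 (a - d) - \<sigma>2 (b - d) - \<sigma>2 (a - c)) / 2"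
proof -
  have i: "integrable M (\<lambda>\<omega>. (G x \<omega> - G y \<omega>)\<^sup>2)" if "0 \<le> x" "0 \<le> y" for x y
    by (rule square_integrableD(2)[OF square_integrable_diff[OF G_square_integrable[OF that(1)] G_square_integrable[OF that(2)]]])
  have "(\<integral>\<omega>. (G b \<omega> - G a \<omega>) * (G d \<omega> - G c \<omega>) \<partial>M) =
     (\<integral>\<omega>. ((G b \<omega> - G c \<omega>)\<^sup>2 + (G a \<omega> - G d \<omega>)\<^sup>2 - (G b \<omega> - G d \<omega>)\<^sup>2 - (G a \<omega> - G c \<omega>)\<^sup>2) / 2 \<partial>M)"
    by (rule Bochner_Integration.integral_cong) (auto simp: power2_eq_square algebra_simps)
  also have "\<dots> = (\<sigma>2 (b - c) + \<sigma>2 (a - d) - \<sigma>2 (b - d) - \<sigma>2 (a - c)) / 2"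
    using i assms by (simp add: variance)
  finally show ?thesis .
qed

text \<open>Freezing the process to the left of 0 yields continuous paths on the whole line, so that
  joint measurability can be stated on all of \<open>borel\<close>.\<close>

definition Gp :: "real \<Rightarrow> 'a \<Rightarrow> real" where "Gp x = G (max 0 x)"

lemma Gp_eq: "0 \<le> x \<Longrightarrow> Gp x = G x" by (simp add: Gp_def)

lemma Gp_continuous: "\<omega> \<in> space M \<Longrightarrow> continuous_on UNIV (\<lambda>x. Gp x \<omega>)"
  unfolding Gp_def by (rule continuous_on_compose2[OF cont]) (auto intro!: continuous_intros)

lemma Gp_gspace: "Gp x \<in> gspace" unfolding Gp_def by (rule G_in_gspace) simp

lemma Gp_square_integrable: "square_integrable M (Gp x)" by (rule gspace_square_integrable[OF Gp_gspace])

lemma Gp_measurable1 [measurable]: "Gp x \<in> borel_measurable M"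
  by (rule square_integrableD(1)[OF Gp_square_integrable])

text \<open>Rounding x down to multiples of 1/(n + 1) leaves countably many values, hence a jointly
  measurable approximation; path continuity gives the limit.\<close>

lemma Gp_measurable [measurable]: "(\<lambda>(x, \<omega>). Gp x \<omega>) \<in> borel_measurable (borel \<Otimes>\<^sub>M M)"
proof (rule borel_measurable_LIMSEQ_real)
  fix p :: "real \<times> 'a" assume "p \<in> space (borel \<Otimes>\<^sub>M M)"
  then have p: "snd p \<in> space M" by (auto simp: space_pair_measure)
  have "(\<lambda>n. of_int \<lfloor>real (Suc n) * fst p\<rfloor> / real (Suc n)) \<longlonglongrightarrow> fst p"
  proof (rule LIMSEQ_I)
    fix r :: real assume "0 < r"
    then obtain N where N: "inverse (real (Suc N)) < r" using reals_Archimedean by blast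
    show "\<exists>no. \<forall>n\<ge>no. norm (of_int \<lfloor>real (Suc n) * fst p\<rfloor> / real (Suc n) - fst p) < r"
    proof (intro exI allI impI)
      fix n assume n: "N \<le> n"
      have "\<bar>of_int \<lfloor>real (Suc n) * fst p\<rfloor> - real (Suc n) * fst p\<bar> \<le> 1" by linarith
      then have "\<bar>of_int \<lfloor>real (Suc n) * fst p\<rfloor> - real (Suc n) * fst p\<bar> / real (Suc n) \<le> inverse (real (Suc n))"
        by (simp add: divide_simps)
      moreover have "norm (of_int \<lfloor>real (Suc n) * fst p\<rfloor> / real (Suc n) - fst p) = \<bar>of_int \<lfloor>real (Suc n) * fst p\<rfloor> - real (Suc n) * fst p\<bar> / real (Suc n)"
      proof -
        have "a / c - b = (a - c * b) / c" if "c \<noteq> 0" for a b c :: real using that by (simp add: diff_divide_distrib)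
        then have "of_int \<lfloor>real (Suc n) * fst p\<rfloor> / real (Suc n) - fst p = (of_int \<lfloor>real (Suc n) * fst p\<rfloor> - real (Suc n) * fst p) / real (Suc n)"
          by simp
        then show ?thesis unfolding real_norm_def by (simp add: abs_divide)
      qed
      moreover have "inverse (real (Suc n)) \<le> inverse (real (Suc N))" using n by (intro le_imp_inverse_le) auto
      ultimately show "norm (of_int \<lfloor>real (Suc n) * fst p\<rfloor> / real (Suc n) - fst p) < r"
        using N by linarith
    qed
  qed
  moreover have "isCont (\<lambda>x. Gp x (snd p)) (fst p)"
    using Gp_continuous[OF p] by (simp add: continuous_on_eq_continuous_at)
  ultimately show "(\<lambda>n. Gp (of_int \<lfloor>real (Suc n) * fst p\<rfloor> / real (Suc n)) (snd p)) \<longlonglongrightarrow> (case p of (x, \<omega>) \<Rightarrow> Gp x \<omega>)"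
    unfolding case_prod_beta by (rule isCont_tendsto_compose[rotated])
next
  fix n
  show "(\<lambda>p. Gp (of_int \<lfloor>real (Suc n) * fst p\<rfloor> / real (Suc n)) (snd p)) \<in> borel_measurable (borel \<Otimes>\<^sub>M M)"
    by (rule measurable_compose_countable[where f = "\<lambda>i p. Gp (of_int i / real (Suc n)) (snd p)"
        and g = "\<lambda>p. \<lfloor>real (Suc n) * fst p\<rfloor>"]) measurable
qed

section \<open>Difference quotients of the process and their second moments\<close>

definition quot :: "real \<Rightarrow> real \<Rightarrow> 'a \<Rightarrow> real" where
  "quot h x \<omega> = (Gp (x + h) \<omega> - Gp x \<omega>) / h"

lemma quot_measurable [measurable]: "(\<lambda>(x, \<omega>). quot h x \<omega>) \<in> borel_measurable (borel \<Otimes>\<^sub>M M)"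
proof -
  have "(\<lambda>p. (\<lambda>(x, \<omega>). Gp x \<omega>) (fst p + h, snd p)) \<in> borel_measurable (borel \<Otimes>\<^sub>M M)"
    by (rule measurable_compose[OF _ Gp_measurable]) measurable
  then have [measurable]: "(\<lambda>p. Gp (fst p + h) (snd p)) \<in> borel_measurable (borel \<Otimes>\<^sub>M M)" by simp
  have [measurable]: "(\<lambda>p. Gp (fst p) (snd p)) \<in> borel_measurable (borel \<Otimes>\<^sub>M M)"
    using Gp_measurable by (simp add: case_prod_beta)
  show ?thesis unfolding quot_def case_prod_beta by measurable
qed

lemma gspace_cmult: "X \<in> gspace \<Longrightarrow> (\<lambda>\<omega>. c * X \<omega>) \<in> gspace"
  using gspace_lincomb[of X X c 0] by simp

lemma gspace_diff: "X \<in> gspace \<Longrightarrow> Y \<in> gspace \<Longrightarrow> (\<lambda>\<omega>. X \<omega> - Y \<omega>) \<in> gspace"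
  using gspace_lincomb[of X Y 1 "-1"] by simp

lemma gspace_sum:
  assumes "\<And>i. i \<in> A \<Longrightarrow> X i \<in> gspace"
  shows "(\<lambda>\<omega>. \<Sum>i\<in>A. X i \<omega>) \<in> gspace"
  using assms
proof (induction A rule: infinite_finite_induct)
  case (insert i A)
  then show ?case using gspace_lincomb[of "X i" "\<lambda>\<omega>. \<Sum>i\<in>A. X i \<omega>" 1 1] by simp
qed (use gspace_cmult[OF Gp_gspace, of 0] in simp_all)

lemma quot_gspace: "quot h x \<in> gspace"
  using gspace_cmult[OF gspace_diff[OF Gp_gspace Gp_gspace], of "1 / h" "x + h" x]
  by (simp add: quot_def[abs_def])

lemma quot_square_integrable: "square_integrable M (quot h x)"
  by (rule gspace_square_integrable[OF quot_gspace])

lemma Gp_increment_second_moment: "(\<integral>\<omega>. (Gp x \<omega> - Gp y \<omega>)\<^sup>2 \<partial>M) \<le> \<sigma>2 (x - y)"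
proof -
  have "(\<integral>\<omega>. (Gp x \<omega> - Gp y \<omega>)\<^sup>2 \<partial>M) = \<sigma>2 (max 0 x - max 0 y)"
    unfolding Gp_def by (rule variance) auto
  also have "\<dots> \<le> \<sigma>2 \<bar>x - y\<bar>"
    by (subst even_var) (intro var_mono, auto)
  finally show ?thesis by (simp flip: even_var)
qed

lemma quot_second_moment: "0 \<le> x \<Longrightarrow> 0 < h \<Longrightarrow> (\<integral>\<omega>. (quot h x \<omega>)\<^sup>2 \<partial>M) = \<sigma>2 h / h\<^sup>2"
  by (simp add: quot_def power_divide Gp_eq variance)

lemma quot_second_moment_le: "(\<integral>\<omega>. (quot h x \<omega>)\<^sup>2 \<partial>M) \<le> \<sigma>2 h / h\<^sup>2"
  using Gp_increment_second_moment[of "x + h" x] by (simp add: quot_def power_divide divide_right_mono)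

lemma quot_diff_second_moment:
  "(\<integral>\<omega>. (quot h x \<omega> - quot h y \<omega>)\<^sup>2 \<partial>M) \<le> 4 * \<sigma>2 (x - y) / h\<^sup>2"
proof -
  let ?A = "\<lambda>\<omega>. Gp (x + h) \<omega> - Gp (y + h) \<omega>" and ?B = "\<lambda>\<omega>. Gp y \<omega> - Gp x \<omega>"
  have s: "square_integrable M ?A" "square_integrable M ?B"
    by (intro square_integrable_diff Gp_square_integrable)+
  have "(\<integral>\<omega>. (quot h x \<omega> - quot h y \<omega>)\<^sup>2 \<partial>M) = (\<integral>\<omega>. (?A \<omega> + ?B \<omega>)\<^sup>2 / h\<^sup>2 \<partial>M)"
    unfolding quot_def diff_divide_distrib[symmetric] power_divide
    by (intro Bochner_Integration.integral_cong refl arg_cong2[where f = "(/)"] arg_cong2[where f = "(^)"]) simp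
  also have "\<dots> = (\<integral>\<omega>. (?A \<omega> + ?B \<omega>)\<^sup>2 \<partial>M) / h\<^sup>2" by simp
  also have "\<dots> \<le> (2 * \<sigma>2 (x - y) + 2 * \<sigma>2 (x - y)) / h\<^sup>2"
  proof (intro divide_right_mono order_trans[OF second_moment_add_le[OF s]] add_mono mult_left_mono)
    show "(\<integral>\<omega>. (Gp (x + h) \<omega> - Gp (y + h) \<omega>)\<^sup>2 \<partial>M) \<le> \<sigma>2 (x - y)"
      using Gp_increment_second_moment[of "x + h" "y + h"] by simp
    show "(\<integral>\<omega>. (Gp y \<omega> - Gp x \<omega>)\<^sup>2 \<partial>M) \<le> \<sigma>2 (x - y)"
      using Gp_increment_second_moment[of y x] even_var[of "y - x"] even_var[of "x - y"]
      by (simp add: abs_minus_commute)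
  qed auto
  finally show ?thesis by simp
qed

section \<open>Difference quotients integrated against test functions\<close>

definition test_function :: "(real \<Rightarrow> real) \<Rightarrow> real \<Rightarrow> real \<Rightarrow> bool" where
  "test_function \<phi> B L \<longleftrightarrow> \<phi> \<in> borel_measurable borel \<and> 0 \<le> B \<and> 0 \<le> L \<and>
     (\<forall>x. 0 \<le> \<phi> x \<and> \<phi> x \<le> B) \<and> (\<forall>x. x \<notin> {0..L} \<longrightarrow> \<phi> x = 0)"

definition smear :: "real \<Rightarrow> (real \<Rightarrow> real) \<Rightarrow> 'a \<Rightarrow> real" where
  "smear h \<phi> \<omega> = (\<integral>x. quot h x \<omega> * \<phi> x \<partial>lborel)"

lemma smear_field:
  assumes "test_function \<phi> B L"
  shows "bounded_field M (\<lambda>x \<omega>. quot h x \<omega> * \<phi> x) 0 L (B\<^sup>2 * (\<sigma>2 h / h\<^sup>2))"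
proof
  have [measurable]: "\<phi> \<in> borel_measurable borel" using assms by (simp add: test_function_def)
  have [measurable]: "(\<lambda>p. quot h (fst p) (snd p)) \<in> borel_measurable (borel \<Otimes>\<^sub>M M)"
    using quot_measurable by (simp add: case_prod_beta)
  show "(\<lambda>(x, \<omega>). quot h x \<omega> * \<phi> x) \<in> borel_measurable (borel \<Otimes>\<^sub>M M)"
    unfolding case_prod_beta by measurable
  show "quot h x \<omega> * \<phi> x = 0" if "x \<notin> {0..L}" for x \<omega>
    using that assms by (simp add: test_function_def)
  show "0 \<le> B\<^sup>2 * (\<sigma>2 h / h\<^sup>2)" using var_nonneg by simp
  show "(\<integral>\<^sup>+\<omega>. ennreal ((quot h x \<omega> * \<phi> x)\<^sup>2) \<partial>M) \<le> ennreal (B\<^sup>2 * (\<sigma>2 h / h\<^sup>2))" for x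
  proof -
    have i: "integrable M (\<lambda>\<omega>. (quot h x \<omega>)\<^sup>2)" by (rule square_integrableD(2)[OF quot_square_integrable])
    have "(\<integral>\<^sup>+\<omega>. ennreal ((quot h x \<omega> * \<phi> x)\<^sup>2) \<partial>M) = ennreal (\<integral>\<omega>. (quot h x \<omega> * \<phi> x)\<^sup>2 \<partial>M)"
      using i by (intro nn_integral_eq_integral) (auto simp: power_mult_distrib)
    also have "(\<integral>\<omega>. (quot h x \<omega> * \<phi> x)\<^sup>2 \<partial>M) = (\<phi> x)\<^sup>2 * (\<integral>\<omega>. (quot h x \<omega>)\<^sup>2 \<partial>M)"
      by (simp add: power_mult_distrib mult.commute)
    also have "\<dots> \<le> B\<^sup>2 * (\<sigma>2 h / h\<^sup>2)"
      using assms quot_second_moment_le by (intro mult_mono power_mono) (auto simp: test_function_def)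
    finally show ?thesis by (simp add: ennreal_leI)
  qed
qed

lemma smear_square_integrable:
  assumes "test_function \<phi> B L" shows "square_integrable M (smear h \<phi>)"
proof -
  interpret bounded_field M "\<lambda>x \<omega>. quot h x \<omega> * \<phi> x" 0 L "B\<^sup>2 * (\<sigma>2 h / h\<^sup>2)"
    using assms by (rule smear_field)
  show ?thesis using field_integral_square_integrable by (simp add: smear_def[abs_def])
qed

text \<open>The integral is an L2 limit of sums over a grid. Rounding x to the grid leaves a finite
  linear combination of difference quotients, and the error is controlled by
  \<open>\<sigma>2\<close> at the mesh width, which tends to 0.\<close>

lemma smear_gspace:
  assumes \<phi>: "test_function \<phi> B L" and h: "0 < h"
  shows "smear h \<phi> \<in> gspace"
proof -
  have \<phi>D [measurable]: "\<phi> \<in> borel_measurable borel" and BL: "0 \<le> B" "0 \<le> L" "\<And>x. 0 \<le> \<phi> x" "\<And>x. \<phi> x \<le> B"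
    "\<And>x. x \<notin> {0..L} \<Longrightarrow> \<phi> x = 0"
    using \<phi> by (auto simp: test_function_def)
  have \<phi>int: "integrable lborel (\<lambda>x. \<phi> x * c x)" if [measurable]: "c \<in> borel_measurable borel" and "\<And>x. \<bar>c x\<bar> \<le> 1" for c
  proof (rule Bochner_Integration.integrable_bound)
    show "integrable lborel (\<lambda>x. B * indicator {0..L} x :: real)" using BL by simp
    have "\<bar>\<phi> x * c x\<bar> \<le> \<bar>B * indicator {0..L} x\<bar>" for x
    proof (cases "x \<in> {0..L}")
      case True
      have "\<bar>\<phi> x * c x\<bar> \<le> B * 1" unfolding abs_mult using that(2)[of x] BL by (intro mult_mono) auto
      then show ?thesis using True BL by simp
    qed (simp add: BL)
    then show "AE x in lborel. norm (\<phi> x * c x) \<le> norm (B * indicator {0..L} x :: real)" by simp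
  qed measurable
  define g where "g n x = real_of_int \<lfloor>real (Suc n) * x\<rfloor> / real (Suc n)" for n x
  have g_close: "0 \<le> x - g n x" "x - g n x \<le> inverse (real (Suc n))" for n x
  proof -
    have *: "0 \<le> real (Suc n) * x - of_int \<lfloor>real (Suc n) * x\<rfloor>" "real (Suc n) * x - of_int \<lfloor>real (Suc n) * x\<rfloor> \<le> 1"
      by linarith+
    have e: "x - g n x = (real (Suc n) * x - of_int \<lfloor>real (Suc n) * x\<rfloor>) / real (Suc n)"
      by (simp add: g_def diff_divide_distrib)
    show "0 \<le> x - g n x" "x - g n x \<le> inverse (real (Suc n))"
      unfolding e using * by (auto simp: divide_simps)
  qed
  define Z where "Z n \<omega> = (\<integral>x. quot h (g n x) \<omega> * \<phi> x \<partial>lborel)" for n \<omega>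
  have Z_gspace: "Z n \<in> gspace" for n
  proof -
    let ?I = "{0..\<lfloor>real (Suc n) * L\<rfloor>}"
    have "Z n \<omega> = (\<Sum>i\<in>?I. (\<integral>x. \<phi> x * of_bool (\<lfloor>real (Suc n) * x\<rfloor> = i) \<partial>lborel) * quot h (of_int i / real (Suc n)) \<omega>)" for \<omega>
    proof -
      have "quot h (g n x) \<omega> * \<phi> x = (\<Sum>i\<in>?I. quot h (of_int i / real (Suc n)) \<omega> * (\<phi> x * of_bool (\<lfloor>real (Suc n) * x\<rfloor> = i)))" for x
      proof (cases "x \<in> {0..L}")
        case True
        then have "\<lfloor>real (Suc n) * x\<rfloor> \<in> ?I" by (auto intro!: floor_mono mult_left_mono)
        then have "(\<Sum>i\<in>?I. quot h (of_int i / real (Suc n)) \<omega> * (\<phi> x * of_bool (\<lfloor>real (Suc n) * x\<rfloor> = i))) =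
          (\<Sum>i\<in>{\<lfloor>real (Suc n) * x\<rfloor>}. quot h (of_int i / real (Suc n)) \<omega> * (\<phi> x * of_bool (\<lfloor>real (Suc n) * x\<rfloor> = i)))"
          by (intro sum.mono_neutral_right) auto
        then show ?thesis by (simp add: g_def)
      qed (simp add: BL)
      then have "Z n \<omega> = (\<integral>x. (\<Sum>i\<in>?I. quot h (of_int i / real (Suc n)) \<omega> * (\<phi> x * of_bool (\<lfloor>real (Suc n) * x\<rfloor> = i))) \<partial>lborel)"
        by (simp add: Z_def)
      also have "\<dots> = (\<Sum>i\<in>?I. (\<integral>x. quot h (of_int i / real (Suc n)) \<omega> * (\<phi> x * of_bool (\<lfloor>real (Suc n) * x\<rfloor> = i)) \<partial>lborel))"
        by (rule Bochner_Integration.integral_sum) (intro integrable_mult_right \<phi>int, auto)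
      finally show ?thesis by (simp add: mult.commute)
    qed
    then have "Z n = (\<lambda>\<omega>. \<Sum>i\<in>?I. (\<integral>x. \<phi> x * of_bool (\<lfloor>real (Suc n) * x\<rfloor> = i) \<partial>lborel) * quot h (of_int i / real (Suc n)) \<omega>)"
      by (rule ext)
    then show ?thesis by (simp only:) (intro gspace_sum gspace_cmult quot_gspace)
  qed
  let ?K = "\<lambda>n. B\<^sup>2 * (4 * \<sigma>2 (inverse (real (Suc n))) / h\<^sup>2)"
  have err: "(\<integral>\<omega>. (Z n \<omega> - smear h \<phi> \<omega>)\<^sup>2 \<partial>M) \<le> ?K n * (L - 0)\<^sup>2" for n
  proof -
    interpret bounded_field M "\<lambda>x \<omega>. (quot h (g n x) \<omega> - quot h x \<omega>) * \<phi> x" 0 L "?K n"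
    proof
      have q1 [measurable]: "(\<lambda>p. quot h (fst p) (snd p)) \<in> borel_measurable (borel \<Otimes>\<^sub>M M)"
        using quot_measurable by (simp add: case_prod_beta)
      have "(\<lambda>p. (\<lambda>p. quot h (fst p) (snd p)) (g n (fst p), snd p)) \<in> borel_measurable (borel \<Otimes>\<^sub>M M)"
        unfolding g_def by (rule measurable_compose[OF _ q1]) measurable
      then have [measurable]: "(\<lambda>p. quot h (g n (fst p)) (snd p)) \<in> borel_measurable (borel \<Otimes>\<^sub>M M)" by simp
      show "(\<lambda>(x, \<omega>). (quot h (g n x) \<omega> - quot h x \<omega>) * \<phi> x) \<in> borel_measurable (borel \<Otimes>\<^sub>M M)"
        unfolding case_prod_beta by measurable
      show "0 \<le> ?K n" using var_nonneg by simp
      show "(quot h (g n x) \<omega> - quot h x \<omega>) * \<phi> x = 0" if "x \<notin> {0..L}" for x \<omega> using that BL by simp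
      show "(\<integral>\<^sup>+\<omega>. ennreal (((quot h (g n x) \<omega> - quot h x \<omega>) * \<phi> x)\<^sup>2) \<partial>M) \<le> ennreal (?K n)" for x
      proof -
        have i: "integrable M (\<lambda>\<omega>. (quot h (g n x) \<omega> - quot h x \<omega>)\<^sup>2)"
          by (rule square_integrableD(2)[OF square_integrable_diff[OF quot_square_integrable quot_square_integrable]])
        have "(\<integral>\<^sup>+\<omega>. ennreal (((quot h (g n x) \<omega> - quot h x \<omega>) * \<phi> x)\<^sup>2) \<partial>M) = ennreal (\<integral>\<omega>. ((quot h (g n x) \<omega> - quot h x \<omega>) * \<phi> x)\<^sup>2 \<partial>M)"
          using i by (intro nn_integral_eq_integral) (auto simp: power_mult_distrib)
        also have "(\<integral>\<omega>. ((quot h (g n x) \<omega> - quot h x \<omega>) * \<phi> x)\<^sup>2 \<partial>M) = (\<phi> x)\<^sup>2 * (\<integral>\<omega>. (quot h (g n x) \<omega> - quot h x \<omega>)\<^sup>2 \<partial>M)"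
          by (simp add: power_mult_distrib mult.commute)
        also have "\<dots> \<le> B\<^sup>2 * (4 * \<sigma>2 (g n x - x) / h\<^sup>2)"
          using BL quot_diff_second_moment by (intro mult_mono power_mono) auto
        also have "\<dots> \<le> ?K n"
        proof (intro mult_left_mono divide_right_mono)
          have "\<sigma>2 (g n x - x) = \<sigma>2 (x - g n x)"
            using even_var[of "g n x - x"] even_var[of "x - g n x"] by (simp add: abs_minus_commute)
          also have "\<dots> \<le> \<sigma>2 (inverse (real (Suc n)))" using g_close by (rule var_mono)
          finally show "\<sigma>2 (g n x - x) \<le> \<sigma>2 (inverse (real (Suc n)))" .
        qed auto
        finally show ?thesis by (simp add: ennreal_leI)
      qed
    qed
    \<comment> \<open>Splitting the integral of a difference requires both parts to be integrable. A
      continuous path is bounded on the compact set that holds all evaluation points, rounding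
      moving them by at most 1.\<close>
    have "(\<integral>x. (quot h (g n x) \<omega> - quot h x \<omega>) * \<phi> x \<partial>lborel) = Z n \<omega> - smear h \<phi> \<omega>" if \<omega>: "\<omega> \<in> space M" for \<omega>
    proof -
      have [measurable]: "(\<lambda>x. Gp x \<omega>) \<in> borel_measurable borel"
        by (rule borel_measurable_continuous_onI[OF Gp_continuous[OF \<omega>]])
      have "compact ((\<lambda>x. Gp x \<omega>) ` {-1..L+h+1})"
        by (rule compact_continuous_image[OF continuous_on_subset[OF Gp_continuous[OF \<omega>]]]) auto
      then obtain c where c: "\<And>x. x \<in> {-1..L+h+1} \<Longrightarrow> \<bar>Gp x \<omega>\<bar> \<le> c"
        using compact_imp_bounded bounded_iff by (metis imageI real_norm_def)
      have bnd: "integrable lborel (\<lambda>x. quot h (u x) \<omega> * \<phi> x)" if [measurable]: "u \<in> borel_measurable borel"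
        and u: "\<And>x. \<bar>u x - x\<bar> \<le> 1" for u
      proof (rule Bochner_Integration.integrable_bound)
        show "integrable lborel (\<lambda>x. ((c + c) / h) * B * indicator {0..L} x :: real)" using BL by simp
        have "\<bar>quot h (u x) \<omega> * \<phi> x\<bar> \<le> \<bar>((c + c) / h) * B * indicator {0..L} x\<bar>" for x
        proof (cases "x \<in> {0..L}")
          case True
          have "u x \<in> {-1..L+h+1}" "u x + h \<in> {-1..L+h+1}" using u[of x] True h by (auto simp: abs_le_iff)
          then have "\<bar>Gp (u x + h) \<omega> - Gp (u x) \<omega>\<bar> \<le> c + c" using c[of "u x"] c[of "u x + h"] by linarith
          then have "\<bar>quot h (u x) \<omega>\<bar> \<le> (c + c) / h" using h by (simp add: quot_def divide_right_mono)
          then have "\<bar>quot h (u x) \<omega> * \<phi> x\<bar> \<le> (c + c) / h * B" unfolding abs_mult using BL by (intro mult_mono) auto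
          then show ?thesis by (intro order_trans[OF _ abs_ge_self]) (use True in simp)
        qed (simp add: BL)
        then show "AE x in lborel. norm (quot h (u x) \<omega> * \<phi> x) \<le> norm (((c + c) / h) * B * indicator {0..L} x :: real)" by simp
      qed (simp add: quot_def)
      have "inverse (real (Suc n)) \<le> 1" by (simp add: inverse_le_1_iff)
      then have "\<bar>g n x - x\<bar> \<le> 1" for x using g_close[of x n] by linarith
      then have "integrable lborel (\<lambda>x. quot h (g n x) \<omega> * \<phi> x)" by (intro bnd) (auto simp: g_def)
      moreover have "integrable lborel (\<lambda>x. quot h x \<omega> * \<phi> x)" by (rule bnd) auto
      ultimately show ?thesis by (simp add: Z_def smear_def left_diff_distrib)
    qed
    then have "(\<integral>\<omega>. (Z n \<omega> - smear h \<phi> \<omega>)\<^sup>2 \<partial>M) = (\<integral>\<omega>. (\<integral>x. (quot h (g n x) \<omega> - quot h x \<omega>) * \<phi> x \<partial>lborel)\<^sup>2 \<partial>M)"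
      by (intro Bochner_Integration.integral_cong) auto
    also have "\<dots> \<le> ?K n * (L - 0)\<^sup>2" using BL(2) by (rule field_integral_second_moment_le)
    finally show ?thesis .
  qed
  show ?thesis
  proof (rule gspace_L2_limit[OF Z_gspace smear_square_integrable[OF \<phi>]])
    have "isCont \<sigma>2 0" using DERIV_var_0 by (rule DERIV_isCont)
    from isCont_tendsto_compose[OF this LIMSEQ_inverse_real_of_nat]
    have "(\<lambda>n. \<sigma>2 (inverse (real (Suc n)))) \<longlonglongrightarrow> 0" by (simp add: var_zero)
    then have "(\<lambda>n. ?K n * (L - 0)\<^sup>2) \<longlonglongrightarrow> B\<^sup>2 * (4 * 0 / h\<^sup>2) * (L - 0)\<^sup>2"
      using h by (intro tendsto_intros) auto
    then have "(\<lambda>n. ?K n * (L - 0)\<^sup>2) \<longlonglongrightarrow> 0" by simp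
    then show "(\<lambda>n. \<integral>\<omega>. (Z n \<omega> - smear h \<phi> \<omega>)\<^sup>2 \<partial>M) \<longlonglongrightarrow> 0"
      by (rule Lim_null_comparison[rotated]) (use err in \<open>auto intro!: always_eventually\<close>)
  qed simp
qed

text \<open>The convolution of \<phi> with the uniform density on [0, h], that is, the mean of
  \<phi> over [u - h, u]. It plays for \<open>smear h \<phi>\<close> the part that \<phi> plays for
  G'(\<phi>).\<close>

definition avg :: "real \<Rightarrow> (real \<Rightarrow> real) \<Rightarrow> real \<Rightarrow> ennreal" where
  "avg h \<phi> u = (\<integral>\<^sup>+x. ennreal (\<phi> x / h) * indicator {x..x+h} u \<partial>lborel)"

lemma avg_measurable [measurable]:
  assumes [measurable]: "\<phi> \<in> borel_measurable borel"
  shows "avg h \<phi> \<in> borel_measurable borel"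
  unfolding avg_def indicator_def of_bool_def atLeastAtMost_iff by measurable

text \<open>\<open>represents Y \<psi>\<close> says that \<open>Y\<close> behaves in covariances like \<open>G'(\<psi>)\<close>.\<close>

definition represents :: "('a \<Rightarrow> real) \<Rightarrow> (real \<Rightarrow> ennreal) \<Rightarrow> bool" where
  "represents Y \<psi> \<longleftrightarrow> Y \<in> gspace \<and> \<psi> \<in> borel_measurable borel \<and>
     (\<forall>a b. 0 \<le> a \<longrightarrow> a \<le> b \<longrightarrow> 0 \<le> (\<integral>\<omega>. (G b \<omega> - G a \<omega>) * Y \<omega> \<partial>M) \<and>
        ennreal (\<integral>\<omega>. (G b \<omega> - G a \<omega>) * Y \<omega> \<partial>M) = Rho (indicator {a..b}) \<psi>)"

lemma representsD:
  assumes "represents Y \<psi>"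
  shows "Y \<in> gspace" "\<psi> \<in> borel_measurable borel" "square_integrable M Y"
    "0 \<le> a \<Longrightarrow> a \<le> b \<Longrightarrow> 0 \<le> (\<integral>\<omega>. (G b \<omega> - G a \<omega>) * Y \<omega> \<partial>M)"
    "0 \<le> a \<Longrightarrow> a \<le> b \<Longrightarrow> ennreal (\<integral>\<omega>. (G b \<omega> - G a \<omega>) * Y \<omega> \<partial>M) = Rho (indicator {a..b}) \<psi>"
  using assms gspace_square_integrable by (auto simp: represents_def)

lemma represents_increment:
  assumes "0 \<le> c" "c \<le> d" shows "represents (\<lambda>\<omega>. G d \<omega> - G c \<omega>) (indicator {c..d})"
proof -
  have "(\<lambda>\<omega>. G d \<omega> - G c \<omega>) \<in> gspace" using assms by (intro gspace_diff G_in_gspace) auto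
  moreover have "0 \<le> (\<integral>\<omega>. (G b \<omega> - G a \<omega>) * (G d \<omega> - G c \<omega>) \<partial>M) \<and>
        ennreal (\<integral>\<omega>. (G b \<omega> - G a \<omega>) * (G d \<omega> - G c \<omega>) \<partial>M) = Rho (indicator {a..b}) (indicator {c..d})"
    if "0 \<le> a" "a \<le> b" for a b
    using Rho_intervals[OF that(2) assms(2)] that assms by (simp add: increment_covariance)
  ultimately show ?thesis by (simp add: represents_def)
qed

lemma represents_cmult:
  assumes Y: "represents Y \<psi>" and r: "0 \<le> r"
  shows "represents (\<lambda>\<omega>. r * Y \<omega>) (\<lambda>u. ennreal r * \<psi> u)"
proof -
  note [measurable] = representsD(2)[OF Y]
  have e: "(\<integral>\<omega>. (G b \<omega> - G a \<omega>) * (r * Y \<omega>) \<partial>M) = r * (\<integral>\<omega>. (G b \<omega> - G a \<omega>) * Y \<omega> \<partial>M)" for a b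
    by (simp add: mult.left_commute)
  show ?thesis
    unfolding represents_def e
    using representsD(4,5)[OF Y] r gspace_cmult[OF representsD(1)[OF Y]]
    by (auto simp: ennreal_mult Rho_cmult_right)
qed

lemma represents_quot:
  assumes "0 \<le> x" "0 < h"
  shows "represents (quot h x) (\<lambda>u. ennreal (1 / h) * indicator {x..x+h} u)"
proof -
  have "quot h x = (\<lambda>\<omega>. (1 / h) * (G (x + h) \<omega> - G x \<omega>))"
    using assms by (auto simp: quot_def Gp_eq fun_eq_iff)
  then show ?thesis using represents_cmult[OF represents_increment[of x "x + h"], of "1 / h"] assms by simp
qed

lemma quot_covariance:
  assumes Y: "represents Y \<psi>" and "0 \<le> x" "0 < h"
  shows "0 \<le> (\<integral>\<omega>. quot h x \<omega> * Y \<omega> \<partial>M)"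
    "ennreal (\<integral>\<omega>. quot h x \<omega> * Y \<omega> \<partial>M) = Rho (\<lambda>u. ennreal (1 / h) * indicator {x..x+h} u) \<psi>"
proof -
  note [measurable] = representsD(2)[OF Y]
  have e: "(\<integral>\<omega>. quot h x \<omega> * Y \<omega> \<partial>M) = (1 / h) * (\<integral>\<omega>. (G (x + h) \<omega> - G x \<omega>) * Y \<omega> \<partial>M)"
    using assms(2,3) by (simp add: quot_def Gp_eq)
  have n: "0 \<le> (\<integral>\<omega>. (G (x + h) \<omega> - G x \<omega>) * Y \<omega> \<partial>M)"
    using representsD(4)[OF Y, of x "x + h"] assms by simp
  show "0 \<le> (\<integral>\<omega>. quot h x \<omega> * Y \<omega> \<partial>M)" unfolding e using n assms(3) by simp
  have "ennreal (\<integral>\<omega>. quot h x \<omega> * Y \<omega> \<partial>M) = ennreal (1 / h) * Rho (indicator {x..x+h}) \<psi>"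
  proof -
    have "ennreal ((1 / h) * (\<integral>\<omega>. (G (x + h) \<omega> - G x \<omega>) * Y \<omega> \<partial>M)) =
        ennreal (1 / h) * ennreal (\<integral>\<omega>. (G (x + h) \<omega> - G x \<omega>) * Y \<omega> \<partial>M)"
      using n assms by (intro ennreal_mult) auto
    then show ?thesis unfolding e using representsD(5)[OF Y, of x "x + h"] assms by simp
  qed
  then show "ennreal (\<integral>\<omega>. quot h x \<omega> * Y \<omega> \<partial>M) = Rho (\<lambda>u. ennreal (1 / h) * indicator {x..x+h} u) \<psi>"
    by (simp add: Rho_cmult_left)
qed

text \<open>The covariance of each difference quotient is an energy with a uniform density; Tonelli
  moves the integration over x from the variable onto this density.\<close>

lemma smear_covariance:
  assumes \<phi>: "test_function \<phi> B L" and h: "0 < h" and Y: "represents Y \<psi>"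
  shows "0 \<le> (\<integral>\<omega>. smear h \<phi> \<omega> * Y \<omega> \<partial>M)"
    and "ennreal (\<integral>\<omega>. smear h \<phi> \<omega> * Y \<omega> \<partial>M) = Rho (avg h \<phi>) \<psi>"
proof -
  interpret bounded_field M "\<lambda>x \<omega>. quot h x \<omega> * \<phi> x" 0 L "B\<^sup>2 * (\<sigma>2 h / h\<^sup>2)"
    using \<phi> by (rule smear_field)
  have [measurable]: "\<phi> \<in> borel_measurable borel" using \<phi> by (simp add: test_function_def)
  have \<phi>0: "0 \<le> \<phi> x" "x < 0 \<Longrightarrow> \<phi> x = 0" for x using \<phi> by (auto simp: test_function_def)
  note [measurable] = representsD(2)[OF Y]
  have sq: "square_integrable M Y" by (rule representsD(3)[OF Y])
  have e: "(\<integral>\<omega>. smear h \<phi> \<omega> * Y \<omega> \<partial>M) = (\<integral>x. (\<integral>\<omega>. quot h x \<omega> * \<phi> x * Y \<omega> \<partial>M) \<partial>lborel)"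
    using field_integral_mult[OF sq] by (simp add: smear_def)
  have pt: "0 \<le> (\<integral>\<omega>. quot h x \<omega> * \<phi> x * Y \<omega> \<partial>M) \<and>
     ennreal (\<integral>\<omega>. quot h x \<omega> * \<phi> x * Y \<omega> \<partial>M) = (\<integral>\<^sup>+u. ennreal (\<phi> x / h) * indicator {x..x+h} u * pot \<psi> u \<partial>lborel)" for x
  proof (cases "x < 0")
    case True
    then show ?thesis by (simp add: \<phi>0)
  next
    case False
    have "(\<integral>\<omega>. quot h x \<omega> * \<phi> x * Y \<omega> \<partial>M) = \<phi> x * (\<integral>\<omega>. quot h x \<omega> * Y \<omega> \<partial>M)"
    proof -
      have "(\<lambda>\<omega>. quot h x \<omega> * \<phi> x * Y \<omega>) = (\<lambda>\<omega>. \<phi> x * (quot h x \<omega> * Y \<omega>))"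
        by (simp add: fun_eq_iff)
      then show ?thesis by (simp only: integral_mult_right_zero)
    qed
    moreover have "ennreal (\<phi> x) * Rho (\<lambda>u. ennreal (1 / h) * indicator {x..x+h} u) \<psi>
       = (\<integral>\<^sup>+u. ennreal (\<phi> x / h) * indicator {x..x+h} u * pot \<psi> u \<partial>lborel)"
    proof -
      have "ennreal (\<phi> x / h) = ennreal (\<phi> x) * ennreal (1 / h)" using h \<phi>0 by (simp add: ennreal_mult[symmetric])
      then show ?thesis unfolding Rho_def by (subst nn_integral_cmult[symmetric]) (simp_all add: mult.assoc)
    qed
    ultimately show ?thesis
      using quot_covariance[OF Y, of x h] False h \<phi>0 by (simp add: ennreal_mult)
  qed
  show "0 \<le> (\<integral>\<omega>. smear h \<phi> \<omega> * Y \<omega> \<partial>M)" unfolding e using pt by (intro integral_nonneg_AE) auto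
  have "ennreal (\<integral>\<omega>. smear h \<phi> \<omega> * Y \<omega> \<partial>M) = (\<integral>\<^sup>+x. ennreal (\<integral>\<omega>. quot h x \<omega> * \<phi> x * Y \<omega> \<partial>M) \<partial>lborel)"
    unfolding e using pt by (intro nn_integral_eq_integral[symmetric] field_mult_integrable[OF sq]) auto
  also have "\<dots> = (\<integral>\<^sup>+x. (\<integral>\<^sup>+u. ennreal (\<phi> x / h) * indicator {x..x+h} u * pot \<psi> u \<partial>lborel) \<partial>lborel)"
    using pt by simp
  also have "\<dots> = (\<integral>\<^sup>+u. (\<integral>\<^sup>+x. ennreal (\<phi> x / h) * indicator {x..x+h} u * pot \<psi> u \<partial>lborel) \<partial>lborel)"
    unfolding indicator_def of_bool_def atLeastAtMost_iff by (rule lborel_pair.Fubini') measurable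
  also have "\<dots> = Rho (avg h \<phi>) \<psi>"
    unfolding Rho_def avg_def by (intro nn_integral_cong nn_integral_multc)
      (simp add: indicator_def of_bool_def)
  finally show "ennreal (\<integral>\<omega>. smear h \<phi> \<omega> * Y \<omega> \<partial>M) = Rho (avg h \<phi>) \<psi>" .
qed

lemma represents_smear:
  assumes \<phi>: "test_function \<phi> B L" and h: "0 < h"
  shows "represents (smear h \<phi>) (avg h \<phi>)"
proof -
  have [measurable]: "\<phi> \<in> borel_measurable borel" using \<phi> by (simp add: test_function_def)
  have "0 \<le> (\<integral>\<omega>. (G b \<omega> - G a \<omega>) * smear h \<phi> \<omega> \<partial>M) \<and>
        ennreal (\<integral>\<omega>. (G b \<omega> - G a \<omega>) * smear h \<phi> \<omega> \<partial>M) = Rho (indicator {a..b}) (avg h \<phi>)"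
    if "0 \<le> a" "a \<le> b" for a b
    using smear_covariance[OF \<phi> h represents_increment[OF that]]
    by (simp add: mult.commute[of "smear h \<phi> _"] Rho_sym[of "avg h \<phi>"])
  then show ?thesis using smear_gspace[OF \<phi> h] by (simp add: represents_def)
qed

lemma Rho_eq_pair:
  assumes [measurable]: "\<phi> \<in> borel_measurable borel" "\<psi> \<in> borel_measurable borel"
  shows "Rho \<phi> \<psi> = (\<integral>\<^sup>+p. \<phi> (fst p) * (ennreal (rho0 (fst p - snd p)) * \<psi> (snd p)) \<partial>(lborel \<Otimes>\<^sub>M lborel))"
  unfolding Rho_def pot_def
  by (subst lborel.nn_integral_fst[symmetric]) (simp_all add: nn_integral_cmult)

text \<open>Dominated convergence on the plane; the dominating energy of [0, L] is finite by
  \<open>Rho_intervals\<close>. The limit at u = 0 is left open because test functions restricted to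
  the half line may jump there.\<close>

lemma Rho_tendsto:
  assumes [measurable]: "\<And>n. \<phi> n \<in> borel_measurable borel" "\<And>n. \<psi> n \<in> borel_measurable borel"
      "\<phi>' \<in> borel_measurable borel" "\<psi>' \<in> borel_measurable borel"
    and bound: "\<And>n u. \<phi> n u \<le> ennreal B * indicator {0..L} u" "\<And>n u. \<psi> n u \<le> ennreal B * indicator {0..L} u"
    and L: "0 \<le> L"
    and lim: "\<And>u. u \<noteq> 0 \<Longrightarrow> (\<lambda>n. \<phi> n u) \<longlonglongrightarrow> \<phi>' u" "\<And>u. u \<noteq> 0 \<Longrightarrow> (\<lambda>n. \<psi> n u) \<longlonglongrightarrow> \<psi>' u"
  shows "(\<lambda>n. Rho (\<phi> n) (\<psi> n)) \<longlonglongrightarrow> Rho \<phi>' \<psi>'"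
proof -
  let ?w = "\<lambda>p. (ennreal B * indicator {0..L} (fst p)) * (ennreal (rho0 (fst p - snd p)) * (ennreal B * indicator {0..L} (snd p)))"
  have fin: "(\<integral>\<^sup>+p. ?w p \<partial>(lborel \<Otimes>\<^sub>M lborel)) < \<infinity>"
  proof -
    have "(\<integral>\<^sup>+p. ?w p \<partial>(lborel \<Otimes>\<^sub>M lborel)) = Rho (\<lambda>u. ennreal B * indicator {0..L} u) (\<lambda>u. ennreal B * indicator {0..L} u)"
      by (subst Rho_eq_pair) auto
    also have "\<dots> = ennreal B * (ennreal B * Rho (indicator {0..L}) (indicator {0..L}))"
      by (simp add: Rho_cmult_left Rho_cmult_right)
    also have "\<dots> < \<infinity>" using Rho_intervals(2)[OF L L] by (simp add: ennreal_mult_less_top)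
    finally show ?thesis .
  qed
  have AE0: "AE p in lborel \<Otimes>\<^sub>M lborel. fst p \<noteq> (0::real) \<and> snd p \<noteq> (0::real)"
  proof (rule lborel_pair.AE_pair_measure)
    show "{p \<in> space (lborel \<Otimes>\<^sub>M lborel). fst p \<noteq> (0::real) \<and> snd p \<noteq> (0::real)} \<in> sets (lborel \<Otimes>\<^sub>M lborel)"
      by measurable
    show "AE x in lborel. AE y in lborel. fst (x, y) \<noteq> (0::real) \<and> snd (x, y) \<noteq> (0::real)"
      using AE_lborel_singleton[of "0::real"] by eventually_elim (use AE_lborel_singleton[of "0::real"] in auto)
  qed
  have "(\<lambda>n. \<integral>\<^sup>+p. \<phi> n (fst p) * (ennreal (rho0 (fst p - snd p)) * \<psi> n (snd p)) \<partial>(lborel \<Otimes>\<^sub>M lborel))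
      \<longlonglongrightarrow> (\<integral>\<^sup>+p. \<phi>' (fst p) * (ennreal (rho0 (fst p - snd p)) * \<psi>' (snd p)) \<partial>(lborel \<Otimes>\<^sub>M lborel))"
  proof (rule nn_integral_dominated_convergence[where w = ?w])
    show "AE p in lborel \<Otimes>\<^sub>M lborel. \<phi> n (fst p) * (ennreal (rho0 (fst p - snd p)) * \<psi> n (snd p)) \<le> ?w p" for n
      by (intro AE_I2 mult_mono bound order_refl) auto
    show "AE p in lborel \<Otimes>\<^sub>M lborel. (\<lambda>n. \<phi> n (fst p) * (ennreal (rho0 (fst p - snd p)) * \<psi> n (snd p)))
        \<longlonglongrightarrow> \<phi>' (fst p) * (ennreal (rho0 (fst p - snd p)) * \<psi>' (snd p))"
      using AE0
    proof eventually_elim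
      case (elim p)
      have le: "(\<phi>' (fst p) \<le> ennreal B * indicator {0..L} (fst p))" "(\<psi>' (snd p) \<le> ennreal B * indicator {0..L} (snd p))"
        using elim bound by (auto intro!: LIMSEQ_le_const2[OF lim(1)] LIMSEQ_le_const2[OF lim(2)])
      have lt: "\<phi>' (fst p) < top" "\<psi>' (snd p) < top"
        using le by (auto intro: order.strict_trans1 simp: ennreal_mult_less_top indicator_def)
      then show ?case
        using elim by (intro tendsto_mult_ennreal tendsto_const lim) (auto simp: ennreal_mult_eq_top_iff)
    qed
  qed (use fin in measurable)
  then show ?thesis by (simp add: Rho_eq_pair)
qed

lemma avg_eq_integral:
  assumes \<phi>: "test_function \<phi> B L" and h: "0 < h"
  shows "integrable lborel (\<lambda>x. \<phi> x * indicator {u-h..u} x)"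
    and "avg h \<phi> u = ennreal ((\<integral>x. \<phi> x * indicator {u-h..u} x \<partial>lborel) / h)"
proof -
  have [measurable]: "\<phi> \<in> borel_measurable borel" using \<phi> by (simp add: test_function_def)
  have b: "0 \<le> \<phi> x" "\<phi> x \<le> B" "0 \<le> B" for x using \<phi> by (auto simp: test_function_def)
  show i: "integrable lborel (\<lambda>x. \<phi> x * indicator {u-h..u} x)"
  proof (rule Bochner_Integration.integrable_bound)
    show "integrable lborel (\<lambda>x. B * indicator {u-h..u} x :: real)" using h by simp
  qed (use b in \<open>auto simp: indicator_def\<close>)
  have "avg h \<phi> u = (\<integral>\<^sup>+x. ennreal (\<phi> x * indicator {u-h..u} x / h) \<partial>lborel)"
    unfolding avg_def by (intro nn_integral_cong) (auto simp: indicator_def)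
  also have "\<dots> = ennreal ((\<integral>x. \<phi> x * indicator {u-h..u} x \<partial>lborel) / h)"
    using i b h by (subst nn_integral_eq_integral) auto
  finally show "avg h \<phi> u = ennreal ((\<integral>x. \<phi> x * indicator {u-h..u} x \<partial>lborel) / h)" .
qed

lemma avg_le:
  assumes \<phi>: "test_function \<phi> B L" and h: "0 < h" "h \<le> 1"
  shows "avg h \<phi> u \<le> ennreal B * indicator {0..L+1} u"
proof (cases "u \<in> {0..L+1}")
  case True
  have b: "0 \<le> \<phi> x" "\<phi> x \<le> B" "0 \<le> B" for x using \<phi> by (auto simp: test_function_def)
  have "(\<integral>x. \<phi> x * indicator {u-h..u} x \<partial>lborel) \<le> (\<integral>x. B * indicator {u-h..u} x \<partial>lborel)"
  proof (intro integral_mono avg_eq_integral(1)[OF \<phi> h(1)])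
    show "integrable lborel (\<lambda>x. B * indicator {u-h..u} x :: real)" using h by simp
  qed (use b in \<open>auto simp: indicator_def\<close>)
  then have "(\<integral>x. \<phi> x * indicator {u-h..u} x \<partial>lborel) / h \<le> B" using h by (simp add: divide_le_eq)
  then show ?thesis using True by (simp add: avg_eq_integral(2)[OF \<phi> h(1)] ennreal_leI)
next
  case False
  have "\<phi> x * indicator {u-h..u} x = 0" for x
    using False \<phi> h by (cases "x \<in> {0..L}") (auto simp: test_function_def indicator_def)
  then have "(\<integral>x. \<phi> x * indicator {u-h..u} x \<partial>lborel) = 0"
    by (intro integral_eq_zero_AE AE_I2)
  then show ?thesis by (simp add: avg_eq_integral(2)[OF \<phi> h(1)])
qed

text \<open>For u > 0 the window [u - h, u] shrinks to a continuity point; for u < 0 everything is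
  0.\<close>

lemma avg_tendsto:
  assumes \<phi>: "test_function \<phi> B L" and c: "continuous_on {0<..} \<phi>" and u: "u \<noteq> 0"
    and h: "\<And>n. 0 < h n" "h \<longlonglongrightarrow> 0"
  shows "(\<lambda>n. avg (h n) \<phi> u) \<longlonglongrightarrow> ennreal (\<phi> u)"
proof (cases "u < 0")
  case True
  have "\<phi> x * indicator {u-h n..u} x = 0" for x n
    using True \<phi> h(1)[of n] by (cases "x \<in> {0..L}") (auto simp: test_function_def indicator_def)
  then have "(\<integral>x. \<phi> x * indicator {u-h n..u} x \<partial>lborel) = 0" for n
    by (intro integral_eq_zero_AE AE_I2)
  then show ?thesis using True \<phi> by (simp add: avg_eq_integral(2)[OF \<phi> h(1)] test_function_def)
next
  case False
  with u have "0 < u" by simp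
  have "(\<lambda>n. (\<integral>x. \<phi> x * indicator {u-h n..u} x \<partial>lborel) / h n) \<longlonglongrightarrow> \<phi> u"
  proof (rule LIMSEQ_I)
    fix r :: real assume "0 < r"
    have "isCont \<phi> u" using c \<open>0 < u\<close> by (simp add: continuous_on_eq_continuous_at)
    then obtain s where s: "0 < s" "\<And>x. \<bar>x - u\<bar> < s \<Longrightarrow> \<bar>\<phi> x - \<phi> u\<bar> < r / 2"
      using \<open>0 < r\<close> unfolding continuous_at_eps_delta dist_real_def by (metis half_gt_zero)
    obtain N where N: "\<And>n. N \<le> n \<Longrightarrow> h n < s"
      using order_tendstoD(2)[OF h(2) s(1)] by (auto simp: eventually_sequentially)
    show "\<exists>no. \<forall>n\<ge>no. norm ((\<integral>x. \<phi> x * indicator {u-h n..u} x \<partial>lborel) / h n - \<phi> u) < r"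
    proof (intro exI allI impI)
      fix n assume n: "N \<le> n"
      have i: "integrable lborel (\<lambda>x. \<phi> x * indicator {u-h n..u} x)" by (rule avg_eq_integral(1)[OF \<phi> h(1)])
      have ci: "integrable lborel (\<lambda>x. c * indicator {u-h n..u} x :: real)" "(\<integral>x. c * indicator {u-h n..u} x \<partial>lborel) = c * h n" for c
        using h(1)[of n] by auto
      have near: "\<bar>\<phi> x - \<phi> u\<bar> < r / 2" if "x \<in> {u-h n..u}" for x
        using s(2)[of x] N[OF n] that by auto
      have pw: "\<phi> x * indicator {u-h n..u} x \<le> (\<phi> u + r / 2) * indicator {u-h n..u} x"
        "(\<phi> u - r / 2) * indicator {u-h n..u} x \<le> \<phi> x * indicator {u-h n..u} x" for x
      proof -
        show "\<phi> x * indicator {u-h n..u} x \<le> (\<phi> u + r / 2) * indicator {u-h n..u} x"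
        proof (cases "x \<in> {u-h n..u}")
          case True
          then have i1: "indicator {u-h n..u} x = (1::real)" by simp
          show ?thesis unfolding i1 mult_1_right using near[OF True] by linarith
        qed simp
        show "(\<phi> u - r / 2) * indicator {u-h n..u} x \<le> \<phi> x * indicator {u-h n..u} x"
        proof (cases "x \<in> {u-h n..u}")
          case True
          then have i1: "indicator {u-h n..u} x = (1::real)" by simp
          show ?thesis unfolding i1 mult_1_right using near[OF True] by linarith
        qed simp
      qed
      have "(\<integral>x. \<phi> x * indicator {u-h n..u} x \<partial>lborel) \<le> (\<integral>x. (\<phi> u + r / 2) * indicator {u-h n..u} x \<partial>lborel)"
        by (intro integral_mono i ci pw)
      moreover have "(\<integral>x. (\<phi> u - r / 2) * indicator {u-h n..u} x \<partial>lborel) \<le> (\<integral>x. \<phi> x * indicator {u-h n..u} x \<partial>lborel)"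
        by (intro integral_mono i ci pw)
      ultimately have "(\<integral>x. \<phi> x * indicator {u-h n..u} x \<partial>lborel) / h n \<le> \<phi> u + r / 2"
         "\<phi> u - r / 2 \<le> (\<integral>x. \<phi> x * indicator {u-h n..u} x \<partial>lborel) / h n"
        unfolding ci using h(1)[of n] by (simp_all add: divide_le_eq le_divide_eq)
      then show "norm ((\<integral>x. \<phi> x * indicator {u-h n..u} x \<partial>lborel) / h n - \<phi> u) < r"
        using \<open>0 < r\<close> unfolding real_norm_def by linarith
    qed
  qed
  then show ?thesis unfolding avg_eq_integral(2)[OF \<phi> h(1)] by (rule tendsto_ennrealI)
qed

text \<open>The limit does not depend on the two null sequences. Hence the three terms of a squared
  distance cancel in the limit, which is the Cauchy property behind the existence of
  G'(\<phi>).\<close>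

lemma smear_cross_tendsto:
  assumes \<phi>: "test_function \<phi> B L" and c: "continuous_on {0<..} \<phi>"
    and h: "\<And>n. 0 < h n" "\<And>n. h n \<le> 1" "h \<longlonglongrightarrow> 0" and h': "\<And>n. 0 < h' n" "\<And>n. h' n \<le> 1" "h' \<longlonglongrightarrow> 0"
  shows "(\<lambda>n. \<integral>\<omega>. smear (h n) \<phi> \<omega> * smear (h' n) \<phi> \<omega> \<partial>M) \<longlonglongrightarrow> enn2real (Rho (\<lambda>u. ennreal (\<phi> u)) (\<lambda>u. ennreal (\<phi> u)))"
proof -
  have [measurable]: "\<phi> \<in> borel_measurable borel" using \<phi> by (simp add: test_function_def)
  have L: "0 \<le> L" using \<phi> by (simp add: test_function_def)
  have e: "(\<integral>\<omega>. smear (h n) \<phi> \<omega> * smear (h' n) \<phi> \<omega> \<partial>M) = enn2real (Rho (avg (h n) \<phi>) (avg (h' n) \<phi>))" for n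
    using smear_covariance[OF \<phi> h(1)[of n] represents_smear[OF \<phi> h'(1)[of n]]] by (metis enn2real_ennreal)
  have lim: "(\<lambda>n. Rho (avg (h n) \<phi>) (avg (h' n) \<phi>)) \<longlonglongrightarrow> Rho (\<lambda>u. ennreal (\<phi> u)) (\<lambda>u. ennreal (\<phi> u))"
    by (rule Rho_tendsto[where B = B and L = "L + 1"])
       (use L avg_le[OF \<phi> h(1,2)] avg_le[OF \<phi> h'(1,2)] avg_tendsto[OF \<phi> c _ h(1,3)] avg_tendsto[OF \<phi> c _ h'(1,3)] in auto)
  have "Rho (\<lambda>u. ennreal (\<phi> u)) (\<lambda>u. ennreal (\<phi> u)) \<le> ennreal B * (ennreal B * Rho (indicator {0..L}) (indicator {0..L}))"
  proof -
    have "Rho (\<lambda>u. ennreal (\<phi> u)) (\<lambda>u. ennreal (\<phi> u)) \<le> Rho (\<lambda>u. ennreal B * indicator {0..L} u) (\<lambda>u. ennreal B * indicator {0..L} u)"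
      using \<phi> by (intro Rho_mono) (auto simp: test_function_def indicator_def intro: ennreal_leI)
    then show ?thesis by (simp add: Rho_cmult_left Rho_cmult_right)
  qed
  also have "\<dots> < top" using Rho_intervals(2)[OF L L] by (simp add: ennreal_mult_less_top)
  finally have "Rho (\<lambda>u. ennreal (\<phi> u)) (\<lambda>u. ennreal (\<phi> u)) = ennreal (enn2real (Rho (\<lambda>u. ennreal (\<phi> u)) (\<lambda>u. ennreal (\<phi> u))))"
    by simp
  with lim show ?thesis unfolding e by (intro tendsto_enn2real) auto
qed

lemma smear_diff_tendsto:
  assumes \<phi>: "test_function \<phi> B L" and c: "continuous_on {0<..} \<phi>"
    and h: "\<And>n. 0 < h n" "\<And>n. h n \<le> 1" "h \<longlonglongrightarrow> 0" and h': "\<And>n. 0 < h' n" "\<And>n. h' n \<le> 1" "h' \<longlonglongrightarrow> 0"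
  shows "(\<lambda>n. \<integral>\<omega>. (smear (h n) \<phi> \<omega> - smear (h' n) \<phi> \<omega>)\<^sup>2 \<partial>M) \<longlonglongrightarrow> 0"
proof -
  let ?R = "enn2real (Rho (\<lambda>u. ennreal (\<phi> u)) (\<lambda>u. ennreal (\<phi> u)))"
  have "(\<lambda>n. (\<integral>\<omega>. smear (h n) \<phi> \<omega> * smear (h n) \<phi> \<omega> \<partial>M) - 2 * (\<integral>\<omega>. smear (h n) \<phi> \<omega> * smear (h' n) \<phi> \<omega> \<partial>M)
      + (\<integral>\<omega>. smear (h' n) \<phi> \<omega> * smear (h' n) \<phi> \<omega> \<partial>M)) \<longlonglongrightarrow> ?R - 2 * ?R + ?R"
    by (rule tendsto_add[OF tendsto_diff[OF _ tendsto_mult[OF tendsto_const]]])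
       (rule smear_cross_tendsto[OF \<phi> c] h h')+
  then show ?thesis
    unfolding second_moment_diff[OF smear_square_integrable[OF \<phi>] smear_square_integrable[OF \<phi>]]
    by (simp add: power2_eq_square)
qed

end

lemma L2_tendsto_cong:
  assumes "\<forall>\<^sub>F t in F. \<forall>\<omega>\<in>space M. X t \<omega> = X' t \<omega>" and X: "L2_tendsto M X Y F"
  shows "L2_tendsto M X' Y F"
  unfolding L2_tendsto_def
proof (intro conjI)
  show "Y \<in> borel_measurable M" "integrable M (\<lambda>\<omega>. (Y \<omega>)\<^sup>2)" using X by (auto simp: L2_tendsto_def)
  have "\<forall>\<^sub>F t in F. X t \<in> borel_measurable M \<and> integrable M (\<lambda>\<omega>. (X t \<omega>)\<^sup>2)"
    using X by (simp add: L2_tendsto_def)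
  then show "\<forall>\<^sub>F t in F. X' t \<in> borel_measurable M \<and> integrable M (\<lambda>\<omega>. (X' t \<omega>)\<^sup>2)"
    using assms(1)
  proof eventually_elim
    case (elim t)
    have "X' t \<in> borel_measurable M \<longleftrightarrow> X t \<in> borel_measurable M"
      by (rule measurable_cong) (use elim in auto)
    moreover have "integrable M (\<lambda>\<omega>. (X' t \<omega>)\<^sup>2) \<longleftrightarrow> integrable M (\<lambda>\<omega>. (X t \<omega>)\<^sup>2)"
      by (rule Bochner_Integration.integrable_cong) (use elim in auto)
    ultimately show ?case using elim by simp
  qed
  have "((\<lambda>t. \<integral>\<omega>. (X t \<omega> - Y \<omega>)\<^sup>2 \<partial>M) \<longlongrightarrow> 0) F" using X by (simp add: L2_tendsto_def)
  then show "((\<lambda>t. \<integral>\<omega>. (X' t \<omega> - Y \<omega>)\<^sup>2 \<partial>M) \<longlongrightarrow> 0) F"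
  proof (rule Lim_transform_eventually)
    show "\<forall>\<^sub>F t in F. (\<integral>\<omega>. (X t \<omega> - Y \<omega>)\<^sup>2 \<partial>M) = (\<integral>\<omega>. (X' t \<omega> - Y \<omega>)\<^sup>2 \<partial>M)"
      using assms(1) by eventually_elim (auto intro!: Bochner_Integration.integral_cong)
  qed
qed

lemma L2_Lim_L2_tendsto: "L2_tendsto M X Y F \<Longrightarrow> L2_tendsto M X (L2_Lim M X F) F"
  unfolding L2_Lim_def by (rule someI[where P = "\<lambda>Y. L2_tendsto M X Y F"])

context prob_space
begin

lemma L2_tendsto_unique:
  assumes Y: "L2_tendsto M X Y F" and Z: "L2_tendsto M X Z F" and F: "F \<noteq> bot"
  shows "AE \<omega> in M. Y \<omega> = Z \<omega>"
proof -
  have s: "square_integrable M Y" "square_integrable M Z"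
    using Y Z by (auto simp: L2_tendsto_def square_integrable_def)
  have l: "((\<lambda>t. 2 * (\<integral>\<omega>. (X t \<omega> - Y \<omega>)\<^sup>2 \<partial>M) + 2 * (\<integral>\<omega>. (X t \<omega> - Z \<omega>)\<^sup>2 \<partial>M)) \<longlongrightarrow> 2 * 0 + 2 * 0) F"
    using Y Z unfolding L2_tendsto_def by (intro tendsto_add tendsto_mult tendsto_const) auto
  have e: "\<forall>\<^sub>F t in F. (\<integral>\<omega>. (Y \<omega> - Z \<omega>)\<^sup>2 \<partial>M) \<le> 2 * (\<integral>\<omega>. (X t \<omega> - Y \<omega>)\<^sup>2 \<partial>M) + 2 * (\<integral>\<omega>. (X t \<omega> - Z \<omega>)\<^sup>2 \<partial>M)"
  proof -
    have "\<forall>\<^sub>F t in F. X t \<in> borel_measurable M \<and> integrable M (\<lambda>\<omega>. (X t \<omega>)\<^sup>2)"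
      using Y by (simp add: L2_tendsto_def)
    then show ?thesis
    proof eventually_elim
      case (elim t)
      then have "square_integrable M (X t)" by (simp add: square_integrable_def)
      from second_moment_triangle[OF s(1) this s(2)] show ?case
        by (simp add: power2_commute[of "Y _"])
    qed
  qed
  have "(\<integral>\<omega>. (Y \<omega> - Z \<omega>)\<^sup>2 \<partial>M) \<le> 2 * 0 + 2 * 0"
    by (rule tendsto_lowerbound[OF l e F])
  then have z: "(\<integral>\<omega>. (Y \<omega> - Z \<omega>)\<^sup>2 \<partial>M) = 0"
    by (intro antisym) auto
  have i: "integrable M (\<lambda>\<omega>. (Y \<omega> - Z \<omega>)\<^sup>2)" by (rule square_integrableD(2)[OF square_integrable_diff[OF s]])
  have "AE \<omega> in M. (Y \<omega> - Z \<omega>)\<^sup>2 = 0"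
    using z by (subst (asm) integral_nonneg_eq_0_iff_AE[OF i]) auto
  then show ?thesis by eventually_elim simp
qed

end

context smooth_gaussian_process
begin

lemma inverse_at_right_0: "filterlim (\<lambda>n. inverse (real (Suc n))) (at_right 0) sequentially"
  unfolding filterlim_at using LIMSEQ_inverse_real_of_nat by auto

text \<open>Any two null sequences of steps give asymptotically equal smeared variables, so
  convergence along the single sequence 1/(n + 1) forces convergence along the whole filter.\<close>

lemma smear_L2_tendsto:
  assumes \<phi>: "test_function \<phi> B L" and c: "continuous_on {0<..} \<phi>" and Y: "square_integrable M Y"
    and lim: "(\<lambda>n. \<integral>\<omega>. (smear (inverse (real (Suc n))) \<phi> \<omega> - Y \<omega>)\<^sup>2 \<partial>M) \<longlonglongrightarrow> 0"
  shows "L2_tendsto M (\<lambda>h. smear h \<phi>) Y (at_right 0)"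
proof -
  let ?i = "\<lambda>n. inverse (real (Suc n))"
  note sq = smear_square_integrable[OF \<phi>]
  have i1: "?i n \<le> 1" for n by (simp add: inverse_le_1_iff)
  have "((\<lambda>h. \<integral>\<omega>. (smear h \<phi> \<omega> - Y \<omega>)\<^sup>2 \<partial>M) \<longlongrightarrow> 0) (at_right 0)"
  proof -
    \<comment> \<open>Restricting to (0, 1) provides h \<le> 1 for every term of a sequence, as
      \<open>smear_diff_tendsto\<close> demands.\<close>
    have "((\<lambda>h. \<integral>\<omega>. (smear h \<phi> \<omega> - Y \<omega>)\<^sup>2 \<partial>M) \<longlongrightarrow> 0) (at 0 within {0<..<1})"
      unfolding tendsto_at_iff_sequentially comp_def
    proof (intro allI impI)
      fix h :: "nat \<Rightarrow> real"
      assume h: "\<forall>i. h i \<in> {0<..<1} - {0}" "h \<longlonglongrightarrow> 0"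
      have "(\<lambda>n. 2 * (\<integral>\<omega>. (smear (h n) \<phi> \<omega> - smear (?i n) \<phi> \<omega>)\<^sup>2 \<partial>M) + 2 * (\<integral>\<omega>. (smear (?i n) \<phi> \<omega> - Y \<omega>)\<^sup>2 \<partial>M)) \<longlonglongrightarrow> 2 * 0 + 2 * 0"
        by (intro tendsto_add tendsto_mult tendsto_const lim smear_diff_tendsto[OF \<phi> c])
           (use h i1 LIMSEQ_inverse_real_of_nat in \<open>auto simp: less_imp_le\<close>)
      then have "(\<lambda>n. 2 * (\<integral>\<omega>. (smear (h n) \<phi> \<omega> - smear (?i n) \<phi> \<omega>)\<^sup>2 \<partial>M) + 2 * (\<integral>\<omega>. (smear (?i n) \<phi> \<omega> - Y \<omega>)\<^sup>2 \<partial>M)) \<longlonglongrightarrow> 0"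
        by simp
      then show "(\<lambda>n. \<integral>\<omega>. (smear (h n) \<phi> \<omega> - Y \<omega>)\<^sup>2 \<partial>M) \<longlonglongrightarrow> 0"
      proof (rule Lim_null_comparison[rotated])
        show "\<forall>\<^sub>F n in sequentially. norm (\<integral>\<omega>. (smear (h n) \<phi> \<omega> - Y \<omega>)\<^sup>2 \<partial>M)
            \<le> 2 * (\<integral>\<omega>. (smear (h n) \<phi> \<omega> - smear (?i n) \<phi> \<omega>)\<^sup>2 \<partial>M) + 2 * (\<integral>\<omega>. (smear (?i n) \<phi> \<omega> - Y \<omega>)\<^sup>2 \<partial>M)"
          using second_moment_triangle[OF sq sq Y] by (intro always_eventually allI) simp
      qed
    qed
    moreover have "at 0 within {0<..<1} = at_right (0::real)"
      by (rule at_within_nhd[of _ "{-1<..<1}"]) auto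
    ultimately show ?thesis by simp
  qed
  then show ?thesis
    unfolding L2_tendsto_def using sq Y by (auto simp: square_integrable_def)
qed

text \<open>For \<open>quot h x\<close> and for \<open>G'(\<phi>)\<close> the covariance formula extends from increments to all
  variables with a bounded density.\<close>

definition strongly_represents :: "('a \<Rightarrow> real) \<Rightarrow> (real \<Rightarrow> ennreal) \<Rightarrow> bool" where
  "strongly_represents X \<phi> \<longleftrightarrow> represents X \<phi> \<and> (\<exists>B L. 0 \<le> L \<and> (\<forall>u. \<phi> u \<le> ennreal B * indicator {0..L} u)) \<and>
     (\<forall>Z \<psi> B L. represents Z \<psi> \<longrightarrow> 0 \<le> L \<longrightarrow> (\<forall>u. \<psi> u \<le> ennreal B * indicator {0..L} u) \<longrightarrow>
        0 \<le> (\<integral>\<omega>. X \<omega> * Z \<omega> \<partial>M) \<and> ennreal (\<integral>\<omega>. X \<omega> * Z \<omega> \<partial>M) = Rho \<phi> \<psi>)"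

lemma strongly_represents_covariance:
  assumes "strongly_represents X \<phi>" "strongly_represents Z \<psi>"
  shows "0 \<le> (\<integral>\<omega>. X \<omega> * Z \<omega> \<partial>M)" "ennreal (\<integral>\<omega>. X \<omega> * Z \<omega> \<partial>M) = Rho \<phi> \<psi>"
  using assms unfolding strongly_represents_def by blast+

lemma strongly_represents_quot:
  assumes "0 \<le> x" "0 < h"
  shows "strongly_represents (quot h x) (\<lambda>u. ennreal (1 / h) * indicator {x..x+h} u)"
proof -
  have "ennreal (1 / h) * indicator {x..x+h} u \<le> ennreal (1 / h) * indicator {0..x+h} u" for u
    using assms by (intro mult_left_mono) (auto simp: indicator_def)
  moreover have "0 \<le> x + h" using assms by simp
  ultimately show ?thesis
    unfolding strongly_represents_def using represents_quot[OF assms] quot_covariance[OF _ assms] by blast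
qed

lemma strongly_represents_deriv:
  assumes \<phi>: "test_function \<phi> B L" and c: "continuous_on {0<..} \<phi>"
    and Y: "L2_tendsto M (\<lambda>h. smear h \<phi>) Y (at_right 0)"
  shows "strongly_represents Y (\<lambda>u. ennreal (\<phi> u))"
proof -
  let ?i = "\<lambda>n. inverse (real (Suc n))"
  have [measurable]: "\<phi> \<in> borel_measurable borel" using \<phi> by (simp add: test_function_def)
  have L: "0 \<le> L" using \<phi> by (simp add: test_function_def)
  have i0: "0 < ?i n" and i1: "?i n \<le> 1" for n by (simp_all add: inverse_le_1_iff)
  note sq = smear_square_integrable[OF \<phi>]
  have sY: "square_integrable M Y" using Y by (simp add: L2_tendsto_def square_integrable_def)
  have "((\<lambda>h. \<integral>\<omega>. (smear h \<phi> \<omega> - Y \<omega>)\<^sup>2 \<partial>M) \<longlongrightarrow> 0) (at_right 0)" using Y by (simp add: L2_tendsto_def)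
  from filterlim_compose[OF this inverse_at_right_0]
  have lim: "(\<lambda>n. \<integral>\<omega>. (smear (?i n) \<phi> \<omega> - Y \<omega>)\<^sup>2 \<partial>M) \<longlonglongrightarrow> 0" .
  have main: "0 \<le> (\<integral>\<omega>. Y \<omega> * Z \<omega> \<partial>M) \<and> ennreal (\<integral>\<omega>. Y \<omega> * Z \<omega> \<partial>M) = Rho (\<lambda>u. ennreal (\<phi> u)) \<psi>"
    if Z: "represents Z \<psi>" and L': "0 \<le> L'" and b: "\<And>u. \<psi> u \<le> ennreal B' * indicator {0..L'} u" for Z \<psi> B' L'
  proof -
    note [measurable] = representsD(2)[OF Z]
    have sZ: "square_integrable M Z" by (rule representsD(3)[OF Z])
    have l1: "(\<lambda>n. \<integral>\<omega>. smear (?i n) \<phi> \<omega> * Z \<omega> \<partial>M) \<longlonglongrightarrow> (\<integral>\<omega>. Y \<omega> * Z \<omega> \<partial>M)"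
      by (rule expectation_mult_tendsto[OF sq sY sZ sZ lim]) simp
    have pos: "0 \<le> (\<integral>\<omega>. smear (?i n) \<phi> \<omega> * Z \<omega> \<partial>M)" for n by (rule smear_covariance(1)[OF \<phi> i0 Z])
    then have "0 \<le> (\<integral>\<omega>. Y \<omega> * Z \<omega> \<partial>M)" by (intro LIMSEQ_le_const[OF l1]) auto
    \<comment> \<open>The boundedness of \<psi> supplies the dominating function; this is why
      \<open>strongly_represents\<close> quantifies over bounded densities.\<close>
    moreover have "(\<lambda>n. Rho (avg (?i n) \<phi>) \<psi>) \<longlonglongrightarrow> Rho (\<lambda>u. ennreal (\<phi> u)) \<psi>"
    proof (rule Rho_tendsto[where B = "max B B'" and L = "max (L + 1) L'"])
      show "avg (?i n) \<phi> u \<le> ennreal (max B B') * indicator {0..max (L + 1) L'} u" for n u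
        using avg_le[OF \<phi> i0 i1, of n u] by (rule order_trans) (auto simp: indicator_def intro!: mult_mono ennreal_leI)
      show "\<psi> u \<le> ennreal (max B B') * indicator {0..max (L + 1) L'} u" for u
        using b by (rule order_trans) (auto simp: indicator_def intro!: mult_mono ennreal_leI)
      show "(\<lambda>n. avg (?i n) \<phi> u) \<longlonglongrightarrow> ennreal (\<phi> u)" if "u \<noteq> 0" for u
        by (rule avg_tendsto[OF \<phi> c that i0 LIMSEQ_inverse_real_of_nat])
    qed (use L in auto)
    moreover have "(\<lambda>n. Rho (avg (?i n) \<phi>) \<psi>) \<longlonglongrightarrow> ennreal (\<integral>\<omega>. Y \<omega> * Z \<omega> \<partial>M)"
      using tendsto_ennrealI[OF l1] unfolding smear_covariance(2)[OF \<phi> i0 Z] .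
    ultimately show ?thesis using LIMSEQ_unique by blast
  qed
  have "Y \<in> gspace"
    by (rule gspace_L2_limit[OF smear_gspace[OF \<phi> i0] sY lim]) simp
  moreover have "0 \<le> (\<integral>\<omega>. (G b \<omega> - G a \<omega>) * Y \<omega> \<partial>M) \<and>
        ennreal (\<integral>\<omega>. (G b \<omega> - G a \<omega>) * Y \<omega> \<partial>M) = Rho (indicator {a..b}) (\<lambda>u. ennreal (\<phi> u))"
    if "0 \<le> a" "a \<le> b" for a b
    using main[OF represents_increment[OF that], of b 1] that
    by (simp add: mult.commute[of "Y _"] Rho_sym[of "\<lambda>u. ennreal (\<phi> u)"] indicator_def)
  ultimately have "represents Y (\<lambda>u. ennreal (\<phi> u))" by (simp add: represents_def)
  moreover have "ennreal (\<phi> u) \<le> ennreal B * indicator {0..L} u" for u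
    using \<phi> by (auto simp: test_function_def indicator_def intro: ennreal_leI)
  ultimately show ?thesis unfolding strongly_represents_def using main L by blast
qed

lemma gen_deriv_integral_eq_smear:
  assumes [measurable]: "\<phi>0 \<in> borel_measurable borel" and \<omega>: "\<omega> \<in> space M" and h: "0 < h"
  shows "(LINT y:{0..}|lebesgue. (G (y + h) \<omega> - G y \<omega>) / h * \<phi>0 y) = smear h (\<lambda>y. \<phi>0 y * indicator {0..} y) \<omega>"
proof -
  have [measurable]: "(\<lambda>x. Gp x \<omega>) \<in> borel_measurable borel"
    by (rule borel_measurable_continuous_onI[OF Gp_continuous[OF \<omega>]])
  have "(LINT y:{0..}|lebesgue. (G (y + h) \<omega> - G y \<omega>) / h * \<phi>0 y) = (LINT y|lebesgue. quot h y \<omega> * (\<phi>0 y * indicator {0..} y))"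
    unfolding set_lebesgue_integral_def using h
    by (intro Bochner_Integration.integral_cong) (auto simp: indicator_def quot_def Gp_eq)
  also have "\<dots> = (\<integral>y. quot h y \<omega> * (\<phi>0 y * indicator {0..} y) \<partial>lborel)"
    by (rule integral_completion) (simp add: quot_def)
  finally show ?thesis by (simp add: smear_def)
qed

text \<open>Restricting the shifted mollifier to the half line may create a jump at 0, so continuity
  is claimed on {0<..} only.\<close>

definition half_shift :: "(real \<Rightarrow> real) \<Rightarrow> real \<Rightarrow> real \<Rightarrow> real" where
  "half_shift p x y = p (y - x) * indicator {0..} y"

text \<open>Both \<open>gen_deriv\<close> and \<open>measurable_version\<close> are choices, so
  existence has to be exhibited before anything is known about them. The witness is the jointly
  measurable L2 limit of smeared difference quotients.\<close>

lemma smoothed_version: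
  assumes p: "continuous_on UNIV p" "\<And>y. 0 \<le> p y" "\<And>y. e < \<bar>y\<bar> \<Longrightarrow> p y = 0" and e: "0 < e"
  shows "is_measurable_version M (\<lambda>x. gen_deriv M G (\<lambda>y. p (y - x))) (measurable_version M (\<lambda>x. gen_deriv M G (\<lambda>y. p (y - x))))"
    and "\<And>x. 0 \<le> x \<Longrightarrow> strongly_represents (measurable_version M (\<lambda>x. gen_deriv M G (\<lambda>y. p (y - x))) x) (\<lambda>u. ennreal (half_shift p x u))"
proof -
  have [measurable]: "p \<in> borel_measurable borel" by (rule borel_measurable_continuous_onI[OF p(1)])
  have "compact (p ` {-e..e})" by (intro compact_continuous_image continuous_on_subset[OF p(1)]) auto
  then obtain b where b: "\<And>x. x \<in> {-e..e} \<Longrightarrow> \<bar>p x\<bar> \<le> b"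
    using compact_imp_bounded bounded_iff by (metis imageI real_norm_def)
  have b0: "0 \<le> b" using b[of 0] e by auto
  have pb: "p x \<le> b" for x using b[of x] p(3)[of x] b0 by (cases "x \<in> {-e..e}") (auto simp: abs_if split: if_splits)
  have test: "test_function (half_shift p x) b (max 0 (x + e))" for x
  proof -
    have "half_shift p x y = 0" if "y \<notin> {0..max 0 (x + e)}" for y
      using that p(3)[of "y - x"] by (auto simp: half_shift_def)
    then show ?thesis
      using p(2) pb b0 by (auto simp: test_function_def half_shift_def[abs_def] indicator_def)
  qed
  have cont: "continuous_on {0<..} (half_shift p x)" for x
  proof -
    have "continuous_on {0<..} (\<lambda>y. p (y - x))"
      by (rule continuous_on_compose2[OF p(1)]) (auto intro!: continuous_intros)
    then show ?thesis by (rule continuous_on_eq) (auto simp: half_shift_def)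
  qed
  define Z where "Z n x = smear (inverse (real (Suc n))) (half_shift p x)" for n x
  have "\<exists>Y. (\<lambda>(x, \<omega>). Y x \<omega>) \<in> borel_measurable (borel \<Otimes>\<^sub>M M) \<and>
    (\<forall>x. square_integrable M (Y x) \<and> (\<lambda>n. \<integral>\<omega>. (Z n x \<omega> - Y x \<omega>)\<^sup>2 \<partial>M) \<longlonglongrightarrow> 0)"
  proof (rule measurable_L2_limit)
    fix n
    have q: "(\<lambda>q. quot (inverse (real (Suc n))) (snd q) (snd (fst q))) \<in> borel_measurable ((borel \<Otimes>\<^sub>M M) \<Otimes>\<^sub>M borel)"
      using measurable_compose[OF _ quot_measurable[of "inverse (real (Suc n))"], of "\<lambda>q. (snd q, snd (fst q))"] by simp
    have "(\<lambda>q. \<integral>y. quot (inverse (real (Suc n))) y (snd q) * half_shift p (fst q) y \<partial>lborel) \<in> borel_measurable (borel \<Otimes>\<^sub>M M)"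
    proof (rule lborel.borel_measurable_lebesgue_integral)
      show "(\<lambda>(q, y). quot (inverse (real (Suc n))) y (snd q) * half_shift p (fst q) y) \<in> borel_measurable ((borel \<Otimes>\<^sub>M M) \<Otimes>\<^sub>M lborel)"
        unfolding case_prod_beta half_shift_def using q by (intro borel_measurable_times) simp_all
    qed
    then show "(\<lambda>(x, \<omega>). Z n x \<omega>) \<in> borel_measurable (borel \<Otimes>\<^sub>M M)"
      by (simp add: Z_def smear_def case_prod_beta)
  next
    show "square_integrable M (Z n x)" for n x unfolding Z_def by (rule smear_square_integrable[OF test])
    fix x and r :: real assume "0 < r"
    show "\<exists>N. \<forall>p\<ge>N. \<forall>q\<ge>N. (\<integral>\<omega>. (Z p x \<omega> - Z q x \<omega>)\<^sup>2 \<partial>M) \<le> r"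
    \<comment> \<open>A failure of the Cauchy property yields pairs of indices tending to infinity
      at distance more than r; \<open>smear_diff_tendsto\<close> excludes this, as it allows two
      arbitrary null sequences.\<close>
    proof (rule ccontr)
      assume "\<not> ?thesis"
      then have "\<forall>N. \<exists>pq. N \<le> fst pq \<and> N \<le> snd pq \<and> r < (\<integral>\<omega>. (Z (fst pq) x \<omega> - Z (snd pq) x \<omega>)\<^sup>2 \<partial>M)"
        by (auto simp: not_le)
      from choice[OF this] obtain s where s: "\<And>N. N \<le> fst (s N)" "\<And>N. N \<le> snd (s N)"
        "\<And>N. r < (\<integral>\<omega>. (Z (fst (s N)) x \<omega> - Z (snd (s N)) x \<omega>)\<^sup>2 \<partial>M)" by blast
      have fl: "filterlim (\<lambda>N. fst (s N)) sequentially sequentially" "filterlim (\<lambda>N. snd (s N)) sequentially sequentially"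
        using s(1,2) by (auto intro!: filterlim_at_top_mono[OF filterlim_ident] always_eventually)
      have "(\<lambda>N. \<integral>\<omega>. (Z (fst (s N)) x \<omega> - Z (snd (s N)) x \<omega>)\<^sup>2 \<partial>M) \<longlonglongrightarrow> 0"
        unfolding Z_def
        by (rule smear_diff_tendsto[OF test cont])
           (use filterlim_compose[OF LIMSEQ_inverse_real_of_nat fl(1)] filterlim_compose[OF LIMSEQ_inverse_real_of_nat fl(2)]
             in \<open>auto simp: inverse_le_1_iff\<close>)
      then have "r \<le> 0" by (rule LIMSEQ_le_const) (use s(3) in \<open>auto intro: less_imp_le\<close>)
      then show False using \<open>0 < r\<close> by simp
    qed
  qed
  then obtain Y where Y: "(\<lambda>(x, \<omega>). Y x \<omega>) \<in> borel_measurable (borel \<Otimes>\<^sub>M M)" "\<And>x. square_integrable M (Y x)"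
    "\<And>x. (\<lambda>n. \<integral>\<omega>. (Z n x \<omega> - Y x \<omega>)\<^sup>2 \<partial>M) \<longlonglongrightarrow> 0" by blast
  have YL: "L2_tendsto M (\<lambda>h. smear h (half_shift p x)) (Y x) (at_right 0)" for x
    using smear_L2_tendsto[OF test cont Y(2)] Y(3) by (simp add: Z_def)
  let ?X = "\<lambda>x. gen_deriv M G (\<lambda>y. p (y - x))"
  \<comment> \<open>\<open>YL\<close> shows that an L2 limit exists, so the one chosen in
    \<open>gen_deriv\<close> is a limit as well. The integrands agree for h > 0 on the sample space,
    which is all that the congruence needs.\<close>
  have XL: "L2_tendsto M (\<lambda>h. smear h (half_shift p x)) (?X x) (at_right 0)" for x
  proof -
    have eq: "\<forall>\<^sub>F h in at_right 0. \<forall>\<omega>\<in>space M. smear h (half_shift p x) \<omega> =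
        (LINT y:{0..}|lebesgue. (G (y + h) \<omega> - G y \<omega>) / h * p (y - x))"
    proof -
      have "smear h (half_shift p x) \<omega> = (LINT y:{0..}|lebesgue. (G (y + h) \<omega> - G y \<omega>) / h * p (y - x))"
        if "0 < h" "\<omega> \<in> space M" for h \<omega>
        unfolding half_shift_def[abs_def]
        by (rule gen_deriv_integral_eq_smear[symmetric]) (use that in simp_all)
      note sm = this
      show ?thesis
        unfolding eventually_at_right_field
      proof (intro exI[of _ 1] conjI allI impI ballI)
        show "(0::real) < 1" by simp
      qed (rule sm)
    qed
    have "L2_tendsto M (\<lambda>h \<omega>. LINT y:{0..}|lebesgue. (G (y + h) \<omega> - G y \<omega>) / h * p (y - x)) (?X x) (at_right 0)"
      unfolding gen_deriv_def by (rule L2_Lim_L2_tendsto[OF L2_tendsto_cong[OF eq YL]])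
    then show ?thesis
      by (rule L2_tendsto_cong[rotated]) (use eq in \<open>simp add: eq_commute\<close>)
  qed
  have "is_measurable_version M ?X Y"
    unfolding is_measurable_version_def
  proof (intro conjI allI impI)
    show "AE \<omega> in M. Y x \<omega> = ?X x \<omega>" for x by (rule L2_tendsto_unique[OF YL XL]) simp
  qed (rule Y(1))
  then show ver: "is_measurable_version M ?X (measurable_version M ?X)"
    unfolding measurable_version_def by (rule someI[where P = "is_measurable_version M ?X"])
  fix x :: real assume x: "0 \<le> x"
  let ?Z = "measurable_version M ?X x"
  have Zm [measurable]: "?Z \<in> borel_measurable M"
  proof -
    have vm: "(\<lambda>(x, \<omega>). measurable_version M ?X x \<omega>) \<in> borel_measurable (borel \<Otimes>\<^sub>M M)"
      using ver by (simp add: is_measurable_version_def)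
    show ?thesis using measurable_compose[OF measurable_Pair1'[of x borel M] vm] by simp
  qed
  have ae: "AE \<omega> in M. ?X x \<omega> = ?Z \<omega>"
  proof -
    have "AE \<omega> in M. ?Z \<omega> = ?X x \<omega>" using ver x by (simp add: is_measurable_version_def)
    then show ?thesis by eventually_elim simp
  qed
  have [measurable]: "?X x \<in> borel_measurable M" using XL[of x] by (simp add: L2_tendsto_def)
  have sm [measurable]: "smear h (half_shift p x) \<in> borel_measurable M" for h
    by (rule square_integrableD(1)[OF smear_square_integrable[OF test]])
  have "L2_tendsto M (\<lambda>h. smear h (half_shift p x)) ?Z (at_right 0)"
  proof -
    have "integrable M (\<lambda>\<omega>. (?X x \<omega>)\<^sup>2) = integrable M (\<lambda>\<omega>. (?Z \<omega>)\<^sup>2)"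
      by (rule integrable_cong_AE) (use ae in auto)
    moreover have "(\<integral>\<omega>. (smear h (half_shift p x) \<omega> - ?X x \<omega>)\<^sup>2 \<partial>M) = (\<integral>\<omega>. (smear h (half_shift p x) \<omega> - ?Z \<omega>)\<^sup>2 \<partial>M)" for h
      by (rule integral_cong_AE) (use ae in auto)
    ultimately show ?thesis using XL[of x] by (simp add: L2_tendsto_def)
  qed
  then show "strongly_represents ?Z (\<lambda>u. ennreal (half_shift p x u))"
    by (rule strongly_represents_deriv[OF test cont])
qed

end

section \<open>Integrated Wick powers\<close>

lemma ennreal_abs_integral_le:
  fixes f :: "'b \<Rightarrow> real"
  shows "ennreal \<bar>\<integral>x. f x \<partial>N\<bar> \<le> (\<integral>\<^sup>+x. ennreal \<bar>f x\<bar> \<partial>N)"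
proof (cases "integrable N f")
  case True
  then show ?thesis using integral_norm_bound_ennreal[OF True] by simp
qed (simp add: not_integrable_integral_eq)

definition mollifier :: "(real \<Rightarrow> ennreal) \<Rightarrow> real \<Rightarrow> bool" where
  "mollifier P e \<longleftrightarrow> P \<in> borel_measurable borel \<and> (\<integral>\<^sup>+u. P u \<partial>lborel) = 1 \<and> (\<forall>u. e < \<bar>u\<bar> \<longrightarrow> P u = 0)"

definition mollifier_pair :: "(real \<Rightarrow> ennreal) \<Rightarrow> (real \<Rightarrow> ennreal) \<Rightarrow> (real \<times> real) measure" where
  "mollifier_pair P Q = density lborel P \<Otimes>\<^sub>M density lborel Q"

lemma mollifier_prob_space: "mollifier P e \<Longrightarrow> prob_space (density lborel P)"
  by (rule prob_spaceI) (simp add: mollifier_def emeasure_density)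

locale wick_setup = smooth_gaussian_process +
  fixes m \<beta> B :: real and k :: nat
  assumes kernel_assms: "singular_kernel rho0 m \<beta> B k"

sublocale wick_setup \<subseteq> singular_kernel rho0 m \<beta> B k
  by (rule kernel_assms)

context wick_setup
begin

lemma smoother_mollifier_pair:
  assumes P: "mollifier P e" and Q: "mollifier Q e"
  shows "smoother (mollifier_pair P Q) (2 * e)"
proof -
  interpret P: prob_space "density lborel P" using P by (rule mollifier_prob_space)
  interpret Q: prob_space "density lborel Q" using Q by (rule mollifier_prob_space)
  interpret PQ: pair_prob_space "density lborel P" "density lborel Q" by unfold_locales
  have [measurable]: "P \<in> borel_measurable borel" "Q \<in> borel_measurable borel"
    using P Q by (auto simp: mollifier_def)
  have sm: "AE u in density lborel R. \<bar>u\<bar> \<le> e" if "mollifier R e" for R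
  proof -
    have [measurable]: "R \<in> borel_measurable borel" using that by (simp add: mollifier_def)
    show ?thesis using that by (subst AE_density) (auto simp: mollifier_def not_le[symmetric])
  qed
  have "AE p in density lborel P \<Otimes>\<^sub>M density lborel Q. \<bar>fst p - snd p\<bar> \<le> 2 * e"
  proof (rule PQ.AE_pair_measure)
    show "{p \<in> space (density lborel P \<Otimes>\<^sub>M density lborel Q). \<bar>fst p - snd p\<bar> \<le> 2 * e} \<in> sets (density lborel P \<Otimes>\<^sub>M density lborel Q)"
      by measurable
    show "AE x in density lborel P. AE y in density lborel Q. \<bar>fst (x, y) - snd (x, y)\<bar> \<le> 2 * e"
      using sm[OF P]
    proof eventually_elim
      case (elim x)
      show ?case using sm[OF Q] by eventually_elim (use elim in auto)
    qed
  qed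
  moreover have "sets (mollifier_pair P Q) = sets (borel \<Otimes>\<^sub>M borel)"
    unfolding mollifier_pair_def by (rule sets_pair_measure_cong) auto
  ultimately show ?thesis
    using PQ.prob_space_axioms by (simp add: smoother_def mollifier_pair_def)
qed

text \<open>Substituting u \<mapsto> x + u and v \<mapsto> y + v shows that the energy of two
  translated mollifiers depends on x - y only; this brings covariances into the form treated by
  \<open>singular_kernel\<close>.\<close>

lemma kernel_mollifier_pair:
  assumes P: "mollifier P e" and Q: "mollifier Q e"
  shows "kernel (mollifier_pair P Q) (x - y) = Rho (\<lambda>u. P (u - x)) (\<lambda>v. Q (v - y))"
proof -
  have [measurable]: "P \<in> borel_measurable borel" "Q \<in> borel_measurable borel"
    using P Q by (auto simp: mollifier_def)
  interpret Q: prob_space "density lborel Q" using Q by (rule mollifier_prob_space)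
  have "kernel (mollifier_pair P Q) (x - y) =
      (\<integral>\<^sup>+u. (\<integral>\<^sup>+v. ennreal (rho0 (x - y + (u - v))) \<partial>density lborel Q) \<partial>density lborel P)"
    unfolding kernel_def mollifier_pair_def by (subst Q.nn_integral_fst[symmetric]) simp_all
  also have "\<dots> = (\<integral>\<^sup>+u. P u * (\<integral>\<^sup>+v. Q v * ennreal (rho0 (x - y + (u - v))) \<partial>lborel) \<partial>lborel)"
    by (simp add: nn_integral_density)
  also have "\<dots> = (\<integral>\<^sup>+u. P (x + 1 * u - x) * pot (\<lambda>v. Q (v - y)) (x + 1 * u) \<partial>lborel)"
  proof (rule nn_integral_cong)
    fix u
    have "pot (\<lambda>v. Q (v - y)) (x + 1 * u) = (\<integral>\<^sup>+v. ennreal (rho0 (x + u - (y + 1 * v))) * Q (y + 1 * v - y) \<partial>lborel)"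
      unfolding pot_def by (subst nn_integral_real_affine[of _ 1 y]) simp_all
    also have "\<dots> = (\<integral>\<^sup>+v. Q v * ennreal (rho0 (x - y + (u - v))) \<partial>lborel)"
      by (intro nn_integral_cong) (simp add: algebra_simps)
    finally show "P u * (\<integral>\<^sup>+v. Q v * ennreal (rho0 (x - y + (u - v))) \<partial>lborel) = P (x + 1 * u - x) * pot (\<lambda>v. Q (v - y)) (x + 1 * u)"
      by simp
  qed
  also have "\<dots> = Rho (\<lambda>u. P (u - x)) (\<lambda>v. Q (v - y))"
    unfolding Rho_def by (subst (2) nn_integral_real_affine[of _ 1 x]) simp_all
  finally show ?thesis .
qed

text \<open>A field of the form \<open>x \<mapsto> G'(P(\<sqdot> - x))\<close>, where near the boundary \<open>0\<close> of the half line the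
  mollifier may be cut off.\<close>

definition mfield :: "(real \<Rightarrow> 'a \<Rightarrow> real) \<Rightarrow> (real \<Rightarrow> ennreal) \<Rightarrow> real \<Rightarrow> bool" where
  "mfield X P e \<longleftrightarrow> (\<lambda>(x, \<omega>). X x \<omega>) \<in> borel_measurable (borel \<Otimes>\<^sub>M M) \<and> mollifier P e \<and> 0 < e \<and>
     (\<exists>b. \<forall>u. P u \<le> ennreal b) \<and>
     (\<forall>x\<ge>0. \<exists>\<phi>. strongly_represents (X x) \<phi> \<and> (\<forall>u. \<phi> u \<le> P (u - x)) \<and> (e \<le> x \<longrightarrow> \<phi> = (\<lambda>u. P (u - x))))"

lemma mfieldE:
  assumes "mfield X P e" "0 \<le> x"
  obtains \<phi> where "strongly_represents (X x) \<phi>" "\<And>u. \<phi> u \<le> P (u - x)" "e \<le> x \<Longrightarrow> \<phi> = (\<lambda>u. P (u - x))"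
  using assms unfolding mfield_def by blast

lemma mfield_gspace: "mfield X P e \<Longrightarrow> 0 \<le> x \<Longrightarrow> X x \<in> gspace"
  by (erule mfieldE) (auto simp: strongly_represents_def represents_def)

text \<open>The cut-off at 0 only removes mass and \<open>rho0\<close> is nonnegative, so the kernel
  is always an upper bound. It is attained when both points are at distance at least e from
  0.\<close>

lemma mfield_covariance:
  assumes X: "mfield X P e" and Y: "mfield Y Q e" and x: "0 \<le> x" and y: "0 \<le> y"
  shows "0 \<le> (\<integral>\<omega>. X x \<omega> * Y y \<omega> \<partial>M)"
    and "ennreal (\<integral>\<omega>. X x \<omega> * Y y \<omega> \<partial>M) \<le> kernel (mollifier_pair P Q) (x - y)"
    and "e \<le> x \<Longrightarrow> e \<le> y \<Longrightarrow> ennreal (\<integral>\<omega>. X x \<omega> * Y y \<omega> \<partial>M) = kernel (mollifier_pair P Q) (x - y)"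
proof -
  have PQ: "mollifier P e" "mollifier Q e" using X Y by (auto simp: mfield_def)
  obtain \<phi> where \<phi>: "strongly_represents (X x) \<phi>" "\<And>u. \<phi> u \<le> P (u - x)" "e \<le> x \<Longrightarrow> \<phi> = (\<lambda>u. P (u - x))"
    using mfieldE[OF X x] by blast
  obtain \<psi> where \<psi>: "strongly_represents (Y y) \<psi>" "\<And>u. \<psi> u \<le> Q (u - y)" "e \<le> y \<Longrightarrow> \<psi> = (\<lambda>u. Q (u - y))"
    using mfieldE[OF Y y] by blast
  note c = strongly_represents_covariance[OF \<phi>(1) \<psi>(1)]
  show "0 \<le> (\<integral>\<omega>. X x \<omega> * Y y \<omega> \<partial>M)" by (rule c(1))
  show "ennreal (\<integral>\<omega>. X x \<omega> * Y y \<omega> \<partial>M) \<le> kernel (mollifier_pair P Q) (x - y)"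
    unfolding c(2) kernel_mollifier_pair[OF PQ] using \<phi>(2) \<psi>(2) by (rule Rho_mono)
  show "e \<le> x \<Longrightarrow> e \<le> y \<Longrightarrow> ennreal (\<integral>\<omega>. X x \<omega> * Y y \<omega> \<partial>M) = kernel (mollifier_pair P Q) (x - y)"
    unfolding c(2) kernel_mollifier_pair[OF PQ] using \<phi>(3) \<psi>(3) by simp
qed

text \<open>The density is bounded and lives on an interval of length at most 2 e, so its energy is
  at most a constant times \<open>\<sigma>2 (2 * e)\<close>, uniformly in x.\<close>

lemma mfield_second_moment:
  assumes X: "mfield X P e"
  shows "\<exists>V\<ge>0. \<forall>x\<ge>0. (\<integral>\<omega>. (X x \<omega>)\<^sup>2 \<partial>M) \<le> V"
proof -
  obtain b where b: "\<And>u. P u \<le> ennreal b" using X by (auto simp: mfield_def)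
  have P: "mollifier P e" "0 < e" using X by (auto simp: mfield_def)
  have "(\<integral>\<omega>. (X x \<omega>)\<^sup>2 \<partial>M) \<le> (max 0 b)\<^sup>2 * \<sigma>2 (2 * e)" if x: "0 \<le> x" for x
  proof -
    obtain \<phi> where \<phi>: "strongly_represents (X x) \<phi>" "\<And>u. \<phi> u \<le> P (u - x)"
      using mfieldE[OF X x] by blast
    obtain B' L where L: "\<And>u. \<phi> u \<le> ennreal B' * indicator {0..L} u"
      using \<phi>(1) by (auto simp: strongly_represents_def)
    let ?a = "max 0 (x - e)" and ?b = "x + e"
    have ab: "?a \<le> ?b" "0 \<le> ?b - ?a" "?b - ?a \<le> 2 * e" using x P(2) by auto
    have le: "\<phi> u \<le> ennreal (max 0 b) * indicator {?a..?b} u" for u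
    proof (cases "u \<in> {?a..?b}")
      case True
      have "\<phi> u \<le> ennreal b" using \<phi>(2) b by (rule order_trans)
      also have "\<dots> \<le> ennreal (max 0 b)" by (intro ennreal_leI) simp
      finally show ?thesis using True by simp
    next
      case False
      \<comment> \<open>Below 0 the mollifier itself need not vanish, but the density does, as
        \<open>strongly_represents\<close> confines it to some {0..L}.\<close>
      then consider "u < 0" | "e < \<bar>u - x\<bar>" by (auto simp: abs_if)
      then have "\<phi> u = 0"
      proof cases
        case 1 then show ?thesis using L[of u] by simp
      next
        case 2 then show ?thesis using \<phi>(2)[of u] P by (simp add: mollifier_def)
      qed
      then show ?thesis by simp
    qed
    have "ennreal (\<integral>\<omega>. (X x \<omega>)\<^sup>2 \<partial>M) = Rho \<phi> \<phi>"
      using strongly_represents_covariance(2)[OF \<phi>(1) \<phi>(1)] by (simp add: power2_eq_square)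
    also have "\<dots> \<le> Rho (\<lambda>u. ennreal (max 0 b) * indicator {?a..?b} u) (\<lambda>u. ennreal (max 0 b) * indicator {?a..?b} u)"
      by (intro Rho_mono le)
    also have "\<dots> = ennreal (max 0 b) * (ennreal (max 0 b) * Rho (indicator {?a..?b}) (indicator {?a..?b}))"
      by (simp add: Rho_cmult_left Rho_cmult_right)
    also have "Rho (indicator {?a..?b}) (indicator {?a..?b}) = ennreal (\<sigma>2 (?b - ?a))"
      using Rho_intervals(2)[OF ab(1) ab(1)] even_var[of "?a - ?b"] even_var[of "?b - ?a"] 
      by (simp add: var_zero abs_minus_commute)
    also have "ennreal (max 0 b) * (ennreal (max 0 b) * ennreal (\<sigma>2 (?b - ?a))) = ennreal ((max 0 b)\<^sup>2 * \<sigma>2 (?b - ?a))"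
      using var_nonneg by (simp add: ennreal_mult power2_eq_square mult.assoc)
    also have "\<dots> \<le> ennreal ((max 0 b)\<^sup>2 * \<sigma>2 (2 * e))"
      using var_mono[OF ab(2,3)] by (intro ennreal_leI mult_left_mono) auto
    finally show ?thesis using var_nonneg by simp
  qed
  moreover have "0 \<le> (max 0 b)\<^sup>2 * \<sigma>2 (2 * e)" using var_nonneg by simp
  ultimately show ?thesis by blast
qed

lemma wick_square_integrable:
  assumes "X \<in> gspace" shows "square_integrable M (wick_power M j X)"
proof -
  interpret gaussian_pair M X X using gspace_pair[OF assms assms] .
  have [measurable]: "X \<in> borel_measurable M" by (rule square_integrableD(1)[OF gspace_square_integrable[OF assms]])
  have "wick_power M j X \<in> borel_measurable M" unfolding wick_power_def[abs_def] by measurable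
  moreover have "integrable M (\<lambda>\<omega>. (wick_power M j X \<omega>)\<^sup>2)"
    unfolding wick_power_eq_hermite[OF gaussian_X] power2_eq_square by (rule integrable_poly_mult_poly)
  ultimately show ?thesis by (simp add: square_integrable_def)
qed

lemma wick_measurable:
  assumes X [measurable]: "(\<lambda>(x, \<omega>). X x \<omega>) \<in> borel_measurable (borel \<Otimes>\<^sub>M M)"
  shows "(\<lambda>(x, \<omega>). wick_power M j (X x) \<omega>) \<in> borel_measurable (borel \<Otimes>\<^sub>M M)"
proof -
  have [measurable]: "(\<lambda>x. \<integral>\<omega>. X x \<omega> ^ n \<partial>M) \<in> borel_measurable borel" for n by measurable
  have [measurable]: "(\<lambda>p. X (fst p) (snd p)) \<in> borel_measurable (borel \<Otimes>\<^sub>M M)"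
    using X by (simp add: case_prod_beta)
  show ?thesis unfolding wick_power_def case_prod_beta by measurable
qed

section \<open>Weighted integrals of Wick powers\<close>

definition weight :: "(real \<Rightarrow> real) \<Rightarrow> real \<Rightarrow> real \<Rightarrow> real \<Rightarrow> bool" where
  "weight g b a l \<longleftrightarrow> g \<in> borel_measurable borel \<and> (\<forall>x. \<bar>g x\<bar> \<le> b) \<and> (\<forall>x. x \<notin> {a..a+l} \<longrightarrow> g x = 0) \<and> 0 \<le> a \<and> 0 \<le> l \<and> 0 \<le> b"

definition wick_integral :: "(real \<Rightarrow> 'a \<Rightarrow> real) \<Rightarrow> (real \<Rightarrow> real) \<Rightarrow> 'a \<Rightarrow> real" where
  "wick_integral X g \<omega> = (\<integral>x. wick_power M k (X x) \<omega> * g x \<partial>lborel)"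

lemma wick_field:
  assumes X: "mfield X P e" and g: "weight g b a l"
  obtains K where "bounded_field M (\<lambda>x \<omega>. wick_power M k (X x) \<omega> * g x) a (a + l) K"
proof -
  obtain V where V: "0 \<le> V" "\<And>x. 0 \<le> x \<Longrightarrow> (\<integral>\<omega>. (X x \<omega>)\<^sup>2 \<partial>M) \<le> V"
    using mfield_second_moment[OF X] by blast
  have [measurable]: "g \<in> borel_measurable borel" using g by (simp add: weight_def)
  have "(\<lambda>(x, \<omega>). wick_power M k (X x) \<omega>) \<in> borel_measurable (borel \<Otimes>\<^sub>M M)"
    using X by (intro wick_measurable) (simp add: mfield_def)
  then have [measurable]: "(\<lambda>p. wick_power M k (X (fst p)) (snd p)) \<in> borel_measurable (borel \<Otimes>\<^sub>M M)"
    by (simp add: case_prod_beta)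
  have "bounded_field M (\<lambda>x \<omega>. wick_power M k (X x) \<omega> * g x) a (a + l) (fact k * V ^ k * b\<^sup>2)"
  proof
    show "(\<lambda>(x, \<omega>). wick_power M k (X x) \<omega> * g x) \<in> borel_measurable (borel \<Otimes>\<^sub>M M)"
      unfolding case_prod_beta by measurable
    show "wick_power M k (X x) \<omega> * g x = 0" if "x \<notin> {a..a+l}" for x \<omega> using that g by (simp add: weight_def)
    show "0 \<le> fact k * V ^ k * b\<^sup>2" using V by simp
    show "(\<integral>\<^sup>+\<omega>. ennreal ((wick_power M k (X x) \<omega> * g x)\<^sup>2) \<partial>M) \<le> ennreal (fact k * V ^ k * b\<^sup>2)" for x
    proof (cases "x \<in> {a..a+l}")
      case True
      then have x: "0 \<le> x" using g by (simp add: weight_def)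
      note gs = mfield_gspace[OF X x]
      have i: "integrable M (\<lambda>\<omega>. (wick_power M k (X x) \<omega>)\<^sup>2)"
        by (rule square_integrableD(2)[OF wick_square_integrable[OF gs]])
      have "(\<integral>\<^sup>+\<omega>. ennreal ((wick_power M k (X x) \<omega> * g x)\<^sup>2) \<partial>M) = ennreal (\<integral>\<omega>. (wick_power M k (X x) \<omega> * g x)\<^sup>2 \<partial>M)"
        using i by (intro nn_integral_eq_integral) (auto simp: power_mult_distrib)
      also have "(\<integral>\<omega>. (wick_power M k (X x) \<omega> * g x)\<^sup>2 \<partial>M) = fact k * (\<integral>\<omega>. (X x \<omega>)\<^sup>2 \<partial>M) ^ k * (g x)\<^sup>2"
      proof -
        have "(\<integral>\<omega>. (wick_power M k (X x) \<omega> * g x)\<^sup>2 \<partial>M) = (\<integral>\<omega>. (g x)\<^sup>2 * (wick_power M k (X x) \<omega> * wick_power M k (X x) \<omega>) \<partial>M)"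
          by (rule Bochner_Integration.integral_cong[OF refl]) (simp add: power2_eq_square mult_ac)
        also have "\<dots> = (g x)\<^sup>2 * (fact k * (\<integral>\<omega>. X x \<omega> * X x \<omega> \<partial>M) ^ k)"
          by (simp add: gspace_wick_expectation[OF gs gs])
        finally show ?thesis by (simp add: power2_eq_square)
      qed
      also have "\<dots> \<le> fact k * V ^ k * b\<^sup>2"
      proof (rule mult_mono)
        show "fact k * (\<integral>\<omega>. (X x \<omega>)\<^sup>2 \<partial>M) ^ k \<le> fact k * V ^ k"
          using V(2)[OF x] by (intro mult_left_mono power_mono) auto
        show "(g x)\<^sup>2 \<le> b\<^sup>2" using g by (intro abs_le_square_iff[THEN iffD1]) (auto simp: weight_def)
      qed (use V in auto)
      finally show ?thesis by (simp add: ennreal_leI)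
    next
      case False
      then have "g x = 0" using g by (simp add: weight_def)
      then show ?thesis by simp
    qed
  qed
  then show thesis by (rule that)
qed

lemma wick_integral_square_integrable:
  assumes X: "mfield X P e" and g: "weight g b a l"
  shows "square_integrable M (wick_integral X g)"
proof -
  obtain K where "bounded_field M (\<lambda>x \<omega>. wick_power M k (X x) \<omega> * g x) a (a + l) K"
    by (rule wick_field[OF assms])
  from bounded_field.field_integral_square_integrable[OF this] show ?thesis
    by (simp add: wick_integral_def[abs_def])
qed

lemma covariance_measurable:
  assumes U: "(\<lambda>(x, \<omega>). U x \<omega>) \<in> borel_measurable (borel \<Otimes>\<^sub>M M)" and V: "(\<lambda>(x, \<omega>). V x \<omega>) \<in> borel_measurable (borel \<Otimes>\<^sub>M M)"
  shows "(\<lambda>q. \<integral>\<omega>. (U (fst q) \<omega> :: real) * V (snd q) \<omega> \<partial>M) \<in> borel_measurable (borel \<Otimes>\<^sub>M borel)"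
proof (rule borel_measurable_lebesgue_integral)
  have "(\<lambda>r. U (fst (fst r)) (snd r)) \<in> borel_measurable ((borel \<Otimes>\<^sub>M borel) \<Otimes>\<^sub>M M)"
  proof -
    have "(\<lambda>r. (fst (fst r), snd r)) \<in> (borel \<Otimes>\<^sub>M borel) \<Otimes>\<^sub>M M \<rightarrow>\<^sub>M borel \<Otimes>\<^sub>M M" by measurable
    from measurable_compose[OF this U] show ?thesis by simp
  qed
  moreover have "(\<lambda>r. V (snd (fst r)) (snd r)) \<in> borel_measurable ((borel \<Otimes>\<^sub>M borel) \<Otimes>\<^sub>M M)"
  proof -
    have "(\<lambda>r. (snd (fst r), snd r)) \<in> (borel \<Otimes>\<^sub>M borel) \<Otimes>\<^sub>M M \<rightarrow>\<^sub>M borel \<Otimes>\<^sub>M M" by measurable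
    from measurable_compose[OF this V] show ?thesis by simp
  qed
  ultimately show "(\<lambda>(q, \<omega>). U (fst q) \<omega> * V (snd q) \<omega>) \<in> borel_measurable ((borel \<Otimes>\<^sub>M borel) \<Otimes>\<^sub>M M)"
    unfolding case_prod_beta by (rule borel_measurable_times)
qed

text \<open>The squared integral becomes a double integral of expected products. Each of the four
  products of Wick powers has expectation k! times the k-th power of a covariance, and the weights
  contribute at most b each.\<close>

lemma wick_integral_diff:
  assumes X: "mfield X P e" and Y: "mfield Y Q e'" and g: "weight g b a l"
  shows "ennreal (\<integral>\<omega>. (wick_integral X g \<omega> - wick_integral Y g \<omega>)\<^sup>2 \<partial>M) \<le> ennreal (fact k * b\<^sup>2) *
    (\<integral>\<^sup>+x. (\<integral>\<^sup>+y. ennreal \<bar>(\<integral>\<omega>. X x \<omega> * X y \<omega> \<partial>M) ^ k - (\<integral>\<omega>. X x \<omega> * Y y \<omega> \<partial>M) ^ k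
        - (\<integral>\<omega>. Y x \<omega> * X y \<omega> \<partial>M) ^ k + (\<integral>\<omega>. Y x \<omega> * Y y \<omega> \<partial>M) ^ k\<bar> * indicator {a..a+l} y \<partial>lborel) * indicator {a..a+l} x \<partial>lborel)"
    (is "_ \<le> _ * (\<integral>\<^sup>+x. (\<integral>\<^sup>+y. ennreal \<bar>?S x y\<bar> * _ \<partial>lborel) * _ \<partial>lborel)")
proof -
  obtain K1 where K1: "bounded_field M (\<lambda>x \<omega>. wick_power M k (X x) \<omega> * g x) a (a + l) K1" by (rule wick_field[OF X g])
  obtain K2 where K2: "bounded_field M (\<lambda>x \<omega>. wick_power M k (Y x) \<omega> * g x) a (a + l) K2" by (rule wick_field[OF Y g])
  interpret F1: bounded_field M "\<lambda>x \<omega>. wick_power M k (X x) \<omega> * g x" a "a + l" K1 by (rule K1)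
  interpret F2: bounded_field M "\<lambda>x \<omega>. wick_power M k (Y x) \<omega> * g x" a "a + l" K2 by (rule K2)
  let ?F = "\<lambda>x \<omega>. wick_power M k (X x) \<omega> * g x - wick_power M k (Y x) \<omega> * g x"
  interpret F: bounded_field M ?F a "a + l" "2 * K1 + 2 * K2"
  proof
    have "(\<lambda>p. (\<lambda>(x, \<omega>). wick_power M k (X x) \<omega> * g x) p - (\<lambda>(x, \<omega>). wick_power M k (Y x) \<omega> * g x) p) \<in> borel_measurable (borel \<Otimes>\<^sub>M M)"
      by (intro borel_measurable_diff F1.F_meas F2.F_meas)
    then show "(\<lambda>(x, \<omega>). ?F x \<omega>) \<in> borel_measurable (borel \<Otimes>\<^sub>M M)" by (simp add: case_prod_beta)
    show "?F x \<omega> = 0" if "x \<notin> {a..a+l}" for x \<omega> using that g by (simp add: weight_def)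
    show "0 \<le> 2 * K1 + 2 * K2" using F1.K_nonneg F2.K_nonneg by simp
    show "(\<integral>\<^sup>+\<omega>. ennreal ((?F x \<omega>)\<^sup>2) \<partial>M) \<le> ennreal (2 * K1 + 2 * K2)" for x
    proof -
      have "integrable M (\<lambda>\<omega>. (?F x \<omega>)\<^sup>2)" by (rule square_integrableD(2)[OF square_integrable_diff[OF F1.F_sq F2.F_sq]])
      then have "(\<integral>\<^sup>+\<omega>. ennreal ((?F x \<omega>)\<^sup>2) \<partial>M) = ennreal (\<integral>\<omega>. (?F x \<omega>)\<^sup>2 \<partial>M)"
        by (intro nn_integral_eq_integral) auto
      also have "(\<integral>\<omega>. (?F x \<omega>)\<^sup>2 \<partial>M) \<le> 2 * K1 + 2 * K2"
        using second_moment_triangle[OF F1.F_sq[of x] square_integrable_zero F2.F_sq[of x]]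
          F1.F_second_moment[of x] F2.F_second_moment[of x] by simp
      finally show ?thesis by (simp add: ennreal_leI)
    qed
  qed
  have one: "square_integrable M (\<lambda>_. 1)" by (simp add: square_integrable_def)
  \<comment> \<open>The difference of the integrals is the integral of the difference only where
    both exist, hence almost surely.\<close>
  have ae: "AE \<omega> in M. (\<integral>x. ?F x \<omega> \<partial>lborel) = wick_integral X g \<omega> - wick_integral Y g \<omega>"
  proof -
    have "AE \<omega> in M. integrable lborel (\<lambda>x. wick_power M k (X x) \<omega> * g x)"
      using F1.AE_integrable_snd[of "\<lambda>x \<omega>. wick_power M k (X x) \<omega> * g x"] F1.field_mult_integrable_pair[OF one] by simp
    moreover have "AE \<omega> in M. integrable lborel (\<lambda>x. wick_power M k (Y x) \<omega> * g x)"
      using F1.AE_integrable_snd[of "\<lambda>x \<omega>. wick_power M k (Y x) \<omega> * g x"] F2.field_mult_integrable_pair[OF one] by simp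
    ultimately show ?thesis by eventually_elim (simp add: wick_integral_def)
  qed
  have "(\<integral>\<omega>. (wick_integral X g \<omega> - wick_integral Y g \<omega>)\<^sup>2 \<partial>M) = (\<integral>\<omega>. (\<integral>x. ?F x \<omega> \<partial>lborel)\<^sup>2 \<partial>M)"
  proof (rule integral_cong_AE)
    have [measurable]: "wick_integral X g \<in> borel_measurable M" "wick_integral Y g \<in> borel_measurable M"
      using square_integrableD(1)[OF wick_integral_square_integrable[OF X g]] square_integrableD(1)[OF wick_integral_square_integrable[OF Y g]] by auto
    show "(\<lambda>\<omega>. (wick_integral X g \<omega> - wick_integral Y g \<omega>)\<^sup>2) \<in> borel_measurable M" by measurable
    show "(\<lambda>\<omega>. (\<integral>x. ?F x \<omega> \<partial>lborel)\<^sup>2) \<in> borel_measurable M" by (intro borel_measurable_power F.field_integral_measurable)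
    show "AE \<omega> in M. (wick_integral X g \<omega> - wick_integral Y g \<omega>)\<^sup>2 = (\<integral>x. ?F x \<omega> \<partial>lborel)\<^sup>2"
      using ae by eventually_elim simp
  qed
  also have "\<dots> = (\<integral>x. (\<integral>y. (\<integral>\<omega>. ?F x \<omega> * ?F y \<omega> \<partial>M) \<partial>lborel) \<partial>lborel)" by (rule F.field_integral_second_moment)
  finally have eq: "(\<integral>\<omega>. (wick_integral X g \<omega> - wick_integral Y g \<omega>)\<^sup>2 \<partial>M) = (\<integral>x. (\<integral>y. (\<integral>\<omega>. ?F x \<omega> * ?F y \<omega> \<partial>M) \<partial>lborel) \<partial>lborel)" .
  have "ennreal (\<integral>\<omega>. (wick_integral X g \<omega> - wick_integral Y g \<omega>)\<^sup>2 \<partial>M)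
      \<le> ennreal \<bar>\<integral>x. (\<integral>y. (\<integral>\<omega>. ?F x \<omega> * ?F y \<omega> \<partial>M) \<partial>lborel) \<partial>lborel\<bar>"
    unfolding eq by (intro ennreal_leI abs_ge_self)
  also have "\<dots> \<le> (\<integral>\<^sup>+x. ennreal \<bar>\<integral>y. (\<integral>\<omega>. ?F x \<omega> * ?F y \<omega> \<partial>M) \<partial>lborel\<bar> \<partial>lborel)" by (rule ennreal_abs_integral_le)
  also have "\<dots> \<le> (\<integral>\<^sup>+x. (\<integral>\<^sup>+y. ennreal \<bar>\<integral>\<omega>. ?F x \<omega> * ?F y \<omega> \<partial>M\<bar> \<partial>lborel) \<partial>lborel)"
    by (intro nn_integral_mono ennreal_abs_integral_le)
  also have "\<dots> \<le> (\<integral>\<^sup>+x. (\<integral>\<^sup>+y. ennreal (fact k * b\<^sup>2) * (ennreal \<bar>?S x y\<bar> * indicator {a..a+l} y * indicator {a..a+l} x) \<partial>lborel) \<partial>lborel)"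
  proof (intro nn_integral_mono)
    fix x y
    show "ennreal \<bar>\<integral>\<omega>. ?F x \<omega> * ?F y \<omega> \<partial>M\<bar> \<le> ennreal (fact k * b\<^sup>2) * (ennreal \<bar>?S x y\<bar> * indicator {a..a+l} y * indicator {a..a+l} x)"
    proof (cases "x \<in> {a..a+l} \<and> y \<in> {a..a+l}")
      case False
      then have "g x * g y = 0" using g by (auto simp: weight_def)
      then consider "g x = 0" | "g y = 0" by auto
      then show ?thesis by cases simp_all
    next
      case True
      then have xy: "0 \<le> x" "0 \<le> y" using g by (auto simp: weight_def)
      note Xx = mfield_gspace[OF X xy(1)] and Xy = mfield_gspace[OF X xy(2)]
        and Yx = mfield_gspace[OF Y xy(1)] and Yy = mfield_gspace[OF Y xy(2)]
      note w = wick_square_integrable[where j = k]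
      have i: "integrable M (\<lambda>\<omega>. wick_power M k U \<omega> * wick_power M k V \<omega>)" if "U \<in> gspace" "V \<in> gspace" for U V
        by (rule square_integrable_mult[OF w[OF that(1)] w[OF that(2)]])
      have "(\<integral>\<omega>. ?F x \<omega> * ?F y \<omega> \<partial>M) = (\<integral>\<omega>. g x * g y * (wick_power M k (X x) \<omega> * wick_power M k (X y) \<omega> -
          wick_power M k (X x) \<omega> * wick_power M k (Y y) \<omega> - wick_power M k (Y x) \<omega> * wick_power M k (X y) \<omega> +
          wick_power M k (Y x) \<omega> * wick_power M k (Y y) \<omega>) \<partial>M)"
        by (rule Bochner_Integration.integral_cong[OF refl]) (simp add: algebra_simps)
      also have "\<dots> = g x * g y * (fact k * ?S x y)"
        unfolding integral_mult_right_zero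
        using i[OF Xx Xy] i[OF Xx Yy] i[OF Yx Xy] i[OF Yx Yy]
        by (simp add: gspace_wick_expectation[OF Xx Xy] gspace_wick_expectation[OF Xx Yy]
            gspace_wick_expectation[OF Yx Xy] gspace_wick_expectation[OF Yx Yy] right_diff_distrib distrib_left)
      finally have e: "\<bar>\<integral>\<omega>. ?F x \<omega> * ?F y \<omega> \<partial>M\<bar> = \<bar>g x\<bar> * \<bar>g y\<bar> * (fact k * \<bar>?S x y\<bar>)"
        by (simp add: abs_mult)
      have "\<bar>g x\<bar> * \<bar>g y\<bar> * (fact k * \<bar>?S x y\<bar>) \<le> b * b * (fact k * \<bar>?S x y\<bar>)"
        using g by (intro mult_right_mono mult_mono) (auto simp: weight_def)
      then have "ennreal \<bar>\<integral>\<omega>. ?F x \<omega> * ?F y \<omega> \<partial>M\<bar> \<le> ennreal (fact k * b\<^sup>2 * \<bar>?S x y\<bar>)"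
        unfolding e by (intro ennreal_leI) (simp add: power2_eq_square mult_ac)
      then show ?thesis using True by (simp add: ennreal_mult)
    qed
  qed
  also have "\<dots> = ennreal (fact k * b\<^sup>2) * (\<integral>\<^sup>+x. (\<integral>\<^sup>+y. ennreal \<bar>?S x y\<bar> * indicator {a..a+l} y \<partial>lborel) * indicator {a..a+l} x \<partial>lborel)"
  proof -
    have Xm: "(\<lambda>(x, \<omega>). X x \<omega>) \<in> borel_measurable (borel \<Otimes>\<^sub>M M)" and Ym: "(\<lambda>(x, \<omega>). Y x \<omega>) \<in> borel_measurable (borel \<Otimes>\<^sub>M M)"
      using X Y by (auto simp: mfield_def)
    note cm = covariance_measurable
    note [measurable] = cm[OF Xm Xm] cm[OF Xm Ym] cm[OF Ym Xm] cm[OF Ym Ym]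
    have [measurable]: "(\<lambda>q. ?S (fst q) (snd q)) \<in> borel_measurable (borel \<Otimes>\<^sub>M borel)" by measurable
    have Sy [measurable]: "(\<lambda>y. ?S x y) \<in> borel_measurable borel" for x
      using measurable_compose[of "\<lambda>y. (x, y)" borel "borel \<Otimes>\<^sub>M borel" "\<lambda>q. ?S (fst q) (snd q)"] by simp
    have in_meas: "(\<lambda>x. \<integral>\<^sup>+y. ennreal \<bar>?S x y\<bar> * indicator {a..a+l} y * indicator {a..a+l} x \<partial>lborel) \<in> borel_measurable lborel"
      by (rule lborel.borel_measurable_nn_integral) (simp add: case_prod_beta)
    have m1: "(\<integral>\<^sup>+y. ennreal \<bar>?S x y\<bar> * indicator {a..a+l} y * indicator {a..a+l} x \<partial>lborel)
       = (\<integral>\<^sup>+y. ennreal \<bar>?S x y\<bar> * indicator {a..a+l} y \<partial>lborel) * indicator {a..a+l} x" for x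
      by (rule nn_integral_multc) measurable
    have m2: "(\<integral>\<^sup>+y. ennreal (fact k * b\<^sup>2) * (ennreal \<bar>?S x y\<bar> * indicator {a..a+l} y * indicator {a..a+l} x) \<partial>lborel)
       = ennreal (fact k * b\<^sup>2) * (\<integral>\<^sup>+y. ennreal \<bar>?S x y\<bar> * indicator {a..a+l} y * indicator {a..a+l} x \<partial>lborel)" for x
      by (rule nn_integral_cmult) measurable
    show ?thesis unfolding m2 nn_integral_cmult[OF in_meas] unfolding m1 ..
  qed
  finally show ?thesis .
qed

end

text \<open>Two points of one interval of length l differ by at most l, so either variable can be
  integrated out over [-l, l]. Both forms are kept in order to retain the mass of p or of q,
  whichever is small.\<close>

lemma nn_convolution_le:
  fixes \<Phi> p q :: "real \<Rightarrow> ennreal"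
  assumes [measurable]: "\<Phi> \<in> borel_measurable borel" "p \<in> borel_measurable borel" "q \<in> borel_measurable borel"
    and p: "\<And>x. p x \<le> indicator {a..a+l} x" and q: "\<And>x. q x \<le> indicator {a..a+l} x"
  shows "(\<integral>\<^sup>+x. (\<integral>\<^sup>+y. \<Phi> (x - y) * q y \<partial>lborel) * p x \<partial>lborel) \<le> (\<integral>\<^sup>+z. \<Phi> z * indicator {-l..l} z \<partial>lborel) * (\<integral>\<^sup>+x. p x \<partial>lborel)"
    and "(\<integral>\<^sup>+x. (\<integral>\<^sup>+y. \<Phi> (x - y) * q y \<partial>lborel) * p x \<partial>lborel) \<le> (\<integral>\<^sup>+z. \<Phi> z * indicator {-l..l} z \<partial>lborel) * (\<integral>\<^sup>+y. q y \<partial>lborel)"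
proof -
  let ?A = "\<integral>\<^sup>+z. \<Phi> z * indicator {-l..l} z \<partial>lborel"
  have supp: "r x = 0" if "x \<notin> {a..a+l}" "\<And>x. r x \<le> indicator {a..a+l} x" for r :: "real \<Rightarrow> ennreal" and x
    using that(1) that(2)[of x] by simp
  have "(\<integral>\<^sup>+y. \<Phi> (x - y) * q y \<partial>lborel) * p x \<le> ?A * p x" for x
  proof (cases "x \<in> {a..a+l}")
    case True
    have "(\<integral>\<^sup>+y. \<Phi> (x - y) * q y \<partial>lborel) \<le> (\<integral>\<^sup>+y. \<Phi> (x + (- 1) * y) * indicator {-l..l} (x + (- 1) * y) \<partial>lborel)"
    proof (rule nn_integral_mono)
      fix y
      have "q y \<le> indicator {-l..l} (x + (- 1) * y)"
        by (rule order_trans[OF q]) (use True in \<open>auto simp: indicator_def\<close>)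
      then show "\<Phi> (x - y) * q y \<le> \<Phi> (x + (- 1) * y) * indicator {-l..l} (x + (- 1) * y)"
        by (simp add: mult_left_mono)
    qed
    also have "\<dots> = ?A"
      by (subst nn_integral_real_affine[of "\<lambda>z. \<Phi> z * indicator {-l..l} z" "-1" x]) simp_all
    finally show ?thesis by (rule mult_right_mono) simp
  next
    case False
    then show ?thesis using supp[OF False p] by simp
  qed
  then have "(\<integral>\<^sup>+x. (\<integral>\<^sup>+y. \<Phi> (x - y) * q y \<partial>lborel) * p x \<partial>lborel) \<le> (\<integral>\<^sup>+x. ?A * p x \<partial>lborel)"
    by (rule nn_integral_mono)
  then show "(\<integral>\<^sup>+x. (\<integral>\<^sup>+y. \<Phi> (x - y) * q y \<partial>lborel) * p x \<partial>lborel) \<le> ?A * (\<integral>\<^sup>+x. p x \<partial>lborel)"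
    by (simp add: nn_integral_cmult)
  have "(\<integral>\<^sup>+x. (\<integral>\<^sup>+y. \<Phi> (x - y) * q y \<partial>lborel) * p x \<partial>lborel) = (\<integral>\<^sup>+x. (\<integral>\<^sup>+y. \<Phi> (x - y) * q y * p x \<partial>lborel) \<partial>lborel)"
    by (simp add: nn_integral_multc)
  also have "\<dots> = (\<integral>\<^sup>+y. (\<integral>\<^sup>+x. \<Phi> (x - y) * q y * p x \<partial>lborel) \<partial>lborel)"
    by (rule lborel_pair.Fubini') measurable
  also have "\<dots> = (\<integral>\<^sup>+y. (\<integral>\<^sup>+x. \<Phi> (x - y) * p x \<partial>lborel) * q y \<partial>lborel)"
  proof (rule nn_integral_cong)
    fix y
    have "(\<integral>\<^sup>+x. \<Phi> (x - y) * p x \<partial>lborel) * q y = (\<integral>\<^sup>+x. \<Phi> (x - y) * p x * q y \<partial>lborel)"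
      by (rule nn_integral_multc[symmetric]) measurable
    then show "(\<integral>\<^sup>+x. \<Phi> (x - y) * q y * p x \<partial>lborel) = (\<integral>\<^sup>+x. \<Phi> (x - y) * p x \<partial>lborel) * q y"
      by (simp add: mult_ac)
  qed
  also have "\<dots> \<le> (\<integral>\<^sup>+y. ?A * q y \<partial>lborel)"
  proof (rule nn_integral_mono)
    fix y
    show "(\<integral>\<^sup>+x. \<Phi> (x - y) * p x \<partial>lborel) * q y \<le> ?A * q y"
    proof (cases "y \<in> {a..a+l}")
      case True
      have "(\<integral>\<^sup>+x. \<Phi> (x - y) * p x \<partial>lborel) \<le> (\<integral>\<^sup>+x. \<Phi> (- y + 1 * x) * indicator {-l..l} (- y + 1 * x) \<partial>lborel)"
      proof (rule nn_integral_mono)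
        fix x
        have "p x \<le> indicator {-l..l} (- y + 1 * x)"
          by (rule order_trans[OF p]) (use True in \<open>auto simp: indicator_def\<close>)
        then show "\<Phi> (x - y) * p x \<le> \<Phi> (- y + 1 * x) * indicator {-l..l} (- y + 1 * x)"
          by (simp add: mult_left_mono)
      qed
      also have "\<dots> = ?A"
        by (subst nn_integral_real_affine[of "\<lambda>z. \<Phi> z * indicator {-l..l} z" 1 "- y"]) simp_all
      finally show ?thesis by (rule mult_right_mono) simp
    next
      case False
      then show ?thesis using supp[OF False q] by simp
    qed
  qed
  also have "\<dots> = ?A * (\<integral>\<^sup>+y. q y \<partial>lborel)" by (simp add: nn_integral_cmult)
  finally show "(\<integral>\<^sup>+x. (\<integral>\<^sup>+y. \<Phi> (x - y) * q y \<partial>lborel) * p x \<partial>lborel) \<le> ?A * (\<integral>\<^sup>+y. q y \<partial>lborel)" .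
qed

lemma power_sum4_le:
  fixes a b c d :: real
  assumes "0 \<le> a" "0 \<le> b" "0 \<le> c" "0 \<le> d"
  shows "(a + b + c + d) ^ k \<le> 4 ^ k * (a ^ k + b ^ k + c ^ k + d ^ k)"
proof -
  define t where "t = max (max a b) (max c d)"
  have t: "a \<le> t" "b \<le> t" "c \<le> t" "d \<le> t" by (auto simp: t_def)
  have "(a + b + c + d) ^ k \<le> (4 * t) ^ k"
    using assms t by (intro power_mono) auto
  also have "\<dots> = 4 ^ k * t ^ k" by (simp add: power_mult_distrib)
  also have "t ^ k \<le> a ^ k + b ^ k + c ^ k + d ^ k"
  proof -
    have nn: "0 \<le> a ^ k" "0 \<le> b ^ k" "0 \<le> c ^ k" "0 \<le> d ^ k" using assms by auto
    have "t = a \<or> t = b \<or> t = c \<or> t = d" by (auto simp: t_def max_def)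
    then show ?thesis using nn by (elim disjE) auto
  qed
  finally show ?thesis by simp
qed

context wick_setup
begin

lemma kernel_power_double_integral:
  assumes N: "smoother N (2 * e)" and e: "0 < e" and l: "0 \<le> l" "l + 2 * e \<le> m"
  shows "(\<integral>\<^sup>+x. (\<integral>\<^sup>+y. kernel N (x - y) ^ k * indicator {a..a+l} y \<partial>lborel) * indicator {a..a+l} x \<partial>lborel)
     \<le> ennreal (l * (near_const * m powr (1 - \<beta>)))"
proof -
  note [measurable] = kernel_measurable[OF N]
  have "(\<integral>\<^sup>+x. (\<integral>\<^sup>+y. kernel N (x - y) ^ k * indicator {a..a+l} y \<partial>lborel) * indicator {a..a+l} x \<partial>lborel)
     \<le> (\<integral>\<^sup>+z. kernel N z ^ k * indicator {-l..l} z \<partial>lborel) * (\<integral>\<^sup>+x. indicator {a..a+l} x \<partial>lborel)"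
    by (rule nn_convolution_le(1)[where \<Phi> = "\<lambda>z. kernel N z ^ k"]) auto
  also have "\<dots> \<le> ennreal (near_const * m powr (1 - \<beta>)) * ennreal l"
  proof (rule mult_mono)
    have "(\<integral>\<^sup>+z. kernel N z ^ k * indicator {-l..l} z \<partial>lborel) \<le> ennreal (near_const * (l + 2 * e) powr (1 - \<beta>))"
      using N l e by (intro kernel_power_integral) auto
    also have "\<dots> \<le> ennreal (near_const * m powr (1 - \<beta>))"
      using l e beta near_const_nonneg by (intro ennreal_leI mult_left_mono powr_mono2) auto
    finally show "(\<integral>\<^sup>+z. kernel N z ^ k * indicator {-l..l} z \<partial>lborel) \<le> ennreal (near_const * m powr (1 - \<beta>))" .
  qed (use l in auto)
  also have "\<dots> = ennreal (l * (near_const * m powr (1 - \<beta>)))"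
    using l near_const_nonneg by (simp add: ennreal_mult[symmetric] mult.commute)
  finally show ?thesis .
qed

text \<open>The first term is the smoothing error at scale 2 e. The second belongs to the boundary
  strip: x or y may lie in it, and there the smoothed and the unsmoothed power are bounded
  separately, hence the 4.\<close>

definition closeness_const :: "real \<Rightarrow> real" where
  "closeness_const l = l * smoothing_const * 2 powr (1 - \<beta>) + 4 * near_const * m powr (1 - \<beta>)"

lemma closeness_const_nonneg: "0 \<le> l \<Longrightarrow> 0 \<le> closeness_const l"
  using smoothing_const_nonneg near_const_nonneg by (simp add: closeness_const_def)

text \<open>Away from 0 the covariance is a kernel smoothed at scale 2 e, so
  \<open>kernel_smoothing_error\<close> applies; the bound 10 e \<le> m is its condition at that
  scale. If x or y is within e of 0 only an upper bound is known, but the strip has width e, and e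
  \<le> e^(1 - \<beta>) since e \<le> 1.\<close>

lemma mfield_closeness:
  assumes X: "mfield X P e" and Y: "mfield Y Q e" and e: "10 * e \<le> m" "e \<le> 1"
    and l: "0 \<le> a" "0 \<le> l" "l + 2 * e \<le> m"
  shows "(\<integral>\<^sup>+x. (\<integral>\<^sup>+y. ennreal \<bar>(\<integral>\<omega>. X x \<omega> * Y y \<omega> \<partial>M) ^ k - rho0 (x - y) ^ k\<bar> * indicator {a..a+l} y \<partial>lborel) * indicator {a..a+l} x \<partial>lborel)
    \<le> ennreal (closeness_const l * e powr (1 - \<beta>))"
proof -
  have P: "mollifier P e" and Q: "mollifier Q e" and e0: "0 < e" using X Y by (auto simp: mfield_def)
  define N where "N = mollifier_pair P Q"
  have N: "smoother N (2 * e)" unfolding N_def using P Q by (rule smoother_mollifier_pair)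
  note [measurable] = kernel_measurable[OF N]
  let ?I = "indicator {a..a+l} :: real \<Rightarrow> ennreal" and ?b = "\<lambda>x. indicator ({a..a+l} \<inter> {..<e}) x :: ennreal"
  \<comment> \<open>\<open>\<Psi>\<close> measures the error in the bulk; \<open>\<Theta>\<close> is
    the crude bound for points of the strip, whose indicator is \<open>?b\<close>.\<close>
  define \<Psi> where "\<Psi> z = ennreal \<bar>enn2real (kernel N z) ^ k - rho0 z ^ k\<bar>" for z
  define \<Theta> where "\<Theta> z = kernel N z ^ k + ennreal (rho0 z ^ k)" for z
  have [measurable]: "\<Psi> \<in> borel_measurable borel" "\<Theta> \<in> borel_measurable borel"
    unfolding \<Psi>_def \<Theta>_def by measurable
  have pt: "ennreal \<bar>(\<integral>\<omega>. X x \<omega> * Y y \<omega> \<partial>M) ^ k - rho0 (x - y) ^ k\<bar> * ?I y * ?I x \<le>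
      \<Psi> (x - y) * ?I y * ?I x + \<Theta> (x - y) * ?I y * ?b x + \<Theta> (x - y) * ?b y * ?I x" for x y
  proof (cases "x \<in> {a..a+l} \<and> y \<in> {a..a+l}")
    case False
    then show ?thesis by auto
  next
    case True
    then have xy: "0 \<le> x" "0 \<le> y" using l by auto
    note c = mfield_covariance[OF X Y xy, folded N_def]
    let ?c = "\<integral>\<omega>. X x \<omega> * Y y \<omega> \<partial>M"
    show ?thesis
    proof (cases "e \<le> x \<and> e \<le> y")
      case True
      then have "ennreal ?c = kernel N (x - y)" using c(3) by simp
      then have "enn2real (kernel N (x - y)) = ?c" using c(1) by (metis enn2real_ennreal)
      then show ?thesis by (simp add: \<Psi>_def add_increasing2)
    next
      case False
      have "ennreal \<bar>?c ^ k - rho0 (x - y) ^ k\<bar> \<le> ennreal (?c ^ k + rho0 (x - y) ^ k)"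
        using c(1) rho0_nonneg[of "x - y"] by (intro ennreal_leI) (simp add: abs_le_iff add_increasing add_increasing2)
      also have "\<dots> = ennreal ?c ^ k + ennreal (rho0 (x - y) ^ k)"
        using c(1) rho0_nonneg by (simp add: ennreal_power)
      also have "\<dots> \<le> \<Theta> (x - y)" unfolding \<Theta>_def using c(2) by (intro add_right_mono power_mono) auto
      finally have le: "ennreal \<bar>?c ^ k - rho0 (x - y) ^ k\<bar> \<le> \<Theta> (x - y)" .
      from False consider "x < e" | "y < e" by linarith
      then show ?thesis
      proof cases
        case 1
        then show ?thesis using True le by (simp add: add_increasing add_increasing2)
      next
        case 2
        then show ?thesis using True le by (simp add: add_increasing add_increasing2)
      qed
    qed
  qed
  have [measurable]: "(\<lambda>q. \<integral>\<omega>. X (fst q) \<omega> * Y (snd q) \<omega> \<partial>M) \<in> borel_measurable (borel \<Otimes>\<^sub>M borel)"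
    by (rule covariance_measurable) (use X Y in \<open>auto simp: mfield_def\<close>)
  have [measurable]: "(\<lambda>y. \<integral>\<omega>. X x \<omega> * Y y \<omega> \<partial>M) \<in> borel_measurable borel" for x
    using measurable_compose[of "\<lambda>y. (x, y)" borel "borel \<Otimes>\<^sub>M borel" "\<lambda>q. \<integral>\<omega>. X (fst q) \<omega> * Y (snd q) \<omega> \<partial>M"] by simp
  have th: "(\<integral>\<^sup>+z. \<Theta> z * indicator {-l..l} z \<partial>lborel) \<le> ennreal (2 * (near_const * m powr (1 - \<beta>)))"
  proof -
    have "(\<integral>\<^sup>+z. \<Theta> z * indicator {-l..l} z \<partial>lborel) =
        (\<integral>\<^sup>+z. kernel N z ^ k * indicator {-l..l} z \<partial>lborel) + (\<integral>\<^sup>+z. ennreal (rho0 z ^ k) * indicator {-l..l} z \<partial>lborel)"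
      unfolding \<Theta>_def by (simp add: distrib_right nn_integral_add)
    also have "\<dots> \<le> ennreal (near_const * (l + 2 * e) powr (1 - \<beta>)) + ennreal (near_const * l powr (1 - \<beta>))"
      using N l e0 by (intro add_mono kernel_power_integral nn_integral_rho_power) auto
    also have "\<dots> \<le> ennreal (near_const * m powr (1 - \<beta>)) + ennreal (near_const * m powr (1 - \<beta>))"
      using l e0 beta near_const_nonneg by (intro add_mono ennreal_leI mult_left_mono powr_mono2) auto
    also have "\<dots> = ennreal (2 * (near_const * m powr (1 - \<beta>)))"
      using near_const_nonneg by (simp add: ennreal_plus[symmetric] del: ennreal_plus)
    finally show ?thesis .
  qed
  have bi: "(\<integral>\<^sup>+x. ?b x \<partial>lborel) \<le> ennreal e"
  proof -
    have "(\<integral>\<^sup>+x. ?b x \<partial>lborel) \<le> (\<integral>\<^sup>+x. indicator {0..e} x \<partial>lborel)"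
      using l by (intro nn_integral_mono) (auto simp: indicator_def)
    then show ?thesis using e0 by simp
  qed
  have "(\<integral>\<^sup>+x. (\<integral>\<^sup>+y. ennreal \<bar>(\<integral>\<omega>. X x \<omega> * Y y \<omega> \<partial>M) ^ k - rho0 (x - y) ^ k\<bar> * ?I y \<partial>lborel) * ?I x \<partial>lborel)
      = (\<integral>\<^sup>+x. (\<integral>\<^sup>+y. ennreal \<bar>(\<integral>\<omega>. X x \<omega> * Y y \<omega> \<partial>M) ^ k - rho0 (x - y) ^ k\<bar> * ?I y * ?I x \<partial>lborel) \<partial>lborel)"
    by (simp add: nn_integral_multc)
  also have "\<dots> \<le> (\<integral>\<^sup>+x. (\<integral>\<^sup>+y. \<Psi> (x - y) * ?I y * ?I x + \<Theta> (x - y) * ?I y * ?b x + \<Theta> (x - y) * ?b y * ?I x \<partial>lborel) \<partial>lborel)"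
    by (intro nn_integral_mono pt)
  also have "\<dots> = (\<integral>\<^sup>+x. (\<integral>\<^sup>+y. \<Psi> (x - y) * ?I y \<partial>lborel) * ?I x \<partial>lborel) + (\<integral>\<^sup>+x. (\<integral>\<^sup>+y. \<Theta> (x - y) * ?I y \<partial>lborel) * ?b x \<partial>lborel)
      + (\<integral>\<^sup>+x. (\<integral>\<^sup>+y. \<Theta> (x - y) * ?b y \<partial>lborel) * ?I x \<partial>lborel)"
    by (simp add: nn_integral_add nn_integral_multc)
  also have "\<dots> \<le> (\<integral>\<^sup>+z. \<Psi> z * indicator {-l..l} z \<partial>lborel) * (\<integral>\<^sup>+x. ?I x \<partial>lborel)
      + (\<integral>\<^sup>+z. \<Theta> z * indicator {-l..l} z \<partial>lborel) * (\<integral>\<^sup>+x. ?b x \<partial>lborel)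
      + (\<integral>\<^sup>+z. \<Theta> z * indicator {-l..l} z \<partial>lborel) * (\<integral>\<^sup>+x. ?b x \<partial>lborel)"
    by (intro add_mono nn_convolution_le(1) nn_convolution_le(2)) (auto simp: indicator_def)
  also have "\<dots> \<le> ennreal (smoothing_const * (2 * e) powr (1 - \<beta>)) * ennreal l
      + ennreal (2 * (near_const * m powr (1 - \<beta>))) * ennreal e + ennreal (2 * (near_const * m powr (1 - \<beta>))) * ennreal e"
  proof (intro add_mono mult_mono th bi)
    show "(\<integral>\<^sup>+z. \<Psi> z * indicator {-l..l} z \<partial>lborel) \<le> ennreal (smoothing_const * (2 * e) powr (1 - \<beta>))"
      unfolding \<Psi>_def using e e0 l by (intro kernel_smoothing_error[OF N]) auto
  qed (use l in auto)
  also have "\<dots> = ennreal (smoothing_const * (2 * e) powr (1 - \<beta>) * l + 4 * (near_const * m powr (1 - \<beta>)) * e)"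
    using smoothing_const_nonneg near_const_nonneg l e0
    by (simp add: ennreal_mult[symmetric] ennreal_plus[symmetric] del: ennreal_plus)
  also have "\<dots> \<le> ennreal (closeness_const l * e powr (1 - \<beta>))"
  proof (rule ennreal_leI)
    have "e powr 1 \<le> e powr (1 - \<beta>)" using e e0 beta by (intro powr_mono') auto
    then have "4 * (near_const * m powr (1 - \<beta>)) * e \<le> 4 * (near_const * m powr (1 - \<beta>)) * e powr (1 - \<beta>)"
      using e0 near_const_nonneg by (intro mult_left_mono) auto
    then show "smoothing_const * (2 * e) powr (1 - \<beta>) * l + 4 * (near_const * m powr (1 - \<beta>)) * e \<le> closeness_const l * e powr (1 - \<beta>)"
      using e0 by (simp add: closeness_const_def powr_mult algebra_simps)
  qed
  finally show ?thesis .
qed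

lemma wick_integral_close:
  assumes X: "mfield X P e" and Y: "mfield Y Q e" and e: "10 * e \<le> m" "e \<le> 1"
    and g: "weight g b a l" and l: "l + 2 * e \<le> m"
  shows "(\<integral>\<omega>. (wick_integral X g \<omega> - wick_integral Y g \<omega>)\<^sup>2 \<partial>M) \<le> (fact k * b\<^sup>2 * 4 * closeness_const l) * e powr (1 - \<beta>)"
proof -
  let ?c = "\<lambda>U V x y. (\<integral>\<omega>. U x \<omega> * V y \<omega> \<partial>M) ^ k"
  let ?I = "indicator {a..a+l} :: real \<Rightarrow> ennreal"
  let ?T = "\<lambda>U V. \<integral>\<^sup>+x. (\<integral>\<^sup>+y. ennreal \<bar>?c U V x y - rho0 (x - y) ^ k\<bar> * ?I y \<partial>lborel) * ?I x \<partial>lborel"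
  have al: "0 \<le> a" "0 \<le> l" using g by (auto simp: weight_def)
  have Xm: "(\<lambda>(x, \<omega>). X x \<omega>) \<in> borel_measurable (borel \<Otimes>\<^sub>M M)" and Ym: "(\<lambda>(x, \<omega>). Y x \<omega>) \<in> borel_measurable (borel \<Otimes>\<^sub>M M)"
    using X Y by (auto simp: mfield_def)
  note cm = covariance_measurable
  note [measurable] = cm[OF Xm Xm] cm[OF Xm Ym] cm[OF Ym Xm] cm[OF Ym Ym]
  have sec: "(\<lambda>y. \<integral>\<omega>. U x \<omega> * V y \<omega> \<partial>M) \<in> borel_measurable borel"
    if "(\<lambda>q. \<integral>\<omega>. (U (fst q) \<omega> :: real) * V (snd q) \<omega> \<partial>M) \<in> borel_measurable (borel \<Otimes>\<^sub>M borel)" for U V x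
    using measurable_compose[OF _ that, of "\<lambda>y. (x, y)" borel] by simp
  note [measurable] = sec[OF cm[OF Xm Xm]] sec[OF cm[OF Xm Ym]] sec[OF cm[OF Ym Xm]] sec[OF cm[OF Ym Ym]]
  \<comment> \<open>The signs of the mixed difference sum to 0, so the same z, here
    \<open>rho0 (x - y) ^ k\<close>, may be subtracted from all four terms.\<close>
  have four: "\<bar>p - q - r + s\<bar> \<le> \<bar>p - z\<bar> + \<bar>q - z\<bar> + \<bar>r - z\<bar> + \<bar>s - z\<bar>" for p q r s z :: real by linarith
  have "(\<integral>\<^sup>+x. (\<integral>\<^sup>+y. ennreal \<bar>?c X X x y - ?c X Y x y - ?c Y X x y + ?c Y Y x y\<bar> * ?I y \<partial>lborel) * ?I x \<partial>lborel)
     \<le> (\<integral>\<^sup>+x. (\<integral>\<^sup>+y. (ennreal \<bar>?c X X x y - rho0 (x - y) ^ k\<bar> + ennreal \<bar>?c X Y x y - rho0 (x - y) ^ k\<bar>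
        + ennreal \<bar>?c Y X x y - rho0 (x - y) ^ k\<bar> + ennreal \<bar>?c Y Y x y - rho0 (x - y) ^ k\<bar>) * ?I y \<partial>lborel) * ?I x \<partial>lborel)"
    by (intro nn_integral_mono mult_right_mono) (simp_all add: four ennreal_leI flip: ennreal_plus)
  also have "\<dots> = ?T X X + ?T X Y + ?T Y X + ?T Y Y"
    by (simp add: distrib_right nn_integral_add)
  also have "\<dots> \<le> ennreal (closeness_const l * e powr (1 - \<beta>)) + ennreal (closeness_const l * e powr (1 - \<beta>))
      + ennreal (closeness_const l * e powr (1 - \<beta>)) + ennreal (closeness_const l * e powr (1 - \<beta>))"
    by (intro add_mono mfield_closeness[OF X X e al l] mfield_closeness[OF X Y e al l] mfield_closeness[OF Y X e al l] mfield_closeness[OF Y Y e al l])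
  also have "\<dots> = ennreal (4 * (closeness_const l * e powr (1 - \<beta>)))"
    using closeness_const_nonneg[OF al(2)] by (simp add: ennreal_plus[symmetric] del: ennreal_plus)
  finally have "(\<integral>\<^sup>+x. (\<integral>\<^sup>+y. ennreal \<bar>?c X X x y - ?c X Y x y - ?c Y X x y + ?c Y Y x y\<bar> * ?I y \<partial>lborel) * ?I x \<partial>lborel)
     \<le> ennreal (4 * (closeness_const l * e powr (1 - \<beta>)))" .
  then have "ennreal (\<integral>\<omega>. (wick_integral X g \<omega> - wick_integral Y g \<omega>)\<^sup>2 \<partial>M) \<le> ennreal (fact k * b\<^sup>2) * ennreal (4 * (closeness_const l * e powr (1 - \<beta>)))"
    by (intro order_trans[OF wick_integral_diff[OF X Y g]] mult_left_mono) auto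
  also have "\<dots> = ennreal ((fact k * b\<^sup>2 * 4 * closeness_const l) * e powr (1 - \<beta>))"
    using closeness_const_nonneg[OF al(2)] by (simp add: ennreal_mult[symmetric] mult_ac)
  finally show ?thesis using closeness_const_nonneg[OF al(2)] by (simp add: ennreal_le_iff)
qed

text \<open>The averaging window lies to the right of x, so nothing is cut off at 0. The shift c is
  needed for the second part of a split difference quotient.\<close>

lemma mfield_quot_shift:
  assumes c: "0 \<le> c" and h: "0 < h" and e: "c + h \<le> e"
  shows "mfield (\<lambda>x. quot h (x + c)) (\<lambda>u. ennreal (1 / h) * indicator {c..c+h} u) e"
  unfolding mfield_def
proof (intro conjI allI impI)
  have "(\<lambda>p. (fst p + c, snd p)) \<in> borel \<Otimes>\<^sub>M M \<rightarrow>\<^sub>M borel \<Otimes>\<^sub>M M" by measurable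
  from measurable_compose[OF this quot_measurable[of h]]
  show "(\<lambda>(x, \<omega>). quot h (x + c) \<omega>) \<in> borel_measurable (borel \<Otimes>\<^sub>M M)" by (simp add: case_prod_beta)
  have "(\<integral>\<^sup>+u. ennreal (1 / h) * indicator {c..c+h} u \<partial>lborel) = ennreal (1 / h) * ennreal h"
    using h by (simp add: nn_integral_cmult)
  also have "\<dots> = 1" using h by (simp add: ennreal_mult[symmetric])
  finally show "mollifier (\<lambda>u. ennreal (1 / h) * indicator {c..c+h} u) e"
    using c e h by (auto simp: mollifier_def indicator_def)
  show "0 < e" using c h e by simp
  have "ennreal (1 / h) * indicator {c..c+h} u \<le> ennreal (1 / h)" for u by (auto simp: indicator_def)
  then show "\<exists>b. \<forall>u. ennreal (1 / h) * indicator {c..c+h} u \<le> ennreal b" by blast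
  fix x :: real assume x: "0 \<le> x"
  have eq: "(\<lambda>u. ennreal (1 / h) * indicator {x+c..x+c+h} u) = (\<lambda>u. ennreal (1 / h) * indicator {c..c+h} (u - x))"
    by (auto simp: indicator_def fun_eq_iff)
  have "strongly_represents (quot h (x + c)) (\<lambda>u. ennreal (1 / h) * indicator {c..c+h} (u - x))"
    unfolding eq[symmetric] using x c h by (intro strongly_represents_quot) auto
  then show "\<exists>\<phi>. strongly_represents (quot h (x + c)) \<phi> \<and> (\<forall>u. \<phi> u \<le> ennreal (1 / h) * indicator {c..c+h} (u - x)) \<and>
      (e \<le> x \<longrightarrow> \<phi> = (\<lambda>u. ennreal (1 / h) * indicator {c..c+h} (u - x)))" by blast
qed

lemma mfield_quot:
  assumes "0 < h" "h \<le> e" shows "mfield (quot h) (\<lambda>u. ennreal (1 / h) * indicator {0..0+h} u) e"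
  using mfield_quot_shift[of 0 h e] assms by simp

lemma covariance_lincomb:
  fixes U V W Z :: "'a \<Rightarrow> real"
  assumes "square_integrable M U" "square_integrable M V" "square_integrable M W" "square_integrable M Z"
  shows "(\<integral>\<omega>. (r * U \<omega> + s * V \<omega>) * (t * W \<omega> + q * Z \<omega>) \<partial>M) =
    r * t * (\<integral>\<omega>. U \<omega> * W \<omega> \<partial>M) + r * q * (\<integral>\<omega>. U \<omega> * Z \<omega> \<partial>M) + s * t * (\<integral>\<omega>. V \<omega> * W \<omega> \<partial>M) + s * q * (\<integral>\<omega>. V \<omega> * Z \<omega> \<partial>M)"
proof -
  note i = square_integrable_mult[OF assms(1,3)] square_integrable_mult[OF assms(1,4)]
    square_integrable_mult[OF assms(2,3)] square_integrable_mult[OF assms(2,4)]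
  have "(\<integral>\<omega>. (r * U \<omega> + s * V \<omega>) * (t * W \<omega> + q * Z \<omega>) \<partial>M) = (\<integral>\<omega>. r * t * (U \<omega> * W \<omega>) + r * q * (U \<omega> * Z \<omega>)
      + s * t * (V \<omega> * W \<omega>) + s * q * (V \<omega> * Z \<omega>) \<partial>M)"
    by (rule Bochner_Integration.integral_cong[OF refl]) (simp add: algebra_simps)
  then show ?thesis using i by simp
qed

text \<open>16 k^2 comes from \<open>power_second_difference_le\<close>, 4^k from
  \<open>power_sum4_le\<close>, and the remaining 4 counts the covariances, each integrated by
  \<open>kernel_power_double_integral\<close>.\<close>

definition lipschitz_const :: "real \<Rightarrow> real \<Rightarrow> real" where
  "lipschitz_const b l = fact k * b\<^sup>2 * (16 * (real k)\<^sup>2 * 4 ^ k * 4 * (l * (near_const * m powr (1 - \<beta>))))"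

text \<open>With \<open>s = (h - h') / h\<close> the difference quotient over \<open>[x, x + h]\<close> is the convex combination
  \<open>(1 - s) quot h' x + s quot (h - h') (x + h')\<close>.\<close>

lemma wick_integral_lipschitz:
  assumes h: "0 < h'" "h' \<le> h" and g: "weight g b a l" and l: "l + 2 * h \<le> m"
  shows "(\<integral>\<omega>. (wick_integral (quot h) g \<omega> - wick_integral (quot h') g \<omega>)\<^sup>2 \<partial>M) \<le> lipschitz_const b l * ((h - h') / h)\<^sup>2"
proof (cases "h = h'")
  case True
  then show ?thesis by simp
next
  case False
  define s where "s = (h - h') / h"
  have hp: "0 < h" "0 < h - h'" using h False by auto
  have s: "0 \<le> s" "s \<le> 1" using h hp by (auto simp: s_def divide_simps)
  let ?Y = "quot h" and ?X = "quot h'" and ?Z = "\<lambda>x. quot (h - h') (x + h')"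
  let ?P1 = "\<lambda>u. ennreal (1 / h') * indicator {0..0+h'} u :: ennreal" and ?P2 = "\<lambda>u. ennreal (1 / (h - h')) * indicator {h'..h'+(h-h')} u :: ennreal"
  have X: "mfield ?X ?P1 h" using h by (intro mfield_quot) auto
  have Z: "mfield ?Z ?P2 h" using h hp by (intro mfield_quot_shift) auto
  have Y: "mfield ?Y (\<lambda>u. ennreal (1 / h) * indicator {0..0+h} u) h" using hp by (intro mfield_quot) auto
  have al: "0 \<le> a" "0 \<le> l" using g by (auto simp: weight_def)
  have comb: "?Y x = (\<lambda>\<omega>. (1 - s) * ?X x \<omega> + s * ?Z x \<omega>)" for x
  proof
    fix \<omega>
    have "(1 - s) * ?X x \<omega> = (Gp (x + h') \<omega> - Gp x \<omega>) / h" using h hp by (simp add: quot_def s_def field_simps)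
    moreover have "s * ?Z x \<omega> = (Gp (x + h) \<omega> - Gp (x + h') \<omega>) / h" using h hp by (simp add: quot_def s_def)
    ultimately show "?Y x \<omega> = (1 - s) * ?X x \<omega> + s * ?Z x \<omega>" by (simp add: quot_def add_divide_distrib[symmetric])
  qed
  note sq = quot_square_integrable
  let ?I = "indicator {a..a+l} :: real \<Rightarrow> ennreal"
  define A where "A x y = (\<integral>\<omega>. ?X x \<omega> * ?X y \<omega> \<partial>M)" for x y
  define p where "p x y = (\<integral>\<omega>. ?X x \<omega> * ?Z y \<omega> \<partial>M)" for x y
  define q where "q x y = (\<integral>\<omega>. ?Z x \<omega> * ?X y \<omega> \<partial>M)" for x y
  define t where "t x y = (\<integral>\<omega>. ?Z x \<omega> * ?Z y \<omega> \<partial>M)" for x y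
  \<comment> \<open>Bilinearity expresses every covariance that involves the step h through the four
    covariances of the two parts, with coefficients polynomial in s.\<close>
  have YY: "(\<integral>\<omega>. ?Y x \<omega> * ?Y y \<omega> \<partial>M) = (1-s) * (1-s) * A x y + (1-s)* s * p x y + s * (1-s) * q x y + s* s * t x y" for x y
    unfolding comb A_def p_def q_def t_def by (rule covariance_lincomb) (rule sq)+
  have YX: "(\<integral>\<omega>. ?Y x \<omega> * ?X y \<omega> \<partial>M) = (1-s) * A x y + s * q x y" for x y
    unfolding comb A_def q_def using covariance_lincomb[OF sq[of h' x] sq[of "h - h'" "x + h'"] sq[of h' y] sq[of h' y], of "1-s" s 1 0] by simp
  have XY: "(\<integral>\<omega>. ?X x \<omega> * ?Y y \<omega> \<partial>M) = (1-s) * A x y + s * p x y" for x y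
    unfolding comb A_def p_def using covariance_lincomb[OF sq[of h' x] sq[of h' x] sq[of h' y] sq[of "h - h'" "y + h'"], of 1 0 "1-s" s] by simp
  have pt: "\<bar>(\<integral>\<omega>. ?Y x \<omega> * ?Y y \<omega> \<partial>M) ^ k - (\<integral>\<omega>. ?Y x \<omega> * ?X y \<omega> \<partial>M) ^ k - (\<integral>\<omega>. ?X x \<omega> * ?Y y \<omega> \<partial>M) ^ k
      + (\<integral>\<omega>. ?X x \<omega> * ?X y \<omega> \<partial>M) ^ k\<bar> \<le> (16 * (real k)\<^sup>2 * s\<^sup>2 * 4 ^ k) * (A x y ^ k + p x y ^ k + q x y ^ k + t x y ^ k)"
    and nn: "0 \<le> A x y" "0 \<le> p x y" "0 \<le> q x y" "0 \<le> t x y"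
    if xy: "0 \<le> x" "0 \<le> y" for x y
  proof -
    show n: "0 \<le> A x y" "0 \<le> p x y" "0 \<le> q x y" "0 \<le> t x y"
      unfolding A_def p_def q_def t_def
      by (rule mfield_covariance(1)[OF X X xy] mfield_covariance(1)[OF X Z xy] mfield_covariance(1)[OF Z X xy] mfield_covariance(1)[OF Z Z xy])+
    let ?A = "A x y" and ?p = "p x y" and ?q = "q x y" and ?t = "t x y"
    \<comment> \<open>All four covariances are nonnegative, so their sum bounds each of them, every
      convex combination of them, and all their differences.\<close>
    let ?R = "?A + ?p + ?q + ?t"
    let ?P = "(1-s) * (1-s) * ?A + (1-s)* s * ?p + s * (1-s) * ?q + s* s * ?t"
    let ?Q = "(1-s) * ?A + s * ?q" and ?S = "(1-s) * ?A + s * ?p"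
    have u: "0 \<le> 1 - s" "1 - s \<le> 1" using s by auto
    have w: "z * c \<le> c" "0 \<le> z * c" if "0 \<le> z" "z \<le> 1" "0 \<le> c" for z c :: real
      using that by (auto intro: mult_left_le_one_le)
    have ab: "0 \<le> (1-s) * (1-s)" "(1-s) * (1-s) \<le> 1" "0 \<le> (1-s)* s" "(1-s)* s \<le> 1" "0 \<le> s * (1-s)" "s * (1-s) \<le> 1" "0 \<le> s* s" "s* s \<le> 1"
      using u s by (auto intro!: mult_nonneg_nonneg mult_le_one)
    have R: "0 \<le> ?R" using n by simp
    have sR: "s * ?R \<le> 4 * s * ?R" "s\<^sup>2 * ?R \<le> 4 * s\<^sup>2 * ?R"
      using mult_nonneg_nonneg[OF s(1) R] mult_nonneg_nonneg[OF zero_le_power2[of s] R] by linarith+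
    have d1: "\<bar>z - ?A\<bar> \<le> ?R" if "z = ?p \<or> z = ?q" for z using that n by auto
    have QA: "\<bar>?Q - ?A\<bar> \<le> s * ?R"
    proof -
      have "?Q - ?A = s * (?q - ?A)" by (simp add: algebra_simps)
      then show ?thesis using s d1[of ?q] by (simp add: abs_mult mult_left_mono)
    qed
    have SA: "\<bar>?S - ?A\<bar> \<le> s * ?R"
    proof -
      have "?S - ?A = s * (?p - ?A)" by (simp add: algebra_simps)
      then show ?thesis using s d1[of ?p] by (simp add: abs_mult mult_left_mono)
    qed
    have conv: "\<bar>(1-s) * c + s * d\<bar> \<le> ?R" if "\<bar>c\<bar> \<le> ?R" "\<bar>d\<bar> \<le> ?R" for c d
    proof -
      have "\<bar>(1-s) * c + s * d\<bar> \<le> (1-s) * \<bar>c\<bar> + s * \<bar>d\<bar>"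
        using abs_triangle_ineq[of "(1-s)*c" "s*d"] s u by (simp add: abs_mult)
      also have "\<dots> \<le> (1-s) * ?R + s * ?R" using that s u by (intro add_mono mult_left_mono) auto
      finally show ?thesis by (simp add: algebra_simps)
    qed
    have PQ: "\<bar>?P - ?Q\<bar> \<le> s * ?R"
    proof -
      have "?P - ?Q = s * ((1-s) * (?p - ?A) + s * (?t - ?q))" by (simp add: algebra_simps)
      moreover have "\<bar>(1-s) * (?p - ?A) + s * (?t - ?q)\<bar> \<le> ?R" using n by (intro conv) auto
      ultimately show ?thesis using s by (simp add: abs_mult mult_left_mono)
    qed
    have PS: "\<bar>?P - ?S\<bar> \<le> s * ?R"
    proof -
      have "?P - ?S = s * ((1-s) * (?q - ?A) + s * (?t - ?p))" by (simp add: algebra_simps)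
      moreover have "\<bar>(1-s) * (?q - ?A) + s * (?t - ?p)\<bar> \<le> ?R" using n by (intro conv) auto
      ultimately show ?thesis using s by (simp add: abs_mult mult_left_mono)
    qed
    \<comment> \<open>Both arguments move by s in the direction Z - X, so the mixed difference is
      s^2 times the covariance of these two displacements.\<close>
    have PQSA: "\<bar>?P - ?Q - ?S + ?A\<bar> \<le> s\<^sup>2 * ?R"
    proof -
      have "?P - ?Q - ?S + ?A = s\<^sup>2 * (?A - ?p - ?q + ?t)" by (simp add: algebra_simps power2_eq_square)
      moreover have "\<bar>?A - ?p - ?q + ?t\<bar> \<le> ?R" using n by linarith
      ultimately show ?thesis by (simp add: abs_mult mult_left_mono)
    qed
    have "\<bar>?P ^ k - ?Q ^ k - ?S ^ k + ?A ^ k\<bar> \<le> 16 * (real k)\<^sup>2 * s\<^sup>2 * ?R ^ k"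
    proof (rule power_second_difference_le)
      show "0 \<le> ?P" "?P \<le> ?R" using w(1)[OF ab(1,2) n(1)] w(1)[OF ab(3,4) n(2)] w(1)[OF ab(5,6) n(3)] w(1)[OF ab(7,8) n(4)]
          w(2)[OF ab(1,2) n(1)] w(2)[OF ab(3,4) n(2)] w(2)[OF ab(5,6) n(3)] w(2)[OF ab(7,8) n(4)] by linarith+
      show "0 \<le> ?Q" "?Q \<le> ?R" "0 \<le> ?S" "?S \<le> ?R"
        using w(1)[OF u n(1)] w(2)[OF u n(1)] w(1)[OF s n(3)] w(2)[OF s n(3)] w(1)[OF s n(2)] w(2)[OF s n(2)] n by linarith+
    qed (use n s QA SA PQ PS PQSA sR in linarith)+
    also have "\<dots> \<le> 16 * (real k)\<^sup>2 * s\<^sup>2 * (4 ^ k * (?A ^ k + ?p ^ k + ?q ^ k + ?t ^ k))"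
      using n by (intro mult_left_mono power_sum4_le) auto
    finally show "\<bar>(\<integral>\<omega>. ?Y x \<omega> * ?Y y \<omega> \<partial>M) ^ k - (\<integral>\<omega>. ?Y x \<omega> * ?X y \<omega> \<partial>M) ^ k - (\<integral>\<omega>. ?X x \<omega> * ?Y y \<omega> \<partial>M) ^ k
      + (\<integral>\<omega>. ?X x \<omega> * ?X y \<omega> \<partial>M) ^ k\<bar> \<le> (16 * (real k)\<^sup>2 * s\<^sup>2 * 4 ^ k) * (?A ^ k + ?p ^ k + ?q ^ k + ?t ^ k)"
      unfolding YY YX XY A_def[symmetric] by (simp add: mult.assoc)
  qed
  have Xm: "(\<lambda>(x, \<omega>). ?X x \<omega>) \<in> borel_measurable (borel \<Otimes>\<^sub>M M)" and Zm: "(\<lambda>(x, \<omega>). ?Z x \<omega>) \<in> borel_measurable (borel \<Otimes>\<^sub>M M)"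
    using X Z by (auto simp: mfield_def)
  note cm = covariance_measurable
  have [measurable]: "(\<lambda>z. A (fst z) (snd z)) \<in> borel_measurable (borel \<Otimes>\<^sub>M borel)" "(\<lambda>z. p (fst z) (snd z)) \<in> borel_measurable (borel \<Otimes>\<^sub>M borel)"
    "(\<lambda>z. q (fst z) (snd z)) \<in> borel_measurable (borel \<Otimes>\<^sub>M borel)" "(\<lambda>z. t (fst z) (snd z)) \<in> borel_measurable (borel \<Otimes>\<^sub>M borel)"
    unfolding A_def p_def q_def t_def by (rule cm[OF Xm Xm] cm[OF Xm Zm] cm[OF Zm Xm] cm[OF Zm Zm])+
  have sec: "(\<lambda>y. r x y) \<in> borel_measurable borel" if "(\<lambda>z. r (fst z) (snd z)) \<in> borel_measurable (borel \<Otimes>\<^sub>M borel)" for r :: "real \<Rightarrow> real \<Rightarrow> real" and x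
    using measurable_compose[OF _ that, of "\<lambda>y. (x, y)" borel] by simp
  have [measurable]: "(\<lambda>y. A x y) \<in> borel_measurable borel" "(\<lambda>y. p x y) \<in> borel_measurable borel" "(\<lambda>y. q x y) \<in> borel_measurable borel" "(\<lambda>y. t x y) \<in> borel_measurable borel" for x
    by (rule sec, measurable)+
  let ?T = "\<lambda>r. \<integral>\<^sup>+x. (\<integral>\<^sup>+y. ennreal (r x y) ^ k * ?I y \<partial>lborel) * ?I x \<partial>lborel"
  let ?K = "l * (near_const * m powr (1 - \<beta>))"
  have K0: "0 \<le> ?K" using al near_const_nonneg by simp
  have T: "?T r \<le> ennreal ?K" if r: "\<And>x y. 0 \<le> x \<Longrightarrow> 0 \<le> y \<Longrightarrow> ennreal (r x y) \<le> kernel (mollifier_pair P Q) (x - y)" and PQ: "mollifier P h" "mollifier Q h" for r P Q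
  proof -
    have "?T r \<le> (\<integral>\<^sup>+x. (\<integral>\<^sup>+y. kernel (mollifier_pair P Q) (x - y) ^ k * ?I y \<partial>lborel) * ?I x \<partial>lborel)"
    proof (rule nn_integral_mono)
      fix x
      show "(\<integral>\<^sup>+y. ennreal (r x y) ^ k * ?I y \<partial>lborel) * ?I x \<le> (\<integral>\<^sup>+y. kernel (mollifier_pair P Q) (x - y) ^ k * ?I y \<partial>lborel) * ?I x"
      proof (cases "x \<in> {a..a+l}")
        case True
        have "ennreal (r x y) ^ k * ?I y \<le> kernel (mollifier_pair P Q) (x - y) ^ k * ?I y" for y
          using True al r[of x y] by (cases "y \<in> {a..a+l}") (auto intro: power_mono)
        then show ?thesis by (intro mult_right_mono[OF nn_integral_mono]) simp_all
      qed simp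
    qed
    also have "\<dots> \<le> ennreal ?K"
      using smoother_mollifier_pair[OF PQ] hp al l by (intro kernel_power_double_integral) auto
    finally show ?thesis .
  qed
  have mo: "mollifier ?P1 h" "mollifier ?P2 h" using X Z by (auto simp: mfield_def)
  have TA: "?T A \<le> ennreal ?K" unfolding A_def by (rule T[OF mfield_covariance(2)[OF X X] mo(1) mo(1)])
  have Tp: "?T p \<le> ennreal ?K" unfolding p_def by (rule T[OF mfield_covariance(2)[OF X Z] mo(1) mo(2)])
  have Tq: "?T q \<le> ennreal ?K" unfolding q_def by (rule T[OF mfield_covariance(2)[OF Z X] mo(2) mo(1)])
  have Tt: "?T t \<le> ennreal ?K" unfolding t_def by (rule T[OF mfield_covariance(2)[OF Z Z] mo(2) mo(2)])
  let ?c = "16 * (real k)\<^sup>2 * s\<^sup>2 * 4 ^ k"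
  have c0: "0 \<le> ?c" by simp
  have "(\<integral>\<^sup>+x. (\<integral>\<^sup>+y. ennreal \<bar>(\<integral>\<omega>. ?Y x \<omega> * ?Y y \<omega> \<partial>M) ^ k - (\<integral>\<omega>. ?Y x \<omega> * ?X y \<omega> \<partial>M) ^ k - (\<integral>\<omega>. ?X x \<omega> * ?Y y \<omega> \<partial>M) ^ k
      + (\<integral>\<omega>. ?X x \<omega> * ?X y \<omega> \<partial>M) ^ k\<bar> * ?I y \<partial>lborel) * ?I x \<partial>lborel)
     \<le> (\<integral>\<^sup>+x. (\<integral>\<^sup>+y. ennreal ?c * (ennreal (A x y) ^ k * ?I y + ennreal (p x y) ^ k * ?I y + ennreal (q x y) ^ k * ?I y + ennreal (t x y) ^ k * ?I y) \<partial>lborel) * ?I x \<partial>lborel)"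
  proof (rule nn_integral_mono)
    fix x
    show "(\<integral>\<^sup>+y. ennreal \<bar>(\<integral>\<omega>. ?Y x \<omega> * ?Y y \<omega> \<partial>M) ^ k - (\<integral>\<omega>. ?Y x \<omega> * ?X y \<omega> \<partial>M) ^ k - (\<integral>\<omega>. ?X x \<omega> * ?Y y \<omega> \<partial>M) ^ k
      + (\<integral>\<omega>. ?X x \<omega> * ?X y \<omega> \<partial>M) ^ k\<bar> * ?I y \<partial>lborel) * ?I x
     \<le> (\<integral>\<^sup>+y. ennreal ?c * (ennreal (A x y) ^ k * ?I y + ennreal (p x y) ^ k * ?I y + ennreal (q x y) ^ k * ?I y + ennreal (t x y) ^ k * ?I y) \<partial>lborel) * ?I x"
    proof (cases "x \<in> {a..a+l}")
      case True
      have "ennreal \<bar>(\<integral>\<omega>. ?Y x \<omega> * ?Y y \<omega> \<partial>M) ^ k - (\<integral>\<omega>. ?Y x \<omega> * ?X y \<omega> \<partial>M) ^ k - (\<integral>\<omega>. ?X x \<omega> * ?Y y \<omega> \<partial>M) ^ k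
        + (\<integral>\<omega>. ?X x \<omega> * ?X y \<omega> \<partial>M) ^ k\<bar> * ?I y \<le> ennreal ?c * (ennreal (A x y) ^ k * ?I y + ennreal (p x y) ^ k * ?I y + ennreal (q x y) ^ k * ?I y + ennreal (t x y) ^ k * ?I y)" for y
      proof (cases "y \<in> {a..a+l}")
        case yT: True
        have xy: "0 \<le> x" "0 \<le> y" using True yT al by auto
        have eq: "ennreal (?c * (A x y ^ k + p x y ^ k + q x y ^ k + t x y ^ k)) = ennreal ?c * (ennreal (A x y) ^ k + ennreal (p x y) ^ k + ennreal (q x y) ^ k + ennreal (t x y) ^ k)"
          using nn[OF xy] c0 by (subst ennreal_mult) (auto simp: ennreal_power)
        show ?thesis using ennreal_leI[OF pt[OF xy]] yT unfolding eq by simp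
      qed simp
      then show ?thesis by (intro mult_right_mono[OF nn_integral_mono]) simp_all
    qed simp
  qed
  also have "\<dots> = ennreal ?c * (?T A + ?T p + ?T q + ?T t)"
    by (simp add: nn_integral_cmult nn_integral_add distrib_right mult.assoc)
  also have "\<dots> \<le> ennreal ?c * (ennreal ?K + ennreal ?K + ennreal ?K + ennreal ?K)"
    by (intro mult_left_mono add_mono TA Tp Tq Tt) simp
  also have "\<dots> = ennreal (?c * (4 * ?K))"
    using c0 K0 by (simp only: ennreal_plus[symmetric] ennreal_mult[symmetric] add_nonneg_nonneg) (simp add: algebra_simps)
  finally have S: "(\<integral>\<^sup>+x. (\<integral>\<^sup>+y. ennreal \<bar>(\<integral>\<omega>. ?Y x \<omega> * ?Y y \<omega> \<partial>M) ^ k - (\<integral>\<omega>. ?Y x \<omega> * ?X y \<omega> \<partial>M) ^ k - (\<integral>\<omega>. ?X x \<omega> * ?Y y \<omega> \<partial>M) ^ k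
      + (\<integral>\<omega>. ?X x \<omega> * ?X y \<omega> \<partial>M) ^ k\<bar> * ?I y \<partial>lborel) * ?I x \<partial>lborel) \<le> ennreal (?c * (4 * ?K))" .
  have "ennreal (\<integral>\<omega>. (wick_integral ?Y g \<omega> - wick_integral ?X g \<omega>)\<^sup>2 \<partial>M) \<le> ennreal (fact k * b\<^sup>2) * ennreal (?c * (4 * ?K))"
    by (rule order_trans[OF wick_integral_diff[OF Y X g] mult_left_mono[OF S]]) simp
  also have "\<dots> = ennreal (lipschitz_const b l * s\<^sup>2)"
  proof -
    have e: "lipschitz_const b l * s\<^sup>2 = (fact k * b\<^sup>2) * (?c * (4 * ?K))" by (simp add: lipschitz_const_def)
    have "0 \<le> ?c * (4 * ?K)" using c0 K0 by simp
    then show ?thesis unfolding e by (intro ennreal_mult[symmetric]) simp_all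
  qed
  finally show ?thesis
    using K0 by (subst (asm) ennreal_le_iff) (auto simp: lipschitz_const_def s_def)
qed

lemma lipschitz_const_nonneg: "0 \<le> l \<Longrightarrow> 0 \<le> lipschitz_const b l"
  using near_const_nonneg by (simp add: lipschitz_const_def)

text \<open>For x >= 0 the variance of \<open>quot h x\<close> is \<open>\<sigma>2 h\<close> / h^2,
  so the coefficients of the Wick power depend on h but not on x. This separates the deterministic
  and the pathwise dependence on h.\<close>

definition wick_coeff :: "nat \<Rightarrow> real \<Rightarrow> real" where
  "wick_coeff j h = (-1) ^ j * real (k choose (2 * j)) * (normal_moment (2 * j) * sqrt (\<sigma>2 h / h\<^sup>2) ^ (2 * j))"

lemma wick_power_quot:
  assumes "0 \<le> x" "0 < h"
  shows "wick_power M k (quot h x) \<omega> = (\<Sum>j=0..k div 2. wick_coeff j h * quot h x \<omega> ^ (k - 2 * j))"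
  unfolding wick_power_def wick_coeff_def
  using centered_gaussian_moment(2)[OF gspace_centered_gaussian[OF quot_gspace[of h x]], of "2 * j" for j]
    quot_second_moment[OF assms] by simp

lemma quot_path_bound:
  assumes \<omega>: "\<omega> \<in> space M" and c: "0 < c"
  obtains S where "0 \<le> S" "\<And>h x. h \<in> {c..d} \<Longrightarrow> x \<in> {a..a+l} \<Longrightarrow> \<bar>quot h x \<omega>\<bar> \<le> S"
proof -
  have "compact ((\<lambda>x. Gp x \<omega>) ` {a..a+l+d})"
    by (rule compact_continuous_image[OF continuous_on_subset[OF Gp_continuous[OF \<omega>]]]) auto
  then obtain s where s: "\<And>x. x \<in> {a..a+l+d} \<Longrightarrow> \<bar>Gp x \<omega>\<bar> \<le> s"
    using compact_imp_bounded bounded_iff by (metis imageI real_norm_def)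
  have "\<bar>quot h x \<omega>\<bar> \<le> (\<bar>s\<bar> + \<bar>s\<bar>) / c" if "h \<in> {c..d}" "x \<in> {a..a+l}" for h x
  proof -
    have "\<bar>Gp (x + h) \<omega> - Gp x \<omega>\<bar> \<le> \<bar>s\<bar> + \<bar>s\<bar>"
      using s[of "x + h"] s[of x] that c by auto
    then show ?thesis unfolding quot_def abs_divide using that c by (intro frac_le) auto
  qed
  then show thesis using that[of "(\<bar>s\<bar> + \<bar>s\<bar>) / c"] c by simp
qed

lemma quot_power_integrable:
  assumes \<omega>: "\<omega> \<in> space M" and h: "0 < h" and g: "weight g b a l"
  shows "integrable lborel (\<lambda>x. quot h x \<omega> ^ i * g x)"
proof -
  have [measurable]: "(\<lambda>x. Gp x \<omega>) \<in> borel_measurable borel"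
    by (rule borel_measurable_continuous_onI[OF Gp_continuous[OF \<omega>]])
  have [measurable]: "g \<in> borel_measurable borel" using g by (simp add: weight_def)
  obtain S where S: "0 \<le> S" "\<And>x. x \<in> {a..a+l} \<Longrightarrow> \<bar>quot h x \<omega>\<bar> \<le> S"
    using quot_path_bound[OF \<omega> h, of h a l] by (metis atLeastAtMost_iff order_refl)
  show ?thesis
  proof (rule Bochner_Integration.integrable_bound)
    show "integrable lborel (\<lambda>x. S ^ i * b * indicator {a..a+l} x :: real)" using g by (simp add: weight_def)
    have "\<bar>quot h x \<omega> ^ i * g x\<bar> \<le> S ^ i * b * indicator {a..a+l} x" for x
    proof (cases "x \<in> {a..a+l}")
      case True
      then show ?thesis using g S by (simp add: abs_mult power_abs weight_def mult_mono power_mono)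
    qed (use g in \<open>simp add: weight_def\<close>)
    then show "AE x in lborel. norm (quot h x \<omega> ^ i * g x) \<le> norm (S ^ i * b * indicator {a..a+l} x :: real)"
      unfolding real_norm_def by (intro AE_I2 order_trans[OF _ abs_ge_self])
  qed (simp add: quot_def)
qed

lemma wick_quot_integral_eq:
  assumes \<omega>: "\<omega> \<in> space M" and h: "0 < h" and g: "weight g b a l"
  shows "integrable lborel (\<lambda>x. wick_power M k (quot h x) \<omega> * g x)"
    and "wick_integral (quot h) g \<omega> = (\<Sum>j=0..k div 2. wick_coeff j h * (\<integral>x. quot h x \<omega> ^ (k - 2 * j) * g x \<partial>lborel))"
proof -
  have g0: "g x = 0" if "x < 0" for x using g that by (auto simp: weight_def)
  have eq: "wick_power M k (quot h x) \<omega> * g x = (\<Sum>j=0..k div 2. wick_coeff j h * (quot h x \<omega> ^ (k - 2 * j) * g x))" for x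
    using g0[of x] wick_power_quot[OF _ h, of x \<omega>] by (cases "x < 0") (simp_all add: sum_distrib_right mult.assoc)
  note i = quot_power_integrable[OF \<omega> h g]
  show "integrable lborel (\<lambda>x. wick_power M k (quot h x) \<omega> * g x)"
    unfolding eq by (intro Bochner_Integration.integrable_sum integrable_mult_right i)
  show "wick_integral (quot h) g \<omega> = (\<Sum>j=0..k div 2. wick_coeff j h * (\<integral>x. quot h x \<omega> ^ (k - 2 * j) * g x \<partial>lborel))"
    unfolding wick_integral_def eq
    by (subst Bochner_Integration.integral_sum) (auto intro!: integrable_mult_right i)
qed

text \<open>\<open>chaining_AE_convergent\<close> requires continuity on every path. The
  coefficients are continuous in h > 0, and the integrals of powers are so by dominated convergence,
  the quotients being bounded while h stays away from 0.\<close>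

lemma wick_integral_quot_continuous:
  assumes \<omega>: "\<omega> \<in> space M" and g: "weight g b a l" and h0: "0 < h0"
  shows "isCont (\<lambda>h. wick_integral (quot h) g \<omega>) h0"
proof -
  have [measurable]: "(\<lambda>x. Gp x \<omega>) \<in> borel_measurable borel"
    by (rule borel_measurable_continuous_onI[OF Gp_continuous[OF \<omega>]])
  have [measurable]: "g \<in> borel_measurable borel" using g by (simp add: weight_def)
  let ?J = "{h0/2..2*h0}"
  obtain S where S: "0 \<le> S" "\<And>h x. h \<in> ?J \<Longrightarrow> x \<in> {a..a+l} \<Longrightarrow> \<bar>quot h x \<omega>\<bar> \<le> S"
    using quot_path_bound[OF \<omega>, of "h0/2" "2*h0" a l] h0 by (metis half_gt_zero)
  have A: "continuous_on ?J (\<lambda>h. \<integral>x. quot h x \<omega> ^ i * g x \<partial>lborel)" for i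
    unfolding continuous_on_sequentially comp_def
  proof (intro allI ballI impI)
    fix u h assume h: "h \<in> ?J" and u: "(\<forall>n. u n \<in> ?J) \<and> u \<longlonglongrightarrow> h"
    show "(\<lambda>n. \<integral>x. quot (u n) x \<omega> ^ i * g x \<partial>lborel) \<longlonglongrightarrow> (\<integral>x. quot h x \<omega> ^ i * g x \<partial>lborel)"
    proof (rule integral_dominated_convergence[where w = "\<lambda>x. S ^ i * b * indicator {a..a+l} x"])
      show "integrable lborel (\<lambda>x. S ^ i * b * indicator {a..a+l} x :: real)" using g by (simp add: weight_def)
      show "AE x in lborel. (\<lambda>n. quot (u n) x \<omega> ^ i * g x) \<longlonglongrightarrow> quot h x \<omega> ^ i * g x"
      proof (rule AE_I2)
        fix x
        have "isCont (\<lambda>x. Gp x \<omega>) (x + h)" using Gp_continuous[OF \<omega>] by (simp add: continuous_on_eq_continuous_at)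
        then have "(\<lambda>n. Gp (x + u n) \<omega>) \<longlonglongrightarrow> Gp (x + h) \<omega>"
          by (rule isCont_tendsto_compose) (intro tendsto_add tendsto_const, use u in blast)
        moreover have "h \<noteq> 0" using h h0 by auto
        ultimately show "(\<lambda>n. quot (u n) x \<omega> ^ i * g x) \<longlonglongrightarrow> quot h x \<omega> ^ i * g x"
          unfolding quot_def using u by (intro tendsto_mult tendsto_power tendsto_divide tendsto_diff tendsto_const) auto
      qed
      show "AE x in lborel. norm (quot (u n) x \<omega> ^ i * g x) \<le> S ^ i * b * indicator {a..a+l} x" for n
      proof (rule AE_I2)
        fix x
        show "norm (quot (u n) x \<omega> ^ i * g x) \<le> S ^ i * b * indicator {a..a+l} x"
        proof (cases "x \<in> {a..a+l}")
          case True
          then show ?thesis using g S(1) S(2)[of "u n" x] u by (simp add: abs_mult power_abs weight_def mult_mono power_mono)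
        qed (use g in \<open>simp add: weight_def\<close>)
      qed
    qed (simp_all add: quot_def)
  qed
  have "continuous_on ?J (\<lambda>h. \<Sum>j=0..k div 2. wick_coeff j h * (\<integral>x. quot h x \<omega> ^ (k - 2 * j) * g x \<partial>lborel))"
    unfolding wick_coeff_def
    using h0 continuous_on_subset[OF var_continuous]
    by (intro continuous_intros A) auto
  then have "continuous_on ?J (\<lambda>h. wick_integral (quot h) g \<omega>)"
    by (rule continuous_on_eq) (use wick_quot_integral_eq(2)[OF \<omega> _ g] h0 in auto)
  moreover have "h0 \<in> interior ?J" using h0 by simp
  ultimately show ?thesis by (rule continuous_on_interior)
qed

lemma powr_one_half_ge: "1 - t \<le> 2 powr (- t)" if "0 \<le> t" for t :: real
proof -
  have "1 - t \<le> 1 - t * ln 2"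
    using mult_left_mono[of "ln 2" 1 t] ln_add_one_self_le_self[of 1] that by simp
  also have "\<dots> \<le> exp (- (t * ln 2))" using exp_ge_add_one_self[of "- (t * ln 2)"] by simp
  also have "\<dots> = 2 powr (- t)" by (simp add: powr_def)
  finally show ?thesis .
qed

lemma AE_wick_integral_quot_convergent:
  assumes g: "weight g b a l" and h0: "0 < h0" "h0 \<le> 1" "10 * h0 \<le> m" "l + 2 * h0 \<le> m"
  shows "AE \<omega> in M. \<exists>L. ((\<lambda>h. wick_integral (quot h) g \<omega>) \<longlongrightarrow> L) (at_right 0)"
proof -
  \<comment> \<open>One unit of u halves the step, so block n of the chaining consists of steps
    between h0 2^(-n - 1) and h0 2^(-n).\<close>
  define \<eta> where "\<eta> u = h0 * 2 powr (- u)" for u :: real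
  have \<eta>: "0 < \<eta> u" for u using h0 by (simp add: \<eta>_def)
  have \<eta>_le: "\<eta> u \<le> h0" if "0 \<le> u" for u
    using h0 powr_mono[of "- u" 0 2] that by (simp add: \<eta>_def mult_le_cancel_left1)
  have \<eta>_anti: "\<eta> v \<le> \<eta> u" if "u \<le> v" for u v
    using h0 that by (simp add: \<eta>_def)
  define X where "X u = wick_integral (quot (\<eta> u)) g" for u
  \<comment> \<open>A step may be regarded as a mollifier of any larger scale, so two steps are
    compared at the scale of the larger one.\<close>
  have mf: "mfield (quot (\<eta> u)) (\<lambda>v. ennreal (1 / \<eta> u) * indicator {0..0+\<eta> u} v) (\<eta> u')" if "u' \<le> u" for u u'
    using \<eta> \<eta>_anti[OF that] by (intro mfield_quot)
  have l0: "0 \<le> l" using g by (simp add: weight_def)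
  have Xsq: "square_integrable M (X u)" for u
    unfolding X_def by (rule wick_integral_square_integrable[OF mf[OF order_refl] g])
  \<comment> \<open>Chosen so that e^16 = 2^(-(1 - \<beta>)), the factor by which h^(1 - \<beta>)
    decreases when h is halved.\<close>
  define e :: real where "e = 2 powr (- (1 - \<beta>) / 16)"
  have e: "0 < e" "e < 1" using beta by (auto simp: e_def powr_less_one)
  have e16: "(e ^ 16) ^ n = (2 powr (- real n)) powr (1 - \<beta>)" for n
  proof -
    have "e ^ 16 = e powr 16" using e by (simp add: powr_numeral)
    also have "\<dots> = 2 powr (- (1 - \<beta>) / 16 * 16)" unfolding e_def powr_powr ..
    also have "- (1 - \<beta>) / 16 * 16 = - (1 - \<beta>)" by (rule nonzero_eq_divide_eq[THEN iffD1]) simp_all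
    finally have "(e ^ 16) ^ n = (2 powr (- (1 - \<beta>))) powr real n" by (simp add: powr_realpow)
    also have "\<dots> = 2 powr (- real n * (1 - \<beta>))" by (simp add: powr_powr algebra_simps)
    finally show ?thesis by (simp add: powr_powr)
  qed
  define Cc where "Cc = fact k * b\<^sup>2 * 4 * closeness_const l"
  have Cc: "0 \<le> Cc" using closeness_const_nonneg[OF l0] by (simp add: Cc_def)
  let ?C = "Cc + lipschitz_const b l"
  have C0: "0 \<le> ?C" using Cc lipschitz_const_nonneg[OF l0] by simp
  have "AE \<omega> in M. \<exists>L. ((\<lambda>u. X u \<omega>) \<longlongrightarrow> L) at_top"
  proof (rule chaining_AE_convergent[where e = e and C = ?C])
    show "X u \<in> borel_measurable M" for u by (rule square_integrableD(1)[OF Xsq])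
    show "integrable M (\<lambda>\<omega>. (X v \<omega> - X u \<omega>)\<^sup>2)" for u v
      by (rule square_integrableD(2)[OF square_integrable_diff[OF Xsq Xsq]])
    show "continuous_on {0..} (\<lambda>u. X u \<omega>)" if "\<omega> \<in> space M" for \<omega>
    proof (rule continuous_at_imp_continuous_on, rule ballI)
      fix u :: real
      have "isCont \<eta> u" unfolding \<eta>_def by (intro continuous_intros) auto
      then show "isCont (\<lambda>u. X u \<omega>) u"
        unfolding X_def by (rule isCont_o2) (rule wick_integral_quot_continuous[OF that g \<eta>])
    qed
    fix n :: nat and u v :: real
    assume uv: "real n \<le> u" "u \<le> v" "v \<le> real n + 1"
    have u0: "0 \<le> u" using uv(1) of_nat_0_le_iff[of n] by linarith
    have sm: "\<eta> u \<le> 1" "10 * \<eta> u \<le> m" "l + 2 * \<eta> u \<le> m" using \<eta>_le[OF u0] h0 by auto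
    have "(\<integral>\<omega>. (X v \<omega> - X u \<omega>)\<^sup>2 \<partial>M) \<le> Cc * \<eta> u powr (1 - \<beta>)"
      unfolding X_def Cc_def by (rule wick_integral_close[OF mf[OF uv(2)] mf[OF order_refl] sm(2,1) g sm(3)])
    also have "\<dots> \<le> Cc * (2 powr (- real n)) powr (1 - \<beta>)"
    proof (intro mult_left_mono powr_mono2)
      have "\<eta> u \<le> 1 * 2 powr (- real n)" unfolding \<eta>_def using h0 uv by (intro mult_mono powr_mono) auto
      then show "\<eta> u \<le> 2 powr (- real n)" by simp
    qed (use beta Cc \<eta>[of u] in auto)
    also have "\<dots> \<le> ?C * (e ^ 16) ^ n"
      unfolding e16 using lipschitz_const_nonneg[OF l0] by (intro mult_right_mono) auto
    finally show "(\<integral>\<omega>. (X v \<omega> - X u \<omega>)\<^sup>2 \<partial>M) \<le> ?C * (e ^ 16) ^ n" .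
    have "(\<integral>\<omega>. (X v \<omega> - X u \<omega>)\<^sup>2 \<partial>M) = (\<integral>\<omega>. (X u \<omega> - X v \<omega>)\<^sup>2 \<partial>M)" by (simp add: power2_commute)
    also have "\<dots> \<le> lipschitz_const b l * ((\<eta> u - \<eta> v) / \<eta> u)\<^sup>2"
      unfolding X_def by (rule wick_integral_lipschitz[OF \<eta> \<eta>_anti[OF uv(2)] g sm(3)])
    also have "\<dots> \<le> lipschitz_const b l * (v - u)\<^sup>2"
    \<comment> \<open>The relative change of the step is 1 - 2^(-(v - u)), which is at most v -
      u.\<close>
    proof (intro mult_left_mono power_mono)
      have "\<eta> v / \<eta> u = 2 powr (- (v - u))"
        using h0 by (simp add: \<eta>_def powr_diff[symmetric] powr_minus_divide)
      then have "(\<eta> u - \<eta> v) / \<eta> u = 1 - 2 powr (- (v - u))" using \<eta>[of u] by (simp add: diff_divide_distrib)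
      then show "(\<eta> u - \<eta> v) / \<eta> u \<le> v - u" using powr_one_half_ge[of "v - u"] uv by simp
      show "0 \<le> (\<eta> u - \<eta> v) / \<eta> u" using \<eta>_anti[OF uv(2)] \<eta>[of u] by simp
    qed (rule lipschitz_const_nonneg[OF l0])
    also have "\<dots> \<le> ?C * (v - u)\<^sup>2" using Cc by (intro mult_right_mono) auto
    finally show "(\<integral>\<omega>. (X v \<omega> - X u \<omega>)\<^sup>2 \<partial>M) \<le> ?C * (v - u)\<^sup>2" .
  qed (use e C0 in auto)
  then show ?thesis
  proof eventually_elim
    case (elim \<omega>)
    then obtain L where L: "((\<lambda>u. X u \<omega>) \<longlongrightarrow> L) at_top" by blast
    \<comment> \<open>The substitution is undone by u = log2 (h0 / h), which tends to infinity as h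
      decreases to 0.\<close>
    have "filterlim (\<lambda>h. h0 * inverse h) at_top (at_right 0)"
      by (rule filterlim_tendsto_pos_mult_at_top[OF tendsto_const h0(1) filterlim_inverse_at_top_right])
    then have "filterlim (\<lambda>h. ln (h0 * inverse h)) at_top (at_right 0)"
      by (rule filterlim_compose[OF ln_at_top])
    then have "filterlim (\<lambda>h. (1 / ln 2) * ln (h0 * inverse h)) at_top (at_right 0)"
      by (rule filterlim_tendsto_pos_mult_at_top[OF tendsto_const, rotated]) simp
    from filterlim_compose[OF L this]
    have "((\<lambda>h. X ((1 / ln 2) * ln (h0 * inverse h)) \<omega>) \<longlongrightarrow> L) (at_right 0)" .
    moreover have "\<forall>\<^sub>F h in at_right 0. X ((1 / ln 2) * ln (h0 * inverse h)) \<omega> = wick_integral (quot h) g \<omega>"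
      unfolding eventually_at_right_field
    proof (intro exI[of _ 1] conjI allI impI)
      fix h :: real assume h: "0 < h"
      have "\<eta> ((1 / ln 2) * ln (h0 * inverse h)) = h0 * exp (- ln (h0 * inverse h))" by (simp add: \<eta>_def powr_def)
      also have "\<dots> = h" using h h0 by (simp add: exp_minus)
      finally show "X ((1 / ln 2) * ln (h0 * inverse h)) \<omega> = wick_integral (quot h) g \<omega>" by (simp add: X_def)
    qed simp
    ultimately have "((\<lambda>h. wick_integral (quot h) g \<omega>) \<longlongrightarrow> L) (at_right 0)" by (rule Lim_transform_eventually)
    then show ?case by (rule exI)
  qed
qed

text \<open>The almost sure limit and the \<open>L\<^sup>2\<close> limit of the smoothed chaos agree, because the two
  families are \<open>L\<^sup>2\<close>-close to each other.\<close>

lemma wick_integral_limit: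
  assumes g: "weight g b a l" and h0: "0 < h0" "h0 \<le> 1" "10 * h0 \<le> m" "l + 2 * h0 \<le> m"
    and Z: "\<And>d. 0 < d \<Longrightarrow> d \<le> d0 \<Longrightarrow> mfield (Z d) (P d) d" and d0: "0 < d0"
  shows "\<exists>Y. square_integrable M Y \<and> (AE \<omega> in M. ((\<lambda>h. wick_integral (quot h) g \<omega>) \<longlongrightarrow> Y \<omega>) (at_right 0)) \<and>
    ((\<lambda>d. \<integral>\<omega>. (wick_integral (Z d) g \<omega> - Y \<omega>)\<^sup>2 \<partial>M) \<longlongrightarrow> 0) (at_right 0)"
proof -
  let ?J = "\<lambda>h. wick_integral (quot h) g"
  let ?h = "\<lambda>n. h0 * inverse (real (Suc n))"
  define Cc where "Cc = fact k * b\<^sup>2 * 4 * closeness_const l"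
  have l0: "0 \<le> l" using g by (simp add: weight_def)
  have hn: "0 < ?h n" for n using h0 by simp
  have Jsq: "square_integrable M (?J h)" if "0 < h" for h
    by (rule wick_integral_square_integrable[OF mfield_quot[OF that order_refl] g])
  have Jm: "?J (?h n) \<in> borel_measurable M" for n by (rule square_integrableD(1)[OF Jsq[OF hn]])
  have lim_h: "?h \<longlonglongrightarrow> 0"
    using tendsto_mult[OF tendsto_const[of h0] LIMSEQ_inverse_real_of_nat] by simp
  have fl: "filterlim ?h (at_right 0) sequentially"
    unfolding filterlim_at using lim_h hn by (auto intro!: always_eventually)
  \<comment> \<open>A limit along a sequence, to have measurability; almost surely it equals the
    limit over all h.\<close>
  define Y where "Y \<omega> = lim (\<lambda>n. ?J (?h n) \<omega>)" for \<omega>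
  have Ym: "Y \<in> borel_measurable M" unfolding Y_def by (rule borel_measurable_lim_metric) (rule Jm)
  have ae: "AE \<omega> in M. ((\<lambda>h. ?J h \<omega>) \<longlongrightarrow> Y \<omega>) (at_right 0)"
    using AE_wick_integral_quot_convergent[OF g h0]
  proof eventually_elim
    case (elim \<omega>)
    then obtain L where L: "((\<lambda>h. ?J h \<omega>) \<longlongrightarrow> L) (at_right 0)" by blast
    from filterlim_compose[OF L fl] have "Y \<omega> = L" unfolding Y_def by (rule limI)
    with L show ?case by simp
  qed
  then have ae_n: "AE \<omega> in M. (\<lambda>n. ?J (?h n) \<omega>) \<longlonglongrightarrow> Y \<omega>"
    by eventually_elim (rule filterlim_compose[OF _ fl])
  \<comment> \<open>The bound between steps h and \<open>?h n\<close> is uniform in large n, and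
    Fatou's lemma transfers it to the almost sure limit.\<close>
  have JY: "square_integrable M Y \<and> (\<integral>\<omega>. (?J h \<omega> - Y \<omega>)\<^sup>2 \<partial>M) \<le> Cc * h powr (1 - \<beta>)" if h: "0 < h" "h \<le> h0" for h
  proof -
    obtain N where N: "\<And>n. N \<le> n \<Longrightarrow> ?h n < h"
      using order_tendstoD(2)[OF lim_h h(1)] by (auto simp: eventually_sequentially)
    have bd: "square_integrable M (?J (?h n)) \<and> (\<integral>\<omega>. (?J h \<omega> - ?J (?h n) \<omega>)\<^sup>2 \<partial>M) \<le> Cc * h powr (1 - \<beta>)" if "N \<le> n" for n
      using Jsq[OF hn] wick_integral_close[OF mfield_quot[OF h(1) order_refl] mfield_quot[OF hn less_imp_le[OF N[OF that]]] _ _ g] h h0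
      by (simp add: Cc_def)
    show ?thesis using Fatou_second_moment[OF Jm Ym ae_n Jsq[OF h(1)] bd] by blast
  qed
  have Ysq: "square_integrable M Y" using JY[of h0] h0 by simp
  have lim0: "((\<lambda>d. 4 * (Cc * d powr (1 - \<beta>))) \<longlongrightarrow> 4 * (Cc * 0)) (at_right 0)"
  proof (intro tendsto_mult tendsto_const)
    have "((\<lambda>d. d powr (1 - \<beta>)) \<longlongrightarrow> 0 powr (1 - \<beta>)) (at_right (0::real))"
      using beta by (intro tendsto_powr' tendsto_const tendsto_ident_at) (auto simp: eventually_at_right_field intro!: exI[of _ 1])
    then show "((\<lambda>d. d powr (1 - \<beta>)) \<longlongrightarrow> 0) (at_right (0::real))" using beta by simp
  qed
  have "((\<lambda>d. \<integral>\<omega>. (wick_integral (Z d) g \<omega> - Y \<omega>)\<^sup>2 \<partial>M) \<longlongrightarrow> 0) (at_right 0)"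
  proof (rule Lim_null_comparison)
    show "((\<lambda>d. 4 * (Cc * d powr (1 - \<beta>))) \<longlongrightarrow> 0) (at_right 0)" using lim0 by simp
    show "\<forall>\<^sub>F d in at_right 0. norm (\<integral>\<omega>. (wick_integral (Z d) g \<omega> - Y \<omega>)\<^sup>2 \<partial>M) \<le> 4 * (Cc * d powr (1 - \<beta>))"
      unfolding eventually_at_right_field
    proof (intro exI[of _ "min h0 d0"] conjI allI impI)
      fix d :: real assume d: "0 < d" "d < min h0 d0"
      have mZ: "mfield (Z d) (P d) d" using d by (intro Z) auto
      have "(\<integral>\<omega>. (wick_integral (Z d) g \<omega> - ?J d \<omega>)\<^sup>2 \<partial>M) \<le> Cc * d powr (1 - \<beta>)"
        unfolding Cc_def using d h0 by (intro wick_integral_close[OF mZ mfield_quot[OF d(1) order_refl] _ _ g]) auto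
      moreover have "(\<integral>\<omega>. (?J d \<omega> - Y \<omega>)\<^sup>2 \<partial>M) \<le> Cc * d powr (1 - \<beta>)" using JY[of d] d by simp
      moreover have "(\<integral>\<omega>. (wick_integral (Z d) g \<omega> - Y \<omega>)\<^sup>2 \<partial>M) \<le> 2 * (\<integral>\<omega>. (wick_integral (Z d) g \<omega> - ?J d \<omega>)\<^sup>2 \<partial>M) + 2 * (\<integral>\<omega>. (?J d \<omega> - Y \<omega>)\<^sup>2 \<partial>M)"
        by (rule second_moment_triangle[OF wick_integral_square_integrable[OF mZ g] Jsq[OF d(1)] Ysq])
      ultimately show "norm (\<integral>\<omega>. (wick_integral (Z d) g \<omega> - Y \<omega>)\<^sup>2 \<partial>M) \<le> 4 * (Cc * d powr (1 - \<beta>))"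
        by simp
    qed (use h0 d0 in auto)
  qed
  with Ysq ae show ?thesis by blast
qed

lemma mfield_smoothed_deriv:
  assumes f: "approx_identity \<delta>0 f" and d: "0 < d" "d \<le> \<delta>0"
  shows "mfield (smoothed_deriv M G f d) (\<lambda>u. ennreal (f d u)) d"
proof -
  have p: "continuous_on UNIV (f d)" "\<And>y. 0 \<le> f d y" "\<And>y. d < \<bar>y\<bar> \<Longrightarrow> f d y = 0" "(LINT y|lborel. f d y) = 1"
    using f d by (auto simp: approx_identity_def)
  have sv1: "is_measurable_version M (\<lambda>x. gen_deriv M G (\<lambda>y. f d (y - x))) (measurable_version M (\<lambda>x. gen_deriv M G (\<lambda>y. f d (y - x))))"
    by (rule smoothed_version(1)[where e = d]) (use p d in auto)
  have sv2: "strongly_represents (measurable_version M (\<lambda>x. gen_deriv M G (\<lambda>y. f d (y - x))) x) (\<lambda>u. ennreal (half_shift (f d) x u))"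
    if "0 \<le> x" for x
    by (rule smoothed_version(2)[where e = d]) (use p d that in auto)
  have "compact (f d ` {-d..d})" by (intro compact_continuous_image continuous_on_subset[OF p(1)]) auto
  then obtain b where b: "\<And>x. x \<in> {-d..d} \<Longrightarrow> \<bar>f d x\<bar> \<le> b"
    using compact_imp_bounded bounded_iff by (metis imageI real_norm_def)
  have pb: "ennreal (f d u) \<le> ennreal b" for u
  proof (cases "d < \<bar>u\<bar>")
    case False
    then have "u \<in> {-d..d}" by auto
    from b[OF this] show ?thesis by (intro ennreal_leI) simp
  qed (simp add: p(3))
  \<comment> \<open>If \<open>f d\<close> were not integrable, its integral would be 0 by convention
    and not 1.\<close>
  have int: "integrable lborel (f d)" using p(4) not_integrable_integral_eq by fastforce
  have [measurable]: "f d \<in> borel_measurable borel" by (rule borel_measurable_continuous_onI[OF p(1)])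
  have moll: "mollifier (\<lambda>u. ennreal (f d u)) d"
    unfolding mollifier_def using int p by (simp add: nn_integral_eq_integral)
  have rep: "\<exists>\<phi>. strongly_represents (smoothed_deriv M G f d x) \<phi> \<and> (\<forall>u. \<phi> u \<le> ennreal (f d (u - x))) \<and> (d \<le> x \<longrightarrow> \<phi> = (\<lambda>u. ennreal (f d (u - x))))"
    if "0 \<le> x" for x
  proof (intro exI conjI allI impI)
    show "strongly_represents (smoothed_deriv M G f d x) (\<lambda>u. ennreal (half_shift (f d) x u))"
      unfolding smoothed_deriv_def by (rule sv2[OF that])
    show "ennreal (half_shift (f d) x u) \<le> ennreal (f d (u - x))" for u
      using p(2) by (intro ennreal_leI) (simp add: half_shift_def indicator_def)
    show "(\<lambda>u. ennreal (half_shift (f d) x u)) = (\<lambda>u. ennreal (f d (u - x)))" if "d \<le> x"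
    proof
      fix u
      have "f d (u - x) = 0" if "u < 0" using \<open>d \<le> x\<close> that by (intro p(3)) auto
      then show "ennreal (half_shift (f d) x u) = ennreal (f d (u - x))" by (simp add: half_shift_def indicator_def)
    qed
  qed
  show ?thesis
    unfolding mfield_def using sv1 moll d pb rep by (auto simp: is_measurable_version_def smoothed_deriv_def)
qed

end

section \<open>The limit\<close>

lemma L2_tendsto_cong_AE:
  assumes X: "L2_tendsto M X Y F"
    and eq: "\<forall>\<^sub>F t in F. X' t \<in> borel_measurable M \<and> (AE \<omega> in M. X' t \<omega> = X t \<omega>)"
  shows "L2_tendsto M X' Y F"
proof -
  have Y: "Y \<in> borel_measurable M" "integrable M (\<lambda>\<omega>. (Y \<omega>)\<^sup>2)"
    and Xm: "\<forall>\<^sub>F t in F. X t \<in> borel_measurable M \<and> integrable M (\<lambda>\<omega>. (X t \<omega>)\<^sup>2)"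
    and lim: "((\<lambda>t. \<integral>\<omega>. (X t \<omega> - Y \<omega>)\<^sup>2 \<partial>M) \<longlongrightarrow> 0) F"
    using X by (auto simp: L2_tendsto_def)
  note [measurable] = Y(1)
  have ev: "\<forall>\<^sub>F t in F. X' t \<in> borel_measurable M \<and> integrable M (\<lambda>\<omega>. (X' t \<omega>)\<^sup>2) \<and>
      (\<integral>\<omega>. (X t \<omega> - Y \<omega>)\<^sup>2 \<partial>M) = (\<integral>\<omega>. (X' t \<omega> - Y \<omega>)\<^sup>2 \<partial>M)"
    using Xm eq
  proof eventually_elim
    case (elim t)
    have [measurable]: "X t \<in> borel_measurable M" "X' t \<in> borel_measurable M" using elim by auto
    have ae: "AE \<omega> in M. X' t \<omega> = X t \<omega>" using elim by simp
    have "integrable M (\<lambda>\<omega>. (X' t \<omega>)\<^sup>2)"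
      by (rule integrable_cong_AE_imp[of _ "\<lambda>\<omega>. (X t \<omega>)\<^sup>2"]) (use elim ae in auto)
    moreover have "(\<integral>\<omega>. (X t \<omega> - Y \<omega>)\<^sup>2 \<partial>M) = (\<integral>\<omega>. (X' t \<omega> - Y \<omega>)\<^sup>2 \<partial>M)"
      by (rule integral_cong_AE) (use ae in auto)
    ultimately show ?case by simp
  qed
  have "((\<lambda>t. \<integral>\<omega>. (X' t \<omega> - Y \<omega>)\<^sup>2 \<partial>M) \<longlongrightarrow> 0) F"
    by (rule Lim_transform_eventually[OF lim]) (use ev in eventually_elim, simp)
  moreover have "\<forall>\<^sub>F t in F. X' t \<in> borel_measurable M \<and> integrable M (\<lambda>\<omega>. (X' t \<omega>)\<^sup>2)"
    using ev by eventually_elim simp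
  ultimately show ?thesis using Y by (simp add: L2_tendsto_def)
qed

context prob_space
begin

lemma L2_tendsto_add:
  assumes X: "L2_tendsto M X Y F" and X': "L2_tendsto M X' Y' F"
  shows "L2_tendsto M (\<lambda>t \<omega>. X t \<omega> + X' t \<omega>) (\<lambda>\<omega>. Y \<omega> + Y' \<omega>) F"
proof -
  have Y: "square_integrable M Y" "square_integrable M Y'"
    using assms by (auto simp: L2_tendsto_def square_integrable_def)
  have ev: "\<forall>\<^sub>F t in F. square_integrable M (X t) \<and> square_integrable M (X' t)"
    using assms by (auto simp: L2_tendsto_def square_integrable_def eventually_conj_iff)
  have "((\<lambda>t. 2 * (\<integral>\<omega>. (X t \<omega> - Y \<omega>)\<^sup>2 \<partial>M) + 2 * (\<integral>\<omega>. (X' t \<omega> - Y' \<omega>)\<^sup>2 \<partial>M)) \<longlongrightarrow> 2 * 0 + 2 * 0) F"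
    using assms unfolding L2_tendsto_def by (intro tendsto_add tendsto_mult tendsto_const) auto
  then have lim: "((\<lambda>t. 2 * (\<integral>\<omega>. (X t \<omega> - Y \<omega>)\<^sup>2 \<partial>M) + 2 * (\<integral>\<omega>. (X' t \<omega> - Y' \<omega>)\<^sup>2 \<partial>M)) \<longlongrightarrow> 0) F" by simp
  have "((\<lambda>t. \<integral>\<omega>. (X t \<omega> + X' t \<omega> - (Y \<omega> + Y' \<omega>))\<^sup>2 \<partial>M) \<longlongrightarrow> 0) F"
  proof (rule tendsto_sandwich[OF _ _ tendsto_const lim])
    show "\<forall>\<^sub>F t in F. (\<integral>\<omega>. (X t \<omega> + X' t \<omega> - (Y \<omega> + Y' \<omega>))\<^sup>2 \<partial>M)
        \<le> 2 * (\<integral>\<omega>. (X t \<omega> - Y \<omega>)\<^sup>2 \<partial>M) + 2 * (\<integral>\<omega>. (X' t \<omega> - Y' \<omega>)\<^sup>2 \<partial>M)"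
      using ev
    proof eventually_elim
      case (elim t)
      have "X t \<omega> + X' t \<omega> - (Y \<omega> + Y' \<omega>) = (X t \<omega> - Y \<omega>) + (X' t \<omega> - Y' \<omega>)" for \<omega> by simp
      then show ?case
        using second_moment_add_le[OF square_integrable_diff[OF conjunct1[OF elim] Y(1)] square_integrable_diff[OF conjunct2[OF elim] Y(2)]]
        by (simp only:)
    qed
  qed simp
  moreover have "\<forall>\<^sub>F t in F. square_integrable M (\<lambda>\<omega>. X t \<omega> + X' t \<omega>)"
    using ev by eventually_elim (rule square_integrable_add, auto)
  moreover have "square_integrable M (\<lambda>\<omega>. Y \<omega> + Y' \<omega>)" by (rule square_integrable_add[OF Y])
  ultimately show ?thesis by (simp add: L2_tendsto_def square_integrable_def)
qed

lemma L2_tendsto_sum: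
  "(\<And>i. i < n \<Longrightarrow> L2_tendsto M (X i) (Y i) F) \<Longrightarrow>
    L2_tendsto M (\<lambda>t \<omega>. \<Sum>i<n. X i t \<omega>) (\<lambda>\<omega>. \<Sum>i<n. Y i \<omega>) F" for n :: nat
proof (induction n)
  case 0
  then show ?case by (simp add: L2_tendsto_def)
next
  case (Suc n)
  show ?case using L2_tendsto_add[OF Suc.IH Suc.prems[of n]] Suc.prems by simp
qed

end

lemma approx_identity_pos: "approx_identity \<delta>0 f \<Longrightarrow> 0 < \<delta>0" by (simp add: approx_identity_def)

text \<open>The test function is Lebesgue measurable, whereas the product measure arguments use
  Borel sets. Replacing it by a Borel function equal almost everywhere leaves the integrals
  unchanged.\<close>

lemma set_lebesgue_integral_borel_version:
  assumes W: "(\<lambda>x. W x) \<in> borel_measurable borel" and g': "g' \<in> borel_measurable borel"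
    and ae: "AE x in lebesgue. indicator {0..} x * g x = (g' x :: real)"
    and gl: "(\<lambda>x. indicator {0..} x * g x) \<in> borel_measurable lebesgue"
  shows "(LINT x:{0..}|lebesgue. W x * g x) = (\<integral>x. W x * g' x \<partial>lborel)"
proof -
  note [measurable] = W g'
  have "(LINT x:{0..}|lebesgue. W x * g x) = (LINT x|lebesgue. W x * (indicator {0..} x * g x))"
    unfolding set_lebesgue_integral_def by (simp add: mult.left_commute)
  also have "\<dots> = (LINT x|lebesgue. W x * g' x)"
  proof (rule integral_cong_AE)
    show "AE x in lebesgue. W x * (indicator {0..} x * g x) = W x * g' x" using ae by eventually_elim simp
    have Wg: "(\<lambda>x. W x * g' x) \<in> borel_measurable lebesgue" by (intro measurable_completion) simp
    then show "(\<lambda>x. W x * g' x) \<in> borel_measurable lebesgue" .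
    show "(\<lambda>x. W x * (indicator {0..} x * g x)) \<in> borel_measurable lebesgue"
      by (intro borel_measurable_times gl measurable_completion) simp
  qed
  also have "\<dots> = (\<integral>x. W x * g' x \<partial>lborel)" by (rule integral_completion) simp
  finally show ?thesis .
qed

context wick_setup
begin

lemma B0_Rplus_borel_version:
  assumes "g \<in> B0_Rplus"
  obtains g' b R where "weight g' b 0 R"
    "AE x in lebesgue. indicator {0..} x * g x = g' x"
    "(\<lambda>x. indicator {0..} x * g x) \<in> borel_measurable lebesgue"
proof -
  have gm: "g \<in> borel_measurable (lebesgue_on {0..})" and gb: "bounded (g ` {0..})"
    and gc: "compact (closure {x \<in> {0..}. g x \<noteq> 0})"
    using assms by (auto simp: B0_Rplus_def)
  obtain b where b: "\<And>x. 0 \<le> x \<Longrightarrow> \<bar>g x\<bar> \<le> b"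
    using gb unfolding bounded_iff by auto
  have "bounded {x \<in> {0..}. g x \<noteq> 0}" by (rule bounded_subset[OF compact_imp_bounded[OF gc] closure_subset])
  then obtain R where R: "\<And>x. x \<in> {x \<in> {0..}. g x \<noteq> 0} \<Longrightarrow> \<bar>x\<bar> \<le> R"
    unfolding bounded_iff by auto
  have gl: "(\<lambda>x. indicator {0..} x * g x) \<in> borel_measurable lebesgue"
    using gm by (subst (asm) borel_measurable_restrict_space_iff) (auto simp: mult.commute)
  from completion_ex_borel_measurable_real[OF gl]
  obtain g1 where g1: "g1 \<in> borel_measurable lborel" "AE x in lborel. indicator {0..} x * g x = g1 x" by blast
  have [measurable]: "g1 \<in> borel_measurable borel" using g1(1) by simp
  define b' where "b' = max 0 b"
  define R' where "R' = max 0 R"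
  \<comment> \<open>The Borel version \<open>g1\<close> agrees with g almost everywhere only;
    truncation makes the bound and the support hold at every point.\<close>
  define g' where "g' x = (if x \<in> {0..R'} then max (- b') (min b' (g1 x)) else 0)" for x
  show thesis
  proof
    show "(\<lambda>x. indicator {0..} x * g x) \<in> borel_measurable lebesgue" by (fact gl)
    have "0 \<le> b'" "0 \<le> R'" by (auto simp: b'_def R'_def)
    moreover have "g' \<in> borel_measurable borel" unfolding g'_def by measurable
    moreover have "\<bar>g' x\<bar> \<le> b'" for x using \<open>0 \<le> b'\<close> by (auto simp: g'_def)
    moreover have "g' x = 0" if "x \<notin> {0..R'}" for x unfolding g'_def if_not_P[OF that] ..
    ultimately show "weight g' b' 0 R'" by (simp add: weight_def)
    have "AE x in lborel. indicator {0..} x * g x = g' x"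
      using g1(2)
    proof eventually_elim
      case (elim x)
      show ?case
      proof (cases "x \<in> {0..R'}")
        case True
        then have "g1 x = g x" "\<bar>g x\<bar> \<le> b'" using elim b[of x] by (auto simp: b'_def)
        then show ?thesis using True by (auto simp: g'_def)
      next
        case False
        have "indicator {0..} x * g x = 0"
        proof (rule ccontr)
          assume "indicator {0..} x * g x \<noteq> 0"
          then have "0 \<le> x" "g x \<noteq> 0" by (auto simp: indicator_def split: if_splits)
          with R[of x] False show False by (auto simp: R'_def)
        qed
        then show ?thesis unfolding g'_def if_not_P[OF False] .
      qed
    qed
    then show "AE x in lebesgue. indicator {0..} x * g x = g' x" by (rule AE_completion)
  qed
qed

lemma wick_section_measurable:
  assumes X: "(\<lambda>(x, \<omega>). X x \<omega>) \<in> borel_measurable (borel \<Otimes>\<^sub>M M)" and \<omega>: "\<omega> \<in> space M"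
  shows "(\<lambda>x. wick_power M k (X x) \<omega>) \<in> borel_measurable borel"
  using measurable_compose[OF measurable_Pair2'[OF \<omega>, of borel] wick_measurable[OF X, of k]] by simp

lemma AE_integrable_wick:
  assumes X: "mfield X P e" and g: "weight g b a l"
  shows "AE \<omega> in M. integrable lborel (\<lambda>x. wick_power M k (X x) \<omega> * g x)"
proof -
  obtain K where K: "bounded_field M (\<lambda>x \<omega>. wick_power M k (X x) \<omega> * g x) a (a + l) K" by (rule wick_field[OF X g])
  interpret F: bounded_field M "\<lambda>x \<omega>. wick_power M k (X x) \<omega> * g x" a "a + l" K by (rule K)
  have one: "square_integrable M (\<lambda>_. 1)" by (simp add: square_integrable_def)
  show ?thesis
    using F.AE_integrable_snd[of "\<lambda>x \<omega>. wick_power M k (X x) \<omega> * g x"] F.field_mult_integrable_pair[OF one] by simp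
qed

lemma AE_tendsto_wick_chaos:
  assumes f: "approx_identity \<delta>0 f" and g: "g \<in> B0_Rplus"
  shows "AE \<omega> in M.
    ((\<lambda>h. LINT x:{0..}|lebesgue. wick_power M k (\<lambda>\<omega>'. (G (x + h) \<omega>' - G x \<omega>') / h) \<omega> * g x)
      \<longlongrightarrow> wick_chaos M G f k g \<omega>) (at_right 0)"
proof -
  obtain g' b R where wg: "weight g' b 0 R" and ae: "AE x in lebesgue. indicator {0..} x * g x = g' x"
    and gl: "(\<lambda>x. indicator {0..} x * g x) \<in> borel_measurable lebesgue"
    using g by (rule B0_Rplus_borel_version)
  have g'm [measurable]: "g' \<in> borel_measurable borel" and bR: "0 \<le> b" "0 \<le> R"
    and g'b: "\<And>x. \<bar>g' x\<bar> \<le> b" and g'0: "\<And>x. x \<notin> {0..R} \<Longrightarrow> g' x = 0"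
    using wg by (auto simp: weight_def)
  \<comment> \<open>Pieces of length m/2 leave room for the smoothing: l + 2 \<open>h0\<close> \<le>
    m/2 + m/5.\<close>
  define l where "l = m / 2"
  define h0 where "h0 = min 1 (m / 10)"
  have l: "0 < l" using m_pos by (simp add: l_def)
  have h0: "0 < h0" "h0 \<le> 1" "10 * h0 \<le> m" "l + 2 * h0 \<le> m" using m_pos by (auto simp: h0_def l_def)
  obtain n :: nat where n: "R / l < real n" using reals_Archimedean2 by blast
  \<comment> \<open>Half-open intervals, so that every point of the support belongs to exactly one
    piece.\<close>
  define gi where "gi i x = g' x * indicator {real i * l..<real (Suc i) * l} x" for i x
  have wi: "weight (gi i) b (real i * l) l" for i
    unfolding weight_def
  proof (intro conjI allI impI)
    show "gi i \<in> borel_measurable borel" unfolding gi_def by measurable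
    show "\<bar>gi i x\<bar> \<le> b" for x using g'b[of x] bR by (simp add: gi_def indicator_def)
    show "gi i x = 0" if "x \<notin> {real i * l..real i * l + l}" for x
      using that by (auto simp: gi_def indicator_def algebra_simps)
    show "0 \<le> real i * l" "0 \<le> l" "0 \<le> b" using l bR by auto
  qed
  have gsum: "(\<Sum>i<n. gi i x) = g' x" for x
  proof (cases "x \<in> {0..R}")
    case False
    then show ?thesis using g'0 by (simp add: gi_def)
  next
    case True
    have iff: "x \<in> {real i * l..<real (Suc i) * l} \<longleftrightarrow> i = nat \<lfloor>x / l\<rfloor>" for i
    proof -
      have "x \<in> {real i * l..<real (Suc i) * l} \<longleftrightarrow> real i \<le> x / l \<and> x / l < real i + 1"
        using l by (simp add: field_simps)
      also have "\<dots> \<longleftrightarrow> \<lfloor>x / l\<rfloor> = int i" by (simp add: floor_eq_iff)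
      also have "\<dots> \<longleftrightarrow> i = nat \<lfloor>x / l\<rfloor>" using True l by auto
      finally show ?thesis .
    qed
    have "x / l \<le> R / l" using True l by (simp add: divide_right_mono)
    then have "\<lfloor>x / l\<rfloor> < int n" using n by (simp add: floor_less_iff)
    moreover have "0 \<le> \<lfloor>x / l\<rfloor>" using True l by simp
    ultimately have "nat \<lfloor>x / l\<rfloor> < n" by linarith
    moreover have "(\<Sum>i<n. gi i x) = (\<Sum>i<n. if i = nat \<lfloor>x / l\<rfloor> then g' x else 0)"
      by (rule sum.cong[OF refl]) (simp add: gi_def indicator_def iff del: of_nat_Suc atLeastLessThan_iff)
    ultimately show ?thesis by simp
  qed
  \<comment> \<open>Additivity requires each piece to be integrable: almost surely so for the
    smoothed fields, on every path for the difference quotients.\<close>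
  have split: "wick_integral X g' \<omega> = (\<Sum>i<n. wick_integral X (gi i) \<omega>)"
    if "\<And>i. integrable lborel (\<lambda>x. wick_power M k (X x) \<omega> * gi i x)" for X \<omega>
  proof -
    have "wick_integral X g' \<omega> = (\<integral>x. (\<Sum>i<n. wick_power M k (X x) \<omega> * gi i x) \<partial>lborel)"
      unfolding wick_integral_def by (simp flip: gsum sum_distrib_left)
    also have "\<dots> = (\<Sum>i<n. wick_integral X (gi i) \<omega>)"
      unfolding wick_integral_def using that by (intro Bochner_Integration.integral_sum)
    finally show ?thesis .
  qed
  let ?Z = "smoothed_deriv M G f"
  let ?F = "at_right (0::real)"
  have d0: "0 < \<delta>0" by (rule approx_identity_pos[OF f])
  have mZ: "mfield (?Z d) (\<lambda>u. ennreal (f d u)) d" if "0 < d" "d \<le> \<delta>0" for d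
    by (rule mfield_smoothed_deriv[OF f that])
  have evd: "\<forall>\<^sub>F d in ?F. 0 < d \<and> d \<le> \<delta>0"
    using eventually_at_right_real[OF d0] by eventually_elim simp
  have "\<forall>i. \<exists>Y. square_integrable M Y \<and> (AE \<omega> in M. ((\<lambda>h. wick_integral (quot h) (gi i) \<omega>) \<longlongrightarrow> Y \<omega>) ?F) \<and>
    ((\<lambda>d. \<integral>\<omega>. (wick_integral (?Z d) (gi i) \<omega> - Y \<omega>)\<^sup>2 \<partial>M) \<longlongrightarrow> 0) ?F"
    by (intro allI wick_integral_limit[OF wi h0 mZ d0])
  then obtain Y where Y: "\<And>i. square_integrable M (Y i)"
      "\<And>i. AE \<omega> in M. ((\<lambda>h. wick_integral (quot h) (gi i) \<omega>) \<longlongrightarrow> Y i \<omega>) ?F"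
      "\<And>i. ((\<lambda>d. \<integral>\<omega>. (wick_integral (?Z d) (gi i) \<omega> - Y i \<omega>)\<^sup>2 \<partial>M) \<longlongrightarrow> 0) ?F"
    by (auto dest!: choice)
  define YY where "YY \<omega> = (\<Sum>i<n. Y i \<omega>)" for \<omega>
  have "L2_tendsto M (\<lambda>d. wick_integral (?Z d) (gi i)) (Y i) ?F" for i
  proof -
    have "\<forall>\<^sub>F d in ?F. square_integrable M (wick_integral (?Z d) (gi i))"
      using evd by eventually_elim (rule wick_integral_square_integrable[OF mZ wi], auto)
    then show ?thesis using Y(1)[of i] Y(3)[of i] by (simp add: L2_tendsto_def square_integrable_def)
  qed
  then have "L2_tendsto M (\<lambda>d \<omega>. \<Sum>i<n. wick_integral (?Z d) (gi i) \<omega>) YY ?F"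
    unfolding YY_def by (rule L2_tendsto_sum)
  then have "L2_tendsto M (\<lambda>d. wick_integral (?Z d) g') YY ?F"
  proof (rule L2_tendsto_cong_AE)
    show "\<forall>\<^sub>F d in ?F. wick_integral (?Z d) g' \<in> borel_measurable M \<and>
        (AE \<omega> in M. wick_integral (?Z d) g' \<omega> = (\<Sum>i<n. wick_integral (?Z d) (gi i) \<omega>))"
      using evd
    proof eventually_elim
      case (elim d)
      note mZd = mZ[OF conjunct1[OF elim] conjunct2[OF elim]]
      have "AE \<omega> in M. \<forall>i. integrable lborel (\<lambda>x. wick_power M k (?Z d x) \<omega> * gi i x)"
        unfolding AE_all_countable using AE_integrable_wick[OF mZd wi] by blast
      then have "AE \<omega> in M. wick_integral (?Z d) g' \<omega> = (\<Sum>i<n. wick_integral (?Z d) (gi i) \<omega>)"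
        by eventually_elim (rule split, blast)
      then show ?case
        using square_integrableD(1)[OF wick_integral_square_integrable[OF mZd wg]] by blast
    qed
  qed
  then have "L2_tendsto M (\<lambda>d \<omega>. LINT x:{0..}|lebesgue. wick_power M k (?Z d x) \<omega> * g x) YY ?F"
  proof (rule L2_tendsto_cong_AE)
    show "\<forall>\<^sub>F d in ?F. (\<lambda>\<omega>. LINT x:{0..}|lebesgue. wick_power M k (?Z d x) \<omega> * g x) \<in> borel_measurable M \<and>
        (AE \<omega> in M. (LINT x:{0..}|lebesgue. wick_power M k (?Z d x) \<omega> * g x) = wick_integral (?Z d) g' \<omega>)"
      using evd
    proof eventually_elim
      case (elim d)
      note mZd = mZ[OF conjunct1[OF elim] conjunct2[OF elim]]
      have Zm: "(\<lambda>(x, \<omega>). ?Z d x \<omega>) \<in> borel_measurable (borel \<Otimes>\<^sub>M M)" using mZd by (simp add: mfield_def)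
      have eq: "(LINT x:{0..}|lebesgue. wick_power M k (?Z d x) \<omega> * g x) = wick_integral (?Z d) g' \<omega>"
        if "\<omega> \<in> space M" for \<omega>
        unfolding wick_integral_def by (rule set_lebesgue_integral_borel_version[OF wick_section_measurable[OF Zm that] g'm ae gl])
      show ?case
        using square_integrableD(1)[OF wick_integral_square_integrable[OF mZd wg]]
        by (auto simp: eq cong: measurable_cong)
    qed
  qed
  \<comment> \<open>\<open>wick_chaos\<close> is a chosen L2 limit; since \<open>YY\<close> is one
    too, the two agree almost surely.\<close>
  then have chaos: "AE \<omega> in M. wick_chaos M G f k g \<omega> = YY \<omega>"
    unfolding wick_chaos_def by (intro L2_tendsto_unique[OF L2_Lim_L2_tendsto]) auto
  have J: "(LINT x:{0..}|lebesgue. wick_power M k (\<lambda>\<omega>'. (G (x + h) \<omega>' - G x \<omega>') / h) \<omega> * g x)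
      = (\<Sum>i<n. wick_integral (quot h) (gi i) \<omega>)" if \<omega>: "\<omega> \<in> space M" and h: "0 < h" for \<omega> h
  proof -
    have "(LINT x:{0..}|lebesgue. wick_power M k (\<lambda>\<omega>'. (G (x + h) \<omega>' - G x \<omega>') / h) \<omega> * g x)
        = (LINT x:{0..}|lebesgue. wick_power M k (quot h x) \<omega> * g x)"
      unfolding set_lebesgue_integral_def
    proof (rule Bochner_Integration.integral_cong[OF refl])
      fix x :: real
      show "indicator {0..} x *\<^sub>R (wick_power M k (\<lambda>\<omega>'. (G (x + h) \<omega>' - G x \<omega>') / h) \<omega> * g x)
          = indicator {0..} x *\<^sub>R (wick_power M k (quot h x) \<omega> * g x)"
      proof (cases "0 \<le> x")
        case True
        then have "(\<lambda>\<omega>'. (G (x + h) \<omega>' - G x \<omega>') / h) = quot h x"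
          using h by (simp add: fun_eq_iff quot_def Gp_eq)
        then show ?thesis by simp
      qed simp
    qed
    also have "\<dots> = wick_integral (quot h) g' \<omega>"
      unfolding wick_integral_def
      by (rule set_lebesgue_integral_borel_version[OF wick_section_measurable[OF quot_measurable \<omega>] g'm ae gl])
    also have "\<dots> = (\<Sum>i<n. wick_integral (quot h) (gi i) \<omega>)"
      by (rule split) (rule wick_quot_integral_eq(1)[OF \<omega> h wi])
    finally show ?thesis .
  qed
  have "AE \<omega> in M. \<forall>i. ((\<lambda>h. wick_integral (quot h) (gi i) \<omega>) \<longlongrightarrow> Y i \<omega>) ?F"
    unfolding AE_all_countable using Y(2) by blast
  then show ?thesis
    using chaos AE_space
  proof eventually_elim
    case (elim \<omega>)
    have "((\<lambda>h. \<Sum>i<n. wick_integral (quot h) (gi i) \<omega>) \<longlongrightarrow> YY \<omega>) ?F"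
      unfolding YY_def by (rule tendsto_sum) (use elim in blast)
    moreover have "\<forall>\<^sub>F h in ?F. (\<Sum>i<n. wick_integral (quot h) (gi i) \<omega>)
        = (LINT x:{0..}|lebesgue. wick_power M k (\<lambda>\<omega>'. (G (x + h) \<omega>' - G x \<omega>') / h) \<omega> * g x)"
      using eventually_at_right_less by eventually_elim (simp add: J elim)
    ultimately have "((\<lambda>h. LINT x:{0..}|lebesgue. wick_power M k (\<lambda>\<omega>'. (G (x + h) \<omega>' - G x \<omega>') / h) \<omega> * g x)
        \<longlongrightarrow> YY \<omega>) ?F" by (rule Lim_transform_eventually)
    then show ?case using elim by simp
  qed
qed

end

theorem theorem1p1:
  fixes M :: "'a measure"
    and G :: "real \<Rightarrow> 'a \<Rightarrow> real"
    and \<sigma>2 \<rho> :: "real \<Rightarrow> real"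
    and f :: "real \<Rightarrow> real \<Rightarrow> real"
    and k :: nat
    and C C\<^sub>M m \<delta> \<delta>\<^sub>0 :: real
    and g :: "real \<Rightarrow> real"
  assumes prob: "prob_space M"
    and gaussian: "gaussian_process M {0..} G"
    and mean_zero: "\<And>x. 0 \<le> x \<Longrightarrow> (\<integral>\<omega>. G x \<omega> \<partial>M) = 0"
    and start: "AE \<omega> in M. G 0 \<omega> = 0"
    and cont: "\<And>\<omega>. \<omega> \<in> space M \<Longrightarrow> continuous_on {0..} (\<lambda>x. G x \<omega>)"
    and stationary: "stationary_increments M G"
    and variance: "\<And>x y. 0 \<le> x \<Longrightarrow> 0 \<le> y \<Longrightarrow> (\<integral>\<omega>. (G x \<omega> - G y \<omega>)\<^sup>2 \<partial>M) = \<sigma>2 (x - y)"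
    and even_var: "\<And>h. \<sigma>2 h = \<sigma>2 \<bar>h\<bar>"
    and convex_var: "convex_on UNIV \<sigma>2"
    and reg_var: "regularly_varying_at_zero \<sigma>2"
    and lim1: "((\<lambda>h. h\<^sup>2 / \<sigma>2 h) \<longlongrightarrow> 0) (at 0)"
    and lim2: "((\<lambda>h. \<sigma>2 h / h) \<longlongrightarrow> 0) (at 0)"
    and second_diff: "\<And>s h. 0 < h \<Longrightarrow> h \<le> s / 8 \<Longrightarrow>
          (\<sigma>2 (s + h) + \<sigma>2 (s - h) - 2 * \<sigma>2 s) / h\<^sup>2 \<le> C * (\<sigma>2 s / s\<^sup>2)"
    and diff1: "\<And>s. s \<noteq> 0 \<Longrightarrow> \<sigma>2 differentiable (at s)"
    and diff2: "\<And>s. s \<noteq> 0 \<Longrightarrow> deriv \<sigma>2 differentiable (at s)"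
    and rho: "\<rho> = half_second_deriv \<sigma>2"
    and k: "1 \<le> k"
    and param_ranges: "0 < \<delta>" "\<delta> < 1 / 2" "0 < m"
    and rho_bound: "\<And>x. 0 < \<bar>x\<bar> \<Longrightarrow> \<bar>x\<bar> \<le> m \<Longrightarrow> \<rho> x \<le> C\<^sub>M / \<bar>x\<bar> powr ((1 - \<delta>) / real k)"
    and rho_diff: "\<And>x h. x \<noteq> 0 \<Longrightarrow> 4 * \<bar>h\<bar> \<le> \<bar>x\<bar> \<Longrightarrow> \<bar>x\<bar> \<le> m \<Longrightarrow>
          \<bar>\<rho> (x + h) - \<rho> x\<bar> \<le> C\<^sub>M * (\<bar>h\<bar> / \<bar>x\<bar>) * \<rho> x"
    and approx: "approx_identity \<delta>\<^sub>0 f"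
    and g: "g \<in> B0_Rplus"
  shows "AE \<omega> in M.
    ((\<lambda>h. LINT x:{0..}|lebesgue.
        wick_power M k (\<lambda>\<omega>'. (G (x + h) \<omega>' - G x \<omega>') / h) \<omega> * g x)
      \<longlongrightarrow> wick_chaos M G f k g \<omega>) (at_right 0)"
proof -
  interpret smooth_gaussian_process M G \<sigma>2
    by (intro smooth_gaussian_process.intro centered_gaussian_process.intro
        centered_gaussian_process_axioms.intro smooth_gaussian_process_axioms.intro)
      (fact prob gaussian mean_zero cont variance even_var convex_var lim2 diff1 diff2)+
  have r: "rho0 x = \<rho> x" if "x \<noteq> 0" for x
    using that by (simp add: rho0_def rho half_second_deriv_def)
  \<comment> \<open>Evaluating the bound on \<open>\<rho>\<close> at x = m shows that the constant
    is nonnegative.\<close>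
  have "0 \<le> C\<^sub>M / m powr ((1 - \<delta>) / real k)"
    using rho_bound[of m] rho0_nonneg[of m] r[of m] param_ranges by simp
  then have "0 \<le> C\<^sub>M"
    using param_ranges by (simp add: zero_le_divide_iff)
  have sk: "singular_kernel rho0 m (1 - \<delta>) C\<^sub>M k"
  proof
    show "rho0 \<in> borel_measurable borel" by (rule rho0_measurable)
    show "0 \<le> rho0 x" for x by (rule rho0_nonneg)
    show "rho0 x \<le> C\<^sub>M / \<bar>x\<bar> powr ((1 - \<delta>) / real k)" if "0 < \<bar>x\<bar>" "\<bar>x\<bar> \<le> m" for x
      using rho_bound[OF that] r[of x] that by simp
    show "\<bar>rho0 (x + h) - rho0 x\<bar> \<le> C\<^sub>M * (\<bar>h\<bar> / \<bar>x\<bar>) * rho0 x"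
      if "x \<noteq> 0" "4 * \<bar>h\<bar> \<le> \<bar>x\<bar>" "\<bar>x\<bar> \<le> m" for x h
    proof -
      \<comment> \<open>Since |h| is at most a quarter of |x|, the point 0, where
        \<open>rho0\<close> and \<open>\<rho>\<close> may differ, is never reached.\<close>
      have "x + h \<noteq> 0" using that by auto
      then show ?thesis using rho_diff[OF that] r that(1) by simp
    qed
  qed (use param_ranges k \<open>0 \<le> C\<^sub>M\<close> in auto)
  interpret wick_setup M G \<sigma>2 m "1 - \<delta>" C\<^sub>M k
    by (rule wick_setup.intro[OF smooth_gaussian_process_axioms wick_setup_axioms.intro[OF sk]])
  show ?thesis by (rule AE_tendsto_wick_chaos[OF approx g])
qed

end
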